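(* Let $\dim(\mathcal G)=+\infty$ and let $V=(M_\psi\otimes K^* )\mathscr V(M_\psi\otimes K)$ with $\nu_0>3$, $0\le\mathscr V\in\mathcal B(\ell^2(\mathbb Z_h,\mathcal G))$ and $K\in\mathfrak S_2(\mathcal G)$. Fix $s\in I_Q$ such that the thresholds $\mu_s$ and $\frac4{h^2}+\mu_s$ are non-degenerate and $\mathrm{Rank}\,P_s\mathbf VP_s^*=\mathrm{Rank}\,P_s\mathbf V_JP_s^*=+\infty$. For $r>0$ put $$\Phi_1(r)=\mathrm{Tr}\,\mathbf 1_{(r,+\infty)}(P_s\mathbf VP_s^* ),\qquad \Phi_2(r)=\mathrm{Tr}\,\mathbf 1_{(r,+\infty)}(P_s\mathbf V_JP_s^* ).$$ Suppose in addition that for $i=1,2$ there is a function $\Psi_i$ with $\Psi_i(r)\to+\infty$ as $r\searrow0$ such that for any small $\varepsilon\in(0,1)$, $\Phi_i(r(1\pm\varepsilon))=\Psi_i(r)(1+o(1)+\mathcal O(\varepsilon))$ as $r\searrow0$ (the constant in $\mathcal O(\varepsilon)$ being independent of $r$ and $\varepsilon$). Then $$\xi(\lambda;H^-,H_Q)=\begin{cases}-\Psi_1\big(\tfrac2h\sqrt{\mu_s-\lambda}\big)(1+o(1)),&\lambda\nearrow\mu_s,\\ \mathcal O(1),&\lambda\searrow\frac4{h^2}+\mu_s,\end{cases}$$ and $$\xi(\lambda;H^+,H_Q)=\begin{cases}\mathcal O(1),&\lambda\nearrow\mu_s,\\ \Psi_2\big(\tfrac2h\sqrt{\lambda-4/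h^2-\mu_s}\big)(1+o(1)),&\lambda\searrow\frac4{h^2}+\mu_s.\end{cases}$$
   Context: Let $h>0$, $\mathbb Z_h=\{hn:n\in\mathbb Z\}$, and let $\mathcal G$ be a separable complex Hilbert space. $\ell^2(\mathbb Z_h)=\ell^2(\mathbb Z_h,\mathbb C)$ has scalar product $\langle\varphi,\phi\rangle=\sum_{n\in\mathbb Z}\overline{\varphi(hn)}\phi(hn)$, and $\ell^2(\mathbb Z_h,\mathcal G)$ is identified with $\ell^2(\mathbb Z_h)\otimes\mathcal G$. On $\ell^2(\mathbb Z_h)$, $(-\Delta_h\phi)(hn)=h^{-2}\big(2\phi(hn)-\phi(h(n+1))-\phi(h(n-1))\big)$, whose spectrum is $[0,4/h^2]$. $Q$ is a self-adjoint operator on $\mathcal G$ such that either $Q=0$, or $Q\ne0$ and $\mathcal G=\bigoplus_{s=1}^d\mathrm{Ker}(Q-\mu_s)$ with $d<+\infty$ and $\mu_1,\dots,\mu_d$ the distinct (real) eigenvalues of $Q$. If $Q=0$ put $I_Q=\{0\}$, $\mu_0=0$, $\pi_0=I_{\mathcal G}$; if $Q\neq0$ put $I_Q=\{1,\dots,d\}$ and let $\pi_s$ be the orthogonal projection onto $\mathrm{Ker}(Q-\mu_s)$. $H_Q=-\Delta_h\otimes I_{\mathcal G}+I_{\ell^2(\mathbb Z_h)}\otimes Q$; the threshold set is $\mathscr E_Q=\{\mu_s,\mu_s+4/h^2\}_{s\in I_Q}$. If $Q\ne0$, $\mu_s$ (resp. $\frac4{h^2}+\mu_s$) is non-degenerate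 if $\mu_s\ne\frac4{h^2}+\mu_{s'}$ (resp. $\frac4{h^2}+\mu_s\neq\mu_{s'}$) for all $s'\ne s$; if $Q=0$ both thresholds $0,4/h^2$ count as non-degenerate. $\mathfrak S_p$ denotes the Schatten class. $\langle n\rangle=(1+n^2)^{1/2}$, $\psi(hn)=\langle n\rangle^{-\nu_0/2}$, $M_\psi$ is multiplication by $\psi$ on $\ell^2(\mathbb Z_h)$. $H^\pm=H_Q\pm V$. Spectral shift function: put $\mathscr M=\mathscr V^{1/2}(M_\psi\otimes K)\in\mathfrak S_2$ (so $V=\mathscr M^*\mathscr M$) and $T(z)=\mathscr M(H_Q-z)^{-1}\mathscr M^*$. For each $\lambda\in\mathbb R\setminus\mathscr E_Q$ the limit $T(\lambda+i0)=\lim_{\varepsilon\searrow0}T(\lambda+i\varepsilon)$ exists in $\mathfrak S_2$; $A(\lambda+i0)$ and $B(\lambda+i0)$ are its real and imaginary (self-adjoint) parts, $0\le B(\lambda+i0)\in\mathfrak S_1$. For compact self-adjoint $S$ and $r>0$, $\mathscr N_\pm(r,S)=\mathrm{Rank}\,\mathbf 1_{(r,\infty)}(\pm S)$. The SSF is identified with its representative $\xi(\lambda;H^\pm,H_Q)=\pm\frac1\pi\int_{\mathbb R}\mathscr N_\mp(1,A(\lambda+i0)+tB(\lambda+i0))\frac{dt}{1+t^2}$, $\lambda\in\mathbb R\setminus\mathscr E_Q$. Effective operators: $\langle\psi|:\ell^2(\mathbb Z_h)\to\mathbb C$, $\phi\mapsto\langle\psi,\phi\rangle$; $(J\varphi)(hn)=(-1)^n\varphi(hn)$;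 $P_s=\langle\psi|\otimes\pi_s:\ell^2(\mathbb Z_h)\otimes\mathcal G\to\mathbb C\otimes\mathcal G$; $\mathbf V=(I\otimes K^* )\mathscr V(I\otimes K)$; $\mathbf V_J=(J\otimes I_{\mathcal G})^*\mathbf V(J\otimes I_{\mathcal G})$. *)

theory Defs
  imports "HOL-Analysis.Analysis"
begin

section \<open>Complex Hilbert spaces\<close>

class scaleC = scaleR +
  fixes scaleC :: "complex \<Rightarrow> 'a \<Rightarrow> 'a"  (infixr "*\<^sub>C" 75)

text \<open>
  The scalar product is antilinear in the first and linear in the second argument. Basing
  the class on \<open>real_inner\<close> (whose \<open>inner\<close> is required to be the real part of \<open>cinner\<close>) gives
  the norm \<open>norm x = sqrt (Re (cinner x x))\<close> and the topology from the library.
\<close>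
class complex_inner = real_inner + scaleC +
  fixes cinner :: "'a \<Rightarrow> 'a \<Rightarrow> complex"
  assumes scaleC_add_right: "a *\<^sub>C (x + y) = a *\<^sub>C x + a *\<^sub>C y"
    and scaleC_add_left: "(a + b) *\<^sub>C x = a *\<^sub>C x + b *\<^sub>C x"
    and scaleC_scaleC: "a *\<^sub>C (b *\<^sub>C x) = (a * b) *\<^sub>C x"
    and scaleR_scaleC: "r *\<^sub>R x = complex_of_real r *\<^sub>C x"
    and cinner_commute: "cinner x y = cnj (cinner y x)"
    and cinner_add_right: "cinner x (y + z) = cinner x y + cinner x z"
    and cinner_scaleC_right: "cinner x (a *\<^sub>C y) = a * cinner x y"
    and inner_eq_Re_cinner: "inner x y = Re (cinner x y)"

class chilbert_space = complex_inner + complete_space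

instantiation complex :: chilbert_space
begin
definition scaleC_complex :: "complex \<Rightarrow> complex \<Rightarrow> complex" where "scaleC_complex a x = a * x"
definition cinner_complex :: "complex \<Rightarrow> complex \<Rightarrow> complex" where "cinner_complex x y = cnj x * y"
instance
  by standard
    (simp_all add: scaleC_complex_def cinner_complex_def algebra_simps scaleR_conv_of_real
      inner_complex_def)
end

lemma scaleC_one [simp]: "1 *\<^sub>C (x :: 'a :: complex_inner) = x"
  using scaleR_scaleC[of 1 x] by simp

global_interpretation complex_vector: vector_space
  "scaleC :: complex \<Rightarrow> 'a \<Rightarrow> 'a :: complex_inner"
  defines cspan = complex_vector.span
    and cdim = complex_vector.dim
    and cdependent = complex_vector.dependent
    and csubspace = complex_vector.subspace
    and crepresentation = complex_vector.representation
    and cextend_basis = complex_vector.extend_basis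
  by standard (simp_all add: scaleC_add_right scaleC_add_left scaleC_scaleC)

definition finite_cdim :: "'a :: complex_inner set \<Rightarrow> bool" where
  "finite_cdim S \<longleftrightarrow> (\<exists>B. finite B \<and> S \<subseteq> cspan B)"

definition is_onb :: "'a :: complex_inner set \<Rightarrow> bool" where
  "is_onb B \<longleftrightarrow> (\<forall>x\<in>B. norm x = 1) \<and> (\<forall>x\<in>B. \<forall>y\<in>B. x \<noteq> y \<longrightarrow> cinner x y = 0)
     \<and> closure (cspan B) = UNIV"

definition orth_proj :: "'a :: complex_inner set \<Rightarrow> 'a \<Rightarrow> 'a" where
  "orth_proj S x = (THE y. y \<in> S \<and> (\<forall>z\<in>S. cinner z (x - y) = 0))"


section \<open>Operators\<close>

definition bounded_clinear :: "('a :: complex_inner \<Rightarrow> 'b :: complex_inner) \<Rightarrow> bool" where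
  "bounded_clinear T \<longleftrightarrow> bounded_linear T \<and> (\<forall>c x. T (c *\<^sub>C x) = c *\<^sub>C T x)"

definition adj :: "('a :: complex_inner \<Rightarrow> 'b :: complex_inner) \<Rightarrow> 'b \<Rightarrow> 'a" where
  "adj T = (THE S. \<forall>x y. cinner (T x) y = cinner x (S y))"

definition selfadjoint :: "('a :: complex_inner \<Rightarrow> 'a) \<Rightarrow> bool" where
  "selfadjoint T \<longleftrightarrow> bounded_clinear T \<and> (\<forall>x y. cinner (T x) y = cinner x (T y))"

definition positive_op :: "('a :: complex_inner \<Rightarrow> 'a) \<Rightarrow> bool" where
  "positive_op T \<longleftrightarrow> selfadjoint T \<and> (\<forall>x. 0 \<le> Re (cinner x (T x)))"

definition op_sqrt :: "('a :: complex_inner \<Rightarrow> 'a) \<Rightarrow> 'a \<Rightarrow> 'a" where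
  "op_sqrt T = (THE R. positive_op R \<and> R \<circ> R = T)"

definition re_part :: "('a :: complex_inner \<Rightarrow> 'a) \<Rightarrow> 'a \<Rightarrow> 'a" where
  "re_part T x = (1 / 2) *\<^sub>C (T x + adj T x)"

definition im_part :: "('a :: complex_inner \<Rightarrow> 'a) \<Rightarrow> 'a \<Rightarrow> 'a" where
  "im_part T x = (1 / (2 * \<i>)) *\<^sub>C (T x - adj T x)"

definition resolvent :: "('a :: complex_inner \<Rightarrow> 'a) \<Rightarrow> complex \<Rightarrow> 'a \<Rightarrow> 'a" where
  "resolvent H z = inv (\<lambda>x. H x - z *\<^sub>C x)"

definition op_rank :: "('a :: complex_inner \<Rightarrow> 'b :: complex_inner) \<Rightarrow> enat" where
  "op_rank T = (if finite_cdim (range T) then enat (cdim (range T)) else \<infinity>)"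

text \<open>Trace of a nonnegative operator, as an element of \<open>[0, \<infinity>]\<close> (independent of the basis).\<close>
definition op_trace :: "('a :: complex_inner \<Rightarrow> 'a) \<Rightarrow> ennreal" where
  "op_trace T = (\<Sum>\<^sub>\<infinity>e \<in> (SOME B. is_onb B). ennreal (Re (cinner e (T e))))"

text \<open>The Schatten class of exponent 2: here \<open>|T|\<^sup>2 = T\<^sup>* T\<close>.\<close>
definition schatten2 :: "('a :: complex_inner \<Rightarrow> 'b :: complex_inner) \<Rightarrow> bool" where
  "schatten2 T \<longleftrightarrow> bounded_clinear T \<and> op_trace (adj T \<circ> T) < \<infinity>"

definition schatten2_norm :: "('a :: complex_inner \<Rightarrow> 'b :: complex_inner) \<Rightarrow> real" where
  "schatten2_norm T = sqrt (enn2real (op_trace (adj T \<circ> T)))"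

definition tendsto_schatten2 ::
  "('c \<Rightarrow> 'a :: complex_inner \<Rightarrow> 'b :: complex_inner) \<Rightarrow> ('a \<Rightarrow> 'b) \<Rightarrow> 'c filter \<Rightarrow> bool" where
  "tendsto_schatten2 F L flt \<longleftrightarrow> schatten2 L \<and> eventually (\<lambda>c. schatten2 (F c)) flt
     \<and> ((\<lambda>c. schatten2_norm (\<lambda>x. F c x - L x)) \<longlongrightarrow> 0) flt"

definition eigenspace :: "('a :: complex_inner \<Rightarrow> 'a) \<Rightarrow> real \<Rightarrow> 'a set" where
  "eigenspace T m = {x. T x = m *\<^sub>R x}"

text \<open>
  The spectral projection \<open>1\<^sub>I(S)\<close> of a compact self-adjoint operator \<open>S\<close>: since
  \<open>S\<close> is diagonalizable, \<open>f(S)\<close> acts on the eigenspace of \<open>m\<close> as multiplication by \<open>f(m)\<close>.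
\<close>
definition spectral_proj :: "real set \<Rightarrow> ('a :: complex_inner \<Rightarrow> 'a) \<Rightarrow> 'a \<Rightarrow> 'a" where
  "spectral_proj I S = orth_proj (closure (cspan (\<Union>m\<in>I. eigenspace S m)))"

definition N_plus :: "real \<Rightarrow> ('a :: complex_inner \<Rightarrow> 'a) \<Rightarrow> enat" where
  "N_plus r S = op_rank (spectral_proj {r<..} S)"

definition N_minus :: "real \<Rightarrow> ('a :: complex_inner \<Rightarrow> 'a) \<Rightarrow> enat" where
  "N_minus r S = op_rank (spectral_proj {r<..} (\<lambda>x. - S x))"


section \<open>The space of square-summable sequences\<close>

text \<open>
  A function on \<open>\<int>\<^sub>h\<close> is represented by the function \<open>n \<mapsto> \<phi>(hn)\<close> on the integers; the scalar
  product carries no weight, so \<open>h\<close> enters through the Laplacian only.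
\<close>

lemma l2_add:
  fixes f g :: "'i \<Rightarrow> 'a :: real_normed_vector"
  assumes "(\<lambda>n. (norm (f n))\<^sup>2) summable_on A" "(\<lambda>n. (norm (g n))\<^sup>2) summable_on A"
  shows "(\<lambda>n. (norm (f n + g n))\<^sup>2) summable_on A"
proof (rule summable_on_comparison_test)
  show "(\<lambda>n. 2 * (norm (f n))\<^sup>2 + 2 * (norm (g n))\<^sup>2) summable_on A"
    by (intro summable_on_add summable_on_cmult_right assms)
  fix n
  have "(norm (f n + g n))\<^sup>2 \<le> (norm (f n) + norm (g n))\<^sup>2"
    by (intro power_mono norm_triangle_ineq) simp
  also have "\<dots> \<le> 2 * (norm (f n))\<^sup>2 + 2 * (norm (g n))\<^sup>2"
    using zero_le_power2[of "norm (f n) - norm (g n)"]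
    by (simp add: power2_eq_square algebra_simps)
  finally show "(norm (f n + g n))\<^sup>2 \<le> 2 * (norm (f n))\<^sup>2 + 2 * (norm (g n))\<^sup>2" .
qed auto

lemma l2_bounded:
  fixes f :: "'i \<Rightarrow> 'a :: real_normed_vector" and g :: "'i \<Rightarrow> 'b :: real_normed_vector"
  assumes "(\<lambda>n. (norm (f n))\<^sup>2) summable_on A" and "\<And>n. norm (g n) \<le> c * norm (f n)"
  shows "(\<lambda>n. (norm (g n))\<^sup>2) summable_on A"
proof (rule summable_on_comparison_test)
  show "(\<lambda>n. c\<^sup>2 * (norm (f n))\<^sup>2) summable_on A"
    by (intro summable_on_cmult_right assms)
  show "(norm (g n))\<^sup>2 \<le> c\<^sup>2 * (norm (f n))\<^sup>2" for n
    using power_mono[OF assms(2)[of n] norm_ge_zero, of 2] by (simp add: power_mult_distrib)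
qed auto

lemma l2_mult_abs_summable:
  fixes f :: "'i \<Rightarrow> 'a :: real_normed_vector" and g :: "'i \<Rightarrow> 'b :: real_normed_vector"
    and p :: "'i \<Rightarrow> 'c :: real_normed_vector"
  assumes "(\<lambda>n. (norm (f n))\<^sup>2) summable_on A" "(\<lambda>n. (norm (g n))\<^sup>2) summable_on A"
    and "\<And>n. norm (p n) \<le> norm (f n) * norm (g n)"
  shows "p abs_summable_on A"
proof (rule summable_on_comparison_test)
  show "(\<lambda>n. (norm (f n))\<^sup>2 + (norm (g n))\<^sup>2) summable_on A"
    by (intro summable_on_add assms)
  fix n
  have "2 * (norm (f n) * norm (g n)) \<le> (norm (f n))\<^sup>2 + (norm (g n))\<^sup>2"
    using zero_le_power2[of "norm (f n) - norm (g n)"]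
    by (simp add: power2_eq_square algebra_simps)
  moreover have "0 \<le> norm (f n) * norm (g n)" by simp
  ultimately show "norm (p n) \<le> (norm (f n))\<^sup>2 + (norm (g n))\<^sup>2"
    using assms(3)[of n] by linarith
qed auto

typedef (overloaded) 'a ell2Z =
  "{f :: int \<Rightarrow> 'a :: real_inner. (\<lambda>n. (norm (f n))\<^sup>2) summable_on UNIV}"
  by (rule exI[of _ "\<lambda>_. 0"]) simp

setup_lifting type_definition_ell2Z

lemma l2_Rep: "(\<lambda>n. (norm (Rep_ell2Z f n))\<^sup>2) summable_on UNIV"
  using Rep_ell2Z[of f] by simp

lemma l2_inner_summable:
  "(\<lambda>n. inner (Rep_ell2Z f n) (Rep_ell2Z g n)) summable_on UNIV"
  by (rule abs_summable_summable, rule l2_mult_abs_summable[OF l2_Rep[of f] l2_Rep[of g]])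
    (simp add: Cauchy_Schwarz_ineq2)

instantiation ell2Z :: (real_inner) real_inner
begin

lift_definition zero_ell2Z :: "'a ell2Z" is "\<lambda>_. 0" by simp
lift_definition plus_ell2Z :: "'a ell2Z \<Rightarrow> 'a ell2Z \<Rightarrow> 'a ell2Z" is "\<lambda>f g n. f n + g n"
  by (rule l2_add)
lift_definition uminus_ell2Z :: "'a ell2Z \<Rightarrow> 'a ell2Z" is "\<lambda>f n. - f n" by simp
lift_definition minus_ell2Z :: "'a ell2Z \<Rightarrow> 'a ell2Z \<Rightarrow> 'a ell2Z" is "\<lambda>f g n. f n - g n"
proof -
  fix f g :: "int \<Rightarrow> 'a"
  assume "(\<lambda>n. (norm (f n))\<^sup>2) summable_on UNIV" "(\<lambda>n. (norm (g n))\<^sup>2) summable_on UNIV"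
  then show "(\<lambda>n. (norm (f n - g n))\<^sup>2) summable_on UNIV"
    using l2_add[of f UNIV "\<lambda>n. - g n"] by simp
qed
lift_definition scaleR_ell2Z :: "real \<Rightarrow> 'a ell2Z \<Rightarrow> 'a ell2Z" is "\<lambda>r f n. r *\<^sub>R f n"
  by (rule l2_bounded) auto

definition inner_ell2Z :: "'a ell2Z \<Rightarrow> 'a ell2Z \<Rightarrow> real" where
  "inner_ell2Z f g = (\<Sum>\<^sub>\<infinity>n. inner (Rep_ell2Z f n) (Rep_ell2Z g n))"
definition norm_ell2Z :: "'a ell2Z \<Rightarrow> real" where "norm_ell2Z f = sqrt (inner f f)"
definition dist_ell2Z :: "'a ell2Z \<Rightarrow> 'a ell2Z \<Rightarrow> real" where "dist_ell2Z f g = norm (f - g)"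
definition sgn_ell2Z :: "'a ell2Z \<Rightarrow> 'a ell2Z" where "sgn_ell2Z f = inverse (norm f) *\<^sub>R f"
definition uniformity_ell2Z :: "('a ell2Z \<times> 'a ell2Z) filter" where
  "uniformity_ell2Z = (INF e\<in>{0<..}. principal {(x, y). dist x y < e})"
definition open_ell2Z :: "'a ell2Z set \<Rightarrow> bool" where
  "open_ell2Z U = (\<forall>x\<in>U. eventually (\<lambda>(x', y). x' = x \<longrightarrow> y \<in> U) uniformity)"

instance
proof
  fix x y z :: "'a ell2Z" and r s :: real
  show "x + y + z = x + (y + z)" by transfer (simp add: add.assoc)
  show "x + y = y + x" by transfer (simp add: add.commute)
  show "0 + x = x" "- x + x = 0" "x - y = x + - y" by (transfer; simp)+
  show "r *\<^sub>R (x + y) = r *\<^sub>R x + r *\<^sub>R y" "(r + s) *\<^sub>R x = r *\<^sub>R x + s *\<^sub>R x"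
    "r *\<^sub>R s *\<^sub>R x = (r * s) *\<^sub>R x" "1 *\<^sub>R x = x"
    by (transfer; simp add: scaleR_add_right scaleR_add_left)+
  show "sgn x = inverse (norm x) *\<^sub>R x" by (rule sgn_ell2Z_def)
  show "dist x y = norm (x - y)" by (rule dist_ell2Z_def)
  show "uniformity = (INF e\<in>{0<..}. principal {(x :: 'a ell2Z, y). dist x y < e})"
    by (rule uniformity_ell2Z_def)
  show "open U = (\<forall>x\<in>U. eventually (\<lambda>(x', y). x' = x \<longrightarrow> y \<in> U) uniformity)"
    for U :: "'a ell2Z set" by (rule open_ell2Z_def)
  show "inner x y = inner y x" by (simp add: inner_ell2Z_def inner_commute)
  show "inner (x + y) z = inner x z + inner y z"
    unfolding inner_ell2Z_def plus_ell2Z.rep_eq inner_add_left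
    by (intro infsum_add l2_inner_summable)
  show "inner (r *\<^sub>R x) y = r * inner x y"
    by (simp add: inner_ell2Z_def scaleR_ell2Z.rep_eq infsum_cmult_right')
  show "0 \<le> inner x x" unfolding inner_ell2Z_def by (rule infsum_nonneg) simp
  show "inner x x = 0 \<longleftrightarrow> x = 0"
  proof
    assume "inner x x = 0"
    then have "inner (Rep_ell2Z x n) (Rep_ell2Z x n) = 0" for n
      unfolding inner_ell2Z_def
      by (intro nonneg_infsum_le_0D[of _ UNIV n]) (auto intro: l2_inner_summable)
    then show "x = 0" by transfer auto
  next
    assume "x = 0"
    then show "inner x x = 0" by (simp add: inner_ell2Z_def zero_ell2Z.rep_eq)
  qed
  show "norm x = sqrt (inner x x)" by (rule norm_ell2Z_def)
qed

end

lemma norm_ell2Z_sq: "(norm f)\<^sup>2 = (\<Sum>\<^sub>\<infinity>n. (norm (Rep_ell2Z f n))\<^sup>2)"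
  by (simp add: power2_norm_eq_inner inner_ell2Z_def)

lemma sum_le_norm_ell2Z: "finite F \<Longrightarrow> (\<Sum>n\<in>F. (norm (Rep_ell2Z f n))\<^sup>2) \<le> (norm f)\<^sup>2"
  unfolding norm_ell2Z_sq by (rule finite_sum_le_infsum[OF l2_Rep]) auto

lemma norm_Rep_ell2Z_le: "norm (Rep_ell2Z f n) \<le> norm f"
  using sum_le_norm_ell2Z[of "{n}" f] by (simp add: power2_le_iff_abs_le)

instance ell2Z :: ("{real_inner, complete_space}") complete_space
proof
  fix X :: "nat \<Rightarrow> 'a ell2Z"
  assume X: "Cauchy X"
  have "Cauchy (\<lambda>k. Rep_ell2Z (X k) n)" for n
  proof (rule CauchyI)
    fix e :: real assume "0 < e"
    then obtain M where "\<forall>m\<ge>M. \<forall>k\<ge>M. norm (X m - X k) < e" using CauchyD[OF X] by blast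
    then show "\<exists>M. \<forall>m\<ge>M. \<forall>k\<ge>M. norm (Rep_ell2Z (X m) n - Rep_ell2Z (X k) n) < e"
      using norm_Rep_ell2Z_le[of "X _ - X _" n]
      by (metis minus_ell2Z.rep_eq order_le_less_trans)
  qed
  then have "\<exists>g. \<forall>n. (\<lambda>k. Rep_ell2Z (X k) n) \<longlonglongrightarrow> g n"
    by (intro choice) (simp add: Cauchy_convergent convergent_def[symmetric])
  then obtain g where g: "\<And>n. (\<lambda>k. Rep_ell2Z (X k) n) \<longlonglongrightarrow> g n" by blast
  have key: "(\<Sum>n\<in>F. (norm (Rep_ell2Z (X k) n - g n))\<^sup>2) \<le> e\<^sup>2"
    if F: "finite F" and k: "\<And>m. m \<ge> M \<Longrightarrow> norm (X k - X m) < e" for F k M and e :: real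
  proof (rule tendsto_upperbound)
    show "(\<lambda>m. \<Sum>n\<in>F. (norm (Rep_ell2Z (X k) n - Rep_ell2Z (X m) n))\<^sup>2)
        \<longlonglongrightarrow> (\<Sum>n\<in>F. (norm (Rep_ell2Z (X k) n - g n))\<^sup>2)"
      by (intro tendsto_intros g)
    show "\<forall>\<^sub>F m in sequentially.
        (\<Sum>n\<in>F. (norm (Rep_ell2Z (X k) n - Rep_ell2Z (X m) n))\<^sup>2) \<le> e\<^sup>2"
    proof (rule eventually_sequentiallyI[of M])
      fix m assume "M \<le> m"
      then have "(norm (X k - X m))\<^sup>2 \<le> e\<^sup>2" using k[of m] by (intro power_mono) auto
      then show "(\<Sum>n\<in>F. (norm (Rep_ell2Z (X k) n - Rep_ell2Z (X m) n))\<^sup>2) \<le> e\<^sup>2"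
        using sum_le_norm_ell2Z[OF F, of "X k - X m"] by (simp add: minus_ell2Z.rep_eq)
    qed
  qed simp
  have diff: "(\<lambda>n. (norm (Rep_ell2Z (X k) n - g n))\<^sup>2) summable_on UNIV
      \<and> (\<Sum>\<^sub>\<infinity>n. (norm (Rep_ell2Z (X k) n - g n))\<^sup>2) \<le> e\<^sup>2"
    if k: "\<And>m. m \<ge> M \<Longrightarrow> norm (X k - X m) < e" for k M and e :: real
  proof -
    have s: "(\<lambda>n. (norm (Rep_ell2Z (X k) n - g n))\<^sup>2) summable_on UNIV"
      using key[OF _ k] by (intro nonneg_bdd_above_summable_on bdd_aboveI2[where M = "e\<^sup>2"]) auto
    moreover have "(\<Sum>\<^sub>\<infinity>n. (norm (Rep_ell2Z (X k) n - g n))\<^sup>2) \<le> e\<^sup>2"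
      using key[OF _ k] by (intro infsum_le_finite_sums s) auto
    ultimately show ?thesis by blast
  qed
  obtain M1 where M1: "\<And>m k. m \<ge> M1 \<Longrightarrow> k \<ge> M1 \<Longrightarrow> norm (X m - X k) < 1"
    using CauchyD[OF X, of 1] by auto
  have "(\<lambda>n. (norm (Rep_ell2Z (X M1) n + - (Rep_ell2Z (X M1) n - g n)))\<^sup>2) summable_on UNIV"
    using diff[of M1 M1 1] M1 by (intro l2_add l2_Rep) (simp add: norm_minus_commute)
  then have gs: "(\<lambda>n. (norm (g n))\<^sup>2) summable_on UNIV" by simp
  define G where "G = Abs_ell2Z g"
  have RG: "Rep_ell2Z G = g" unfolding G_def using gs by (simp add: Abs_ell2Z_inverse)
  have "X \<longlonglongrightarrow> G"
  proof (rule LIMSEQ_I)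
    fix e :: real assume e: "0 < e"
    obtain M where M: "\<And>m k. m \<ge> M \<Longrightarrow> k \<ge> M \<Longrightarrow> norm (X m - X k) < e / 2"
      using CauchyD[OF X, of "e / 2"] e by auto
    show "\<exists>no. \<forall>n\<ge>no. norm (X n - G) < e"
    proof (intro exI[of _ M] allI impI)
      fix k assume "M \<le> k"
      then have "(norm (X k - G))\<^sup>2 \<le> (e / 2)\<^sup>2"
        unfolding norm_ell2Z_sq minus_ell2Z.rep_eq RG using diff[of M k "e / 2"] M by blast
      then have "norm (X k - G) \<le> e / 2" using e by (auto intro: power2_le_imp_le)
      then show "norm (X k - G) < e" using e by simp
    qed
  qed
  then show "convergent X" by (rule convergentI)
qed

lemma norm_sq_eq_cinner: "(norm (x :: 'a :: complex_inner))\<^sup>2 = Re (cinner x x)"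
  by (simp add: power2_norm_eq_inner inner_eq_Re_cinner)

lemma cinner_self: "cinner x x = complex_of_real ((norm (x :: 'a :: complex_inner))\<^sup>2)"
  using cinner_commute[of x x] by (simp add: norm_sq_eq_cinner complex_eq_iff)

lemma norm_scaleC: "norm (c *\<^sub>C (x :: 'a :: complex_inner)) = cmod c * norm x"
proof -
  have "cinner (c *\<^sub>C x) (c *\<^sub>C x) = (cnj c * c) * cinner x x"
    by (simp add: cinner_scaleC_right cinner_commute[of "c *\<^sub>C x" x])
      (metis cinner_commute complex_cnj_mult mult.left_commute)
  also have "\<dots> = complex_of_real ((cmod c * norm x)\<^sup>2)"
    by (simp add: cinner_self power_mult_distrib complex_norm_square[symmetric] mult.commute)
  finally have "(norm (c *\<^sub>C x))\<^sup>2 = (cmod c * norm x)\<^sup>2"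
    by (simp add: norm_sq_eq_cinner)
  then show ?thesis by simp
qed

lemma cmod_cinner_le: "cmod (cinner x y) \<le> norm x * norm (y :: 'a :: complex_inner)"
proof (cases "cinner x y = 0")
  case False
  define u where "u = cnj (cinner x y) / cmod (cinner x y)"
  have u: "cmod u = 1" using False by (simp add: u_def norm_divide)
  have "complex_of_real (cmod (cinner x y)) = cinner x (u *\<^sub>C y)"
    using False by (simp add: cinner_scaleC_right u_def complex_norm_square[symmetric]
        power2_eq_square mult.commute[of "cnj _"] field_simps)
  then have "cmod (cinner x y) = inner x (u *\<^sub>C y)"
    by (metis Re_complex_of_real inner_eq_Re_cinner)
  also have "\<dots> \<le> norm x * norm (u *\<^sub>C y)" by (rule norm_cauchy_schwarz)
  finally show ?thesis by (simp add: norm_scaleC u)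
qed simp

lemma l2_cinner_summable:
  "(\<lambda>n. cinner (Rep_ell2Z f n) (Rep_ell2Z g n :: 'a :: complex_inner)) summable_on UNIV"
  by (rule abs_summable_summable, rule l2_mult_abs_summable[OF l2_Rep[of f] l2_Rep[of g]])
    (rule cmod_cinner_le)

instantiation ell2Z :: (complex_inner) complex_inner
begin

lift_definition scaleC_ell2Z :: "complex \<Rightarrow> 'a ell2Z \<Rightarrow> 'a ell2Z" is "\<lambda>c f n. c *\<^sub>C f n"
  by (rule l2_bounded) (auto simp: norm_scaleC)

definition cinner_ell2Z :: "'a ell2Z \<Rightarrow> 'a ell2Z \<Rightarrow> complex" where
  "cinner_ell2Z f g = (\<Sum>\<^sub>\<infinity>n. cinner (Rep_ell2Z f n) (Rep_ell2Z g n))"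

instance
proof
  fix x y z :: "'a ell2Z" and a b :: complex and r :: real
  show "a *\<^sub>C (x + y) = a *\<^sub>C x + a *\<^sub>C y" by transfer (simp add: scaleC_add_right)
  show "(a + b) *\<^sub>C x = a *\<^sub>C x + b *\<^sub>C x" by transfer (simp add: scaleC_add_left)
  show "a *\<^sub>C (b *\<^sub>C x) = (a * b) *\<^sub>C x" by transfer (simp add: scaleC_scaleC)
  show "r *\<^sub>R x = complex_of_real r *\<^sub>C x" by transfer (simp add: scaleR_scaleC)
  show "cinner x y = cnj (cinner y x)"
    by (simp add: cinner_ell2Z_def infsum_cnj[symmetric] cinner_commute[symmetric])
  show "cinner x (y + z) = cinner x y + cinner x z"
    unfolding cinner_ell2Z_def plus_ell2Z.rep_eq cinner_add_right
    by (intro infsum_add l2_cinner_summable)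
  show "cinner x (a *\<^sub>C y) = a * cinner x y"
    by (simp add: cinner_ell2Z_def scaleC_ell2Z.rep_eq cinner_scaleC_right infsum_cmult_right')
  show "inner x y = Re (cinner x y)"
    by (simp add: inner_ell2Z_def cinner_ell2Z_def inner_eq_Re_cinner infsum_Re l2_cinner_summable)
qed

end

instance ell2Z :: (chilbert_space) chilbert_space ..


section \<open>The unperturbed operator and its thresholds\<close>

text \<open>
  \<open>\<ell>\<^sup>2(\<int>\<^sub>h) \<otimes> \<G>\<close> is identified with \<open>\<ell>\<^sup>2(\<int>\<^sub>h, \<G>)\<close>, the elementary tensor \<open>\<phi> \<otimes> g\<close> being the
  function \<open>n \<mapsto> \<phi>(hn) g\<close>. Under this identification a multiplication operator tensored with an
  operator on \<open>\<G>\<close> acts fibrewise, and the Laplacian tensored with the identity is given by the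
  formula for the scalar Laplacian; the \<open>etensor\<close> lemmas below record this.
\<close>
lift_definition etensor :: "complex ell2Z \<Rightarrow> 'g :: complex_inner \<Rightarrow> 'g ell2Z" is
  "\<lambda>\<phi> g n. \<phi> n *\<^sub>C g"
  by (rule l2_bounded) (auto simp: norm_scaleC mult.commute)

lemma summable_on_shift_int:
  fixes f :: "int \<Rightarrow> real"
  assumes "f summable_on UNIV"
  shows "(\<lambda>n. f (n + k)) summable_on UNIV"
proof -
  have "bij_betw (\<lambda>n. n + k) UNIV (UNIV :: int set)"
    by (rule bij_betwI[of _ _ _ "\<lambda>n. n - k"]) auto
  from summable_on_reindex_bij_betw[OF this, of f] assms show ?thesis by simp
qed

lift_definition neg_laplacian :: "real \<Rightarrow> 'g :: complex_inner ell2Z \<Rightarrow> 'g ell2Z" is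
  "\<lambda>h \<phi> n. (1 / h\<^sup>2) *\<^sub>R (2 *\<^sub>R \<phi> n - \<phi> (n + 1) - \<phi> (n - 1))"
proof -
  fix h :: real and \<phi> :: "int \<Rightarrow> 'g"
  assume a: "(\<lambda>n. (norm (\<phi> n))\<^sup>2) summable_on UNIV"
  have "(\<lambda>n. (norm (- \<phi> (n + k)))\<^sup>2) summable_on UNIV" for k
    using summable_on_shift_int[OF a, of k] by simp
  from l2_add[OF l2_add[OF l2_bounded[OF a, of "\<lambda>n. 2 *\<^sub>R \<phi> n" 2] this[of 1]] this[of "-1"]]
  have "(\<lambda>n. (norm (2 *\<^sub>R \<phi> n - \<phi> (n + 1) - \<phi> (n - 1)))\<^sup>2) summable_on UNIV" by simp
  then show "(\<lambda>n. (norm ((1 / h\<^sup>2) *\<^sub>R (2 *\<^sub>R \<phi> n - \<phi> (n + 1) - \<phi> (n - 1))))\<^sup>2) summable_on UNIV"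
    by (rule l2_bounded[where c = "\<bar>1 / h\<^sup>2\<bar>"]) simp
qed

definition fibre_op ::
  "(int \<Rightarrow> 'a \<Rightarrow> 'b) \<Rightarrow> 'a :: complex_inner ell2Z \<Rightarrow> 'b :: complex_inner ell2Z" where
  "fibre_op k \<phi> = Abs_ell2Z (\<lambda>n. k n (Rep_ell2Z \<phi> n))"

lemma Rep_fibre_op:
  assumes "\<And>n x. norm (k n x) \<le> c * norm x"
  shows "Rep_ell2Z (fibre_op k \<phi>) = (\<lambda>n. k n (Rep_ell2Z \<phi> n))"
  unfolding fibre_op_def
  by (intro Abs_ell2Z_inverse CollectI l2_bounded[OF l2_Rep[of \<phi>], where c = c] assms)

definition I_tensor :: "('g :: complex_inner \<Rightarrow> 'g) \<Rightarrow> 'g ell2Z \<Rightarrow> 'g ell2Z" where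
  "I_tensor A = fibre_op (\<lambda>n. A)"

definition psi :: "real \<Rightarrow> int \<Rightarrow> real" where
  "psi \<nu>0 n = sqrt (1 + (real_of_int n)\<^sup>2) powr (- \<nu>0 / 2)"

definition Mpsi_tensor :: "real \<Rightarrow> ('g :: complex_inner \<Rightarrow> 'g) \<Rightarrow> 'g ell2Z \<Rightarrow> 'g ell2Z" where
  "Mpsi_tensor \<nu>0 A = fibre_op (\<lambda>n x. psi \<nu>0 n *\<^sub>R A x)"

definition J_tensor :: "'g :: complex_inner ell2Z \<Rightarrow> 'g ell2Z" where
  "J_tensor = fibre_op (\<lambda>n x. ((- 1) powi n :: real) *\<^sub>R x)"

text \<open>\<open>\<langle>\<psi>| \<otimes> A\<close>, with \<open>\<complex> \<otimes> \<G>\<close> identified with \<open>\<G>\<close>.\<close>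
definition bra_psi_tensor ::
  "real \<Rightarrow> ('g :: complex_inner \<Rightarrow> 'g) \<Rightarrow> 'g ell2Z \<Rightarrow> 'g" where
  "bra_psi_tensor \<nu>0 A \<phi> = (\<Sum>\<^sub>\<infinity>n. psi \<nu>0 n *\<^sub>R A (Rep_ell2Z \<phi> n))"

lemma psi_le_1: "0 \<le> \<nu>0 \<Longrightarrow> psi \<nu>0 n \<le> 1"
  unfolding psi_def using powr_mono[of "- \<nu>0 / 2" 0 "sqrt (1 + (real_of_int n)\<^sup>2)"]
  by (simp add: add_nonneg_eq_0_iff)

lemma psi_nonneg: "0 \<le> psi \<nu>0 n"
  by (simp add: psi_def)

lemma bounded_clinearD:
  assumes "bounded_clinear A"
  shows "bounded_linear A" "A (c *\<^sub>C x) = c *\<^sub>C A x"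
  using assms by (auto simp: bounded_clinear_def)

lemma scaleR_scaleC_commute: "r *\<^sub>R (c *\<^sub>C (x :: 'a :: complex_inner)) = c *\<^sub>C (r *\<^sub>R x)"
  by (simp add: scaleR_scaleC scaleC_scaleC mult.commute)

lemma neg_laplacian_etensor: "neg_laplacian h (etensor \<phi> g) = etensor (neg_laplacian h \<phi>) g"
  by transfer (simp add: scaleC_complex_def scaleR_scaleC scaleC_scaleC scaleR_conv_of_real
      complex_vector.scale_left_diff_distrib complex_vector.scale_right_diff_distrib
      algebra_simps)

lemma I_tensor_etensor:
  assumes "bounded_clinear A"
  shows "I_tensor A (etensor \<phi> g) = etensor \<phi> (A g)"
proof -
  obtain c where c: "\<And>x. norm (A x) \<le> c * norm x"
    using bounded_linear.bounded[OF bounded_clinearD(1)[OF assms]] by (auto simp: mult.commute)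
  show ?thesis
    unfolding I_tensor_def Rep_ell2Z_inject[symmetric]
    by (subst Rep_fibre_op[where c = c])
      (use c in \<open>auto simp: etensor.rep_eq bounded_clinearD(2)[OF assms]\<close>)
qed

lemma Mpsi_tensor_etensor:
  assumes "bounded_clinear A" "0 \<le> \<nu>0"
  shows "Mpsi_tensor \<nu>0 A (etensor \<phi> g)
    = etensor (fibre_op (\<lambda>n x. complex_of_real (psi \<nu>0 n) * x) \<phi>) (A g)"
proof -
  obtain c where c: "\<And>x. norm (A x) \<le> c * norm x"
    using bounded_linear.bounded[OF bounded_clinearD(1)[OF assms(1)]] by (auto simp: mult.commute)
  have b: "psi \<nu>0 n * t \<le> 1 * t" if "0 \<le> t" for n t
    using that psi_le_1[OF assms(2), of n] by (intro mult_right_mono) auto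
  have c': "norm (psi \<nu>0 n *\<^sub>R A x) \<le> c * norm x" for n x
    using b[of "norm (A x)" n] c[of x] by (simp add: psi_nonneg)
  have d': "norm (complex_of_real (psi \<nu>0 n) * x) \<le> 1 * norm x" for n x
    using b[of "norm x" n] by (simp add: norm_mult psi_nonneg)
  show ?thesis
    unfolding Mpsi_tensor_def Rep_ell2Z_inject[symmetric] etensor.rep_eq
    by (subst Rep_fibre_op[OF c'], subst Rep_fibre_op[OF d'])
      (simp add: etensor.rep_eq bounded_clinearD(2)[OF assms(1)] scaleR_scaleC scaleC_scaleC)
qed

lemma bra_psi_tensor_etensor:
  fixes A :: "'a :: complex_inner \<Rightarrow> 'a"
  assumes "bounded_clinear A" "(\<lambda>n. (psi \<nu>0 n)\<^sup>2) summable_on UNIV"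
  shows "bra_psi_tensor \<nu>0 A (etensor \<phi> g)
    = (\<Sum>\<^sub>\<infinity>n. complex_of_real (psi \<nu>0 n) * Rep_ell2Z \<phi> n) *\<^sub>C A g"
proof -
  have bl: "bounded_linear (\<lambda>c. c *\<^sub>C A g)"
    by (rule bounded_linear_intro[where K = "norm (A g)"])
      (simp_all add: scaleC_add_left norm_scaleC scaleR_scaleC[where 'a = 'a] scaleC_scaleC
        scaleR_conv_of_real)
  have "(\<lambda>n. complex_of_real (psi \<nu>0 n) * Rep_ell2Z \<phi> n) summable_on UNIV"
    by (rule abs_summable_summable,
        rule l2_mult_abs_summable[where f = "psi \<nu>0", OF _ l2_Rep[of \<phi>]])
      (use assms(2) in \<open>auto simp: norm_mult\<close>)
  from infsumI[OF has_sum_bounded_linear[OF bl has_sum_infsum[OF this]]] show ?thesis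
    by (simp add: bra_psi_tensor_def etensor.rep_eq bounded_clinearD(2)[OF assms(1)]
        scaleR_scaleC scaleC_scaleC o_def)
qed

definition H_free :: "real \<Rightarrow> ('g :: complex_inner \<Rightarrow> 'g) \<Rightarrow> 'g ell2Z \<Rightarrow> 'g ell2Z" where
  "H_free h Q \<phi> = neg_laplacian h \<phi> + I_tensor Q \<phi>"

text \<open>
  \<open>IQ\<close> is the index set \<open>I\<^sub>Q\<close> and \<open>\<mu>\<close> the enumeration of the distinct eigenvalues of \<open>Q\<close>. The
  decomposition of the space makes a self-adjoint \<open>Q\<close> automatically bounded and the sum of the
  eigenspaces automatically orthogonal.
\<close>
definition spectral_data ::
  "('g :: complex_inner \<Rightarrow> 'g) \<Rightarrow> nat set \<Rightarrow> (nat \<Rightarrow> real) \<Rightarrow> bool" where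
  "spectral_data Q IQ \<mu> \<longleftrightarrow> selfadjoint Q \<and>
     ((Q = (\<lambda>_. 0) \<and> IQ = {0} \<and> \<mu> 0 = 0) \<or>
      (Q \<noteq> (\<lambda>_. 0) \<and> (\<exists>d. IQ = {1..d}) \<and> inj_on \<mu> IQ \<and>
       \<mu> ` IQ = {m. eigenspace Q m \<noteq> {0}} \<and>
       (\<forall>x. \<exists>y. (\<forall>s\<in>IQ. y s \<in> eigenspace Q (\<mu> s)) \<and> x = (\<Sum>s\<in>IQ. y s))))"

text \<open>For \<open>Q = 0\<close> the following two conditions hold vacuously.\<close>
definition lower_threshold_nondeg :: "real \<Rightarrow> nat set \<Rightarrow> (nat \<Rightarrow> real) \<Rightarrow> nat \<Rightarrow> bool" where
  "lower_threshold_nondeg h IQ \<mu> s \<longleftrightarrow> (\<forall>s'\<in>IQ. s' \<noteq> s \<longrightarrow> \<mu> s \<noteq> 4 / h\<^sup>2 + \<mu> s')"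

definition upper_threshold_nondeg :: "real \<Rightarrow> nat set \<Rightarrow> (nat \<Rightarrow> real) \<Rightarrow> nat \<Rightarrow> bool" where
  "upper_threshold_nondeg h IQ \<mu> s \<longleftrightarrow> (\<forall>s'\<in>IQ. s' \<noteq> s \<longrightarrow> 4 / h\<^sup>2 + \<mu> s \<noteq> \<mu> s')"


section \<open>The spectral shift function\<close>

definition T_boundary ::
  "('a :: complex_inner \<Rightarrow> 'a) \<Rightarrow> ('a \<Rightarrow> 'a) \<Rightarrow> real \<Rightarrow> 'a \<Rightarrow> 'a" where
  "T_boundary H0 M E =
     (THE L. tendsto_schatten2 (\<lambda>\<epsilon>. M \<circ> resolvent H0 (Complex E \<epsilon>) \<circ> adj M) L (at_right 0))"

text \<open>
  The representatives of \<open>\<xi>(E; H0 + M\<^sup>*M, H0)\<close> and \<open>\<xi>(E; H0 - M\<^sup>*M, H0)\<close>. They are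
  extended-real-valued so that finiteness is not built into the definition.
\<close>
definition ssf_plus :: "('a :: complex_inner \<Rightarrow> 'a) \<Rightarrow> ('a \<Rightarrow> 'a) \<Rightarrow> real \<Rightarrow> ereal" where
  "ssf_plus H0 M E = (let T = T_boundary H0 M E in
     ereal (1 / pi) * enn2ereal (\<integral>\<^sup>+t.
       ennreal_of_enat (N_minus 1 (\<lambda>x. re_part T x + t *\<^sub>R im_part T x))
         * ennreal (1 / (1 + t\<^sup>2)) \<partial>lborel))"

definition ssf_minus :: "('a :: complex_inner \<Rightarrow> 'a) \<Rightarrow> ('a \<Rightarrow> 'a) \<Rightarrow> real \<Rightarrow> ereal" where
  "ssf_minus H0 M E = (let T = T_boundary H0 M E in
     - ereal (1 / pi) * enn2ereal (\<integral>\<^sup>+t.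
       ennreal_of_enat (N_plus 1 (\<lambda>x. re_part T x + t *\<^sub>R im_part T x))
         * ennreal (1 / (1 + t\<^sup>2)) \<partial>lborel))"

text \<open>
  \<open>V = (M\<^sub>\<psi> \<otimes> K\<^sup>*) \<V> (M\<^sub>\<psi> \<otimes> K) = M\<^sup>* M\<close> for the factor \<open>M = \<V>\<^sup>1\<^sup>/\<^sup>2 (M\<^sub>\<psi> \<otimes> K)\<close>, and \<open>H\<^sup>\<plusminus> = H\<^sub>Q \<plusminus> V\<close>.
\<close>
definition V_factor ::
  "real \<Rightarrow> ('g :: complex_inner ell2Z \<Rightarrow> 'g ell2Z) \<Rightarrow> ('g \<Rightarrow> 'g) \<Rightarrow> 'g ell2Z \<Rightarrow> 'g ell2Z" where
  "V_factor \<nu>0 W K = op_sqrt W \<circ> Mpsi_tensor \<nu>0 K"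

definition xi_plus where
  "xi_plus h \<nu>0 Q W K = ssf_plus (H_free h Q) (V_factor \<nu>0 W K)"

definition xi_minus where
  "xi_minus h \<nu>0 Q W K = ssf_minus (H_free h Q) (V_factor \<nu>0 W K)"


section \<open>Effective operators\<close>

definition V_bold ::
  "('g :: complex_inner ell2Z \<Rightarrow> 'g ell2Z) \<Rightarrow> ('g \<Rightarrow> 'g) \<Rightarrow> 'g ell2Z \<Rightarrow> 'g ell2Z" where
  "V_bold W K = I_tensor (adj K) \<circ> W \<circ> I_tensor K"

definition V_bold_J ::
  "('g :: complex_inner ell2Z \<Rightarrow> 'g ell2Z) \<Rightarrow> ('g \<Rightarrow> 'g) \<Rightarrow> 'g ell2Z \<Rightarrow> 'g ell2Z" where
  "V_bold_J W K = adj J_tensor \<circ> V_bold W K \<circ> J_tensor"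

definition P_thr :: "real \<Rightarrow> ('g :: complex_inner \<Rightarrow> 'g) \<Rightarrow> real \<Rightarrow> 'g ell2Z \<Rightarrow> 'g" where
  "P_thr \<nu>0 Q m = bra_psi_tensor \<nu>0 (orth_proj (eigenspace Q m))"

definition sandwich ::
  "('a :: complex_inner \<Rightarrow> 'b :: complex_inner) \<Rightarrow> ('a \<Rightarrow> 'a) \<Rightarrow> 'b \<Rightarrow> 'b" where
  "sandwich P A = P \<circ> A \<circ> adj P"

definition counting_fun :: "('a :: complex_inner \<Rightarrow> 'a) \<Rightarrow> real \<Rightarrow> ennreal" where
  "counting_fun S r = op_trace (spectral_proj {r<..} S)"

text \<open>
  For any small \<open>\<epsilon>\<close>, \<open>\<Phi>(r(1 \<plusminus> \<epsilon>)) = \<Psi>(r)(1 + o(1) + O(\<epsilon>))\<close> as \<open>r\<close> decreases to 0: \<open>a\<close> is the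
  \<open>o(1)\<close> term (which may depend on \<open>\<epsilon>\<close>) and \<open>b\<close> the \<open>O(\<epsilon>)\<close> term, \<open>C\<close> being independent of
  \<open>r\<close> and \<open>\<epsilon>\<close>.
\<close>
definition regular_counting :: "(real \<Rightarrow> ennreal) \<Rightarrow> (real \<Rightarrow> real) \<Rightarrow> bool" where
  "regular_counting \<Phi> \<Psi> \<longleftrightarrow>
     (\<exists>C. \<exists>\<epsilon>0\<in>{0<..<1}. \<forall>\<epsilon>\<in>{0<..<\<epsilon>0}. \<forall>\<sigma>\<in>{1, -1}.
        \<exists>a b. (a \<longlongrightarrow> 0) (at_right 0) \<and>
          (\<forall>\<^sub>F r in at_right 0. \<bar>b r\<bar> \<le> C * \<epsilon> \<and>
             enn2ereal (\<Phi> (r * (1 + \<sigma> * \<epsilon>))) = ereal (\<Psi> r * (1 + a r + b r))))"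

end

theory Submission
  imports Defs
begin

text \<open>
  Write \<open>A + \<i> B\<close> for the boundary value of the sandwiched resolvent. The resolvent of the lattice
  Laplacian has the kernel \<open>c \<rho>^\<bar>n - m\<bar>\<close> with \<open>\<rho> + 1 / \<rho> = 2 - h\<^sup>2 e\<close>, so \<open>A\<close> and \<open>B\<close> are sums of
  Hilbert--Schmidt operators, one for each eigenvalue of \<open>Q\<close>. At a non-degenerate threshold all
  but one of them stay bounded; the remaining one is a large multiple \<open>\<plusminus> c Y\<^sup>* Y\<close> of the rank-one
  kernel of the threshold plus a bounded error, where \<open>Y Y\<^sup>*\<close> is the effective operator. Moreover
  \<open>B \<ge> 0\<close> has bounded trace, and the integral of \<open>n\<^sub>+(\<delta>, t B) / (1 + t\<^sup>2)\<close> over \<open>t\<close> is at most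
  \<open>Tr B / \<delta>\<close>. Weyl's inequalities therefore squeeze the spectral shift function between the
  counting functions of the effective operator at \<open>(1 \<plusminus> \<delta>) / c\<close>, up to an error depending on
  \<open>\<delta>\<close> only, which is negligible against \<open>\<Psi>\<close>.
\<close>

section \<open>Complex inner products\<close>

text \<open>The two thresholds differ by a sign. Below \<open>\<mu> s\<close> the root tends to
  \<open>1\<close> and the leading kernel is a positive multiple of a constant. Above
  \<open>4 / h^2 + \<mu> s\<close> the root tends to \<open>- 1\<close>: the kernel alternates,
  which is where \<open>J\<close> comes from, and the multiple is negative. Where the leading term
  is negative it may be dropped from an upper bound, which gives the two bounded cases. The obstacle
  is \<open>t B\<close>, which is not small uniformly in \<open>t\<close>. From above it is
  controlled only after integration over \<open>t\<close>. From below the integral is cut to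
  \<open>|t| <= T\<close>, where \<open>t B\<close> has bounded Hilbert-Schmidt norm, at the price
  of a factor \<open>2 arctan T / pi\<close>; \<open>T\<close> grows only after the limit in the
  energy has been taken for fixed \<open>T\<close>. Measurability of the count in \<open>t\<close>
  is never established: integrals are compared by monotonicity with measurable functions. Only
  eigenvalues above a positive level are counted, and a Hilbert-Schmidt operator has finitely many
  of them, so maximising the quadratic form takes the place of the spectral theorem.\<close>

lemma cinner_add_left: "cinner (x + y) (z :: 'a :: complex_inner) = cinner x z + cinner y z"
  by (metis cinner_add_right cinner_commute complex_cnj_add)

lemma cinner_scaleC_left: "cinner (a *\<^sub>C x) (y :: 'a :: complex_inner) = cnj a * cinner x y"
  by (metis cinner_commute cinner_scaleC_right complex_cnj_mult)

lemma cinner_scaleR_right: "cinner x (r *\<^sub>R (y :: 'a :: complex_inner)) = of_real r * cinner x y"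
  by (simp add: scaleR_scaleC cinner_scaleC_right)

lemma cinner_scaleR_left: "cinner (r *\<^sub>R x) (y :: 'a :: complex_inner) = of_real r * cinner x y"
  by (simp add: scaleR_scaleC cinner_scaleC_left)

lemma cinner_zero_right [simp]: "cinner x (0 :: 'a :: complex_inner) = 0"
  using cinner_scaleR_right[of x 0 0] by simp

lemma cinner_zero_left [simp]: "cinner 0 (x :: 'a :: complex_inner) = 0"
  using cinner_scaleR_left[of 0 0 x] by simp

lemma cinner_minus_right: "cinner x (- y :: 'a :: complex_inner) = - cinner x y"
  using cinner_scaleR_right[of x "-1" y] by simp

lemma cinner_minus_left: "cinner (- x) (y :: 'a :: complex_inner) = - cinner x y"
  using cinner_scaleR_left[of "-1" x y] by simp

lemma cinner_diff_right: "cinner x (y - z :: 'a :: complex_inner) = cinner x y - cinner x z"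
  using cinner_add_right[of x y "- z"] by (simp add: cinner_minus_right)

lemma cinner_diff_left: "cinner (x - y) (z :: 'a :: complex_inner) = cinner x z - cinner y z"
  using cinner_add_left[of x "- y" z] by (simp add: cinner_minus_left)

lemma cinner_sum_right: "cinner x (\<Sum>i\<in>I. f i :: 'a :: complex_inner) = (\<Sum>i\<in>I. cinner x (f i))"
  by (induction I rule: infinite_finite_induct) (auto simp: cinner_add_right)

lemma cinner_sum_left: "cinner (\<Sum>i\<in>I. f i) (x :: 'a :: complex_inner) = (\<Sum>i\<in>I. cinner (f i) x)"
  by (induction I rule: infinite_finite_induct) (auto simp: cinner_add_left)

lemmas cinner_simps = cinner_add_left cinner_add_right cinner_diff_left cinner_diff_right
  cinner_minus_left cinner_minus_right cinner_scaleC_left cinner_scaleC_right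
  cinner_scaleR_left cinner_scaleR_right

lemma cinner_eq_0_commute: "cinner x y = 0 \<longleftrightarrow> cinner y (x :: 'a :: complex_inner) = 0"
  by (metis cinner_commute complex_cnj_zero)

lemma cinner_self_eq_0: "cinner x x = 0 \<longleftrightarrow> (x :: 'a :: complex_inner) = 0"
  by (simp add: cinner_self)

lemma bounded_linear_cinner_right: "bounded_linear (cinner (x :: 'a :: complex_inner))"
  by (rule bounded_linear_intro[where K = "norm x"])
    (use cmod_cinner_le[of x] in \<open>simp_all add: cinner_add_right cinner_scaleR_right scaleR_conv_of_real
      mult.commute[of _ "norm x"]\<close>)

lemma bounded_linear_cinner_left: "bounded_linear (\<lambda>x. cinner x (y :: 'a :: complex_inner))"
  by (rule bounded_linear_intro[where K = "norm y"])
    (simp_all add: cinner_add_left cinner_scaleR_left scaleR_conv_of_real cmod_cinner_le)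

lemmas tendsto_cinner_right = bounded_linear.tendsto[OF bounded_linear_cinner_right]

lemma cinner_ext: "(\<And>z. cinner z x = cinner z y) \<Longrightarrow> x = (y :: 'a :: complex_inner)"
  by (metis cinner_diff_right cinner_self_eq_0 eq_iff_diff_eq_0)

lemma bounded_linear_scaleC_right: "bounded_linear (\<lambda>x :: 'a :: complex_inner. c *\<^sub>C x)"
  by (rule bounded_linear_intro[where K = "cmod c"])
    (simp_all add: scaleC_add_right scaleR_scaleC_commute norm_scaleC mult.commute)

lemma bounded_linear_scaleC_left: "bounded_linear (\<lambda>c. c *\<^sub>C (x :: 'a :: complex_inner))"
  by (rule bounded_linear_intro[where K = "norm x"])
    (simp_all add: scaleC_add_left norm_scaleC scaleR_conv_of_real scaleR_scaleC[where 'a='a]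
      scaleC_scaleC)


section \<open>Finite orthonormal sets\<close>

definition orthonormal :: "'a :: complex_inner set \<Rightarrow> bool" where
  "orthonormal F \<longleftrightarrow> (\<forall>x\<in>F. norm x = 1) \<and> (\<forall>x\<in>F. \<forall>y\<in>F. x \<noteq> y \<longrightarrow> cinner x y = 0)"

lemma orthonormal_cinner:
  "orthonormal F \<Longrightarrow> x \<in> F \<Longrightarrow> y \<in> F \<Longrightarrow> cinner x y = (if x = y then 1 else 0)"
  by (auto simp: orthonormal_def cinner_self)

lemma orthonormal_subset: "orthonormal F \<Longrightarrow> G \<subseteq> F \<Longrightarrow> orthonormal G"
  by (auto simp: orthonormal_def)

lemma orthonormal_empty [simp]: "orthonormal {}"
  by (simp add: orthonormal_def)

lemma orthonormal_insert:
  assumes "orthonormal F" "norm x = 1" "\<And>f. f \<in> F \<Longrightarrow> cinner f x = 0"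
  shows "orthonormal (insert x F)"
proof -
  have "cinner x f = 0" if "f \<in> F" for f using assms(3)[OF that] cinner_eq_0_commute by blast
  then show ?thesis using assms by (auto simp: orthonormal_def)
qed

text \<open>The orthogonal projection onto the span when \<open>F\<close> is finite and orthonormal.
  As a plain sum it is linear and symmetric for every \<open>F\<close>, so only statements about its
  range or its remainder carry those assumptions.\<close>

definition fproj :: "'a :: complex_inner set \<Rightarrow> 'a \<Rightarrow> 'a" where
  "fproj F x = (\<Sum>f\<in>F. cinner f x *\<^sub>C f)"

lemma fproj_in_span: "fproj F x \<in> cspan F"
  unfolding fproj_def
  by (intro complex_vector.span_sum complex_vector.span_scale complex_vector.span_base)

lemma cinner_fproj:
  assumes "finite F" "orthonormal F" "f \<in> F"
  shows "cinner f (fproj F x) = cinner f x"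
proof -
  have "cinner f (fproj F x) = (\<Sum>g\<in>F. if g = f then cinner f x else 0)"
    unfolding fproj_def cinner_sum_right
    by (intro sum.cong) (auto simp: cinner_scaleC_right orthonormal_cinner[OF assms(2)] assms(3))
  then show ?thesis using assms by simp
qed

lemma cinner_span_zero:
  assumes "\<And>f. f \<in> F \<Longrightarrow> cinner f x = 0" "z \<in> cspan F"
  shows "cinner z (x :: 'a :: complex_inner) = 0"
  using assms(2)
  by (induction rule: complex_vector.span_induct_alt) (auto simp: cinner_simps assms(1))

lemma cinner_fproj_diff:
  assumes "finite F" "orthonormal F" "z \<in> cspan F"
  shows "cinner z (x - fproj F x) = 0"
  using assms(3) by (rule cinner_span_zero[rotated]) (simp add: cinner_diff_right cinner_fproj assms)

lemma fproj_scaleC: "fproj F (c *\<^sub>C x) = c *\<^sub>C fproj F x"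
  by (simp add: fproj_def cinner_scaleC_right scaleC_scaleC complex_vector.scale_sum_right)

lemma fproj_span:
  assumes "finite F" "orthonormal F" "x \<in> cspan F"
  shows "fproj F x = x"
proof -
  have "x - fproj F x \<in> cspan F"
    by (intro complex_vector.span_diff assms fproj_in_span)
  from cinner_fproj_diff[OF assms(1,2) this, of x] show ?thesis
    by (simp add: cinner_self_eq_0)
qed

lemma norm_add_orthogonal:
  assumes "cinner x y = 0"
  shows "(norm (x + y :: 'a :: complex_inner))\<^sup>2 = (norm x)\<^sup>2 + (norm y)\<^sup>2"
proof -
  have "cinner y x = 0" using assms cinner_eq_0_commute by blast
  then show ?thesis using assms by (simp add: norm_sq_eq_cinner cinner_simps)
qed

lemma norm_fproj:
  assumes "finite F" "orthonormal F"
  shows "(norm (fproj F x))\<^sup>2 = (\<Sum>f\<in>F. (cmod (cinner f x))\<^sup>2)"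
proof -
  have "cinner (fproj F x) (fproj F x) = (\<Sum>f\<in>F. cnj (cinner f x) * cinner f (fproj F x))"
    by (subst (1) fproj_def) (simp add: cinner_sum_left cinner_scaleC_left)
  also have "\<dots> = (\<Sum>f\<in>F. of_real ((cmod (cinner f x))\<^sup>2))"
    by (intro sum.cong refl, subst complex_norm_square) (simp add: cinner_fproj assms mult.commute)
  finally show ?thesis by (simp add: norm_sq_eq_cinner)
qed

lemma norm_fproj_pythagoras:
  assumes "finite F" "orthonormal F"
  shows "(norm x)\<^sup>2 = (norm (fproj F x))\<^sup>2 + (norm (x - fproj F x))\<^sup>2"
  using norm_add_orthogonal[OF cinner_fproj_diff[OF assms fproj_in_span, of x x]] by simp

lemma bessel:
  assumes "finite F" "orthonormal F"
  shows "(\<Sum>f\<in>F. (cmod (cinner f x))\<^sup>2) \<le> (norm x)\<^sup>2"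
  using norm_fproj_pythagoras[OF assms, of x] norm_fproj[OF assms, of x] by simp

lemma fproj_best_approx:
  assumes "finite F" "orthonormal F" "y \<in> cspan F"
  shows "norm (x - fproj F x) \<le> norm (x - y)"
proof -
  have *: "fproj F x - y \<in> cspan F"
    by (intro complex_vector.span_diff assms fproj_in_span)
  have "(norm (fproj F x - y + (x - fproj F x)))\<^sup>2
      = (norm (fproj F x - y))\<^sup>2 + (norm (x - fproj F x))\<^sup>2"
    by (rule norm_add_orthogonal[OF cinner_fproj_diff[OF assms(1,2) *]])
  then show ?thesis by (intro power2_le_imp_le[OF _ norm_ge_zero]) simp
qed

text \<open>The cardinality clause makes this usable as a dimension count: a vector already in the
  span adds nothing, any other adds its normalised remainder.\<close>

lemma gram_schmidt:
  fixes G :: "'a :: complex_inner set"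
  assumes "finite G"
  shows "\<exists>F. finite F \<and> orthonormal F \<and> cspan F = cspan G \<and> card F \<le> card G"
  using assms
proof (induction G)
  case empty
  then show ?case by (intro exI[of _ "{}"]) simp
next
  case (insert x G)
  then obtain F where F: "finite F" "orthonormal F" "cspan F = cspan G" "card F \<le> card G" by auto
  define y where "y = x - fproj F x"
  have xy: "x = y + fproj F x" by (simp add: y_def)
  have pg: "fproj F x \<in> cspan G" using fproj_in_span[of F x] F by simp
  show ?case
  proof (cases "y = 0")
    case True
    then have "x \<in> cspan G" using pg xy by simp
    then have "cspan (insert x G) = cspan G" by (rule complex_vector.span_redundant)
    moreover have "card F \<le> card (insert x G)" using F insert by (simp add: card_insert_if)
    ultimately show ?thesis using F by (intro exI[of _ F]) auto
  next
    case False
    define e where "e = (1 / norm y) *\<^sub>R y"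
    have fy: "cinner f y = 0" if "f \<in> F" for f
      using cinner_fproj_diff[OF F(1,2) complex_vector.span_base[OF that]] by (simp add: y_def)
    have e: "orthonormal (insert e F)" using False F fy
      by (intro orthonormal_insert) (auto simp: e_def cinner_scaleR_right)
    have ye: "y = complex_of_real (norm y) *\<^sub>C e" using False
      by (simp add: e_def scaleR_scaleC[symmetric])
    have ey: "e = complex_of_real (1 / norm y) *\<^sub>C y" by (simp only: e_def scaleR_scaleC)
    have pg': "fproj F x \<in> cspan (insert x G)"
      using pg complex_vector.span_mono[of G "insert x G"] by blast
    have "y \<in> cspan (insert x G)"
      unfolding y_def by (intro complex_vector.span_diff pg' complex_vector.span_base) simp
    then have s1: "e \<in> cspan (insert x G)"
      by (subst ey) (rule complex_vector.span_scale)
    have pf': "fproj F x \<in> cspan (insert e F)"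
      using fproj_in_span[of F x] complex_vector.span_mono[of F "insert e F"] by blast
    have "y \<in> cspan (insert e F)"
      by (subst ye) (intro complex_vector.span_scale complex_vector.span_base, simp)
    then have s2: "x \<in> cspan (insert e F)"
      by (subst xy) (rule complex_vector.span_add[OF _ pf'])
    have "F \<subseteq> cspan (insert x G)" "G \<subseteq> cspan (insert e F)"
      using order_trans[OF complex_vector.span_superset[of F], of "cspan (insert x G)"]
        order_trans[OF complex_vector.span_superset[of G], of "cspan (insert e F)"]
        complex_vector.span_mono[of G "insert x G", OF subset_insertI]
        complex_vector.span_mono[of F "insert e F", OF subset_insertI] unfolding F(3) by simp_all
    then have "cspan (insert e F) = cspan (insert x G)"
      using s1 s2 by (subst complex_vector.span_eq) auto
    moreover have "card (insert e F) \<le> card (insert x G)" using F insert by (simp add: card_insert_if)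
    ultimately show ?thesis using F e by (intro exI[of _ "insert e F"]) auto
  qed
qed

lemma orthonormal_independent:
  assumes "finite F" "orthonormal F"
  shows "\<not> cdependent F"
proof
  assume "cdependent F"
  then obtain a where a: "a \<in> F" "a \<in> cspan (F - {a})" by (auto simp: complex_vector.dependent_def)
  have "cinner f a = 0" if "f \<in> F - {a}" for f
    using that a assms by (auto simp: orthonormal_def)
  from cinner_span_zero[OF this a(2)] have "a = 0" by (simp add: cinner_self_eq_0)
  then show False using a assms by (auto simp: orthonormal_def)
qed

lemma cdim_orthonormal:
  assumes "finite F" "orthonormal F"
  shows "cdim (cspan F) = card F"
  by (rule complex_vector.dim_span_eq_card_independent[OF orthonormal_independent[OF assms]])

lemma card_orthonormal_le:
  fixes F :: "'a :: complex_inner set"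
  assumes "finite F" "orthonormal F" "finite G" "F \<subseteq> cspan G"
  shows "card F \<le> card G"
  using complex_vector.independent_span_bound[OF assms(3) orthonormal_independent[OF assms(1,2)] assms(4)]
  by simp

text \<open>The dimension count behind every min-max argument below. For vectors of the span of
  \<open>F\<close>, orthogonality to \<open>g\<close> is orthogonality to \<open>fproj F g\<close>,
  and these projections span fewer than \<open>card F\<close> dimensions.\<close>

lemma exists_orthogonal_in_span:
  fixes F :: "'a :: complex_inner set"
  assumes F: "finite F" "orthonormal F" and G: "finite G" "card G < card F"
  shows "\<exists>x\<in>cspan F. x \<noteq> 0 \<and> (\<forall>g\<in>G. cinner g x = 0)"
proof -
  obtain E where E: "finite E" "orthonormal E" "cspan E = cspan (fproj F ` G)"
      "card E \<le> card (fproj F ` G)"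
    using gram_schmidt[of "fproj F ` G"] G by auto
  have cE: "card E < card F" using E(4) card_image_le[OF G(1), of "fproj F"] G by simp
  have EF: "cspan E \<subseteq> cspan F"
    unfolding E(3) by (rule complex_vector.span_minimal)
      (auto simp: fproj_in_span)
  have "\<not> F \<subseteq> cspan E" using card_orthonormal_le[OF F E(1)] cE by auto
  then obtain y where y: "y \<in> F" "y \<notin> cspan E" by auto
  define x where "x = y - fproj E y"
  have xF: "x \<in> cspan F" unfolding x_def using y EF fproj_in_span[of E y]
    by (intro complex_vector.span_diff) (auto intro: complex_vector.span_base)
  have "x \<noteq> 0" using y fproj_in_span[of E y] by (auto simp: x_def)
  moreover have "cinner g x = 0" if g: "g \<in> G" for g
  proof -
    have "cinner (fproj F g) x = 0" unfolding x_def
      by (rule cinner_fproj_diff[OF E(1,2)]) (use E(3) g in \<open>auto intro: complex_vector.span_base\<close>)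
    moreover have "cinner (g - fproj F g) x = 0"
      using cinner_fproj_diff[OF F xF, of g] cinner_eq_0_commute by blast
    ultimately show ?thesis by (simp add: cinner_diff_left)
  qed
  ultimately show ?thesis using xF by blast
qed

lemma bounded_linear_fproj: "bounded_linear (fproj F)"
  unfolding fproj_def
  by (intro bounded_linear_sum bounded_linear_compose[OF bounded_linear_scaleC_left bounded_linear_cinner_right])

lemma closed_cspan_orthonormal:
  assumes "finite F" "orthonormal F"
  shows "closed (cspan F)"
proof -
  have "cspan F = {x. fproj F x = x}"
    using fproj_span[OF assms] fproj_in_span[of F] by (auto, metis)
  moreover have "closed {x. fproj F x = x}"
    by (intro closed_Collect_eq continuous_intros
        linear_continuous_on bounded_linear_fproj)
  ultimately show ?thesis by simp
qed

text \<open>Two candidates differ by an element of \<open>S\<close> that is orthogonal to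
  \<open>S\<close>. This resolves the definite description in \<open>orth_proj\<close>.\<close>

lemma orth_proj_unique:
  fixes S :: "'a :: complex_inner set"
  assumes S: "csubspace S" and y: "y \<in> S" "\<And>z. z \<in> S \<Longrightarrow> cinner z (x - y) = 0"
  shows "orth_proj S x = y"
  unfolding orth_proj_def
proof (rule the_equality)
  show "y \<in> S \<and> (\<forall>z\<in>S. cinner z (x - y) = 0)" using y by blast
  fix y' assume y': "y' \<in> S \<and> (\<forall>z\<in>S. cinner z (x - y') = 0)"
  have "y - y' \<in> S" using S y y' by (intro complex_vector.subspace_diff) auto
  then have "cinner (y - y') (x - y') - cinner (y - y') (x - y) = 0" using y y' by simp
  then have "cinner (y - y') (y - y') = 0" by (simp add: cinner_diff_right)
  then show "y' = y" by (simp add: cinner_self_eq_0)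
qed

lemma orth_proj_cspan:
  assumes "finite F" "orthonormal F"
  shows "orth_proj (cspan F) = fproj F"
  by (rule ext, rule orth_proj_unique)
    (auto simp: fproj_in_span cinner_fproj_diff[OF assms])


section \<open>Riesz representation, adjoints and orthonormal bases\<close>

text \<open>Minimising \<open>|z|^2 - 2 \<phi> z\<close> over \<open>S\<close> serves two purposes:
  \<open>S = UNIV\<close> gives the Riesz representation, and \<open>\<phi> = inner x\<close> gives
  the orthogonal projection of \<open>x\<close> onto \<open>S\<close>.\<close>

lemma inner_le_bounded_linear_min:
  fixes S :: "'a :: {real_inner, complete_space} set"
  assumes S: "subspace S" "closed S" and \<phi>: "bounded_linear (\<phi> :: 'a \<Rightarrow> real)"
  shows "\<exists>y\<in>S. \<forall>z\<in>S. inner y z = \<phi> z"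
proof -
  interpret \<phi>: bounded_linear \<phi> by (rule \<phi>)
  define J where "J z = (norm z)\<^sup>2 - 2 * \<phi> z" for z
  define j where "j = Inf (J ` S)"
  obtain C where C: "\<And>z. norm (\<phi> z) \<le> norm z * C" using \<phi>.bounded by auto
  have "J z \<ge> - C\<^sup>2" for z
    using C[of z] zero_le_power2[of "norm z - C"] by (simp add: J_def power2_eq_square algebra_simps)
  then have bdd: "bdd_below (J ` S)" by (intro bdd_belowI2)
  have S0: "0 \<in> S" using S by (simp add: subspace_0)
  have jle: "j \<le> J z" if "z \<in> S" for z unfolding j_def using that bdd by (intro cInf_lower) auto
  have "\<exists>z\<in>S. J z < j + 1 / real (Suc n)" for n
    using cInf_lessD[of "J ` S" "j + 1 / real (Suc n)"] S0 unfolding j_def by force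
  then obtain X where X: "\<And>n. X n \<in> S" "\<And>n. J (X n) < j + 1 / real (Suc n)" by metis
  \<comment> \<open>The parallelogram law, with the midpoint of \<open>a\<close> and
    \<open>b\<close> as a competitor in \<open>S\<close>, makes minimising sequences Cauchy.\<close>
  have par: "(norm (a - b))\<^sup>2 \<le> 2 * (J a - j) + 2 * (J b - j)" if "a \<in> S" "b \<in> S" for a b
  proof -
    have "(1/2) *\<^sub>R (a + b) \<in> S" using S that by (simp add: subspace_add subspace_scale)
    moreover have "\<phi> ((1/2) *\<^sub>R (a + b)) = (\<phi> a + \<phi> b) / 2"
      unfolding \<phi>.scaleR \<phi>.add by simp
    moreover have "(norm ((1/2) *\<^sub>R (a + b)))\<^sup>2 = (norm (a + b))\<^sup>2 / 4"
      by (simp only: norm_scaleR power_mult_distrib) (simp add: power_divide)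
    ultimately have "j \<le> (norm (a + b))\<^sup>2 / 4 - \<phi> a - \<phi> b"
      using jle[of "(1/2) *\<^sub>R (a + b)"] by (simp add: J_def)
    moreover have "(norm (a + b))\<^sup>2 + (norm (a - b))\<^sup>2 = 2 * (norm a)\<^sup>2 + 2 * (norm b)\<^sup>2"
      by (simp add: power2_norm_eq_inner algebra_simps inner_commute)
    ultimately show ?thesis by (simp add: J_def)
  qed
  have "Cauchy X"
  proof (rule metric_CauchyI)
    fix e :: real assume e: "0 < e"
    obtain N :: nat where N: "4 / e\<^sup>2 < real N" using reals_Archimedean2 by blast
    have "norm (X m - X n) < e" if "m \<ge> N" "n \<ge> N" for m n
    proof -
      have "J (X k) - j < e\<^sup>2 / 4" if "k \<ge> N" for k
      proof -
        have "J (X k) - j < 1 / real (Suc k)" using X(2)[of k] by (simp only: less_diff_eq diff_less_eq add.commute)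
        also have "4 / e\<^sup>2 < real (Suc k)" using N that by simp
        then have "1 / real (Suc k) < e\<^sup>2 / 4" using e by (simp add: field_simps)
        finally show ?thesis .
      qed
      from this[OF that(1)] this[OF that(2)]
      have "(norm (X m - X n))\<^sup>2 < e\<^sup>2"
        using par[OF X(1)[of m] X(1)[of n]] by argo
      then show ?thesis using e by (meson less_imp_le power2_less_imp_less)
    qed
    then show "\<exists>M. \<forall>m\<ge>M. \<forall>n\<ge>M. dist (X m) (X n) < e" by (auto simp: dist_norm)
  qed
  then obtain y where y: "X \<longlonglongrightarrow> y" using Cauchy_convergent convergent_def by blast
  have yS: "y \<in> S" using closed_sequentially[OF S(2)] X(1) y by blast
  have "(\<lambda>n. J (X n)) \<longlonglongrightarrow> J y" unfolding J_def by (intro tendsto_intros \<phi>.tendsto y)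
  moreover have "(\<lambda>n. j + 1 / real (Suc n)) \<longlonglongrightarrow> j + 0"
    by (intro tendsto_intros LIMSEQ_inverse_real_of_nat[unfolded inverse_eq_divide])
  ultimately have Jy: "J y \<le> j" using X(2)
    by (intro LIMSEQ_le[of "\<lambda>n. J (X n)"]) (auto intro!: exI[of _ 0] less_imp_le)
  have "inner y z = \<phi> z" if z: "z \<in> S" for z
  proof -
    define d where "d = inner y z - \<phi> z"
    \<comment> \<open>First variation at the minimiser in the direction \<open>z\<close>; a
      quadratic in \<open>t\<close> that is nowhere negative and vanishes at \<open>0\<close> has no
      linear term.\<close>
    have q: "0 \<le> 2 * t * d + t\<^sup>2 * (norm z)\<^sup>2" for t
    proof -
      have "y + t *\<^sub>R z \<in> S" using S yS z by (simp add: subspace_add subspace_scale)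
      from jle[OF this] Jy have "J y \<le> J (y + t *\<^sub>R z)" by simp
      also have "J (y + t *\<^sub>R z) = J y + 2 * t * d + t\<^sup>2 * (norm z)\<^sup>2"
        unfolding J_def d_def \<phi>.add \<phi>.scaleR power2_norm_eq_inner
          by (simp add: inner_add_left inner_add_right inner_commute[of z y] power2_eq_square algebra_simps)
      finally show ?thesis by simp
    qed
    have "d = 0"
    proof (cases "z = 0")
      case True then show ?thesis by (simp add: d_def \<phi>.zero)
    next
      case False
      then have n: "(norm z)\<^sup>2 > 0" by simp
      \<comment> \<open>The value of \<open>t\<close> is the minimiser of that quadratic.\<close>
      have "2 * (- d / (norm z)\<^sup>2) * d + (- d / (norm z)\<^sup>2)\<^sup>2 * (norm z)\<^sup>2 = - (d\<^sup>2 / (norm z)\<^sup>2)"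
        using n by (simp add: power2_eq_square field_simps)
      with q[of "- d / (norm z)\<^sup>2"] have "d\<^sup>2 / (norm z)\<^sup>2 \<le> 0" by linarith
      then show ?thesis using n by (simp add: divide_le_0_iff)
    qed
    then show ?thesis by (simp add: d_def)
  qed
  then show ?thesis using yS by blast
qed

lemma csubspace_subspace: "csubspace S \<Longrightarrow> subspace (S :: 'a :: complex_inner set)"
  unfolding subspace_def complex_vector.subspace_def by (auto simp: scaleR_scaleC)

lemma cinner_eq_if_Re:
  assumes "\<And>c. Re (cinner x (c *\<^sub>C z)) = Re (cinner y (c *\<^sub>C (z :: 'a :: complex_inner)))"
  shows "cinner x z = cinner y z"
  using assms[of 1] assms[of "\<i>"] by (simp add: complex_eq_iff cinner_scaleC_right)

text \<open>The real minimisation with functional \<open>inner x\<close>. Since \<open>S\<close> is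
  a complex subspace, testing with \<open>z\<close> and \<open>\<i> z\<close> upgrades real
  orthogonality to complex orthogonality.\<close>

lemma orth_proj_exists:
  fixes S :: "'a :: chilbert_space set"
  assumes S: "csubspace S" "closed S"
  obtains y where "y \<in> S" "\<And>z. z \<in> S \<Longrightarrow> cinner z (x - y) = 0"
proof -
  obtain y where y: "y \<in> S" "\<And>z. z \<in> S \<Longrightarrow> inner y z = inner x z"
    using inner_le_bounded_linear_min[OF csubspace_subspace[OF S(1)] S(2), of "inner x"]
    by (auto simp: bounded_linear_inner_right)
  have "cinner y z = cinner x z" if "z \<in> S" for z
    using y(2)[of "_ *\<^sub>C z"] that S(1)
    by (intro cinner_eq_if_Re) (auto simp: inner_eq_Re_cinner complex_vector.subspace_scale)
  then have "cinner z (x - y) = 0" if "z \<in> S" for z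
    using that by (subst cinner_eq_0_commute) (simp add: cinner_diff_left)
  then show ?thesis using y that by blast
qed

lemma bounded_clinear_add: "bounded_clinear T \<Longrightarrow> T (x + y) = T x + T y"
  by (metis bounded_clinear_def bounded_linear.axioms(1) linear_add)
lemma bounded_clinear_diff: "bounded_clinear T \<Longrightarrow> T (x - y) = T x - T y"
  by (metis bounded_clinear_def bounded_linear.axioms(1) linear_diff)
lemma bounded_clinear_zero: "bounded_clinear T \<Longrightarrow> T 0 = 0"
  by (metis bounded_clinear_def bounded_linear.axioms(1) linear_0)
lemma bounded_clinear_scaleR: "bounded_clinear T \<Longrightarrow> T (r *\<^sub>R x) = r *\<^sub>R T x"
  by (metis bounded_clinear_def bounded_linear.axioms(1) linear_scale)
lemma bounded_clinear_sum: "bounded_clinear T \<Longrightarrow> T (\<Sum>i\<in>I. f i) = (\<Sum>i\<in>I. T (f i))"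
  by (metis bounded_clinear_def bounded_linear.axioms(1) linear_sum)
lemma bounded_clinear_bound:
  assumes "bounded_clinear T" obtains C where "C > 0" "\<And>x. norm (T x) \<le> C * norm x"
  using bounded_linear.pos_bounded[OF bounded_clinearD(1)[OF assms]] by (auto simp: mult.commute)

lemma bounded_clinearI:
  fixes T :: "'a :: complex_inner \<Rightarrow> 'b :: complex_inner"
  assumes "\<And>x y. T (x + y) = T x + T y" "\<And>c x. T (c *\<^sub>C x) = c *\<^sub>C T x"
    and "\<And>x. norm (T x) \<le> C * norm x"
  shows "bounded_clinear T"
  unfolding bounded_clinear_def
  by (intro conjI allI bounded_linear_intro[where K = C])
    (use assms in \<open>auto simp: scaleR_scaleC mult.commute\<close>)

lemma bounded_clinear_compose:
  "bounded_clinear S \<Longrightarrow> bounded_clinear T \<Longrightarrow> bounded_clinear (S \<circ> T)"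
  by (auto simp: bounded_clinear_def o_def intro: bounded_linear_compose)

lemma bounded_clinear_add_fun:
  "bounded_clinear S \<Longrightarrow> bounded_clinear T \<Longrightarrow> bounded_clinear (\<lambda>x. S x + T x)"
  by (auto simp: bounded_clinear_def scaleC_add_right intro: bounded_linear_add)

lemma bounded_clinear_scaleC_fun:
  "bounded_clinear T \<Longrightarrow> bounded_clinear (\<lambda>x. c *\<^sub>C T x)"
  by (auto simp: bounded_clinear_def scaleC_scaleC mult.commute
      intro: bounded_linear_compose[OF bounded_linear_scaleC_right])

lemma bounded_clinear_scaleR_fun:
  "bounded_clinear T \<Longrightarrow> bounded_clinear (\<lambda>x. c *\<^sub>R T x)"
  using bounded_clinear_scaleC_fun[of T "of_real c"] by (simp add: scaleR_scaleC)

lemma bounded_clinear_diff_fun: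
  "bounded_clinear S \<Longrightarrow> bounded_clinear T \<Longrightarrow> bounded_clinear (\<lambda>x. S x - T x)"
  using bounded_clinear_add_fun[OF _ bounded_clinear_scaleR_fun[of T "-1"], of S] by simp

lemma bounded_clinear_sum_fun:
  "(\<And>i. i \<in> I \<Longrightarrow> bounded_clinear (T i)) \<Longrightarrow> bounded_clinear (\<lambda>x. \<Sum>i\<in>I. T i x)"
  by (auto simp: bounded_clinear_def complex_vector.scale_sum_right intro!: bounded_linear_sum)

text \<open>Riesz is applied to the real functional \<open>Re (cinner y (T x))\<close>; evaluating
  it at \<open>\<i> z\<close> as well recovers the imaginary part.\<close>

lemma adjoint_exists:
  fixes T :: "'a :: chilbert_space \<Rightarrow> 'b :: complex_inner"
  assumes T: "bounded_clinear T"
  shows "\<exists>S. \<forall>x y. cinner (T x) y = cinner x (S y)"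
proof -
  have "\<exists>s. \<forall>x. cinner (T x) y = cinner x s" for y
  proof -
    have bl: "bounded_linear (\<lambda>x. Re (cinner y (T x)))"
      by (intro bounded_linear_compose[OF bounded_linear_Re]
          bounded_linear_compose[OF bounded_linear_cinner_right] bounded_clinearD(1)[OF T])
    obtain s where s: "\<And>z. inner s z = Re (cinner y (T z))"
      using inner_le_bounded_linear_min[OF subspace_UNIV closed_UNIV bl] by auto
    have "cinner s z = cinner y (T z)" for z
      using s[of z] s[of "\<i> *\<^sub>C z"]
      by (simp add: complex_eq_iff cinner_scaleC_right inner_eq_Re_cinner bounded_clinearD(2)[OF T])
    then have "cinner (T z) y = cinner z s" for z by (metis cinner_commute)
    then show ?thesis by blast
  qed
  then show ?thesis by metis
qed

lemma adj_eqI: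
  fixes T :: "'a :: complex_inner \<Rightarrow> 'b :: complex_inner"
  assumes "\<And>x y. cinner (T x) y = cinner x (S y)"
  shows "adj T = S"
  unfolding adj_def
proof (rule the_equality)
  show "\<forall>x y. cinner (T x) y = cinner x (S y)" using assms by blast
  fix S' assume S': "\<forall>x y. cinner (T x) y = cinner x (S' y)"
  have "cinner z (S' y) = cinner z (S y)" for y z
    using trans[OF S'[rule_format, of z y, symmetric] assms[of z y]] .
  show "S' = S" by (rule ext, rule cinner_ext) fact
qed

lemma cinner_adj:
  fixes T :: "'a :: chilbert_space \<Rightarrow> 'b :: complex_inner"
  assumes "bounded_clinear T"
  shows "cinner (T x) y = cinner x (adj T y)"
  using adjoint_exists[OF assms] adj_eqI[of T] by metis

lemma cinner_adj':
  fixes T :: "'a :: chilbert_space \<Rightarrow> 'b :: complex_inner"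
  assumes "bounded_clinear T"
  shows "cinner y (T x) = cinner (adj T y) x"
  by (metis assms cinner_adj cinner_commute)

text \<open>From \<open>|S y|^2 = <T (S y), y>\<close> alone, so it also serves to prove that an
  adjoint is bounded.\<close>

lemma norm_adjoint_le:
  fixes T :: "'a :: complex_inner \<Rightarrow> 'b :: complex_inner"
  assumes "\<And>x y. cinner (T x) y = cinner x (S y)" "\<And>x. norm (T x) \<le> C * norm x" "0 \<le> C"
  shows "norm (S y) \<le> C * norm y"
proof (cases "S y = 0")
  case False
  have "(norm (S y))\<^sup>2 = Re (cinner (T (S y)) y)" by (simp add: assms(1) norm_sq_eq_cinner)
  also have "\<dots> \<le> norm (T (S y)) * norm y"
    using cmod_cinner_le complex_Re_le_cmod order_trans by blast
  also have "\<dots> \<le> (C * norm (S y)) * norm y" by (intro mult_right_mono assms) simp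
  finally show ?thesis using False by (simp add: power2_eq_square)
qed (use assms in simp)

lemma csubspace_closure:
  fixes S :: "'a :: complex_inner set"
  assumes S: "csubspace S"
  shows "csubspace (closure S)"
  unfolding complex_vector.subspace_def
proof (intro conjI ballI allI)
  show "0 \<in> closure S" using complex_vector.subspace_0[OF S] closure_subset by blast
  fix x y assume "x \<in> closure S" "y \<in> closure S"
  then obtain X Y where "\<And>n. X n \<in> S" "X \<longlonglongrightarrow> x" "\<And>n. Y n \<in> S" "Y \<longlonglongrightarrow> y"
    unfolding closure_sequential by blast
  then have "(\<forall>n. X n + Y n \<in> S) \<and> (\<lambda>n. X n + Y n) \<longlonglongrightarrow> x + y"
    using complex_vector.subspace_add[OF S] tendsto_add by blast
  then show "x + y \<in> closure S" unfolding closure_sequential by (intro exI[of _ "\<lambda>n. X n + Y n"])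
next
  fix c x assume "x \<in> closure S"
  then obtain X where "\<And>n. X n \<in> S" "X \<longlonglongrightarrow> x" unfolding closure_sequential by blast
  then have "(\<forall>n. c *\<^sub>C X n \<in> S) \<and> (\<lambda>n. c *\<^sub>C X n) \<longlonglongrightarrow> c *\<^sub>C x"
    using complex_vector.subspace_scale[OF S] bounded_linear.tendsto[OF bounded_linear_scaleC_right]
    by blast
  then show "c *\<^sub>C x \<in> closure S" unfolding closure_sequential by (intro exI[of _ "\<lambda>n. c *\<^sub>C X n"])
qed

lemma unit_vector_scale:
  assumes "(x :: 'a :: complex_inner) \<noteq> 0"
  shows "norm ((1 / norm x) *\<^sub>R x) = 1"
  using assms by simp

text \<open>\<open>op_trace\<close> sums over a basis picked by \<open>SOME\<close>, so existence
  gives that choice its meaning. A maximal orthonormal set (Zorn) is total: otherwise the normalised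
  component of some vector off its closed span could be added.\<close>

lemma onb_exists: "\<exists>B :: 'a :: chilbert_space set. is_onb B"
proof -
  have *: "\<exists>M\<in>Collect orthonormal. \<forall>X\<in>Collect orthonormal. M \<subseteq> X \<longrightarrow> X = (M :: 'a set)"
  proof (rule subset_Zorn_nonempty)
    show "Collect orthonormal \<noteq> ({} :: 'a set set)" using orthonormal_empty by blast
    fix C :: "'a set set" assume C: "C \<noteq> {}" "subset.chain (Collect orthonormal) C"
    have o: "orthonormal X" if "X \<in> C" for X using C(2) that by (auto simp: subset.chain_def)
    show "\<Union>C \<in> Collect orthonormal"
      unfolding mem_Collect_eq orthonormal_def
    proof (intro conjI ballI impI)
      fix x assume "x \<in> \<Union>C" then show "norm x = 1" using o by (auto simp: orthonormal_def)
    next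
      fix x y assume "x \<in> \<Union>C" "y \<in> \<Union>C" and xy: "x \<noteq> y"
      then obtain X Y where XY: "X \<in> C" "x \<in> X" "Y \<in> C" "y \<in> Y" by blast
      then have "X \<subseteq> Y \<or> Y \<subseteq> X" using C(2) by (auto simp: subset_chain_def)
      then obtain Z where "Z \<in> C" "x \<in> Z" "y \<in> Z" using XY by blast
      then show "cinner x y = 0" using o xy by (auto simp: orthonormal_def)
    qed
  qed
  obtain M :: "'a set" where M: "orthonormal M"
    "\<And>X. orthonormal X \<Longrightarrow> M \<subseteq> X \<Longrightarrow> X = M" using * by auto
  have "x \<in> closure (cspan M)" for x
  proof (rule ccontr)
    assume x: "x \<notin> closure (cspan M)"
    obtain y where y: "y \<in> closure (cspan M)"
      "\<And>z. z \<in> closure (cspan M) \<Longrightarrow> cinner z (x - y) = 0"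
      using orth_proj_exists[of "closure (cspan M)" x] csubspace_closure[of "cspan M"] by auto
    define w where "w = x - y"
    have w0: "w \<noteq> 0" using x y by (auto simp: w_def)
    define e where "e = (1 / norm w) *\<^sub>R w"
    have e: "norm e = 1" unfolding e_def using w0 by (rule unit_vector_scale)
    have "cinner f e = 0" if "f \<in> M" for f
      using y(2)[of f] that closure_subset[of "cspan M"] complex_vector.span_base[of f M]
      by (auto simp: e_def cinner_scaleR_right w_def)
    from orthonormal_insert[OF M(1) e this] have "insert e M = M" using M(2) by blast
    then have "e \<in> M" by blast
    then have "cinner e e = 0" by fact
    then show False using e by (simp add: cinner_self_eq_0)
  qed
  then have "is_onb M" using M(1) by (auto simp: is_onb_def orthonormal_def)
  then show ?thesis by blast
qed

lemma is_onb_some: "is_onb (SOME B :: 'a :: chilbert_space set. is_onb B)"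
  using onb_exists by (rule someI_ex)

lemma is_onb_orthonormal: "is_onb B \<Longrightarrow> orthonormal B"
  by (auto simp: is_onb_def orthonormal_def)

text \<open>Parseval's identity up to \<open>\<delta>\<close>. Holding for all larger finite
  \<open>E\<close>, it survives the passage to a union, which the version for several vectors
  needs.\<close>

lemma onb_approx:
  assumes B: "is_onb B" and d: "\<delta> > 0"
  shows "\<exists>D. finite D \<and> D \<subseteq> B \<and> (\<forall>E. finite E \<and> D \<subseteq> E \<and> E \<subseteq> B \<longrightarrow>
      (norm x)\<^sup>2 < (\<Sum>e\<in>E. (cmod (cinner e x))\<^sup>2) + \<delta>)"
proof -
  have "x \<in> closure (cspan B)" using B by (simp add: is_onb_def)
  then obtain y where y: "y \<in> cspan B" "dist y x < sqrt \<delta>"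
    using d by (meson closure_approachable real_sqrt_gt_zero)
  obtain D where D: "finite D" "D \<subseteq> B" "y \<in> cspan D"
  proof -
    from y(1) obtain t r where t: "finite t" "t \<subseteq> B" "y = (\<Sum>a\<in>t. r a *\<^sub>C a)"
      unfolding complex_vector.span_explicit by blast
    have "y \<in> cspan t" unfolding t(3)
      by (intro complex_vector.span_sum complex_vector.span_scale complex_vector.span_base)
    then show thesis using t that by blast
  qed
  show ?thesis
  proof (intro exI[of _ D] conjI allI impI D)
    fix E assume E: "finite E \<and> D \<subseteq> E \<and> E \<subseteq> B"
    then have oE: "orthonormal E" using is_onb_orthonormal[OF B] orthonormal_subset by blast
    have yE: "y \<in> cspan E" using D(3) E complex_vector.span_mono[of D E] by blast
    have "norm (x - fproj E x) \<le> norm (x - y)"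
      using E by (intro fproj_best_approx oE yE) simp
    then have "norm (x - fproj E x) < sqrt \<delta>" using y(2) by (simp add: dist_norm norm_minus_commute)
    then have "(norm (x - fproj E x))\<^sup>2 < \<delta>"
      by (metis abs_norm_cancel real_sqrt_abs real_sqrt_less_iff)
    then show "(norm x)\<^sup>2 < (\<Sum>e\<in>E. (cmod (cinner e x))\<^sup>2) + \<delta>"
      using norm_fproj_pythagoras[of E x] norm_fproj[of E x] oE E by simp
  qed
qed

lemma onb_approx_finite:
  fixes B :: "'a :: complex_inner set"
  assumes B: "is_onb B" and d: "\<delta> > 0" and I: "finite I"
  shows "\<exists>D. finite D \<and> D \<subseteq> B \<and>
      (\<Sum>i\<in>I. (norm (x i))\<^sup>2) \<le> (\<Sum>i\<in>I. \<Sum>e\<in>D. (cmod (cinner e (x i)))\<^sup>2) + \<delta>"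
proof -
  \<comment> \<open>The error is shared among the indices; the \<open>+ 1\<close> covers an empty
    \<open>I\<close>.\<close>
  define \<delta>' where "\<delta>' = \<delta> / (real (card I) + 1)"
  have d': "\<delta>' > 0" using d by (simp add: \<delta>'_def add_nonneg_pos)
  have "\<forall>i. \<exists>D. finite D \<and> D \<subseteq> B \<and> (\<forall>E. finite E \<and> D \<subseteq> E \<and> E \<subseteq> B \<longrightarrow>
      (norm (x i))\<^sup>2 < (\<Sum>e\<in>E. (cmod (cinner e (x i)))\<^sup>2) + \<delta>')"
    using onb_approx[OF B d'] by blast
  then obtain D where D: "\<And>i. finite (D i)" "\<And>i. D i \<subseteq> B"
    "\<And>i E. finite E \<Longrightarrow> D i \<subseteq> E \<Longrightarrow> E \<subseteq> B \<Longrightarrow>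
      (norm (x i))\<^sup>2 < (\<Sum>e\<in>E. (cmod (cinner e (x i)))\<^sup>2) + \<delta>'" by metis
  have "(\<Sum>i\<in>I. (norm (x i))\<^sup>2) \<le> (\<Sum>i\<in>I. (\<Sum>e\<in>(\<Union>i\<in>I. D i). (cmod (cinner e (x i)))\<^sup>2) + \<delta>')"
    using D(1,2) finite_UN_I[OF I, of D] by (intro sum_mono, intro order.strict_implies_order[OF D(3)]) auto
  also have "\<dots> = (\<Sum>i\<in>I. \<Sum>e\<in>(\<Union>i\<in>I. D i). (cmod (cinner e (x i)))\<^sup>2) + real (card I) * \<delta>'"
    by (simp add: sum.distrib)
  also have "real (card I) * \<delta>' \<le> \<delta>" using d by (simp add: \<delta>'_def field_simps)
  finally show ?thesis using finite_UN_I[OF I, of D] D(1,2)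
    by (intro exI[of _ "\<Union>i\<in>I. D i"] conjI) auto
qed


section \<open>Hilbert--Schmidt bounds\<close>

text \<open>A bound on the squared Hilbert-Schmidt norm, tested on all finite orthonormal sets at
  once. No basis has to be fixed, and adjoints and compositions need no infinite sums.\<close>

definition hs_le :: "('a :: complex_inner \<Rightarrow> 'b :: complex_inner) \<Rightarrow> real \<Rightarrow> bool" where
  "hs_le T c \<longleftrightarrow> (\<forall>F. finite F \<and> orthonormal F \<longrightarrow> (\<Sum>e\<in>F. (norm (T e))\<^sup>2) \<le> c)"

lemma hs_leD: "hs_le T c \<Longrightarrow> finite F \<Longrightarrow> orthonormal F \<Longrightarrow> (\<Sum>e\<in>F. (norm (T e))\<^sup>2) \<le> c"
  by (simp add: hs_le_def)

lemma hs_le_nonneg: "hs_le T c \<Longrightarrow> 0 \<le> c"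
  using hs_leD[of T c "{}"] by simp

lemma hs_le_mono: "hs_le T c \<Longrightarrow> c \<le> d \<Longrightarrow> hs_le T d"
  unfolding hs_le_def using order_trans by blast

lemma hs_le_norm:
  assumes T: "bounded_clinear T" and c: "hs_le T c"
  shows "(norm (T x))\<^sup>2 \<le> c * (norm x)\<^sup>2"
proof (cases "x = 0")
  case False
  define e where "e = (1 / norm x) *\<^sub>R x"
  have "norm e = 1" unfolding e_def using False by (rule unit_vector_scale)
  then have "(norm (T e))\<^sup>2 \<le> c" using hs_leD[OF c, of "{e}"] by (simp add: orthonormal_def)
  moreover have "T x = norm x *\<^sub>R T e"
    using False by (simp add: e_def bounded_clinear_scaleR[OF T])
  ultimately show ?thesis
    by (simp add: power_mult_distrib mult.commute[of c] mult_left_mono)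
qed (simp add: bounded_clinear_zero[OF T])

lemma hs_le_compose_left:
  fixes T :: "'a :: complex_inner \<Rightarrow> 'b :: complex_inner" and A :: "'b \<Rightarrow> 'c :: complex_inner"
  assumes "hs_le T c" "\<And>y. norm (A y) \<le> C * norm y"
  shows "hs_le (\<lambda>x. A (T x)) (C\<^sup>2 * c)"
  unfolding hs_le_def
proof (intro allI impI)
  fix F :: "'a set" assume F:  "finite F \<and> orthonormal F"
  have "(\<Sum>e\<in>F. (norm (A (T e)))\<^sup>2) \<le> (\<Sum>e\<in>F. C\<^sup>2 * (norm (T e))\<^sup>2)"
    using power_mono[OF assms(2) norm_ge_zero, of _ 2] by (intro sum_mono) (simp add: power_mult_distrib)
  also have "\<dots> \<le> C\<^sup>2 * c"
    unfolding sum_distrib_left[symmetric] using F by (intro mult_left_mono hs_leD[OF assms(1)]) auto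
  finally show "(\<Sum>e\<in>F. (norm (A (T e)))\<^sup>2) \<le> C\<^sup>2 * c" .
qed

text \<open>Both sides are governed by the same matrix \<open>|<f, T e>|^2\<close>; exchange the
  sums and apply Bessel for \<open>F\<close>.\<close>

lemma hs_sum_le_adjoint:
  fixes T :: "'a :: complex_inner \<Rightarrow> 'b :: complex_inner"
  assumes adj: "\<And>x y. cinner (T x) y = cinner x (S y)" and F: "finite F" "orthonormal F"
  shows "(\<Sum>f\<in>F. \<Sum>e\<in>E. (cmod (cinner e (S f)))\<^sup>2) \<le> (\<Sum>e\<in>E. (norm (T e))\<^sup>2)"
proof -
  have c: "cmod (cinner e (S f)) = cmod (cinner f (T e))" for e f
    by (metis adj cinner_commute complex_mod_cnj)
  show ?thesis unfolding c
    by (subst sum.swap) (intro sum_mono bessel F)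
qed

text \<open>The vectors \<open>S f\<close> span a finite-dimensional space, so they are expanded
  exactly in an orthonormal set \<open>E\<close>, and the matrix of \<open>T\<close> on
  \<open>E\<close> bounds the sum.\<close>

lemma hs_le_adjoint:
  fixes T :: "'a :: complex_inner \<Rightarrow> 'b :: complex_inner"
  assumes adj: "\<And>x y. cinner (T x) y = cinner x (S y)" and c: "hs_le T c"
  shows "hs_le S c"
  unfolding hs_le_def
proof (intro allI impI)
  fix F :: "'b set" assume F: "finite F \<and> orthonormal F"
  obtain E where E: "finite E" "orthonormal E" "cspan E = cspan (S ` F)"
    using gram_schmidt[of "S ` F"] F by auto
  have "(\<Sum>f\<in>F. (norm (S f))\<^sup>2) = (\<Sum>f\<in>F. (norm (fproj E (S f)))\<^sup>2)"
    by (intro sum.cong refl, subst fproj_span[OF E(1,2)])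
      (auto simp: E(3) intro: complex_vector.span_base)
  also have "\<dots> \<le> (\<Sum>e\<in>E. (norm (T e))\<^sup>2)"
    unfolding norm_fproj[OF E(1,2)] using F by (intro hs_sum_le_adjoint adj) auto
  also have "\<dots> \<le> c" using E by (intro hs_leD[OF c])
  finally show "(\<Sum>f\<in>F. (norm (S f))\<^sup>2) \<le> c" .
qed

text \<open>One basis suffices for the test. The detour through the adjoint does it:
  \<open>S f\<close> is nearly exhausted by finitely many basis vectors, which bounds
  \<open>S\<close> on every orthonormal set, and \<open>hs_le_adjoint\<close> returns to
  \<open>T\<close>.\<close>

lemma hs_le_onb:
  fixes T :: "'a :: complex_inner \<Rightarrow> 'b :: complex_inner"
  assumes adj: "\<And>x y. cinner (T x) y = cinner x (S y)" and B: "is_onb B"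
    and c: "\<And>F. finite F \<Longrightarrow> F \<subseteq> B \<Longrightarrow> (\<Sum>e\<in>F. (norm (T e))\<^sup>2) \<le> c"
  shows "hs_le T c"
proof -
  have adj': "cinner (S y) x = cinner y (T x)" for x y
    by (metis adj cinner_commute)
  have "hs_le S c"
    unfolding hs_le_def
  proof (intro allI impI, rule field_le_epsilon)
    fix F :: "'b set" and \<delta> :: real assume F: "finite F \<and> orthonormal F" and d: "\<delta> > 0"
    obtain D where D: "finite D" "D \<subseteq> B"
      "(\<Sum>f\<in>F. (norm (S f))\<^sup>2) \<le> (\<Sum>f\<in>F. \<Sum>e\<in>D. (cmod (cinner e (S f)))\<^sup>2) + \<delta>"
      using onb_approx_finite[OF B d, of F S] F by auto
    note D(3)
    also have "(\<Sum>f\<in>F. \<Sum>e\<in>D. (cmod (cinner e (S f)))\<^sup>2) \<le> (\<Sum>e\<in>D. (norm (T e))\<^sup>2)"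
      using F by (intro hs_sum_le_adjoint adj) auto
    also have "\<dots> \<le> c" using D by (intro c)
    finally show "(\<Sum>f\<in>F. (norm (S f))\<^sup>2) \<le> c + \<delta>" by simp
  qed
  from hs_le_adjoint[OF adj' this] show ?thesis .
qed

text \<open>Multiplication on the right is multiplication on the left for the adjoints.\<close>

lemma hs_le_compose_right:
  fixes T :: "'b :: complex_inner \<Rightarrow> 'c :: complex_inner" and A :: "'a :: complex_inner \<Rightarrow> 'b"
  assumes T: "\<And>x y. cinner (T x) y = cinner x (T' y)" and A: "\<And>x y. cinner (A x) y = cinner x (A' y)"
    and c: "hs_le T c" and C: "\<And>x. norm (A x) \<le> C * norm x" "0 \<le> C"
  shows "hs_le (\<lambda>x. T (A x)) (C\<^sup>2 * c)"
proof -
  have "hs_le (\<lambda>y. A' (T' y)) (C\<^sup>2 * c)"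
    by (intro hs_le_compose_left hs_le_adjoint[OF T c] norm_adjoint_le[OF A C(1) C(2)])
  moreover have "cinner (A' (T' y)) x = cinner y (T (A x))" for x y
    by (metis A T cinner_commute)
  ultimately show ?thesis using hs_le_adjoint[of "\<lambda>y. A' (T' y)" "\<lambda>x. T (A x)"] by blast
qed

text \<open>The factor \<open>card I\<close> is the price of Cauchy-Schwarz for the norm of a sum; a
  crude constant is enough throughout.\<close>

lemma hs_le_sum:
  fixes T :: "'i \<Rightarrow> 'a :: complex_inner \<Rightarrow> 'b :: complex_inner"
  assumes I: "finite I" and c: "\<And>i. i \<in> I \<Longrightarrow> hs_le (T i) (c i)"
  shows "hs_le (\<lambda>x. \<Sum>i\<in>I. T i x) (real (card I) * (\<Sum>i\<in>I. c i))"
  unfolding hs_le_def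
proof (intro allI impI)
  fix F :: "'a set" assume F: "finite F \<and> orthonormal F"
  have "(norm (\<Sum>i\<in>I. T i e))\<^sup>2 \<le> real (card I) * (\<Sum>i\<in>I. (norm (T i e))\<^sup>2)" for e
  proof -
    have "(norm (\<Sum>i\<in>I. T i e))\<^sup>2 \<le> (\<Sum>i\<in>I. norm (T i e))\<^sup>2"
      by (intro power_mono norm_sum) simp
    also have "\<dots> \<le> real (card I) * (\<Sum>i\<in>I. (norm (T i e))\<^sup>2)"
      using sum_squared_le_sum_of_squares[of "\<lambda>i. norm (T i e)" I] by (simp add: mult.commute)
    finally show ?thesis .
  qed
  then have "(\<Sum>e\<in>F. (norm (\<Sum>i\<in>I. T i e))\<^sup>2) \<le> (\<Sum>e\<in>F. real (card I) * (\<Sum>i\<in>I. (norm (T i e))\<^sup>2))"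
    by (intro sum_mono)
  also have "\<dots> = real (card I) * (\<Sum>i\<in>I. \<Sum>e\<in>F. (norm (T i e))\<^sup>2)"
    by (subst sum.swap) (simp add: sum_distrib_left)
  also have "\<dots> \<le> real (card I) * (\<Sum>i\<in>I. c i)"
    using F c by (intro mult_left_mono sum_mono hs_leD) auto
  finally show "(\<Sum>e\<in>F. (norm (\<Sum>i\<in>I. T i e))\<^sup>2) \<le> real (card I) * (\<Sum>i\<in>I. c i)" .
qed

lemma hs_le_add:
  assumes "hs_le S a" "hs_le T b"
  shows "hs_le (\<lambda>x. S x + T x) (2 * (a + b))"
  using hs_le_sum[of "{True, False}" "\<lambda>i. if i then S else T" "\<lambda>i. if i then a else b"] assms
  by simp

lemma hs_le_scaleC:
  assumes "hs_le T c" shows "hs_le (\<lambda>x. a *\<^sub>C T x) ((cmod a)\<^sup>2 * c)"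
  using hs_le_compose_left[OF assms, of "\<lambda>x. a *\<^sub>C x" "cmod a"] by (simp add: norm_scaleC)

lemma hs_le_scaleR:
  assumes "hs_le T c" shows "hs_le (\<lambda>x. a *\<^sub>R T x) (a\<^sup>2 * c)"
  using hs_le_scaleC[OF assms, of "of_real a"] by (simp add: scaleR_scaleC)

section \<open>The Schatten class of exponent 2 in terms of finite orthonormal sums\<close>

lemma infsum_ennreal_le_iff:
  fixes f :: "'i \<Rightarrow> real"
  assumes "\<And>x. 0 \<le> f x" "0 \<le> c"
  shows "(\<Sum>\<^sub>\<infinity>x\<in>A. ennreal (f x)) \<le> ennreal c \<longleftrightarrow> (\<forall>F. finite F \<and> F \<subseteq> A \<longrightarrow> sum f F \<le> c)"
proof -
  have "(\<Sum>\<^sub>\<infinity>x\<in>A. ennreal (f x)) = (SUP F\<in>{F. finite F \<and> F \<subseteq> A}. (\<Sum>x\<in>F. ennreal (f x)))"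
    by (rule nonneg_infsum_complete) simp
  moreover have "(\<Sum>x\<in>F. ennreal (f x)) \<le> ennreal c \<longleftrightarrow> sum f F \<le> c" for F
    using assms by (simp add: sum_ennreal ennreal_le_iff)
  ultimately show ?thesis by (auto simp: SUP_le_iff)
qed

text \<open>The bridge from the basis-dependent trace to \<open>hs_le\<close>: the diagonal entry of
  \<open>adj T \<circ> T\<close> at \<open>e\<close> is \<open>|T e|^2\<close>.\<close>

lemma op_trace_le_iff:
  fixes T :: "'a :: chilbert_space \<Rightarrow> 'b :: complex_inner"
  assumes T: "bounded_clinear T" and c: "0 \<le> c"
  shows "op_trace (adj T \<circ> T) \<le> ennreal c \<longleftrightarrow> hs_le T c"
proof -
  define B :: "'a set" where "B = (SOME B. is_onb B)"
  have B: "is_onb B" unfolding B_def by (rule is_onb_some)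
  have "op_trace (adj T \<circ> T) = (\<Sum>\<^sub>\<infinity>e\<in>B. ennreal ((norm (T e))\<^sup>2))"
    by (simp add: op_trace_def B_def cinner_adj[OF T, symmetric] norm_sq_eq_cinner)
  then have "op_trace (adj T \<circ> T) \<le> ennreal c \<longleftrightarrow>
      (\<forall>F. finite F \<and> F \<subseteq> B \<longrightarrow> (\<Sum>e\<in>F. (norm (T e))\<^sup>2) \<le> c)"
    using infsum_ennreal_le_iff[of "\<lambda>e. (norm (T e))\<^sup>2" c B] c by simp
  also have "\<dots> \<longleftrightarrow> hs_le T c"
  proof
    assume "\<forall>F. finite F \<and> F \<subseteq> B \<longrightarrow> (\<Sum>e\<in>F. (norm (T e))\<^sup>2) \<le> c"
    then show "hs_le T c" by (intro hs_le_onb[OF cinner_adj[OF T] B]) blast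
  next
    assume "hs_le T c"
    then show "\<forall>F. finite F \<and> F \<subseteq> B \<longrightarrow> (\<Sum>e\<in>F. (norm (T e))\<^sup>2) \<le> c"
      using orthonormal_subset[OF is_onb_orthonormal[OF B]] by (auto intro: hs_leD)
  qed
  finally show ?thesis .
qed

lemma schatten2_iff:
  fixes T :: "'a :: chilbert_space \<Rightarrow> 'b :: complex_inner"
  shows "schatten2 T \<longleftrightarrow> bounded_clinear T \<and> (\<exists>c. hs_le T c)"
proof (cases "bounded_clinear T")
  case True
  have "op_trace (adj T \<circ> T) < \<infinity> \<longleftrightarrow> (\<exists>c. hs_le T c)"
  proof
    assume f: "op_trace (adj T \<circ> T) < \<infinity>"
    then have "op_trace (adj T \<circ> T) \<le> ennreal (enn2real (op_trace (adj T \<circ> T)))"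
      by (simp add: ennreal_enn2real)
    then show "\<exists>c. hs_le T c" using op_trace_le_iff[OF True, of "enn2real _"] by auto
  next
    assume "\<exists>c. hs_le T c"
    then obtain c where "hs_le T c" by blast
    then have "op_trace (adj T \<circ> T) \<le> ennreal c" using op_trace_le_iff[OF True] hs_le_nonneg by blast
    then show "op_trace (adj T \<circ> T) < \<infinity>" using ennreal_less_top le_less_trans by (metis infinity_ennreal_def)
  qed
  then show ?thesis using True by (simp add: schatten2_def)
qed (simp add: schatten2_def)

lemma hs_le_schatten2_norm:
  fixes T :: "'a :: chilbert_space \<Rightarrow> 'b :: complex_inner"
  assumes "schatten2 T"
  shows "hs_le T ((schatten2_norm T)\<^sup>2)"
proof -
  have "op_trace (adj T \<circ> T) \<le> ennreal (enn2real (op_trace (adj T \<circ> T)))"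
    using assms by (simp add: schatten2_def ennreal_enn2real)
  then show ?thesis using assms op_trace_le_iff[of T "enn2real (op_trace (adj T \<circ> T))"]
    by (simp add: schatten2_def schatten2_norm_def)
qed

lemma schatten2_norm_le:
  fixes T :: "'a :: chilbert_space \<Rightarrow> 'b :: complex_inner"
  assumes "bounded_clinear T" "hs_le T c"
  shows "schatten2_norm T \<le> sqrt c"
proof -
  have "op_trace (adj T \<circ> T) \<le> ennreal c"
    using op_trace_le_iff[OF assms(1)] assms(2) hs_le_nonneg by blast
  then have "enn2real (op_trace (adj T \<circ> T)) \<le> c"
    using hs_le_nonneg[OF assms(2)] by (simp add: enn2real_leI)
  then show ?thesis by (simp add: schatten2_norm_def)
qed

lemma schatten2_norm_nonneg: "0 \<le> schatten2_norm T"
  by (simp add: schatten2_norm_def)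

lemma schatten2_diff:
  fixes S T :: "'a :: chilbert_space \<Rightarrow> 'b :: complex_inner"
  assumes "schatten2 S" "schatten2 T"
  shows "schatten2 (\<lambda>x. S x - T x)"
proof -
  obtain a b where "hs_le S a" "hs_le T b" using assms by (auto simp: schatten2_iff)
  then have "hs_le (\<lambda>x. S x + (-1) *\<^sub>R T x) (2 * (a + (-1)\<^sup>2 * b))"
    by (intro hs_le_add hs_le_scaleR)
  then show ?thesis using assms by (auto simp: schatten2_iff intro!: bounded_clinear_diff_fun)
qed

text \<open>The Hilbert-Schmidt norm dominates the operator norm. Its purpose is uniqueness of the
  limit, on which the definite description in \<open>T_boundary\<close> depends.\<close>

lemma tendsto_schatten2_pointwise:
  fixes L :: "'a :: chilbert_space \<Rightarrow> 'b :: complex_inner"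
  assumes "tendsto_schatten2 F L flt"
  shows "((\<lambda>c. F c x) \<longlongrightarrow> L x) flt"
proof -
  have L: "schatten2 L" and F: "eventually (\<lambda>c. schatten2 (F c)) flt"
    and lim: "((\<lambda>c. schatten2_norm (\<lambda>x. F c x - L x)) \<longlongrightarrow> 0) flt"
    using assms by (auto simp: tendsto_schatten2_def)
  have ev: "eventually (\<lambda>c. norm (F c x - L x) \<le> schatten2_norm (\<lambda>x. F c x - L x) * norm x) flt"
    using F
  proof eventually_elim
    case (elim c)
    have d: "schatten2 (\<lambda>x. F c x - L x)" using schatten2_diff[OF elim L] .
    then have "bounded_clinear (\<lambda>x. F c x - L x)" by (simp add: schatten2_def)
    from hs_le_norm[OF this hs_le_schatten2_norm[OF d], of x]
    have "(norm (F c x - L x))\<^sup>2 \<le> (schatten2_norm (\<lambda>x. F c x - L x) * norm x)\<^sup>2"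
      by (simp add: power_mult_distrib)
    then show ?case by (rule power2_le_imp_le) (simp add: schatten2_norm_nonneg)
  qed
  have "((\<lambda>c. schatten2_norm (\<lambda>x. F c x - L x) * norm x) \<longlongrightarrow> 0 * norm x) flt"
    by (rule tendsto_mult_right[OF lim])
  then have "((\<lambda>c. F c x - L x) \<longlongrightarrow> 0) flt"
    by (intro Lim_null_comparison[OF ev]) simp
  then show ?thesis using LIM_zero_iff by blast
qed

lemma tendsto_schatten2_unique:
  fixes L :: "'a :: chilbert_space \<Rightarrow> 'b :: complex_inner"
  assumes "tendsto_schatten2 F L flt" "tendsto_schatten2 F L' flt" "flt \<noteq> bot"
  shows "L = L'"
  using tendsto_unique[OF assms(3) tendsto_schatten2_pointwise[OF assms(1)]
      tendsto_schatten2_pointwise[OF assms(2)]] by (rule ext)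

lemma tendsto_schatten2I:
  fixes L :: "'a :: chilbert_space \<Rightarrow> 'b :: complex_inner"
  assumes L: "bounded_clinear L" "hs_le L l"
    and F: "eventually (\<lambda>c. bounded_clinear (F c) \<and> hs_le (\<lambda>x. F c x - L x) (d c)) flt"
    and d: "(d \<longlongrightarrow> 0) flt"
  shows "tendsto_schatten2 F L flt"
  unfolding tendsto_schatten2_def
proof (intro conjI)
  show "schatten2 L" using L schatten2_iff by blast
  show "eventually (\<lambda>c. schatten2 (F c)) flt" using F
  proof eventually_elim
    case (elim c)
    then have "hs_le (\<lambda>x. (F c x - L x) + L x) (2 * (d c + l))" using L by (intro hs_le_add) auto
    then show ?case using elim schatten2_iff by auto
  qed
  have "eventually (\<lambda>c. norm (schatten2_norm (\<lambda>x. F c x - L x)) \<le> sqrt (d c)) flt"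
    using F
    by eventually_elim (use L in \<open>auto simp: schatten2_norm_nonneg intro!: schatten2_norm_le
        bounded_clinear_diff_fun\<close>)
  then show "((\<lambda>c. schatten2_norm (\<lambda>x. F c x - L x)) \<longlongrightarrow> 0) flt"
    by (rule Lim_null_comparison) (use tendsto_real_sqrt[OF d] in simp)
qed

lemma T_boundary_eqI:
  fixes H0 M L :: "'a :: chilbert_space \<Rightarrow> 'a"
  assumes "tendsto_schatten2 (\<lambda>\<epsilon>. M \<circ> resolvent H0 (Complex E \<epsilon>) \<circ> adj M) L (at_right 0)"
  shows "T_boundary H0 M E = L"
  unfolding T_boundary_def
  proof (rule the_equality)
  show "L' = L" if "tendsto_schatten2 (\<lambda>\<epsilon>. M \<circ> resolvent H0 (Complex E \<epsilon>) \<circ> adj M) L' (at_right 0)"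
    for L' by (rule tendsto_schatten2_unique[OF that assms]) simp
qed (rule assms)

section \<open>Eigenvalue counting for self-adjoint Hilbert--Schmidt operators\<close>

text \<open>A finite Minkowski sum of images of the closed unit disc is compact.\<close>

lemma compact_combinations:
  fixes v :: "'i \<Rightarrow> 'b :: complex_inner"
  assumes "finite F"
  shows "\<exists>K. compact K \<and> (\<forall>c. (\<forall>f\<in>F. cmod (c f) \<le> 1) \<longrightarrow> (\<Sum>f\<in>F. c f *\<^sub>C v f) \<in> K)"
  using assms
proof (induction F)
  case empty
  show ?case by (intro exI[of _ "{0}"]) simp
next
  case (insert a F)
  then obtain K where K: "compact K" "\<And>c. (\<forall>f\<in>F. cmod (c f) \<le> 1) \<Longrightarrow> (\<Sum>f\<in>F. c f *\<^sub>C v f) \<in> K"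
    by blast
  define K' where "K' = {x + y | x y. x \<in> (\<lambda>z. z *\<^sub>C v a) ` cball 0 1 \<and> y \<in> K}"
  have "compact ((\<lambda>z. z *\<^sub>C v a) ` cball 0 1)"
    by (intro compact_continuous_image linear_continuous_on bounded_linear_scaleC_left compact_cball)
  then have "compact K'" unfolding K'_def using K(1) by (rule compact_sums)
  moreover have "(\<Sum>f\<in>insert a F. c f *\<^sub>C v f) \<in> K'" if "\<forall>f\<in>insert a F. cmod (c f) \<le> 1" for c
  proof -
    have "c a *\<^sub>C v a \<in> (\<lambda>z. z *\<^sub>C v a) ` cball 0 1" using that by (intro imageI) simp
    moreover have "(\<Sum>f\<in>F. c f *\<^sub>C v f) \<in> K" using that by (intro K(2)) simp
    ultimately show ?thesis using insert.hyps unfolding K'_def by auto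
  qed
  ultimately show ?case by blast
qed

text \<open>Split a vector along a finite orthonormal \<open>F\<close> that almost exhausts the
  Hilbert-Schmidt sum: \<open>S\<close> sends the part in the span of \<open>F\<close> into a
  compact set and makes the remainder small.\<close>

lemma hs_image_totally_bounded:
  fixes S :: "'a :: complex_inner \<Rightarrow> 'b :: complex_inner"
  assumes S: "bounded_clinear S" and c: "hs_le S c" and e: "e > 0"
  shows "\<exists>k. finite k \<and> S ` cball 0 1 \<subseteq> (\<Union>x\<in>k. ball x e)"
proof -
  define V where "V = {(\<Sum>e\<in>F. (norm (S e))\<^sup>2) | F. finite F \<and> orthonormal F}"
  have bdd: "bdd_above V" unfolding V_def using hs_leD[OF c] by (intro bdd_aboveI[of _ c]) auto
  have "0 \<in> V" unfolding V_def by (intro CollectI exI[of _ "{}"]) simp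
  \<comment> \<open>A unit vector orthogonal to such an \<open>F\<close> could be added to it, so
    its image contributes less than \<open>(e / 2)^2\<close>.\<close>
  then have "\<exists>v\<in>V. Sup V - (e / 2)\<^sup>2 < v"
    using e by (intro less_cSupD) auto
  then obtain F where F: "finite F" "orthonormal F" "Sup V - (e / 2)\<^sup>2 < (\<Sum>e\<in>F. (norm (S e))\<^sup>2)"
    unfolding V_def by blast
  have small: "norm (S x) \<le> e / 2 * norm x" if x: "\<And>f. f \<in> F \<Longrightarrow> cinner f x = 0" for x
  proof (cases "x = 0")
    case False
    define u where "u = (1 / norm x) *\<^sub>R x"
    have u: "norm u = 1" unfolding u_def using False by (rule unit_vector_scale)
    have fu: "cinner f u = 0" if "f \<in> F" for f using x[OF that] by (simp add: u_def cinner_scaleR_right)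
    have "u \<notin> F" using fu[of u] u by (auto simp: cinner_self_eq_0)
    have "(\<Sum>e\<in>insert u F. (norm (S e))\<^sup>2) \<in> V"
      unfolding V_def using orthonormal_insert[OF F(2) u fu] F(1) by blast
    then have "(\<Sum>e\<in>insert u F. (norm (S e))\<^sup>2) \<le> Sup V" using bdd by (rule cSup_upper)
    then have "(norm (S u))\<^sup>2 < (e / 2)\<^sup>2" using F \<open>u \<notin> F\<close> by simp
    then have "norm (S u) \<le> e / 2" using e power_less_imp_less_base[of "norm (S u)" 2 "e / 2"] by simp
    then have "norm x * norm (S u) \<le> norm x * (e / 2)" by (rule mult_left_mono) simp
    moreover have "S x = norm x *\<^sub>R S u" using False by (simp add: u_def bounded_clinear_scaleR[OF S])
    ultimately show ?thesis by (simp add: mult.commute)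
  qed (simp add: bounded_clinear_zero[OF S])
  obtain K where K: "compact K" "\<And>c. (\<forall>f\<in>F. cmod (c f) \<le> 1) \<Longrightarrow> (\<Sum>f\<in>F. c f *\<^sub>C S f) \<in> K"
    using compact_combinations[OF F(1)] by metis
  obtain k where k: "finite k" "K \<subseteq> (\<Union>x\<in>k. ball x (e / 2))"
    using compact_eq_totally_bounded[THEN iffD1, OF K(1)] e by (meson half_gt_zero)
  have "S x \<in> (\<Union>x\<in>k. ball x e)" if x: "norm x \<le> 1" for x
  proof -
    have "cmod (cinner f x) \<le> 1" if "f \<in> F" for f
    proof -
      have "norm f = 1" using F(2) that by (simp add: orthonormal_def)
      then show ?thesis using cmod_cinner_le[of f x] x by simp
    qed
    then have "S (fproj F x) \<in> K"
      using K(2)[of "\<lambda>f. cinner f x"]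
      by (simp add: fproj_def bounded_clinear_sum[OF S] bounded_clinearD(2)[OF S])
    then obtain p where p: "p \<in> k" "dist p (S (fproj F x)) < e / 2" using k(2) by auto
    have "norm (S (x - fproj F x)) \<le> e / 2 * norm (x - fproj F x)"
      by (rule small) (use cinner_fproj_diff[OF F(1,2)] in \<open>auto intro: complex_vector.span_base\<close>)
    also have "norm (x - fproj F x) \<le> norm (x - 0)"
      by (rule fproj_best_approx[OF F(1,2) complex_vector.span_zero])
    then have "e / 2 * norm (x - fproj F x) \<le> e / 2 * 1"
      using x e by (intro mult_left_mono) auto
    finally have "dist (S (fproj F x)) (S x) \<le> e / 2"
      by (simp add: dist_norm bounded_clinear_diff[OF S] norm_minus_commute)
    then have "dist p (S x) < e" using p(2) dist_triangle[of p "S x" "S (fproj F x)"] by linarith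
    then show ?thesis using p(1) by auto
  qed
  then show ?thesis using k(1) by (intro exI[of _ k]) auto
qed

lemma hs_image_subseq:
  fixes S :: "'a :: complex_inner \<Rightarrow> 'b :: chilbert_space"
  assumes S: "bounded_clinear S" and c: "hs_le S c" and X: "\<And>n :: nat. norm (X n) \<le> 1"
  shows "\<exists>\<phi> l. strict_mono \<phi> \<and> (\<lambda>n. S (X (\<phi> n))) \<longlonglongrightarrow> l"
proof -
  have "compact (closure (S ` cball 0 1))"
    unfolding compact_eq_totally_bounded
  proof (intro conjI allI impI)
    show "complete (closure (S ` cball 0 1))" by (simp add: complete_eq_closed)
    fix e :: real assume e: "0 < e"
    obtain k where k: "finite k" "S ` cball 0 1 \<subseteq> (\<Union>x\<in>k. ball x (e / 2))"
      using hs_image_totally_bounded[OF S c, of "e / 2"] e by auto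
    have "closure (S ` cball 0 1) \<subseteq> (\<Union>x\<in>k. ball x e)"
    proof
      fix y assume "y \<in> closure (S ` cball 0 1)"
      then obtain z where z: "z \<in> S ` cball 0 1" "dist z y < e / 2"
        using e by (meson closure_approachable half_gt_zero)
      then obtain p where "p \<in> k" "dist p z < e / 2" using k(2) by auto
      then show "y \<in> (\<Union>x\<in>k. ball x e)"
        using z(2) dist_triangle[of p y z] by (auto intro!: bexI[of _ p])
    qed
    then show "\<exists>k. finite k \<and> closure (S ` cball 0 1) \<subseteq> (\<Union>x\<in>k. ball x e)" using k(1) by blast
  qed
  moreover have "\<forall>n. S (X n) \<in> closure (S ` cball 0 1)"
    using X closure_subset[of "S ` cball 0 1"] by auto
  ultimately obtain l \<phi> where "strict_mono (\<phi> :: nat \<Rightarrow> nat)" "((\<lambda>n. S (X n)) \<circ> \<phi>) \<longlonglongrightarrow> l"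
    unfolding compact_def by meson
  then show ?thesis by (auto simp: o_def)
qed

lemma selfadjointD:
  assumes "selfadjoint S"
  shows "bounded_clinear S" "cinner (S x) y = cinner x (S y)"
  using assms by (auto simp: selfadjoint_def)

lemma quadratic_form_add:
  assumes S: "selfadjoint S"
  shows "Re (cinner (x + y) (S (x + y)))
    = Re (cinner x (S x)) + 2 * Re (cinner (S x) y) + Re (cinner y (S y))"
proof -
  have "Re (cinner y (S x)) = Re (cinner (S x) y)" using cinner_commute[of y "S x"] by simp
  then show ?thesis
    by (simp add: bounded_clinear_add[OF selfadjointD(1)[OF S]] cinner_simps
        selfadjointD(2)[OF S, of x y, symmetric])
qed

lemma quadratic_form_scaleR:
  assumes S: "selfadjoint S"
  shows "Re (cinner (t *\<^sub>R x) (S (t *\<^sub>R x))) = t\<^sup>2 * Re (cinner x (S x))"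
  by (simp add: bounded_clinear_scaleR[OF selfadjointD(1)[OF S]] cinner_simps power2_eq_square)

lemma Re_cinner_le: "Re (cinner x y) \<le> norm x * norm (y :: 'a :: complex_inner)"
  using complex_Re_le_cmod cmod_cinner_le order_trans by blast

lemma selfadjoint_add: "selfadjoint S \<Longrightarrow> selfadjoint T \<Longrightarrow> selfadjoint (\<lambda>x. S x + T x)"
  by (simp add: selfadjoint_def bounded_clinear_add_fun cinner_simps)

lemma selfadjoint_scaleR: "selfadjoint S \<Longrightarrow> selfadjoint (\<lambda>x. a *\<^sub>R S x)"
  by (simp add: selfadjoint_def bounded_clinear_scaleR_fun cinner_simps)

lemma selfadjoint_zero: "selfadjoint (\<lambda>x. 0)"
  unfolding selfadjoint_def by (auto intro!: bounded_clinearI[where C = 0])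

text \<open>The supremum \<open>m\<close> of the quadratic form on the unit sphere of the invariant
  subspace \<open>L\<close> is attained at an eigenvector. Positivity of \<open>m\<close> matters at
  the end, where convergence of \<open>S (X n)\<close> is turned into convergence of
  \<open>X n\<close>.\<close>

lemma max_eigenvector:
  fixes S :: "'a :: chilbert_space \<Rightarrow> 'a"
  assumes S: "selfadjoint S" and c: "hs_le S c" and L: "csubspace L" "closed L" "\<And>x. x \<in> L \<Longrightarrow> S x \<in> L"
    and r: "r > 0" and x0: "x0 \<in> L" "Re (cinner x0 (S x0)) > r * (norm x0)\<^sup>2"
  shows "\<exists>v\<in>L. \<exists>m>r. norm v = 1 \<and> S v = m *\<^sub>R v"
proof -
  note Sb = selfadjointD(1)[OF S]
  define q where "q x = Re (cinner x (S x))" for x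
  obtain C where C: "C > 0" "\<And>x. norm (S x) \<le> C * norm x" using bounded_clinear_bound[OF Sb] by blast
  have qC: "\<bar>q x\<bar> \<le> C * (norm x)\<^sup>2" for x
  proof -
    have "\<bar>q x\<bar> \<le> norm x * norm (S x)"
      unfolding q_def using abs_Re_le_cmod cmod_cinner_le order_trans by blast
    also have "\<dots> \<le> norm x * (C * norm x)" by (intro mult_left_mono C) simp
    finally show ?thesis by (simp add: power2_eq_square mult_ac)
  qed
  define U where "U = q ` {u\<in>L. norm u = 1}"
  have bdd: "bdd_above U"
    unfolding U_def
  proof (rule bdd_aboveI2)
    fix u assume "u \<in> {u\<in>L. norm u = 1}"
    then show "q u \<le> C" using qC[of u] by simp
  qed
  define m where "m = Sup U"
  have norml: "(1 / norm y) *\<^sub>R y \<in> {u\<in>L. norm u = 1} \<and> q ((1 / norm y) *\<^sub>R y) = q y / (norm y)\<^sup>2"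
    if "y \<in> L" "y \<noteq> 0" for y
  proof
    show "(1 / norm y) *\<^sub>R y \<in> {u\<in>L. norm u = 1}"
      using complex_vector.subspace_scale[OF L(1) that(1), of "complex_of_real (1 / norm y)"]
        unit_vector_scale[OF that(2)] by (simp add: scaleR_scaleC)
    show "q ((1 / norm y) *\<^sub>R y) = q y / (norm y)\<^sup>2"
      unfolding q_def quadratic_form_scaleR[OF S] by (simp add: power_divide)
  qed
  have qm: "q y \<le> m * (norm y)\<^sup>2" if y: "y \<in> L" for y
  proof (cases "y = 0")
    case False
    have "q ((1 / norm y) *\<^sub>R y) \<in> U" unfolding U_def using norml[OF y False] by blast
    then have "q y / (norm y)\<^sup>2 \<le> m"
      unfolding m_def using norml[OF y False] cSup_upper[OF _ bdd] by metis
    then show ?thesis using False by (simp add: divide_le_eq)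
  qed (simp add: q_def)
  have x0n: "x0 \<noteq> 0" using x0(2) by auto
  have "r < q x0 / (norm x0)\<^sup>2" using x0(2) x0n by (simp add: q_def less_divide_eq)
  also have "\<dots> \<le> m" using qm[OF x0(1)] x0n by (simp add: divide_le_eq)
  finally have mr: "m > r" .
  then have m0: "m > 0" using r by simp
  have Une: "U \<noteq> {}" unfolding U_def using norml[OF x0(1) x0n] by blast
  have "\<exists>u. u \<in> L \<and> norm u = 1 \<and> m - 1 / real (Suc n) < q u" for n
  proof -
    have "\<exists>w\<in>U. m - 1 / real (Suc n) < w" unfolding m_def using Une by (intro less_cSupD) auto
    then show ?thesis unfolding U_def by auto
  qed
  then obtain X where X: "\<And>n. X n \<in> L" "\<And>n. norm (X n) = 1" "\<And>n. m - 1 / real (Suc n) < q (X n)"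
    by metis
  \<comment> \<open>On \<open>L\<close> the form \<open>a\<close> of \<open>D = m - S\<close> is
    nonnegative, and it tends to \<open>0\<close> along a maximising sequence.\<close>
  define D where "D y = m *\<^sub>R y + (-1) *\<^sub>R S y" for y
  have sid: "selfadjoint (\<lambda>y :: 'a. y)"
    by (auto simp: selfadjoint_def intro!: bounded_clinearI[where C = 1])
  have Dsa: "selfadjoint D" unfolding D_def
    by (intro selfadjoint_add selfadjoint_scaleR S sid)
  define a where "a y = Re (cinner y (D y))" for y
  have a_eq: "a y = m * (norm y)\<^sup>2 - q y" for y
    by (simp add: a_def D_def q_def cinner_simps norm_sq_eq_cinner)
  have DL: "D y \<in> L" if "y \<in> L" for y
    unfolding D_def scaleR_scaleC
    by (intro complex_vector.subspace_add complex_vector.subspace_scale L that)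
  have key: "(norm (D y))\<^sup>2 \<le> (m + C) * a y" if y: "y \<in> L" for y
  proof -
    define w where "w = D y"
    \<comment> \<open>Evaluating \<open>a\<close> at \<open>y - t D y\<close> yields the
      Cauchy-Schwarz inequality for a nonnegative form; this \<open>t\<close> is optimal because
      \<open>a w <= (m + C) |w|^2\<close>. The test vector stays in \<open>L\<close> by
      invariance.\<close>
    define t where "t = 1 / (m + C)"
    have t: "t * (m + C) = 1" "t > 0" using m0 C(1) by (auto simp: t_def)
    have wL: "w \<in> L" unfolding w_def by (rule DL[OF y])
    have "y + (- t) *\<^sub>R w \<in> L"
      unfolding scaleR_scaleC by (intro complex_vector.subspace_add complex_vector.subspace_scale L y wL)
    then have "0 \<le> a (y + (- t) *\<^sub>R w)" using qm unfolding a_eq by simp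
    also have "\<dots> = a y - 2 * t * (norm w)\<^sup>2 + t\<^sup>2 * a w"
      unfolding a_def quadratic_form_add[OF Dsa] quadratic_form_scaleR[OF Dsa]
      by (simp add: w_def[symmetric] cinner_simps norm_sq_eq_cinner)
    also have "a w \<le> (m + C) * (norm w)\<^sup>2"
      using qC[of w] by (simp add: a_eq algebra_simps abs_le_iff)
    then have "t\<^sup>2 * a w \<le> t\<^sup>2 * ((m + C) * (norm w)\<^sup>2)" by (rule mult_left_mono) simp
    also have "t\<^sup>2 * ((m + C) * (norm w)\<^sup>2) = t * (norm w)\<^sup>2"
      using t(1) by (simp add: power2_eq_square mult.assoc[symmetric])
    finally have "t * (norm w)\<^sup>2 \<le> a y" by simp
    then have "(m + C) * (t * (norm w)\<^sup>2) \<le> (m + C) * a y" using m0 C(1) by (intro mult_left_mono) auto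
    then show ?thesis using t(1) by (simp add: w_def mult.assoc[symmetric] mult.commute[of _ t])
  qed
  have D0: "(\<lambda>n. D (X n)) \<longlonglongrightarrow> 0"
  proof -
    have "(norm (D (X n)))\<^sup>2 \<le> (m + C) * (1 / real (Suc n))" for n
    proof -
      have "a (X n) \<le> 1 / real (Suc n)" using X(3)[of n] unfolding a_eq X(2) by simp
      then have "(m + C) * a (X n) \<le> (m + C) * (1 / real (Suc n))"
        using m0 C(1) by (intro mult_left_mono) auto
      then show ?thesis using key[OF X(1)[of n]] by linarith
    qed
    then have "\<forall>\<^sub>F n in sequentially. norm ((norm (D (X n)))\<^sup>2) \<le> (m + C) * (1 / real (Suc n))" by simp
    moreover have "(\<lambda>n. (m + C) * (1 / real (Suc n))) \<longlonglongrightarrow> (m + C) * 0"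
      by (intro tendsto_mult_left LIMSEQ_inverse_real_of_nat[unfolded inverse_eq_divide])
    ultimately have "(\<lambda>n. (norm (D (X n)))\<^sup>2) \<longlonglongrightarrow> 0"
      using Lim_null_comparison[of "\<lambda>n. (norm (D (X n)))\<^sup>2" "\<lambda>n. (m + C) * (1 / real (Suc n))"] by simp
    from tendsto_real_sqrt[OF this] show ?thesis by (simp add: tendsto_norm_zero_iff)
  qed
  obtain \<phi> l where \<phi>: "strict_mono \<phi>" "(\<lambda>n. S (X (\<phi> n))) \<longlonglongrightarrow> l"
    using hs_image_subseq[OF Sb c, of X] X(2) by auto
  have "(\<lambda>n. D (X (\<phi> n)) + S (X (\<phi> n))) \<longlonglongrightarrow> 0 + l"
    using LIMSEQ_subseq_LIMSEQ[OF D0 \<phi>(1)] \<phi>(2) by (intro tendsto_add) (simp_all add: o_def)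
  \<comment> \<open>\<open>m X = D X + S X\<close>: the first term vanishes in the limit, the second
    converges along the subsequence by compactness.\<close>
  then have "(\<lambda>n. m *\<^sub>R X (\<phi> n)) \<longlonglongrightarrow> l" by (simp add: D_def)
  then have "(\<lambda>n. (1 / m) *\<^sub>R m *\<^sub>R X (\<phi> n)) \<longlonglongrightarrow> (1 / m) *\<^sub>R l" by (intro tendsto_scaleR tendsto_const)
  then have lim: "(\<lambda>n. X (\<phi> n)) \<longlonglongrightarrow> (1 / m) *\<^sub>R l" using m0 by simp
  define v where "v = (1 / m) *\<^sub>R l"
  have vL: "v \<in> L" unfolding v_def using closed_sequentially[OF L(2) _ lim] X(1) by blast
  have "(\<lambda>n. norm (X (\<phi> n))) \<longlonglongrightarrow> norm v" unfolding v_def by (rule tendsto_norm[OF lim])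
  then have v1: "norm v = 1" unfolding X(2) by (simp add: LIMSEQ_const_iff)
  have "(\<lambda>n. S (X (\<phi> n))) \<longlonglongrightarrow> S v"
    unfolding v_def by (rule bounded_linear.tendsto[OF bounded_clinearD(1)[OF Sb] lim])
  then have "S v = l" using LIMSEQ_unique \<phi>(2) by blast
  then have "S v = m *\<^sub>R v" using m0 by (simp add: v_def)
  then show ?thesis using vL v1 mr by blast
qed

text \<open>A finite orthonormal basis of the spectral subspace for \<open>(r, \<infinity>)\<close>,
  consisting of eigenvectors; every count below is the cardinality of such a set.\<close>

definition spectral_ons :: "('a :: complex_inner \<Rightarrow> 'a) \<Rightarrow> real \<Rightarrow> 'a set \<Rightarrow> bool" where
  "spectral_ons S r F \<longleftrightarrow> finite F \<and> orthonormal F \<and> (\<forall>f\<in>F. \<exists>m>r. S f = m *\<^sub>R f)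
     \<and> (\<forall>x. \<forall>m>r. S x = m *\<^sub>R x \<longrightarrow> x \<in> cspan F)"

lemma spectral_ons_card_le:
  assumes c: "hs_le S c" and r: "r > 0" and F: "finite F" "orthonormal F" "\<And>f. f \<in> F \<Longrightarrow> \<exists>m>r. S f = m *\<^sub>R f"
  shows "real (card F) * r\<^sup>2 \<le> c"
proof -
  have "real (card F) * r\<^sup>2 = (\<Sum>f\<in>F. r\<^sup>2)" by simp
  also have "\<dots> \<le> (\<Sum>f\<in>F. (norm (S f))\<^sup>2)"
  proof (rule sum_mono)
    fix f assume f: "f \<in> F"
    obtain m where "m > r" "S f = m *\<^sub>R f" using F(3)[OF f] by blast
    moreover have "norm f = 1" using F(2) f by (simp add: orthonormal_def)
    ultimately show "r\<^sup>2 \<le> (norm (S f))\<^sup>2" using r by (simp add: power_mono)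
  qed
  also have "\<dots> \<le> c" by (rule hs_leD[OF c F(1,2)])
  finally show ?thesis .
qed

text \<open>Each eigenvector with eigenvalue above \<open>r\<close> uses up more than
  \<open>r^2\<close> of the Hilbert-Schmidt sum, so an orthonormal family of them of maximal
  cardinality exists. An eigenvector outside its span would leave a remainder that enlarges
  it.\<close>

lemma spectral_ons_exists:
  fixes S :: "'a :: complex_inner \<Rightarrow> 'a"
  assumes S: "selfadjoint S" and c: "hs_le S c" and r: "r > 0"
  shows "\<exists>F. spectral_ons S r F"
proof -
  note Sb = selfadjointD(1)[OF S]
  define P where "P F \<longleftrightarrow> finite F \<and> orthonormal F \<and> (\<forall>f\<in>F. \<exists>m>r. S f = m *\<^sub>R f)" for F
  have b: "card F < Suc (nat \<lceil>c / r\<^sup>2\<rceil>)" if "P F" for F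
  proof -
    have "real (card F) * r\<^sup>2 \<le> c" using that unfolding P_def by (intro spectral_ons_card_le[OF c r]) auto
    then have "real (card F) \<le> c / r\<^sup>2" using r by (simp add: le_divide_eq)
    then show ?thesis by linarith
  qed
  have "P {}" by (simp add: P_def)
  then obtain F where F: "P F" "\<And>E. P E \<Longrightarrow> card E \<le> card F"
    using ex_has_greatest_nat[of P "{}" card "Suc (nat \<lceil>c / r\<^sup>2\<rceil>)"] b by blast
  have fF: "finite F" "orthonormal F" using F(1) by (auto simp: P_def)
  have "x \<in> cspan F" if m: "m > r" "S x = m *\<^sub>R x" for x m
  proof (rule ccontr)
    assume x: "x \<notin> cspan F"
    define y where "y = x - fproj F x"
    have y0: "y \<noteq> 0" using x fproj_in_span[of F x] by (auto simp: y_def)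
    \<comment> \<open>Either the eigenvalue of \<open>f\<close> is \<open>m\<close> or the
      coefficient \<open>cinner f x\<close> vanishes, so projection and remainder are again in the
      eigenspace of \<open>m\<close>.\<close>
    have "S (cinner f x *\<^sub>C f) = m *\<^sub>R (cinner f x *\<^sub>C f)" if f: "f \<in> F" for f
    proof -
      obtain k where k: "S f = k *\<^sub>R f" using F(1) f by (auto simp: P_def)
      have "of_real k * cinner f x = of_real m * cinner f x"
        using selfadjointD(2)[OF S, of f x] by (simp add: k m(2) cinner_simps)
      then show ?thesis
        by (simp add: bounded_clinearD(2)[OF Sb] k scaleR_scaleC scaleC_scaleC mult.commute)
    qed
    then have "S (fproj F x) = m *\<^sub>R fproj F x"
      unfolding fproj_def bounded_clinear_sum[OF Sb] scaleR_sum_right by (rule sum.cong[OF refl])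
    then have Sy: "S y = m *\<^sub>R y"
      by (simp add: y_def bounded_clinear_diff[OF Sb] m(2) scaleR_diff_right)
    define e where "e = (1 / norm y) *\<^sub>R y"
    have e1: "norm e = 1" unfolding e_def using y0 by (rule unit_vector_scale)
    have fe: "cinner f e = 0" if "f \<in> F" for f
      using cinner_fproj_diff[OF fF complex_vector.span_base[OF that], of x]
      by (simp add: e_def cinner_scaleR_right y_def)
    have "S e = m *\<^sub>R e" by (simp add: e_def bounded_clinear_scaleR[OF Sb] Sy)
    then have "P (insert e F)"
      using F(1) orthonormal_insert[OF fF(2) e1 fe] m(1) by (auto simp: P_def)
    from F(2)[OF this] have "e \<in> F" using fF by (simp add: card_insert_if split: if_splits)
    from fe[OF this] e1 show False by (simp add: cinner_self_eq_0)
  qed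
  then show ?thesis using F(1) unfolding spectral_ons_def P_def by blast
qed

lemma spectral_ons_closure:
  fixes S :: "'a :: complex_inner \<Rightarrow> 'a"
  assumes "spectral_ons S r F"
  shows "closure (cspan (\<Union>m\<in>{r<..}. eigenspace S m)) = cspan F"
proof -
  have F: "finite F" "orthonormal F" using assms by (auto simp: spectral_ons_def)
  have "cspan (\<Union>m\<in>{r<..}. eigenspace S m) = cspan F"
  proof (rule antisym; rule complex_vector.span_minimal)
    show "(\<Union>m\<in>{r<..}. eigenspace S m) \<subseteq> cspan F"
      using assms by (auto simp: spectral_ons_def eigenspace_def)
    show "F \<subseteq> cspan (\<Union>m\<in>{r<..}. eigenspace S m)"
    proof
      fix f assume "f \<in> F"
      then obtain m where "m > r" "S f = m *\<^sub>R f" using assms by (auto simp: spectral_ons_def)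
      then show "f \<in> cspan (\<Union>m\<in>{r<..}. eigenspace S m)"
        by (intro complex_vector.span_base) (auto simp: eigenspace_def)
    qed
  qed auto
  then show ?thesis using closed_cspan_orthonormal[OF F] by simp
qed

lemma spectral_proj_eq_fproj: "spectral_ons S r F \<Longrightarrow> spectral_proj {r<..} S = fproj F"
  unfolding spectral_proj_def by (simp add: spectral_ons_closure orth_proj_cspan spectral_ons_def)

lemma N_plus_eq_card:
  assumes "spectral_ons S r F"
  shows "N_plus r S = enat (card F)"
proof -
  have F: "finite F" "orthonormal F" using assms by (auto simp: spectral_ons_def)
  have "range (fproj F) = cspan F"
    using fproj_in_span[of F] fproj_span[OF F] by (auto, metis rangeI)
  moreover have "finite_cdim (cspan F)" using F by (auto simp: finite_cdim_def)
  ultimately show ?thesis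
    unfolding N_plus_def spectral_proj_eq_fproj[OF assms] op_rank_def
    by (simp only: cdim_orthonormal[OF F] if_True)
qed

lemma cinner_fproj_commute: "cinner (fproj F x) y = cinner x (fproj F y)"
proof -
  have "cinner (fproj F x) y = (\<Sum>f\<in>F. cnj (cinner f x) * cinner f y)"
    by (simp add: fproj_def cinner_sum_left cinner_scaleC_left)
  also have "\<dots> = (\<Sum>f\<in>F. cinner f y * cinner x f)"
    using cinner_commute[of x] by (intro sum.cong refl) (simp add: mult.commute)
  finally show ?thesis by (simp add: fproj_def cinner_sum_right cinner_scaleC_right)
qed

lemma bounded_clinear_fproj: "bounded_clinear (fproj F)"
  by (simp add: bounded_clinear_def bounded_linear_fproj fproj_scaleC)

text \<open>A projection \<open>P\<close> satisfies \<open>adj P \<circ> P = P\<close>, so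
  \<open>op_trace_le_iff\<close> applies; the trace is then identified by which real bounds it
  admits.\<close>

lemma op_trace_fproj:
  fixes F :: "'a :: chilbert_space set"
  assumes F: "finite F" "orthonormal F"
  shows "op_trace (fproj F) = ennreal (card F)"
proof -
  have 1: "adj (fproj F) = fproj F" by (rule adj_eqI) (rule cinner_fproj_commute)
  have 2: "adj (fproj F) \<circ> fproj F = fproj F"
    unfolding 1 by (simp add: o_def fproj_span[OF F fproj_in_span])
  have hs: "hs_le (fproj F) c \<longleftrightarrow> real (card F) \<le> c" for c
  proof
    assume "hs_le (fproj F) c"
    from hs_leD[OF this F] show "real (card F) \<le> c"
      using F(2) fproj_span[OF F complex_vector.span_base] by (simp add: orthonormal_def)
  next
    assume c: "real (card F) \<le> c"
    show "hs_le (fproj F) c"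
      unfolding hs_le_def
    proof (intro allI impI)
      fix E :: "'a set" assume E: "finite E \<and> orthonormal E"
      have "(\<Sum>e\<in>E. (norm (fproj F e))\<^sup>2) = (\<Sum>e\<in>E. \<Sum>f\<in>F. (cmod (cinner f e))\<^sup>2)"
        by (simp add: norm_fproj[OF F])
      also have "\<dots> \<le> (\<Sum>f\<in>F. (norm f)\<^sup>2)"
        using E by (intro hs_sum_le_adjoint[of "\<lambda>x. x" "\<lambda>x. x"]) auto
      also have "\<dots> = real (card F)" using F(2) by (simp add: orthonormal_def)
      finally show "(\<Sum>e\<in>E. (norm (fproj F e))\<^sup>2) \<le> c" using c by simp
    qed
  qed
  have le: "op_trace (fproj F) \<le> ennreal c \<longleftrightarrow> real (card F) \<le> c" if "0 \<le> c" for c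
    using op_trace_le_iff[OF bounded_clinear_fproj that, of F] unfolding 2 hs .
  have "op_trace (fproj F) \<le> ennreal (card F)" using le[of "card F"] by simp
  then obtain t where t: "op_trace (fproj F) = ennreal t" "0 \<le> t"
    by (cases "op_trace (fproj F)") (auto simp: top_unique)
  then show ?thesis using le[of t] le[of "card F"] by (intro antisym) (auto simp: ennreal_le_iff)
qed

lemma counting_fun_eq_card:
  fixes S :: "'a :: chilbert_space \<Rightarrow> 'a"
  assumes "spectral_ons S r F"
  shows "counting_fun S r = ennreal (card F)"
  using assms op_trace_fproj[of F]
  by (simp add: counting_fun_def spectral_proj_eq_fproj spectral_ons_def)

text \<open>The cross term vanishes because \<open>S\<close> maps the span of \<open>F\<close> into
  itself and the remainder is orthogonal to it.\<close>

lemma quadratic_form_fproj: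
  assumes S: "selfadjoint S" and F: "spectral_ons S r F"
    and m: "\<And>f. f \<in> F \<Longrightarrow> S f = m f *\<^sub>R f"
  shows "Re (cinner x (S x)) = (\<Sum>f\<in>F. m f * (cmod (cinner f x))\<^sup>2)
    + Re (cinner (x - fproj F x) (S (x - fproj F x)))"
proof -
  note Sb = selfadjointD(1)[OF S]
  have fF: "finite F" "orthonormal F" using F by (auto simp: spectral_ons_def)
  have Sf: "S (fproj F x) = (\<Sum>f\<in>F. (cinner f x * of_real (m f)) *\<^sub>C f)"
    unfolding fproj_def bounded_clinear_sum[OF Sb]
    by (intro sum.cong refl) (simp add: bounded_clinearD(2)[OF Sb] m scaleR_scaleC scaleC_scaleC)
  have Sspan: "S (fproj F x) \<in> cspan F" unfolding Sf
    by (intro complex_vector.span_sum complex_vector.span_scale complex_vector.span_base)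
  have "cinner (fproj F x) (S (fproj F x)) = (\<Sum>f\<in>F. (cinner f x * of_real (m f)) * cinner (fproj F x) f)"
    unfolding Sf by (simp add: cinner_sum_right cinner_scaleC_right)
  also have "\<dots> = (\<Sum>f\<in>F. of_real (m f * (cmod (cinner f x))\<^sup>2))"
  proof (intro sum.cong refl)
    fix f assume f: "f \<in> F"
    have "cinner (fproj F x) f = cnj (cinner f x)"
      unfolding cinner_commute[of "fproj F x" f] cinner_fproj[OF fF f] ..
    then show "(cinner f x * of_real (m f)) * cinner (fproj F x) f = of_real (m f * (cmod (cinner f x))\<^sup>2)"
      by (simp add: complex_norm_square[symmetric] mult_ac)
  qed
  finally have "Re (cinner (fproj F x) (S (fproj F x))) = (\<Sum>f\<in>F. m f * (cmod (cinner f x))\<^sup>2)" by simp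
  moreover have "cinner (S (fproj F x)) (x - fproj F x) = 0"
    by (rule cinner_fproj_diff[OF fF Sspan])
  ultimately show ?thesis
    using quadratic_form_add[OF S, of "fproj F x" "x - fproj F x"] by simp
qed

text \<open>Otherwise \<open>max_eigenvector\<close> on the invariant orthogonal complement of
  \<open>F\<close> would produce an eigenvector above \<open>r\<close> there, while all of these lie
  in the span of \<open>F\<close>.\<close>

lemma spectral_ons_orthogonal:
  fixes S :: "'a :: chilbert_space \<Rightarrow> 'a"
  assumes S: "selfadjoint S" and c: "hs_le S c" and r: "r > 0" and F: "spectral_ons S r F"
    and x: "\<And>f. f \<in> F \<Longrightarrow> cinner f x = 0"
  shows "Re (cinner x (S x)) \<le> r * (norm x)\<^sup>2"
proof (rule ccontr)
  assume "\<not> ?thesis"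
  then have big: "Re (cinner x (S x)) > r * (norm x)\<^sup>2" by simp
  define L where "L = {x. \<forall>f\<in>F. cinner f x = 0}"
  have "\<exists>v\<in>L. \<exists>m>r. norm v = 1 \<and> S v = m *\<^sub>R v"
  proof (rule max_eigenvector[OF S c _ _ _ r _ big])
    show "csubspace L" by (auto simp: L_def complex_vector.subspace_def cinner_simps)
    have "L = (\<Inter>f\<in>F. {x. cinner f x = 0})" by (auto simp: L_def)
    then show "closed L"
      by (auto intro!: closed_INT closed_Collect_eq linear_continuous_on bounded_linear_cinner_right)
    show "x \<in> L" using x by (simp add: L_def)
    fix y assume y: "y \<in> L"
    have "cinner f (S y) = 0" if f: "f \<in> F" for f
    proof -
      obtain m where m: "S f = m *\<^sub>R f" using F f unfolding spectral_ons_def by blast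
      have "cinner f (S y) = cinner (S f) y" by (simp add: selfadjointD(2)[OF S])
      then show ?thesis using y f by (simp add: m cinner_scaleR_left L_def)
    qed
    then show "S y \<in> L" by (simp add: L_def)
  qed
  then obtain v m where v: "v \<in> L" "m > r" "norm v = 1" "S v = m *\<^sub>R v" by blast
  then have "v \<in> cspan F" using F by (auto simp: spectral_ons_def)
  moreover have "cinner f v = 0" if "f \<in> F" for f using v(1) that by (simp add: L_def)
  ultimately have "cinner v v = 0" by (rule cinner_span_zero[rotated])
  then show False using v(3) by (simp add: cinner_self_eq_0)
qed

lemma spectral_ons_span:
  assumes S: "selfadjoint S" and F: "spectral_ons S r F" and x: "x \<in> cspan F" "x \<noteq> 0"
  shows "Re (cinner x (S x)) > r * (norm x)\<^sup>2"
proof -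
  have fF: "finite F" "orthonormal F" using F by (auto simp: spectral_ons_def)
  obtain m where m: "\<And>f. f \<in> F \<Longrightarrow> m f > r \<and> S f = m f *\<^sub>R f"
    using F unfolding spectral_ons_def by metis
  have n: "(norm x)\<^sup>2 = (\<Sum>f\<in>F. (cmod (cinner f x))\<^sup>2)"
    using norm_fproj[OF fF, of x] by (simp add: fproj_span[OF fF x(1)])
  have ex: "\<exists>f\<in>F. cinner f x \<noteq> 0"
  proof (rule ccontr)
    assume "\<not> ?thesis"
    then have "(norm x)\<^sup>2 = 0" unfolding n by simp
    then show False using x(2) by simp
  qed
  then have "(\<Sum>f\<in>F. r * (cmod (cinner f x))\<^sup>2) < (\<Sum>f\<in>F. m f * (cmod (cinner f x))\<^sup>2)"
    proof (intro sum_strict_mono_ex1 fF(1) ballI)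
    show "r * (cmod (cinner f x))\<^sup>2 \<le> m f * (cmod (cinner f x))\<^sup>2" if "f \<in> F" for f
      using m[OF that] by (intro mult_right_mono) auto
    obtain f where "f \<in> F" "cinner f x \<noteq> 0" using ex by blast
    then show "\<exists>f\<in>F. r * (cmod (cinner f x))\<^sup>2 < m f * (cmod (cinner f x))\<^sup>2"
      using m by (intro bexI[of _ f] mult_strict_right_mono) auto
  qed
  also have "\<dots> = Re (cinner x (S x))"
    using quadratic_form_fproj[OF S F, of m x] m by (simp add: fproj_span[OF fF x(1)])
  finally show ?thesis unfolding n by (simp add: sum_distrib_left)
qed

section \<open>Variational inequalities for eigenvalue counts\<close>

definition ncount :: "real \<Rightarrow> ('a :: complex_inner \<Rightarrow> 'a) \<Rightarrow> nat" where
  "ncount r S = the_enat (N_plus r S)"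

lemma ncount_eq_card: "spectral_ons S r F \<Longrightarrow> ncount r S = card F"
  by (simp add: ncount_def N_plus_eq_card)

definition hs_selfadjoint :: "('a :: complex_inner \<Rightarrow> 'a) \<Rightarrow> bool" where
  "hs_selfadjoint S \<longleftrightarrow> selfadjoint S \<and> (\<exists>c. hs_le S c)"

lemma hs_selfadjointE:
  assumes "hs_selfadjoint S" "r > 0"
  obtains F where "spectral_ons S r F"
  using assms spectral_ons_exists unfolding hs_selfadjoint_def by blast

lemma N_plus_eq_ncount: "hs_selfadjoint S \<Longrightarrow> r > 0 \<Longrightarrow> N_plus r S = enat (ncount r S)"
  by (metis N_plus_eq_card hs_selfadjointE ncount_eq_card)

lemma counting_fun_eq_ncount:
  "hs_selfadjoint (S :: 'a :: chilbert_space \<Rightarrow> 'a) \<Longrightarrow> r > 0 \<Longrightarrow> counting_fun S r = ennreal (ncount r S)"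
  by (metis counting_fun_eq_card hs_selfadjointE ncount_eq_card)

lemma hs_selfadjoint_add:
  "hs_selfadjoint S \<Longrightarrow> hs_selfadjoint T \<Longrightarrow> hs_selfadjoint (\<lambda>x. S x + T x)"
  unfolding hs_selfadjoint_def by (blast intro: selfadjoint_add hs_le_add)

lemma hs_selfadjoint_scaleR: "hs_selfadjoint S \<Longrightarrow> hs_selfadjoint (\<lambda>x. a *\<^sub>R S x)"
  unfolding hs_selfadjoint_def by (blast intro: selfadjoint_scaleR hs_le_scaleR)

lemma hs_selfadjoint_zero: "hs_selfadjoint (\<lambda>x. 0)"
  unfolding hs_selfadjoint_def hs_le_def by (auto intro!: selfadjoint_zero exI[of _ 0])

text \<open>One half of the min-max principle: were the spectral subspace larger than
  \<open>G\<close>, it would contain a nonzero vector orthogonal to \<open>G\<close>, where the form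
  exceeds \<open>r\<close>.\<close>

lemma ncount_le_card:
  fixes S :: "'a :: chilbert_space \<Rightarrow> 'a"
  assumes S: "hs_selfadjoint S" and r: "r > 0" and G: "finite G"
    and le: "\<And>x. (\<And>g. g \<in> G \<Longrightarrow> cinner g x = 0) \<Longrightarrow> Re (cinner x (S x)) \<le> r * (norm x)\<^sup>2"
  shows "ncount r S \<le> card G"
proof (rule ccontr)
  obtain F where F: "spectral_ons S r F" using hs_selfadjointE[OF S r] .
  then have fF: "finite F" "orthonormal F" by (auto simp: spectral_ons_def)
  assume "\<not> ?thesis"
  then have "card G < card F" by (simp add: ncount_eq_card[OF F])
  then obtain x where x: "x \<in> cspan F" "x \<noteq> 0" "\<And>g. g \<in> G \<Longrightarrow> cinner g x = 0"
    using exists_orthogonal_in_span[OF fF G] by blast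
  have "Re (cinner x (S x)) > r * (norm x)\<^sup>2"
    using S by (intro spectral_ons_span[OF _ F x(1,2)]) (simp add: hs_selfadjoint_def)
  with le[OF x(3)] show False by simp
qed

text \<open>The other half: the count is attained by a set of conditions, namely the eigenvectors.
  Together with \<open>ncount_le_card\<close> it reduces comparisons of counts to comparisons of
  quadratic forms.\<close>

lemma ncount_orthogonal:
  fixes S :: "'a :: chilbert_space \<Rightarrow> 'a"
  assumes S: "hs_selfadjoint S" and r: "r > 0"
  obtains G where "finite G" "card G = ncount r S"
    "\<And>x. (\<And>g. g \<in> G \<Longrightarrow> cinner g x = 0) \<Longrightarrow> Re (cinner x (S x)) \<le> r * (norm x)\<^sup>2"
proof -
  obtain F where F: "spectral_ons S r F" using hs_selfadjointE[OF S r] .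
  obtain c where c: "selfadjoint S" "hs_le S c" using S by (auto simp: hs_selfadjoint_def)
  show ?thesis
    by (rule that[of F]) (use F spectral_ons_orthogonal[OF c r F] in
        \<open>auto simp: ncount_eq_card spectral_ons_def\<close>)
qed

lemma ncount_le_hs:
  fixes S :: "'a :: chilbert_space \<Rightarrow> 'a"
  assumes "hs_selfadjoint S" "hs_le S c" "r > 0"
  shows "real (ncount r S) \<le> c / r\<^sup>2"
proof -
  obtain F where F: "spectral_ons S r F" using hs_selfadjointE[OF assms(1,3)] .
  have "real (card F) * r\<^sup>2 \<le> c"
    using F by (intro spectral_ons_card_le[OF assms(2,3)]) (auto simp: spectral_ons_def)
  then show ?thesis using assms(3) by (simp add: ncount_eq_card[OF F] le_divide_eq)
qed

text \<open>Impose the orthogonality conditions for \<open>S1\<close> and \<open>S2\<close>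
  simultaneously; their numbers add.\<close>

lemma ncount_weyl:
  fixes S :: "'a :: chilbert_space \<Rightarrow> 'a"
  assumes "hs_selfadjoint S" "hs_selfadjoint S1" "hs_selfadjoint S2" and r: "r1 > 0" "r2 > 0"
    and le: "\<And>x. Re (cinner x (S x)) \<le> Re (cinner x (S1 x)) + Re (cinner x (S2 x))"
  shows "ncount (r1 + r2) S \<le> ncount r1 S1 + ncount r2 S2"
proof -
  obtain G1 where G1: "finite G1" "card G1 = ncount r1 S1"
    "\<And>x. (\<And>g. g \<in> G1 \<Longrightarrow> cinner g x = 0) \<Longrightarrow> Re (cinner x (S1 x)) \<le> r1 * (norm x)\<^sup>2"
    using ncount_orthogonal[OF assms(2) r(1)] by blast
  obtain G2 where G2: "finite G2" "card G2 = ncount r2 S2"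
    "\<And>x. (\<And>g. g \<in> G2 \<Longrightarrow> cinner g x = 0) \<Longrightarrow> Re (cinner x (S2 x)) \<le> r2 * (norm x)\<^sup>2"
    using ncount_orthogonal[OF assms(3) r(2)] by blast
  have "ncount (r1 + r2) S \<le> card (G1 \<union> G2)"
  proof (rule ncount_le_card[OF assms(1)])
    fix x assume x: "\<And>g. g \<in> G1 \<union> G2 \<Longrightarrow> cinner g x = 0"
    have "Re (cinner x (S1 x)) \<le> r1 * (norm x)\<^sup>2" using x by (intro G1(3)) blast
    moreover have "Re (cinner x (S2 x)) \<le> r2 * (norm x)\<^sup>2" using x by (intro G2(3)) blast
    ultimately show "Re (cinner x (S x)) \<le> (r1 + r2) * (norm x)\<^sup>2"
      using le[of x] by (simp add: distrib_right)
  qed (use r G1 G2 in auto)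
  also have "\<dots> \<le> card G1 + card G2" by (rule card_Un_le)
  finally show ?thesis by (simp add: G1 G2)
qed

text \<open>The same conditions serve for both operators. The scale \<open>a\<close> lets a large
  coupling be moved into the level, which is how the energy enters the counting function.\<close>

lemma ncount_mono:
  fixes S :: "'a :: chilbert_space \<Rightarrow> 'a"
  assumes "hs_selfadjoint S" "hs_selfadjoint S'" "0 < r'" "0 < r" "0 \<le> a"
    and le: "\<And>x. Re (cinner x (S x)) \<le> a * Re (cinner x (S' x))" and ar: "a * r' \<le> r"
  shows "ncount r S \<le> ncount r' S'"
proof -
  obtain G where G: "finite G" "card G = ncount r' S'"
    "\<And>x. (\<And>g. g \<in> G \<Longrightarrow> cinner g x = 0) \<Longrightarrow> Re (cinner x (S' x)) \<le> r' * (norm x)\<^sup>2"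
    using ncount_orthogonal[OF assms(2,3)] by blast
  have "ncount r S \<le> card G"
  proof (rule ncount_le_card[OF assms(1,4) G(1)])
    fix x assume x: "\<And>g. g \<in> G \<Longrightarrow> cinner g x = 0"
    note le[of x]
    also have "a * Re (cinner x (S' x)) \<le> a * (r' * (norm x)\<^sup>2)"
      using G(3)[OF x] assms(5) by (rule mult_left_mono)
    also have "\<dots> \<le> r * (norm x)\<^sup>2" using ar by (simp add: mult.assoc[symmetric] mult_right_mono)
    finally show "Re (cinner x (S x)) \<le> r * (norm x)\<^sup>2" .
  qed
  then show ?thesis using G(2) by simp
qed

lemma ncount_zero: "r > 0 \<Longrightarrow> ncount r (\<lambda>x :: 'a :: chilbert_space. 0) = 0"
  using ncount_le_card[OF hs_selfadjoint_zero, of r "{}"] by simp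

text \<open>\<open>Y Z\<close> and \<open>Z Y\<close> have the same positive spectrum; the
  variational proof transports the conditions by \<open>Y\<close>. If \<open>y\<close> is orthogonal
  to \<open>Y g\<close>, then \<open>Z y\<close> is orthogonal to \<open>g\<close>, so
  \<open>|Y Z y| <= sqrt r |Z y|\<close>, and \<open>|Z y|^2 = <y, Y Z y>\<close> gives the bound
  for \<open>Z y\<close>.\<close>

lemma ncount_swap_le:
  fixes Y :: "'a :: chilbert_space \<Rightarrow> 'b :: chilbert_space"
  assumes adj: "\<And>x y. cinner (Y x) y = cinner x (Z y)"
    and S: "hs_selfadjoint (\<lambda>y. Y (Z y))" "hs_selfadjoint (\<lambda>x. Z (Y x))" and r: "r > 0"
  shows "ncount r (\<lambda>y. Y (Z y)) \<le> ncount r (\<lambda>x. Z (Y x))"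
proof -
  obtain G where G: "finite G" "card G = ncount r (\<lambda>x. Z (Y x))"
    "\<And>x. (\<And>g. g \<in> G \<Longrightarrow> cinner g x = 0) \<Longrightarrow> Re (cinner x (Z (Y x))) \<le> r * (norm x)\<^sup>2"
    using ncount_orthogonal[OF S(2) r] by blast
  have n: "Re (cinner y (Y (Z y))) = (norm (Z y))\<^sup>2" for y
    proof -
    have "cinner y (Y (Z y)) = cnj (cinner (Z y) (Z y))"
      unfolding cinner_commute[of y] by (simp add: adj)
    then show ?thesis by (simp add: norm_sq_eq_cinner)
  qed
  have n': "Re (cinner x (Z (Y x))) = (norm (Y x))\<^sup>2" for x
    by (simp add: adj[symmetric] norm_sq_eq_cinner)
  have "ncount r (\<lambda>y. Y (Z y)) \<le> card (Y ` G)"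
  proof (rule ncount_le_card[OF S(1) r])
    fix y assume y: "\<And>g. g \<in> Y ` G \<Longrightarrow> cinner g y = 0"
    have "cinner g (Z y) = 0" if "g \<in> G" for g using y[of "Y g"] that by (simp add: adj)
    from G(3)[OF this] have "(norm (Y (Z y)))\<^sup>2 \<le> r * (norm (Z y))\<^sup>2" unfolding n' .
    also have "\<dots> = (sqrt r * norm (Z y))\<^sup>2" using r by (simp add: power_mult_distrib)
    finally have le: "norm (Y (Z y)) \<le> sqrt r * norm (Z y)"
      by (rule power2_le_imp_le) (use r in simp)
    have "norm (Z y) \<le> sqrt r * norm y"
    proof (cases "norm (Z y) = 0")
      case False
      have "(norm (Z y))\<^sup>2 \<le> norm y * norm (Y (Z y))" unfolding n[symmetric] by (rule Re_cinner_le)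
      also have "\<dots> \<le> norm y * (sqrt r * norm (Z y))" using le by (rule mult_left_mono) simp
      finally show ?thesis using False by (simp add: power2_eq_square mult_ac)
    qed (use r in simp)
    then have "(norm (Z y))\<^sup>2 \<le> (sqrt r * norm y)\<^sup>2" by (rule power_mono) simp
    then show "Re (cinner y (Y (Z y))) \<le> r * (norm y)\<^sup>2"
      unfolding n using r by (simp add: power_mult_distrib)
  qed (use G in simp)
  also have "\<dots> \<le> card G" by (rule card_image_le[OF G(1)])
  finally show ?thesis using G(2) by simp
qed

text \<open>For nonnegative \<open>B\<close> this bounds the trace norm; as with
  \<open>hs_le\<close>, all finite orthonormal sets are tested instead of one basis.\<close>

definition tr_le :: "('a :: complex_inner \<Rightarrow> 'a) \<Rightarrow> real \<Rightarrow> bool" where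
  "tr_le B b \<longleftrightarrow> (\<forall>F. finite F \<and> orthonormal F \<longrightarrow> (\<Sum>e\<in>F. Re (cinner e (B e))) \<le> b)"

section \<open>Integrals of counting functions against the Cauchy weight\<close>

definition cauchy_weight :: "real \<Rightarrow> ennreal" where
  "cauchy_weight t = ennreal (1 / (1 + t\<^sup>2))"

lemma cauchy_weight_measurable [measurable]: "cauchy_weight \<in> borel_measurable borel"
  unfolding cauchy_weight_def by measurable

lemma cauchy_weight_tail:
  assumes a: "a > 0"
  shows "(\<integral>\<^sup>+t. indicator {a<..} t * cauchy_weight t \<partial>lborel) \<le> ennreal (1 / a)"
proof -
  have "(\<integral>\<^sup>+t. indicator {a<..} t * cauchy_weight t \<partial>lborel)
      \<le> (\<integral>\<^sup>+t. ennreal ((inverse t)\<^sup>2) * indicator {a..} t \<partial>lborel)"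
  proof (rule nn_integral_mono)
    fix t :: real
    have "1 / (1 + t\<^sup>2) \<le> (inverse t)\<^sup>2" if "t > a"
    proof -
      have "t\<^sup>2 > 0" using that a by simp
      then have "inverse (1 + t\<^sup>2) \<le> inverse (t\<^sup>2)" by (intro le_imp_inverse_le) auto
      then show ?thesis by (simp add: power_inverse inverse_eq_divide[symmetric])
    qed
    then show "indicator {a<..} t * cauchy_weight t \<le> ennreal ((inverse t)\<^sup>2) * indicator {a..} t"
      by (auto simp: cauchy_weight_def indicator_def intro!: ennreal_leI)
  qed
  also have "\<dots> = ennreal (0 - (- inverse a))"
  proof (rule nn_integral_FTC_atLeast)
    fix x assume "a \<le> x"
    then have "x \<noteq> 0" using a by simp
    then show "DERIV (\<lambda>x. - inverse x) x :> (inverse x)\<^sup>2"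
      by (auto intro!: derivative_eq_intros simp: power2_eq_square)
  next
    have "((\<lambda>x :: real. - inverse x) \<longlongrightarrow> - 0) at_top"
      by (rule tendsto_minus[OF tendsto_inverse_0_at_top[OF filterlim_ident]])
    then show "((\<lambda>x :: real. - inverse x) \<longlongrightarrow> 0) at_top" by simp
  qed auto
  finally show ?thesis by (simp add: inverse_eq_divide)
qed

lemma cauchy_weight_total_le: "(\<integral>\<^sup>+t. cauchy_weight t \<partial>lborel) \<le> ennreal pi"
proof -
  have "(\<integral>\<^sup>+t. ennreal (inverse (1 + t\<^sup>2)) * indicator {0..} t \<partial>lborel) = ennreal (pi / 2 - arctan 0)"
    by (rule nn_integral_FTC_atLeast)
      (simp_all add: DERIV_arctan tendsto_arctan_at_top)
  then have h: "(\<integral>\<^sup>+t. cauchy_weight t * indicator {0..} t \<partial>lborel) = ennreal (pi / 2)"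
    by (simp add: cauchy_weight_def inverse_eq_divide)
  have "(\<integral>\<^sup>+t. cauchy_weight t * indicator {..0} t \<partial>lborel)
      = ennreal \<bar>- 1\<bar> * (\<integral>\<^sup>+t. cauchy_weight (0 + (- 1) * t) * indicator {..0} (0 + (- 1) * t) \<partial>lborel)"
    by (rule nn_integral_real_affine) auto
  also have "\<dots> = (\<integral>\<^sup>+t. cauchy_weight t * indicator {0..} t \<partial>lborel)"
    by (simp, intro nn_integral_cong) (auto simp: cauchy_weight_def indicator_def)
  finally have h': "(\<integral>\<^sup>+t. cauchy_weight t * indicator {..0} t \<partial>lborel) = ennreal (pi / 2)" using h by simp
  have "(\<integral>\<^sup>+t. cauchy_weight t \<partial>lborel)
      \<le> (\<integral>\<^sup>+t. cauchy_weight t * indicator {0..} t + cauchy_weight t * indicator {..0} t \<partial>lborel)"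
    by (intro nn_integral_mono) (auto simp: indicator_def)
  also have "\<dots> = ennreal (pi / 2) + ennreal (pi / 2)"
    by (subst nn_integral_add) (auto simp: h h')
  also have "\<dots> = ennreal pi" by (subst ennreal_plus[symmetric]) auto
  finally show ?thesis .
qed

lemma cauchy_weight_interval:
  assumes "T > 0"
  shows "(\<integral>\<^sup>+t. cauchy_weight t * indicator {-T..T} t \<partial>lborel) = ennreal (2 * arctan T)"
proof -
  have "(\<integral>\<^sup>+t. ennreal (inverse (1 + t\<^sup>2)) * indicator {-T..T} t \<partial>lborel) = ennreal (arctan T - arctan (- T))"
    using assms by (intro nn_integral_FTC_Icc) (simp_all add: DERIV_arctan)
  then show ?thesis by (simp add: cauchy_weight_def inverse_eq_divide arctan_minus)
qed

text \<open>
  The eigenvalues \<open>m\<close> of \<open>B\<close> contribute to the count of \<open>t B\<close> above \<open>d\<close> for \<open>t > d / m\<close> only,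
  and that half-line has weight at most \<open>m / d\<close>.
\<close>
lemma ncount_family_integral:
  fixes B :: "'a :: chilbert_space \<Rightarrow> 'a"
  assumes B: "hs_selfadjoint B" and pos: "\<And>x. 0 \<le> Re (cinner x (B x))" and b: "tr_le B b" and d: "d > 0"
  shows "\<exists>g\<in>borel_measurable borel. (\<forall>t>0. ennreal (real (ncount d (\<lambda>x. t *\<^sub>R B x))) * cauchy_weight t \<le> g t)
    \<and> (\<integral>\<^sup>+t. g t \<partial>lborel) \<le> ennreal (b / d)"
proof -
  obtain c where S: "selfadjoint B" and c: "hs_le B c" using B by (auto simp: hs_selfadjoint_def)
  \<comment> \<open>Chosen so that \<open>t r n <= d\<close> for \<open>t <= n + 1\<close>: for
    these \<open>t\<close> the eigenvalues of \<open>B\<close> up to \<open>r n\<close> cannot push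
    \<open>t B\<close> above \<open>d\<close>.\<close>
  define r where "r n = d / real (Suc n)" for n
  have r: "r n > 0" for n using d by (simp add: r_def)
  have "\<forall>n. \<exists>F. spectral_ons B (r n) F" using spectral_ons_exists[OF S c r] by blast
  then obtain F where F: "\<And>n. spectral_ons B (r n) (F n)" by metis
  have fF: "finite (F n)" "orthonormal (F n)" for n using F[of n] by (auto simp: spectral_ons_def)
  have "\<forall>n. \<forall>f. \<exists>k. f \<in> F n \<longrightarrow> k > r n \<and> B f = k *\<^sub>R f"
    using F unfolding spectral_ons_def by blast
  then obtain m where m: "\<And>n f. f \<in> F n \<Longrightarrow> m n f > r n \<and> B f = m n f *\<^sub>R f" by metis
  have m0: "m n f > 0" if "f \<in> F n" for n f using m[OF that] r[of n] by linarith
  define g where "g n t = (\<Sum>f\<in>F n. indicator {d / m n f<..} t :: ennreal)" for n t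
  have gm [measurable]: "g n \<in> borel_measurable borel" for n unfolding g_def by measurable
  have int: "(\<integral>\<^sup>+t. g n t * cauchy_weight t \<partial>lborel) \<le> ennreal (b / d)" for n
  proof -
    have "(\<integral>\<^sup>+t. g n t * cauchy_weight t \<partial>lborel)
        = (\<Sum>f\<in>F n. \<integral>\<^sup>+t. indicator {d / m n f<..} t * cauchy_weight t \<partial>lborel)"
      unfolding g_def sum_distrib_right by (rule nn_integral_sum) simp
    also have "\<dots> \<le> (\<Sum>f\<in>F n. ennreal (m n f / d))"
    proof (rule sum_mono)
      fix f assume "f \<in> F n"
      then have "d / m n f > 0" using m0 d by simp
      from cauchy_weight_tail[OF this]
      show "(\<integral>\<^sup>+t. indicator {d / m n f<..} t * cauchy_weight t \<partial>lborel) \<le> ennreal (m n f / d)" by simp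
    qed
    also have "\<dots> = ennreal (\<Sum>f\<in>F n. m n f / d)"
      by (rule sum_ennreal) (use m0 d in \<open>simp add: less_imp_le\<close>)
    also have "(\<Sum>f\<in>F n. m n f / d) = (\<Sum>f\<in>F n. Re (cinner f (B f))) / d"
      unfolding sum_divide_distrib
    proof (intro sum.cong refl)
      fix f assume f: "f \<in> F n"
      then have "norm f = 1" using fF(2)[of n] by (simp add: orthonormal_def)
      then show "m n f / d = Re (cinner f (B f)) / d"
        using m[OF f] by (simp add: cinner_scaleR_right cinner_self)
    qed
    also have "\<dots> \<le> b / d" using b fF[of n] d unfolding tr_le_def by (intro divide_right_mono) auto
    finally show ?thesis by (simp add: ennreal_leI)
  qed
  have dom: "ennreal (real (ncount d (\<lambda>x. t *\<^sub>R B x))) \<le> g n t" if t: "0 < t" "t \<le> real (Suc n)" for n t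
  proof -
    define G where "G = {f\<in>F n. t * m n f > d}"
    have "ncount d (\<lambda>x. t *\<^sub>R B x) \<le> card G"
    proof (rule ncount_le_card[OF hs_selfadjoint_scaleR[OF B] d])
      show "finite G" using fF(1)[of n] by (simp add: G_def)
      fix x assume x: "\<And>g. g \<in> G \<Longrightarrow> cinner g x = 0"
      define y where "y = x - fproj (F n) x"
      have fy: "cinner f y = 0" if "f \<in> F n" for f
        unfolding y_def by (rule cinner_fproj_diff[OF fF complex_vector.span_base[OF that]])
      have "Re (cinner y (B y)) \<le> r n * (norm y)\<^sup>2" by (rule spectral_ons_orthogonal[OF S c r F fy])
      then have "t * Re (cinner y (B y)) \<le> t * (r n * (norm y)\<^sup>2)" using t(1) by (intro mult_left_mono) auto
      also have "t * (r n * (norm y)\<^sup>2) \<le> d * (norm y)\<^sup>2"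
      proof -
        have "t * r n \<le> d" using t d by (simp add: r_def pos_divide_le_eq mult.commute)
        then show ?thesis by (simp add: mult.assoc[symmetric] mult_right_mono)
      qed
      finally have 1: "t * Re (cinner y (B y)) \<le> d * (norm y)\<^sup>2" .
      have 2: "(\<Sum>f\<in>F n. t * (m n f * (cmod (cinner f x))\<^sup>2)) \<le> (\<Sum>f\<in>F n. d * (cmod (cinner f x))\<^sup>2)"
      proof (rule sum_mono)
        fix f assume f: "f \<in> F n"
        show "t * (m n f * (cmod (cinner f x))\<^sup>2) \<le> d * (cmod (cinner f x))\<^sup>2"
        proof (cases "f \<in> G")
          case False
          then have "t * m n f \<le> d" using f by (simp add: G_def)
          then show ?thesis by (simp add: mult.assoc[symmetric] mult_right_mono)
        qed (simp add: x)
      qed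
      have "Re (cinner x (t *\<^sub>R B x)) = t * Re (cinner x (B x))" by (simp add: cinner_scaleR_right)
      also have "\<dots> = (\<Sum>f\<in>F n. t * (m n f * (cmod (cinner f x))\<^sup>2)) + t * Re (cinner y (B y))"
        using quadratic_form_fproj[OF S F, of n "m n" x] m[of _ n]
        by (simp add: y_def distrib_left sum_distrib_left)
      also have "\<dots> \<le> d * (norm (fproj (F n) x))\<^sup>2 + d * (norm y)\<^sup>2"
        using 1 2 by (simp add: norm_fproj[OF fF] sum_distrib_left)
      also have "\<dots> = d * (norm x)\<^sup>2"
        using norm_fproj_pythagoras[OF fF, of x n] by (simp add: y_def distrib_left)
      finally show "Re (cinner x (t *\<^sub>R B x)) \<le> d * (norm x)\<^sup>2" .
    qed
    then have "ennreal (real (ncount d (\<lambda>x. t *\<^sub>R B x))) \<le> ennreal (real (card G))"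
      by (intro ennreal_leI) simp
    also have "\<dots> = g n t"
    proof -
      have "g n t = (\<Sum>f\<in>F n. if f \<in> G then 1 else 0)"
        unfolding g_def
      proof (intro sum.cong refl)
        fix f assume f: "f \<in> F n"
        then show "indicator {d / m n f<..} t = (if f \<in> G then 1 else 0 :: ennreal)"
          using m0[OF f] by (auto simp: G_def indicator_def divide_less_eq)
      qed
      also have "\<dots> = of_nat (card G)"
        using fF(1)[of n] by (subst sum.inter_filter[symmetric]) (auto simp: G_def)
      finally show ?thesis by (simp add: ennreal_of_nat_eq_real_of_nat)
    qed
    finally show ?thesis .
  qed
  \<comment> \<open>Each \<open>g n\<close> is a majorant only for \<open>t <= n + 1\<close>. The
    limit inferior majorises the count for every \<open>t > 0\<close>, is measurable, and Fatou's
    lemma preserves the integral bound.\<close>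
  define h where "h t = liminf (\<lambda>n. g n t * cauchy_weight t)" for t
  have hm: "h \<in> borel_measurable borel" unfolding h_def by measurable
  have "ennreal (real (ncount d (\<lambda>x. t *\<^sub>R B x))) * cauchy_weight t \<le> h t" if t: "t > 0" for t
    unfolding h_def
  proof (rule Liminf_bounded)
    obtain N where N: "t \<le> real N" using real_arch_simple by blast
    show "\<forall>\<^sub>F n in sequentially. ennreal (real (ncount d (\<lambda>x. t *\<^sub>R B x))) * cauchy_weight t
        \<le> g n t * cauchy_weight t"
      by (rule eventually_sequentiallyI[of N]) (use N t in \<open>auto intro!: mult_right_mono dom\<close>)
  qed
  moreover have "(\<integral>\<^sup>+t. h t \<partial>lborel) \<le> ennreal (b / d)"
  proof -
    have "(\<integral>\<^sup>+t. h t \<partial>lborel) \<le> liminf (\<lambda>n. \<integral>\<^sup>+t. g n t * cauchy_weight t \<partial>lborel)"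
      unfolding h_def by (rule nn_integral_liminf) simp
    also have "\<dots> \<le> liminf (\<lambda>n :: nat. ennreal (b / d))"
      by (rule Liminf_mono) (simp add: int)
    also have "\<dots> = ennreal (b / d)" by (rule Liminf_const) simp
    finally show ?thesis .
  qed
  ultimately show ?thesis using hm by blast
qed

text \<open>Weyl's inequality twice with \<open>1 = (1 - 2 d) + d + d\<close>: one \<open>d\<close>
  pays for the bounded error \<open>A0\<close>, with at most \<open>a / d^2\<close> eigenvalues, the
  other for \<open>t B\<close>, whose contribution is bounded only after integration. The sign
  \<open>sg\<close> covers both spectral shift functions and is removed by a reflection of
  \<open>t\<close>.\<close>

lemma ssf_integral_upper:
  fixes A :: "'a :: chilbert_space \<Rightarrow> 'a"
  assumes A: "hs_selfadjoint A" and L: "hs_selfadjoint L" and A0: "hs_selfadjoint A0" "hs_le A0 a"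
    and B: "hs_selfadjoint B" "\<And>x. 0 \<le> Re (cinner x (B x))" "tr_le B b"
    and d: "0 < d" "d < 1 / 2" and sg: "\<bar>sg\<bar> = 1"
    and le: "\<And>x. Re (cinner x (A x)) \<le> Re (cinner x (L x)) + Re (cinner x (A0 x))"
  shows "(\<integral>\<^sup>+t. ennreal_of_enat (N_plus 1 (\<lambda>x. A x + (sg * t) *\<^sub>R B x)) * ennreal (1 / (1 + t\<^sup>2)) \<partial>lborel)
    \<le> ennreal (pi * (real (ncount (1 - 2 * d) L) + a / d\<^sup>2) + b / d)"
proof -
  obtain g where g [measurable]: "g \<in> borel_measurable borel"
    and gt: "\<And>t. t > 0 \<Longrightarrow> ennreal (real (ncount d (\<lambda>x. t *\<^sub>R B x))) * cauchy_weight t \<le> g t"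
    and gi: "(\<integral>\<^sup>+t. g t \<partial>lborel) \<le> ennreal (b / d)"
    using ncount_family_integral[OF B d(1)] by blast
  define k where "k = real (ncount (1 - 2 * d) L) + a / d\<^sup>2"
  have k0: "k \<ge> 0" using hs_le_nonneg[OF A0(2)] by (simp add: k_def)
  have b0: "b \<ge> 0" using B(3)[unfolded tr_le_def, rule_format, of "{}"] by simp
  have sB: "hs_selfadjoint (\<lambda>x. t *\<^sub>R B x)" for t by (rule hs_selfadjoint_scaleR[OF B(1)])
  have bound: "ennreal_of_enat (N_plus 1 (\<lambda>x. A x + t *\<^sub>R B x)) * cauchy_weight t
      \<le> ennreal k * cauchy_weight t + g t" for t
  proof -
    have sAB: "hs_selfadjoint (\<lambda>x. A x + t *\<^sub>R B x)" by (rule hs_selfadjoint_add[OF A sB])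
    have "ncount ((1 - d) + d) (\<lambda>x. A x + t *\<^sub>R B x) \<le> ncount (1 - d) A + ncount d (\<lambda>x. t *\<^sub>R B x)"
      by (rule ncount_weyl[OF sAB A sB]) (use d in \<open>auto simp: cinner_add_right\<close>)
    moreover have "ncount ((1 - 2 * d) + d) A \<le> ncount (1 - 2 * d) L + ncount d A0"
      by (rule ncount_weyl[OF A L A0(1)]) (use d le in auto)
    moreover have "real (ncount d A0) \<le> a / d\<^sup>2" by (rule ncount_le_hs[OF A0 d(1)])
    ultimately have n: "real (ncount 1 (\<lambda>x. A x + t *\<^sub>R B x)) \<le> k + real (ncount d (\<lambda>x. t *\<^sub>R B x))"
      by (simp add: k_def)
    have "ennreal (real (ncount d (\<lambda>x. t *\<^sub>R B x))) * cauchy_weight t \<le> g t"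
    proof (cases "t > 0")
      case False
      \<comment> \<open>For \<open>t <= 0\<close> the operator \<open>t B\<close> is nonpositive and
        has no eigenvalue above \<open>d\<close>.\<close>
      have "ncount d (\<lambda>x. t *\<^sub>R B x) \<le> card ({} :: 'a set)"
      proof (rule ncount_le_card[OF sB d(1)])
        fix x :: 'a
        have "Re (cinner x (t *\<^sub>R B x)) \<le> 0"
          using False B(2)[of x] by (simp add: cinner_scaleR_right mult_nonpos_nonneg)
        also have "0 \<le> d * (norm x)\<^sup>2" using d by simp
        finally show "Re (cinner x (t *\<^sub>R B x)) \<le> d * (norm x)\<^sup>2" .
      qed simp
      then show ?thesis by simp
    qed (rule gt)
    then have 1: "ennreal k * cauchy_weight t + ennreal (real (ncount d (\<lambda>x. t *\<^sub>R B x))) * cauchy_weight t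
        \<le> ennreal k * cauchy_weight t + g t"
      by (rule add_left_mono)
    have "ennreal (real (ncount 1 (\<lambda>x. A x + t *\<^sub>R B x)))
        \<le> ennreal (k + real (ncount d (\<lambda>x. t *\<^sub>R B x)))"
      using n by (rule ennreal_leI)
    then have "ennreal (real (ncount 1 (\<lambda>x. A x + t *\<^sub>R B x))) * cauchy_weight t
        \<le> ennreal (k + real (ncount d (\<lambda>x. t *\<^sub>R B x))) * cauchy_weight t"
      by (rule mult_right_mono) simp
    also have "\<dots> = ennreal k * cauchy_weight t + ennreal (real (ncount d (\<lambda>x. t *\<^sub>R B x))) * cauchy_weight t"
      unfolding ennreal_plus[OF k0 of_nat_0_le_iff] distrib_right ..
    finally show ?thesis
      unfolding N_plus_eq_ncount[OF sAB zero_less_one] ennreal_of_enat_enat ennreal_of_nat_eq_real_of_nat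
      using 1 by (rule order_trans)
  qed
  have even: "cauchy_weight (sg * t) = cauchy_weight t" for t
    using sg by (simp add: cauchy_weight_def power_mult_distrib abs_square_eq_1)
  have "(\<integral>\<^sup>+t. ennreal_of_enat (N_plus 1 (\<lambda>x. A x + (sg * t) *\<^sub>R B x)) * ennreal (1 / (1 + t\<^sup>2)) \<partial>lborel)
      \<le> (\<integral>\<^sup>+t. ennreal k * cauchy_weight t + g (sg * t) \<partial>lborel)"
  proof (rule nn_integral_mono)
    fix t
    show "ennreal_of_enat (N_plus 1 (\<lambda>x. A x + (sg * t) *\<^sub>R B x)) * ennreal (1 / (1 + t\<^sup>2))
        \<le> ennreal k * cauchy_weight t + g (sg * t)"
      using bound[of "sg * t"] unfolding even by (simp add: cauchy_weight_def)
  qed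
  also have "\<dots> = ennreal k * (\<integral>\<^sup>+t. cauchy_weight t \<partial>lborel) + (\<integral>\<^sup>+t. g t \<partial>lborel)"
  proof -
    have "sg \<noteq> 0" using sg by auto
    then have "(\<integral>\<^sup>+t. g (sg * t) \<partial>lborel) = (\<integral>\<^sup>+t. g t \<partial>lborel)"
      using nn_integral_real_affine[OF g, of sg 0] sg by simp
    then show ?thesis by (simp add: nn_integral_add nn_integral_cmult)
  qed
  also have "\<dots> \<le> ennreal k * ennreal pi + ennreal (b / d)"
    by (intro add_mono mult_left_mono cauchy_weight_total_le gi) simp
  also have "\<dots> = ennreal (pi * k + b / d)"
    using k0 b0 d by (simp add: ennreal_mult'[symmetric] mult.commute)
  finally show ?thesis unfolding k_def .
qed

text \<open>On \<open>|t| <= T\<close> the operator \<open>t B\<close> has squared Hilbert-Schmidt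
  norm at most \<open>T^2 c\<close>, hence costs at most \<open>T^2 c / d^2\<close> eigenvalues;
  \<open>2 arctan T\<close> is the weight of that interval. A negative difference is harmless
  because \<open>ennreal\<close> truncates it to \<open>0\<close>.\<close>

lemma ssf_integral_lower:
  fixes A :: "'a :: chilbert_space \<Rightarrow> 'a"
  assumes A: "hs_selfadjoint A" and L: "hs_selfadjoint L" and A0: "hs_selfadjoint A0" "hs_le A0 a"
    and B: "hs_selfadjoint B" "hs_le B c"
    and d: "0 < d" and T: "T > 0" and sg: "\<bar>sg\<bar> = 1"
    and le: "\<And>x. Re (cinner x (L x)) \<le> Re (cinner x (A x)) + Re (cinner x (A0 x))"
  shows "ennreal (2 * arctan T * (real (ncount (1 + 2 * d) L) - a / d\<^sup>2 - T\<^sup>2 * c / d\<^sup>2)) \<le>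
    (\<integral>\<^sup>+t. ennreal_of_enat (N_plus 1 (\<lambda>x. A x + (sg * t) *\<^sub>R B x)) * ennreal (1 / (1 + t\<^sup>2)) \<partial>lborel)"
proof -
  define k where "k = real (ncount (1 + 2 * d) L) - a / d\<^sup>2 - T\<^sup>2 * c / d\<^sup>2"
  have sB: "hs_selfadjoint (\<lambda>x. t *\<^sub>R B x)" for t by (rule hs_selfadjoint_scaleR[OF B(1)])
  have bound: "ennreal k \<le> ennreal_of_enat (N_plus 1 (\<lambda>x. A x + t *\<^sub>R B x))" if t: "\<bar>t\<bar> \<le> T" for t
  proof -
    have sAB: "hs_selfadjoint (\<lambda>x. A x + t *\<^sub>R B x)" by (rule hs_selfadjoint_add[OF A sB])
    have "ncount (1 + d) A \<le> ncount 1 (\<lambda>x. A x + t *\<^sub>R B x) + ncount d (\<lambda>x. (- t) *\<^sub>R B x)"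
      by (rule ncount_weyl[OF A sAB sB]) (use d in \<open>auto simp: cinner_simps\<close>)
    then have "real (ncount (1 + d) A) \<le> real (ncount 1 (\<lambda>x. A x + t *\<^sub>R B x))
        + real (ncount d (\<lambda>x. (- t) *\<^sub>R B x))"
      by (metis of_nat_add of_nat_mono)
    moreover have "ncount ((1 + d) + d) L \<le> ncount (1 + d) A + ncount d A0"
      by (rule ncount_weyl[OF L A A0(1)]) (use d le in auto)
    then have "real (ncount (1 + 2 * d) L) \<le> real (ncount (1 + d) A) + real (ncount d A0)"
      by (simp add: algebra_simps)
    moreover have "real (ncount d A0) \<le> a / d\<^sup>2" by (rule ncount_le_hs[OF A0 d(1)])
    moreover have "real (ncount d (\<lambda>x. (- t) *\<^sub>R B x)) \<le> (- t)\<^sup>2 * c / d\<^sup>2"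
      by (rule ncount_le_hs[OF sB hs_le_scaleR[OF B(2)] d])
    moreover have "(- t)\<^sup>2 * c / d\<^sup>2 \<le> T\<^sup>2 * c / d\<^sup>2"
      using power_mono[OF t abs_ge_zero, of 2] hs_le_nonneg[OF B(2)]
      by (intro divide_right_mono mult_right_mono) auto
    ultimately have "k \<le> real (ncount 1 (\<lambda>x. A x + t *\<^sub>R B x))"
      unfolding k_def by linarith
    then show ?thesis
      by (simp add: N_plus_eq_ncount[OF sAB] ennreal_of_nat_eq_real_of_nat ennreal_leI)
  qed
  have "ennreal (2 * arctan T * k) = ennreal k * (\<integral>\<^sup>+t. cauchy_weight t * indicator {-T..T} t \<partial>lborel)"
    using T unfolding cauchy_weight_interval[OF T]
    by (simp add: ennreal_mult''[symmetric] mult.commute)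
  also have "\<dots> = (\<integral>\<^sup>+t. ennreal k * (cauchy_weight t * indicator {-T..T} t) \<partial>lborel)"
    by (rule nn_integral_cmult[symmetric]) simp
  also have "\<dots> \<le> (\<integral>\<^sup>+t. ennreal_of_enat (N_plus 1 (\<lambda>x. A x + (sg * t) *\<^sub>R B x)) * ennreal (1 / (1 + t\<^sup>2)) \<partial>lborel)"
  proof (rule nn_integral_mono)
    fix t
    show "ennreal k * (cauchy_weight t * indicator {-T..T} t)
        \<le> ennreal_of_enat (N_plus 1 (\<lambda>x. A x + (sg * t) *\<^sub>R B x)) * ennreal (1 / (1 + t\<^sup>2))"
      using bound[of "sg * t"] sg
      by (auto simp: cauchy_weight_def indicator_def abs_mult intro!: mult_right_mono)
  qed
  finally show ?thesis unfolding k_def .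
qed

instance chilbert_space \<subseteq> banach ..

lemma infsum_bounded_linear:
  assumes "bounded_linear h" "f summable_on A"
  shows "infsum (\<lambda>x. h (f x)) A = h (infsum f A)"
  by (rule infsumI[OF has_sum_bounded_linear[OF assms(1) has_sum_infsum[OF assms(2)]]])
section \<open>The square root of a positive operator\<close>

lemma positive_opD:
  assumes "positive_op W"
  shows "selfadjoint W" "0 \<le> Re (cinner x (W x))"
  using assms by (auto simp: positive_op_def)

text \<open>Cauchy-Schwarz for the form of \<open>W\<close>, obtained by evaluating it at
  \<open>x - W x / C\<close>.\<close>

lemma positive_op_norm_le:
  assumes W: "positive_op W" and C: "C > 0" "\<And>x. norm (W x) \<le> C * norm x"
  shows "(norm (W x))\<^sup>2 \<le> C * Re (cinner x (W x))"
proof -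
  note S = positive_opD(1)[OF W]
  define w where "w = W x"
  have "0 \<le> Re (cinner (x + (- 1 / C) *\<^sub>R w) (W (x + (- 1 / C) *\<^sub>R w)))" by (rule positive_opD(2)[OF W])
  also have "\<dots> = Re (cinner x w) - 2 * (norm w)\<^sup>2 / C + (1 / C)\<^sup>2 * Re (cinner w (W w))"
    unfolding quadratic_form_add[OF S] quadratic_form_scaleR[OF S]
    by (simp add: w_def[symmetric] cinner_simps norm_sq_eq_cinner power_divide)
  also have "Re (cinner w (W w)) \<le> C * (norm w)\<^sup>2"
  proof -
    have "Re (cinner w (W w)) \<le> norm w * norm (W w)" by (rule Re_cinner_le)
    also have "\<dots> \<le> norm w * (C * norm w)" by (intro mult_left_mono C) simp
    finally show ?thesis by (simp add: power2_eq_square mult_ac)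
  qed
  then have "(1 / C)\<^sup>2 * Re (cinner w (W w)) \<le> (1 / C)\<^sup>2 * (C * (norm w)\<^sup>2)" by (rule mult_left_mono) simp
  also have "(1 / C)\<^sup>2 * (C * (norm w)\<^sup>2) = (norm w)\<^sup>2 / C" using C(1) by (simp add: power2_eq_square)
  finally have "(norm w)\<^sup>2 / C \<le> Re (cinner x w)" by (simp add: field_simps)
  then show ?thesis using C(1) by (simp add: w_def divide_le_eq mult.commute)
qed

lemma positive_op_kernel:
  assumes W: "positive_op W" and "Re (cinner x (W x)) \<le> 0"
  shows "W x = 0"
proof -
  obtain C where C: "C > 0" "\<And>x. norm (W x) \<le> C * norm x"
    using bounded_clinear_bound[OF selfadjointD(1)[OF positive_opD(1)[OF W]]] by blast
  have "C * Re (cinner x (W x)) \<le> 0" using C(1) assms(2) by (simp add: mult_nonneg_nonpos)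
  then have "(norm (W x))\<^sup>2 \<le> 0" using positive_op_norm_le[OF W C, of x] by linarith
  then show ?thesis by simp
qed

text \<open>Taylor coefficients of \<open>sqrt (1 - y)\<close>.\<close>
definition sqrt_coeff :: "nat \<Rightarrow> real" where
  "sqrt_coeff k = pochhammer (- 1 / 2) k / fact k"

lemma sqrt_coeff_0: "sqrt_coeff 0 = 1"
  by (simp add: sqrt_coeff_def)

lemma sqrt_coeff_nonpos: "k > 0 \<Longrightarrow> sqrt_coeff k \<le> 0"
proof (cases k)
  case (Suc m)
  have "pochhammer (- 1 / 2 :: real) (Suc m) = (- 1 / 2) * pochhammer (1 / 2) m"
    by (subst pochhammer_rec) simp
  moreover have "pochhammer (1 / 2 :: real) m \<ge> 0" by (rule pochhammer_nonneg) simp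
  ultimately show ?thesis by (simp add: sqrt_coeff_def Suc divide_le_0_iff)
qed simp

text \<open>Partial sums correspond to division by \<open>1 - y\<close>, and
  \<open>sqrt (1 - y) / (1 - y)\<close> has the Taylor coefficients on the right. The closed form
  shows that they are nonnegative.\<close>

lemma sum_sqrt_coeff: "(\<Sum>k\<le>n. sqrt_coeff k) = pochhammer (1 / 2) n / fact n"
proof (induction n)
  case (Suc n)
  have "pochhammer (- 1 / 2 :: real) (Suc n) = (- 1 / 2) * pochhammer (1 / 2) n"
    by (subst pochhammer_rec) simp
  then have "(\<Sum>k\<le>Suc n. sqrt_coeff k)
      = pochhammer (1 / 2) n / fact n + (- 1 / 2) * pochhammer (1 / 2) n / fact (Suc n)"
    using Suc by (simp only: sum.atMost_Suc sqrt_coeff_def)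
  also have "\<dots> = pochhammer (1 / 2) n * (1 / 2 + real n) / fact (Suc n)"
  proof -
    have e: "p / a + (- 1 / 2) * p / ((1 + m) * a) = p * (1 / 2 + m) / ((1 + m) * a)"
      if "a \<noteq> 0" "1 + m \<noteq> 0" for p a m :: real
      using that by (simp add: divide_simps) (simp add: algebra_simps)
    have f: "fact (Suc n) = (1 + real n) * fact n" by simp
    show ?thesis unfolding f by (rule e) auto
  qed
  finally show ?case by (simp only: pochhammer_Suc)
qed (simp add: sqrt_coeff_def)

lemma sum_sqrt_coeff_nonneg: "0 \<le> (\<Sum>k\<le>n. sqrt_coeff k)"
  unfolding sum_sqrt_coeff by (simp add: pochhammer_nonneg)

text \<open>Only the first coefficient, \<open>1\<close>, is positive, so the sum of moduli is
  \<open>2\<close> minus a nonnegative partial sum.\<close>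

lemma sum_abs_sqrt_coeff_le: "(\<Sum>k\<le>n. \<bar>sqrt_coeff k\<bar>) \<le> 2"
proof -
  have "(\<Sum>k\<le>n. \<bar>sqrt_coeff k\<bar>) = (\<Sum>k\<le>n. (if k = 0 then 2 else 0) - sqrt_coeff k)"
    by (intro sum.cong refl) (auto simp: sqrt_coeff_0 sqrt_coeff_nonpos abs_if not_less
        intro: antisym)
  also have "\<dots> = 2 - (\<Sum>k\<le>n. sqrt_coeff k)" by (simp add: sum_subtractf)
  finally show ?thesis using sum_sqrt_coeff_nonneg[of n] by simp
qed

text \<open>The square of the series is \<open>1 - y\<close>: the Vandermonde identity adds the
  parameters \<open>- 1 / 2\<close> to \<open>- 1\<close>, whose Pochhammer symbols vanish from
  index \<open>2\<close> on.\<close>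

lemma sqrt_coeff_convolution:
  "(\<Sum>j\<le>n. sqrt_coeff j * sqrt_coeff (n - j)) = (if n = 0 then 1 else if n = 1 then - 1 else 0)"
proof -
  have "pochhammer (- 1 / 2 + - 1 / 2 :: real) n
      = (\<Sum>j\<le>n. of_nat (n choose j) * pochhammer (- 1 / 2) j * pochhammer (- 1 / 2) (n - j))"
    by (rule pochhammer_binomial_sum)
  also have "\<dots> = (\<Sum>j\<le>n. fact n * (sqrt_coeff j * sqrt_coeff (n - j)))"
    by (intro sum.cong refl) (simp add: sqrt_coeff_def binomial_fact field_simps)
  finally have "(\<Sum>j\<le>n. sqrt_coeff j * sqrt_coeff (n - j)) = pochhammer (- 1) n / fact n"
    by (simp add: sum_distrib_left[symmetric])
  also have "\<dots> = (if n = 0 then 1 else if n = 1 then - 1 else 0)"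
  proof (cases "n \<le> 1")
    case True
    then have "n = 0 \<or> n = 1" by auto
    then show ?thesis by auto
  next
    case False
    then have "pochhammer (- 1 :: real) n = 0"
      by (intro pochhammer_eq_0_iff[THEN iffD2] exI[of _ 1]) auto
    then show ?thesis using False by auto
  qed
  finally show ?thesis .
qed

lemma finite_nat_prod_subset:
  assumes "finite (F :: (nat \<times> nat) set)" obtains N where "F \<subseteq> {..N} \<times> {..N}"
proof -
  have "finite (fst ` F \<union> snd ` F)" using assms by simp
  then obtain N where "fst ` F \<union> snd ` F \<subseteq> {..N}"
    using finite_nat_iff_bounded_le by blast
  then have "F \<subseteq> {..N} \<times> {..N}" by force
  then show thesis by (rule that)
qed

text \<open>The square root is \<open>sqrt C\<close> times the binomial series of \<open>sqrt (1 - T)\<close>, \<open>T = 1 - W / C\<close>.\<close>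
lemma op_sqrt_contraction:
  fixes T :: "'a :: chilbert_space \<Rightarrow> 'a"
  assumes T: "selfadjoint T" and T1: "\<And>x. norm (T x) \<le> norm x"
  shows "\<exists>R. positive_op R \<and> (\<forall>x. R (R x) = x - T x) \<and>
    (\<forall>S. bounded_clinear S \<and> (\<forall>x. S (T x) = T (S x)) \<longrightarrow> (\<forall>x. S (R x) = R (S x)))"
proof -
  note Tb = selfadjointD(1)[OF T]
  let ?c = sqrt_coeff
  have P1: "norm ((T ^^ k) x) \<le> norm x" for k x
  proof (induction k)
    case (Suc k)
    then show ?case using T1[of "(T ^^ k) x"] by simp
  qed simp
  have Pb: "bounded_clinear (T ^^ k)" for k
  proof (induction k)
    case 0
    show ?case by (rule bounded_clinearI[where C = 1]) auto
  next
    case (Suc k)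
    then show ?case using bounded_clinear_compose[OF Tb] by (simp only: funpow.simps)
  qed
  have Psa: "cinner ((T ^^ k) x) y = cinner x ((T ^^ k) y)" for k x y
  proof (induction k arbitrary: x y)
    case (Suc k)
    have "cinner ((T ^^ Suc k) x) y = cinner ((T ^^ k) x) (T y)" by (simp add: selfadjointD(2)[OF T])
    also have "\<dots> = cinner x ((T ^^ k) (T y))" by (rule Suc)
    also have "(T ^^ k) (T y) = (T ^^ Suc k) y" by (simp add: funpow_swap1)
    finally show ?case .
  qed simp
  define t where "t x k = ?c k *\<^sub>R (T ^^ k) x" for x k
  have tn: "norm (t x k) \<le> \<bar>?c k\<bar> * norm x" for x k
    by (simp add: t_def P1 mult_left_mono)
  have cs: "(\<lambda>k. \<bar>?c k\<bar>) summable_on UNIV"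
  proof (rule nonneg_bdd_above_summable_on)
    show "bdd_above (sum (\<lambda>k. \<bar>?c k\<bar>) ` {F. F \<subseteq> UNIV \<and> finite F})"
    proof (rule bdd_aboveI2)
      fix F :: "nat set" assume "F \<in> {F. F \<subseteq> UNIV \<and> finite F}"
      then obtain N where "F \<subseteq> {..N}" using finite_nat_iff_bounded_le by auto
      then have "(\<Sum>k\<in>F. \<bar>?c k\<bar>) \<le> (\<Sum>k\<le>N. \<bar>?c k\<bar>)" by (intro sum_mono2) auto
      then show "(\<Sum>k\<in>F. \<bar>?c k\<bar>) \<le> 2" using sum_abs_sqrt_coeff_le[of N] by linarith
    qed
  qed simp
  have ts: "t x abs_summable_on UNIV" for x
    by (rule summable_on_comparison_test[OF summable_on_cmult_left[OF cs, of "norm x"]])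
      (use tn in auto)
  have ts': "t x summable_on UNIV" for x by (rule abs_summable_summable[OF ts])
  define R where "R x = (\<Sum>\<^sub>\<infinity>k. t x k)" for x
  have Rn: "norm (R x) \<le> (\<Sum>\<^sub>\<infinity>k. \<bar>?c k\<bar>) * norm x" for x
  proof -
    have "norm (R x) \<le> (\<Sum>\<^sub>\<infinity>k. norm (t x k))" unfolding R_def by (rule norm_infsum_bound[OF ts])
    also have "\<dots> \<le> (\<Sum>\<^sub>\<infinity>k. \<bar>?c k\<bar> * norm x)"
      by (intro infsum_mono ts summable_on_cmult_left[OF cs] tn)
    also have "\<dots> = (\<Sum>\<^sub>\<infinity>k. \<bar>?c k\<bar>) * norm x" by (rule infsum_cmult_left[OF cs])
    finally show ?thesis .
  qed
  have Radd: "R (x + y) = R x + R y" for x y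
    unfolding R_def t_def bounded_clinear_add[OF Pb] scaleR_add_right
    using ts' by (intro infsum_add) (simp_all add: t_def[abs_def])
  have Rscale: "R (a *\<^sub>C x) = a *\<^sub>C R x" for a x
  proof -
    have "R (a *\<^sub>C x) = (\<Sum>\<^sub>\<infinity>k. a *\<^sub>C t x k)"
      by (simp add: R_def t_def bounded_clinearD(2)[OF Pb] scaleR_scaleC_commute)
    also have "\<dots> = a *\<^sub>C R x"
      unfolding R_def by (rule infsum_bounded_linear[OF bounded_linear_scaleC_right ts'])
    finally show ?thesis .
  qed
  have Rb: "bounded_clinear R" by (rule bounded_clinearI[OF Radd Rscale Rn])
  have Rin: "cinner y (R x) = (\<Sum>\<^sub>\<infinity>k. of_real (?c k) * cinner y ((T ^^ k) x))" for x y
    unfolding R_def using infsum_bounded_linear[OF bounded_linear_cinner_right[of y] ts'[of x]]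
    by (simp add: t_def cinner_scaleR_right)
  have Rin': "cinner (R x) y = (\<Sum>\<^sub>\<infinity>k. of_real (?c k) * cinner ((T ^^ k) x) y)" for x y
    unfolding R_def using infsum_bounded_linear[OF bounded_linear_cinner_left[of y] ts'[of x]]
    by (simp add: t_def cinner_scaleR_left)
  have Rsa: "cinner (R x) y = cinner x (R y)" for x y by (simp add: Rin Rin' Psa)
  \<comment> \<open>For \<open>k > 0\<close> the coefficient is nonpositive and
    \<open><x, T^k x> <= |x|^2\<close>, so each term is at least \<open>sqrt_coeff k |x|^2\<close>;
    the partial sums of the coefficients are nonnegative.\<close>
  have Rpos: "0 \<le> Re (cinner x (R x))" for x
  proof -
    have "((\<lambda>k. t x k) has_sum R x) UNIV" unfolding R_def by (rule has_sum_infsum[OF ts'])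
    then have "(t x) sums R x" by (rule has_sum_imp_sums)
    then have "(\<lambda>n. \<Sum>k\<le>n. t x k) \<longlonglongrightarrow> R x" by (simp add: sums_def_le)
    then have "(\<lambda>n. Re (cinner x (\<Sum>k\<le>n. t x k))) \<longlonglongrightarrow> Re (cinner x (R x))"
      by (intro tendsto_Re tendsto_cinner_right)
    moreover have "0 \<le> Re (cinner x (\<Sum>k\<le>n. t x k))" for n
    proof -
      have "0 \<le> (\<Sum>k\<le>n. ?c k) * (norm x)\<^sup>2" by (intro mult_nonneg_nonneg sum_sqrt_coeff_nonneg) simp
      also have "\<dots> \<le> (\<Sum>k\<le>n. ?c k * Re (cinner x ((T ^^ k) x)))"
        unfolding sum_distrib_right
      proof (rule sum_mono)
        fix k
        have "Re (cinner x ((T ^^ k) x)) \<le> norm x * norm ((T ^^ k) x)" by (rule Re_cinner_le)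
        also have "\<dots> \<le> norm x * norm x" by (intro mult_left_mono P1) simp
        finally have le: "Re (cinner x ((T ^^ k) x)) \<le> (norm x)\<^sup>2" by (simp add: power2_eq_square)
        show "?c k * (norm x)\<^sup>2 \<le> ?c k * Re (cinner x ((T ^^ k) x))"
        proof (cases "k = 0")
          case True
          then show ?thesis by (simp add: norm_sq_eq_cinner)
        next
          case False
          then show ?thesis using le sqrt_coeff_nonpos[of k] by (intro mult_left_mono_neg) auto
        qed
      qed
      also have "\<dots> = Re (cinner x (\<Sum>k\<le>n. t x k))"
        by (simp add: cinner_sum_right t_def cinner_scaleR_right)
      finally show ?thesis .
    qed
    ultimately show ?thesis by (intro LIMSEQ_le_const[of _ "Re (cinner x (R x))" 0]) auto
  qed
  have RR: "R (R x) = x - T x" for x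
  proof -
    \<comment> \<open>The Cauchy product as a family over pairs. Its absolute summability permits
      resummation along \<open>j + k = n\<close>, where the coefficients become the convolution and
      only \<open>n = 0, 1\<close> survive.\<close>
    define f where "f = (\<lambda>(j, k). (?c j * ?c k) *\<^sub>R (T ^^ (j + k)) x)"
    have fs: "f abs_summable_on UNIV"
    proof (rule nonneg_bdd_above_summable_on)
      show "bdd_above (sum (\<lambda>p. norm (f p)) ` {F. F \<subseteq> UNIV \<and> finite F})"
      proof (rule bdd_aboveI2)
        fix F :: "(nat \<times> nat) set" assume "F \<in> {F. F \<subseteq> UNIV \<and> finite F}"
        then obtain N where N: "F \<subseteq> {..N} \<times> {..N}" using finite_nat_prod_subset by blast
        have "(\<Sum>p\<in>F. norm (f p)) \<le> (\<Sum>p\<in>{..N} \<times> {..N}. norm (f p))" using N by (intro sum_mono2) auto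
        also have "\<dots> \<le> (\<Sum>p\<in>{..N} \<times> {..N}. \<bar>?c (fst p)\<bar> * \<bar>?c (snd p)\<bar> * norm x)"
          by (intro sum_mono) (auto simp: f_def abs_mult intro!: mult_left_mono P1)
        also have "\<dots> = (\<Sum>j\<le>N. \<bar>?c j\<bar>) * (\<Sum>k\<le>N. \<bar>?c k\<bar>) * norm x"
          unfolding sum_product by (simp add: sum_distrib_right sum.cartesian_product case_prod_unfold)
        also have "\<dots> \<le> 2 * 2 * norm x"
          by (intro mult_right_mono mult_mono sum_abs_sqrt_coeff_le) (auto intro: sum_nonneg)
        finally show "(\<Sum>p\<in>F. norm (f p)) \<le> 4 * norm x" by simp
      qed
    qed simp
    then have fs': "f summable_on UNIV" by (rule abs_summable_summable)
    have "R (R x) = (\<Sum>\<^sub>\<infinity>j. \<Sum>\<^sub>\<infinity>k. f (j, k))"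
      unfolding R_def[of "R x"]
    proof (rule infsum_cong)
      fix j
      have "bounded_linear (\<lambda>y. ?c j *\<^sub>R (T ^^ j) y)"
        by (intro bounded_linear_compose[OF bounded_linear_scaleR_right] bounded_clinearD(1)[OF Pb])
      note i = infsum_bounded_linear[OF this ts'[of x]]
      have "t (R x) j = ?c j *\<^sub>R (T ^^ j) (R x)" by (simp only: t_def)
      also have "\<dots> = (\<Sum>\<^sub>\<infinity>k. ?c j *\<^sub>R (T ^^ j) (t x k))" unfolding i R_def ..
      also have "\<dots> = (\<Sum>\<^sub>\<infinity>k. f (j, k))"
        by (simp add: f_def t_def bounded_clinear_scaleR[OF Pb] funpow_add)
      finally show "t (R x) j = (\<Sum>\<^sub>\<infinity>k. f (j, k))" .
    qed
    also have "\<dots> = infsum f (UNIV \<times> UNIV)"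
      using infsum_Sigma'_banach[of "\<lambda>j k. f (j, k)" UNIV "\<lambda>_. UNIV"] fs' by simp
    also have "\<dots> = infsum (\<lambda>(n, j). f (j, n - j)) (Sigma UNIV (\<lambda>n. {..n}))"
    proof -
      have bij: "bij_betw (\<lambda>(n, j). (j, n - j)) (Sigma UNIV (\<lambda>n. {..n})) (UNIV \<times> UNIV :: (nat \<times> nat) set)"
        by (rule bij_betwI[where g = "\<lambda>(j, k). (j + k, j)"]) auto
      show ?thesis using infsum_reindex_bij_betw[OF bij, of f] by (simp add: case_prod_unfold)
    qed
    also have "\<dots> = (\<Sum>\<^sub>\<infinity>n. \<Sum>\<^sub>\<infinity>j\<in>{..n}. f (j, n - j))"
    proof (rule infsum_Sigma'_banach[symmetric])
      have bij: "bij_betw (\<lambda>(n, j). (j, n - j)) (Sigma UNIV (\<lambda>n. {..n})) (UNIV \<times> UNIV :: (nat \<times> nat) set)"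
        by (rule bij_betwI[where g = "\<lambda>(j, k). (j + k, j)"]) auto
      show "(\<lambda>(n, j). f (j, n - j)) summable_on Sigma UNIV (\<lambda>n. {..n})"
        using summable_on_reindex_bij_betw[OF bij, of f] fs' by (simp add: case_prod_unfold)
    qed
    also have "\<dots> = (\<Sum>\<^sub>\<infinity>n. (if n = 0 then 1 else if n = 1 then - 1 else 0) *\<^sub>R (T ^^ n) x)"
    proof (rule infsum_cong)
      fix n :: nat
      have "(\<Sum>j\<le>n. f (j, n - j)) = (\<Sum>j\<le>n. (?c j * ?c (n - j)) *\<^sub>R (T ^^ n) x)"
        by (intro sum.cong refl) (simp add: f_def)
      then show "(\<Sum>\<^sub>\<infinity>j\<in>{..n}. f (j, n - j)) = (if n = 0 then 1 else if n = 1 then - 1 else 0) *\<^sub>R (T ^^ n) x"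
        by (simp only: infsum_finite[OF finite_atMost] scaleR_sum_left[symmetric] sqrt_coeff_convolution)
    qed
    also have "\<dots> = (\<Sum>\<^sub>\<infinity>n\<in>{0, 1}. (if n = 0 then 1 else if n = 1 then - 1 else 0) *\<^sub>R (T ^^ n) x)"
      by (rule infsum_cong_neutral) auto
    also have "\<dots> = x - T x" by simp
    finally show ?thesis .
  qed
  \<comment> \<open>Commutation with everything that commutes with \<open>T\<close> is recorded for
    the uniqueness of the square root.\<close>
  have comm: "S (R x) = R (S x)" if S: "bounded_clinear S" "\<And>x. S (T x) = T (S x)" for S x
  proof -
    have Sk: "S ((T ^^ k) y) = (T ^^ k) (S y)" for k y by (induction k) (simp_all add: S(2))
    have "S (R x) = (\<Sum>\<^sub>\<infinity>k. S (t x k))"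
      unfolding R_def using infsum_bounded_linear[OF bounded_clinearD(1)[OF S(1)] ts'[of x]] by simp
    also have "\<dots> = R (S x)" by (simp add: R_def t_def bounded_clinear_scaleR[OF S(1)] Sk)
    finally show ?thesis .
  qed
  have "positive_op R" unfolding positive_op_def selfadjoint_def using Rb Rsa Rpos by blast
  then show ?thesis using RR comm by blast
qed

text \<open>With \<open>C\<close> a bound for \<open>W\<close>, the operator
  \<open>1 - W / C\<close> is a contraction by \<open>positive_op_norm_le\<close>; the root of its
  complement is rescaled by \<open>sqrt C\<close>.\<close>

lemma op_sqrt_exists:
  fixes W :: "'a :: chilbert_space \<Rightarrow> 'a"
  assumes W: "positive_op W"
  shows "\<exists>R. positive_op R \<and> R \<circ> R = W \<and>
    (\<forall>S. bounded_clinear S \<and> (\<forall>x. S (W x) = W (S x)) \<longrightarrow> (\<forall>x. S (R x) = R (S x)))"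
proof -
  note Wsa = positive_opD(1)[OF W]
  obtain C where C: "C > 0" "\<And>x. norm (W x) \<le> C * norm x"
    using bounded_clinear_bound[OF selfadjointD(1)[OF Wsa]] by blast
  define T where "T x = x + (- 1 / C) *\<^sub>R W x" for x
  have sid: "selfadjoint (\<lambda>y :: 'a. y)"
    by (auto simp: selfadjoint_def intro!: bounded_clinearI[where C = 1])
  have T: "selfadjoint T" unfolding T_def by (intro selfadjoint_add selfadjoint_scaleR Wsa sid)
  have T1: "norm (T x) \<le> norm x" for x
  proof (rule power2_le_imp_le[OF _ norm_ge_zero])
    have "Re (cinner (W x) x) = Re (cinner x (W x))" by (simp add: selfadjointD(2)[OF Wsa])
    then have "(norm (T x))\<^sup>2 = (norm x)\<^sup>2  - 2 * Re (cinner x (W x)) / C + (norm (W x))\<^sup>2 / C\<^sup>2"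
      using C(1) by (simp add: T_def norm_sq_eq_cinner cinner_simps power2_eq_square[of C] field_simps)
    also have "(norm (W x))\<^sup>2 / C\<^sup>2 \<le> C * Re (cinner x (W x)) / C\<^sup>2"
      by (intro divide_right_mono positive_op_norm_le[OF W C]) simp
    also have "\<dots> = Re (cinner x (W x)) / C" using C(1) by (simp add: power2_eq_square)
    finally show "(norm (T x))\<^sup>2 \<le> (norm x)\<^sup>2"
      using divide_nonneg_pos[OF positive_opD(2)[OF W, of x] C(1)] by linarith
  qed
  obtain R where R: "positive_op R" "\<And>x. R (R x) = x - T x"
    "\<And>S x. bounded_clinear S \<Longrightarrow> (\<And>x. S (T x) = T (S x)) \<Longrightarrow> S (R x) = R (S x)"
    using op_sqrt_contraction[OF T T1] by blast
  note Rsa = positive_opD(1)[OF R(1)]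
  note Rb = selfadjointD(1)[OF Rsa]
  define R' where "R' x = sqrt C *\<^sub>R R x" for x
  have "positive_op R'"
    unfolding positive_op_def R'_def using C(1) positive_opD(2)[OF R(1)]
    by (auto intro!: selfadjoint_scaleR Rsa simp: cinner_scaleR_right)
  moreover have "R' (R' x) = W x" for x
  proof -
    have "R' (R' x) = C *\<^sub>R R (R x)"
      using C(1) by (simp add: R'_def bounded_clinear_scaleR[OF Rb])
    then show ?thesis using C(1) by (simp add: R(2) T_def)
  qed
  then have "R' \<circ> R' = W" by (simp add: fun_eq_iff)
  moreover have "S (R' x) = R' (S x)" if S: "bounded_clinear S" "\<And>x. S (W x) = W (S x)" for S x
  proof -
    have "S (T y) = T (S y)" for y
      unfolding T_def by (simp add: bounded_clinear_add[OF S(1)] bounded_clinear_scaleR[OF S(1)] S(2)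
          bounded_clinear_diff[OF S(1)])
    from R(3)[OF S(1) this] show ?thesis by (simp add: R'_def bounded_clinear_scaleR[OF S(1)])
  qed
  ultimately show ?thesis by blast
qed

lemma op_sqrt_positive:
  fixes W :: "'a :: chilbert_space \<Rightarrow> 'a"
  assumes W: "positive_op W"
  shows "positive_op (op_sqrt W) \<and> op_sqrt W \<circ> op_sqrt W = W"
proof -
  obtain R where R: "positive_op R" "R \<circ> R = W"
    "\<And>S x. bounded_clinear S \<Longrightarrow> (\<And>x. S (W x) = W (S x)) \<Longrightarrow> S (R x) = R (S x)"
    using op_sqrt_exists[OF W] by blast
  have "op_sqrt W = R"
    unfolding op_sqrt_def
  proof (rule the_equality)
    show "positive_op R \<and> R \<circ> R = W" using R by blast
    fix S assume S: "positive_op S \<and> S \<circ> S = W"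
    have Ssa: "selfadjoint S" and Rsa: "selfadjoint R" using S R(1) positive_opD(1) by blast+
    note Sb = selfadjointD(1)[OF Ssa] and Rb = selfadjointD(1)[OF Rsa]
    have SS: "S (S x) = W x" and RR: "R (R x) = W x" for x
      using S R(2) by (auto simp: fun_eq_iff)
    have "S (W x) = W (S x)" for x by (simp add: SS[symmetric])
    then have comm: "S (R x) = R (S x)" for x by (rule R(3)[OF Sb])
    show "S = R"
    proof
      fix y
      \<comment> \<open>Since \<open>R\<close> and \<open>S\<close> commute,
        \<open>(R + S) z = R (R y) - S (S y) = 0\<close>. Both forms are nonnegative at
        \<open>z\<close>, hence \<open>R z = S z = 0\<close>, and then
        \<open>|z|^2 = <y, R z - S z> = 0\<close>.\<close>
      define z where "z = R y - S y"
      have "R z + S z = 0"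
        by (simp add: z_def bounded_clinear_diff[OF Rb] bounded_clinear_diff[OF Sb] RR SS comm)
      then have "Re (cinner z (R z + S z)) = 0" by simp
      then have "Re (cinner z (R z)) + Re (cinner z (S z)) = 0" by (simp add: cinner_add_right)
      then have "Re (cinner z (R z)) \<le> 0" "Re (cinner z (S z)) \<le> 0"
        using positive_opD(2)[OF R(1), of z] positive_opD(2)[of S z] S by linarith+
      then have "R z = 0" "S z = 0" using positive_op_kernel R(1) S by blast+
      moreover have "cinner z z = cinner (R y) z - cinner (S y) z"
        by (subst (1) z_def) (rule cinner_diff_left)
      ultimately have "cinner z z = 0"
        by (simp add: selfadjointD(2)[OF Rsa] selfadjointD(2)[OF Ssa])
      then have "z = 0" by (simp add: cinner_self_eq_0)
      then show "S y = R y" by (simp add: z_def)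
    qed
  qed
  then show ?thesis using R by simp
qed

section \<open>Square-summable kernels\<close>

lemma summable_on_product_pairs:
  fixes f :: "'i \<Rightarrow> real" and g :: "'j \<Rightarrow> real"
  assumes f: "f summable_on UNIV" "\<And>x. 0 \<le> f x" and g: "g summable_on UNIV" "\<And>x. 0 \<le> g x"
  shows "(\<lambda>p. f (fst p) * g (snd p)) summable_on UNIV"
    and "(\<Sum>\<^sub>\<infinity>p. f (fst p) * g (snd p)) = (\<Sum>\<^sub>\<infinity>x. f x) * (\<Sum>\<^sub>\<infinity>y. g y)"
proof -
  have "(\<lambda>p. f (fst p) * g (snd p)) summable_on Sigma UNIV (\<lambda>_. UNIV)"
  proof (rule summable_on_SigmaI)
    show "((\<lambda>y. f (fst (x, y)) * g (snd (x, y))) has_sum f x * (\<Sum>\<^sub>\<infinity>y. g y)) UNIV" for x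
      using has_sum_cmult_right[OF has_sum_infsum[OF g(1)], of "f x"] by simp
    show "(\<lambda>x. f x * (\<Sum>\<^sub>\<infinity>y. g y)) summable_on UNIV" by (rule summable_on_cmult_left[OF f(1)])
  qed (use f g in simp)
  then show 1: "(\<lambda>p. f (fst p) * g (snd p)) summable_on UNIV" by simp
  have "(\<Sum>\<^sub>\<infinity>p. f (fst p) * g (snd p)) = (\<Sum>\<^sub>\<infinity>x. \<Sum>\<^sub>\<infinity>y. f x * g y)"
    using infsum_Sigma'_banach[of "\<lambda>x y. f x * g y" UNIV "\<lambda>_. UNIV"] 1 by (simp add: case_prod_unfold)
  then show "(\<Sum>\<^sub>\<infinity>p. f (fst p) * g (snd p)) = (\<Sum>\<^sub>\<infinity>x. f x) * (\<Sum>\<^sub>\<infinity>y. g y)"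
    by (simp add: infsum_cmult_right' infsum_cmult_left')
qed

lemma infsum_Cauchy_Schwarz:
  fixes f :: "'i \<Rightarrow> 'a :: real_normed_vector" and g :: "'i \<Rightarrow> 'b :: real_normed_vector"
  assumes f: "(\<lambda>n. (norm (f n))\<^sup>2) summable_on UNIV" and g: "(\<lambda>n. (norm (g n))\<^sup>2) summable_on UNIV"
  shows "(\<lambda>n. norm (f n) * norm (g n)) summable_on UNIV"
    and "(\<Sum>\<^sub>\<infinity>n. norm (f n) * norm (g n)) \<le> sqrt (\<Sum>\<^sub>\<infinity>n. (norm (f n))\<^sup>2) * sqrt (\<Sum>\<^sub>\<infinity>n. (norm (g n))\<^sup>2)"
proof -
  show s: "(\<lambda>n. norm (f n) * norm (g n)) summable_on UNIV"
    using l2_mult_abs_summable[OF f g, of "\<lambda>n. norm (f n) * norm (g n)"] by simp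
  show "(\<Sum>\<^sub>\<infinity>n. norm (f n) * norm (g n)) \<le> sqrt (\<Sum>\<^sub>\<infinity>n. (norm (f n))\<^sup>2) * sqrt (\<Sum>\<^sub>\<infinity>n. (norm (g n))\<^sup>2)"
  proof (rule infsum_le_finite_sums[OF s])
    fix F :: "'i set" assume F: "finite F" "F \<subseteq> UNIV"
    have "(\<Sum>n\<in>F. norm (f n) * norm (g n))\<^sup>2 \<le> (\<Sum>n\<in>F. (norm (f n))\<^sup>2) * (\<Sum>n\<in>F. (norm (g n))\<^sup>2)"
      by (rule Cauchy_Schwarz_ineq_sum)
    also have "\<dots> \<le> (\<Sum>\<^sub>\<infinity>n. (norm (f n))\<^sup>2) * (\<Sum>\<^sub>\<infinity>n. (norm (g n))\<^sup>2)"
      using F by (intro mult_mono finite_sum_le_infsum f g sum_nonneg infsum_nonneg) auto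
    finally show "(\<Sum>n\<in>F. norm (f n) * norm (g n))
        \<le> sqrt (\<Sum>\<^sub>\<infinity>n. (norm (f n))\<^sup>2) * sqrt (\<Sum>\<^sub>\<infinity>n. (norm (g n))\<^sup>2)"
      by (simp add: real_sqrt_mult[symmetric] real_le_rsqrt)
  qed
qed

definition sqnorm :: "(int \<Rightarrow> complex) \<Rightarrow> real" where
  "sqnorm f = (\<Sum>\<^sub>\<infinity>n. (cmod (f n))\<^sup>2)"

definition square_summable :: "(int \<Rightarrow> complex) \<Rightarrow> bool" where
  "square_summable f \<longleftrightarrow> (\<lambda>n. (cmod (f n))\<^sup>2) summable_on UNIV"

lemma sqnorm_nonneg: "0 \<le> sqnorm f"
  unfolding sqnorm_def by (rule infsum_nonneg) simp

definition pairing :: "(int \<Rightarrow> complex) \<Rightarrow> 'a :: complex_inner ell2Z \<Rightarrow> 'a" where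
  "pairing f \<phi> = (\<Sum>\<^sub>\<infinity>n. f n *\<^sub>C Rep_ell2Z \<phi> n)"

lemma pairing_abs_summable:
  assumes "square_summable f"
  shows "(\<lambda>n. norm (f n *\<^sub>C Rep_ell2Z (\<phi> :: 'a :: complex_inner ell2Z) n)) summable_on UNIV"
  by (rule l2_mult_abs_summable[OF assms[unfolded square_summable_def] l2_Rep[of \<phi>]]) (simp add: norm_scaleC)

lemma pairing_summable:
  assumes "square_summable f"
  shows "(\<lambda>n. f n *\<^sub>C Rep_ell2Z (\<phi> :: 'a :: chilbert_space ell2Z) n) summable_on UNIV"
  by (rule abs_summable_summable[OF pairing_abs_summable[OF assms]])

lemma norm_pairing_le:
  assumes f: "square_summable f"
  shows "norm (pairing f \<phi>) \<le> sqrt (sqnorm f) * norm \<phi>"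
proof -
  have "norm (pairing f \<phi>) \<le> (\<Sum>\<^sub>\<infinity>n. norm (f n *\<^sub>C Rep_ell2Z \<phi> n))"
    unfolding pairing_def by (rule norm_infsum_bound[OF pairing_abs_summable[OF f]])
  also have "\<dots> \<le> sqrt (sqnorm f) * sqrt (\<Sum>\<^sub>\<infinity>n. (norm (Rep_ell2Z \<phi> n))\<^sup>2)"
    unfolding sqnorm_def norm_scaleC
    by (rule infsum_Cauchy_Schwarz(2)[OF f[unfolded square_summable_def] l2_Rep])
  also have "sqrt (\<Sum>\<^sub>\<infinity>n. (norm (Rep_ell2Z \<phi> n))\<^sup>2) = norm \<phi>"
    by (simp add: norm_ell2Z_sq[symmetric])
  finally show ?thesis .
qed

lemma bounded_clinear_pairing:
  assumes f: "square_summable f"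
  shows "bounded_clinear (pairing f :: 'a :: chilbert_space ell2Z \<Rightarrow> 'a)"
proof (rule bounded_clinearI[where C = "sqrt (sqnorm f)"])
  fix \<phi> \<eta> :: "'a ell2Z" and c :: complex
  show "pairing f (\<phi> + \<eta>) = pairing f \<phi> + pairing f \<eta>"
    unfolding pairing_def plus_ell2Z.rep_eq scaleC_add_right
    by (intro infsum_add pairing_summable f)
  have "pairing f (c *\<^sub>C \<phi>) = (\<Sum>\<^sub>\<infinity>n. c *\<^sub>C f n *\<^sub>C Rep_ell2Z \<phi> n)"
    by (simp add: pairing_def scaleC_ell2Z.rep_eq scaleC_scaleC mult.commute)
  also have "\<dots> = c *\<^sub>C pairing f \<phi>"
    unfolding pairing_def by (rule infsum_bounded_linear[OF bounded_linear_scaleC_right pairing_summable[OF f]])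
  finally show "pairing f (c *\<^sub>C \<phi>) = c *\<^sub>C pairing f \<phi>" .
qed (rule norm_pairing_le[OF f])

lemma pairing_add:
  assumes "square_summable f" "square_summable g"
  shows "pairing (\<lambda>n. f n + g n) \<phi> = pairing f \<phi> + pairing g (\<phi> :: 'a :: chilbert_space ell2Z)"
  unfolding pairing_def scaleC_add_left by (intro infsum_add pairing_summable assms)

lemma pairing_cmult:
  assumes "square_summable f"
  shows "pairing (\<lambda>n. c * f n) \<phi> = c *\<^sub>C pairing f (\<phi> :: 'a :: chilbert_space ell2Z)"
  unfolding pairing_def scaleC_scaleC[symmetric]
  by (rule infsum_bounded_linear[OF bounded_linear_scaleC_right pairing_summable[OF assms]])

text \<open>\<open>pairing\<close> carries no conjugation, so the one here makes
  \<open>tensor f\<close> its adjoint.\<close>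

definition tensor :: "(int \<Rightarrow> complex) \<Rightarrow> 'a :: complex_inner \<Rightarrow> 'a ell2Z" where
  "tensor f g = Abs_ell2Z (\<lambda>n. cnj (f n) *\<^sub>C g)"

lemma Rep_tensor:
  assumes "square_summable f"
  shows "Rep_ell2Z (tensor f g) = (\<lambda>n. cnj (f n) *\<^sub>C g)"
  unfolding tensor_def
  by (intro Abs_ell2Z_inverse CollectI l2_bounded[OF assms[unfolded square_summable_def], of _ "norm g"])
    (simp add: norm_scaleC mult.commute)

lemma cinner_pairing:
  fixes \<phi> :: "'a :: chilbert_space ell2Z"
  assumes f: "square_summable f"
  shows "cinner (pairing f \<phi>) g = cinner \<phi> (tensor f g)"
proof -
  have "cinner (pairing f \<phi>) g = (\<Sum>\<^sub>\<infinity>n. cinner (f n *\<^sub>C Rep_ell2Z \<phi> n) g)"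
    unfolding pairing_def
    by (rule infsum_bounded_linear[OF bounded_linear_cinner_left pairing_summable[OF f], symmetric])
  then show ?thesis by (simp add: cinner_ell2Z_def Rep_tensor[OF f] cinner_simps)
qed

definition l2_kernel :: "(int \<Rightarrow> int \<Rightarrow> complex) \<Rightarrow> bool" where
  "l2_kernel a \<longleftrightarrow> (\<lambda>p. (cmod (a (fst p) (snd p)))\<^sup>2) summable_on UNIV"

definition kernel_sqnorm :: "(int \<Rightarrow> int \<Rightarrow> complex) \<Rightarrow> real" where
  "kernel_sqnorm a = (\<Sum>\<^sub>\<infinity>p. (cmod (a (fst p) (snd p)))\<^sup>2)"

lemma l2_kernel_rows:
  assumes "l2_kernel a"
  shows "square_summable (a n)" "(\<lambda>n. sqnorm (a n)) summable_on UNIV"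
    "(\<Sum>\<^sub>\<infinity>n. sqnorm (a n)) = kernel_sqnorm a"
proof -
  have s: "(\<lambda>(n, m). (cmod (a n m))\<^sup>2) summable_on Sigma UNIV (\<lambda>_. UNIV)"
    using assms by (simp add: l2_kernel_def case_prod_unfold)
  show "square_summable (a n)"
    unfolding square_summable_def using summable_on_SigmaD1[OF s, of n] by simp
  show "(\<lambda>n. sqnorm (a n)) summable_on UNIV"
    unfolding sqnorm_def using summable_on_Sigma_banach[OF s] by simp
  show "(\<Sum>\<^sub>\<infinity>n. sqnorm (a n)) = kernel_sqnorm a"
    unfolding sqnorm_def kernel_sqnorm_def using infsum_Sigma'_banach[OF s] by (simp add: case_prod_unfold)
qed

lemma l2_kernel_swap:
  assumes "l2_kernel a" shows "l2_kernel (\<lambda>n m. cnj (a m n))"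
proof -
  have "(\<lambda>p. (\<lambda>p. (cmod (a (fst p) (snd p)))\<^sup>2) (prod.swap p)) summable_on UNIV"
    using assms summable_on_reindex_bij_betw[OF bij_swap, of "\<lambda>p. (cmod (a (fst p) (snd p)))\<^sup>2"]
    by (simp add: l2_kernel_def)
  then show ?thesis by (simp add: l2_kernel_def)
qed

lemma l2_kernel_add: "l2_kernel a \<Longrightarrow> l2_kernel b \<Longrightarrow> l2_kernel (\<lambda>n m. a n m + b n m)"
  unfolding l2_kernel_def by (rule l2_add)

lemma l2_kernel_cmult:
  assumes "l2_kernel a" shows "l2_kernel (\<lambda>n m. c * a n m)"
  unfolding l2_kernel_def
  by (rule l2_bounded[OF assms[unfolded l2_kernel_def], of _ "cmod c"]) (simp add: norm_mult)

text \<open>The tensor product of the lattice operator with matrix \<open>a\<close> and the fibre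
  operator \<open>A\<close>.\<close>

definition kernel_op ::
  "(int \<Rightarrow> int \<Rightarrow> complex) \<Rightarrow> ('a :: complex_inner \<Rightarrow> 'a) \<Rightarrow> 'a ell2Z \<Rightarrow> 'a ell2Z" where
  "kernel_op a A \<phi> = Abs_ell2Z (\<lambda>n. A (pairing (a n) \<phi>))"

context
  fixes A :: "'a :: chilbert_space \<Rightarrow> 'a"
  assumes A: "bounded_clinear A"
begin

lemma kernel_op_row_bound:
  assumes a: "l2_kernel a" and C: "\<And>x. norm (A x) \<le> C * norm x" "C > 0"
  shows "(norm (A (pairing (a n) \<phi>)))\<^sup>2 \<le> (C\<^sup>2 * (norm \<phi>)\<^sup>2) * sqnorm (a n)"
proof -
  have "norm (A (pairing (a n) \<phi>)) \<le> C * (sqrt (sqnorm (a n)) * norm \<phi>)"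
    using C(1)[of "pairing (a n) \<phi>"]
      mult_left_mono[OF norm_pairing_le[OF l2_kernel_rows(1)[OF a], of n \<phi>] less_imp_le[OF C(2)]]
    by linarith
  from power_mono[OF this norm_ge_zero, of 2] show ?thesis
    by (simp add: power_mult_distrib sqnorm_nonneg mult_ac)
qed

lemma kernel_op_summable:
  assumes a: "l2_kernel a"
  shows "(\<lambda>n. (norm (A (pairing (a n) \<phi>)))\<^sup>2) summable_on UNIV"
proof -
  obtain C where C: "C > 0" "\<And>x. norm (A x) \<le> C * norm x" using bounded_clinear_bound[OF A] by blast
  show ?thesis
    by (rule summable_on_comparison_test[OF summable_on_cmult_right[OF l2_kernel_rows(2)[OF a]]])
      (use kernel_op_row_bound[OF a C(2,1)] in auto)
qed

lemma Rep_kernel_op: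
  assumes a: "l2_kernel a"
  shows "Rep_ell2Z (kernel_op a A \<phi>) = (\<lambda>n. A (pairing (a n) \<phi>))"
  unfolding kernel_op_def by (intro Abs_ell2Z_inverse CollectI kernel_op_summable[OF a])

lemma bounded_clinear_kernel_op:
  assumes a: "l2_kernel a"
  shows "bounded_clinear (kernel_op a A)"
proof -
  obtain C where C: "C > 0" "\<And>x. norm (A x) \<le> C * norm x" using bounded_clinear_bound[OF A] by blast
  note p = bounded_clinear_pairing[OF l2_kernel_rows(1)[OF a]]
  show ?thesis
  proof (rule bounded_clinearI[where C = "C * sqrt (kernel_sqnorm a)"])
    fix \<phi> \<eta> :: "'a ell2Z" and c :: complex
    show "kernel_op a A (\<phi> + \<eta>) = kernel_op a A \<phi> + kernel_op a A \<eta>"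
      unfolding Rep_ell2Z_inject[symmetric] plus_ell2Z.rep_eq Rep_kernel_op[OF a]
      by (simp add: bounded_clinear_add[OF p] bounded_clinear_add[OF A])
    show "kernel_op a A (c *\<^sub>C \<phi>) = c *\<^sub>C kernel_op a A \<phi>"
      unfolding Rep_ell2Z_inject[symmetric] scaleC_ell2Z.rep_eq Rep_kernel_op[OF a]
      by (simp add: bounded_clinearD(2)[OF p] bounded_clinearD(2)[OF A])
    have "(norm (kernel_op a A \<phi>))\<^sup>2 = (\<Sum>\<^sub>\<infinity>n. (norm (A (pairing (a n) \<phi>)))\<^sup>2)"
      by (simp add: norm_ell2Z_sq Rep_kernel_op[OF a])
    also have "\<dots> \<le> (\<Sum>\<^sub>\<infinity>n. (C\<^sup>2 * (norm \<phi>)\<^sup>2) * sqnorm (a n))"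
      by (intro infsum_mono kernel_op_summable a summable_on_cmult_right l2_kernel_rows(2)
          kernel_op_row_bound C)
    also have "\<dots> = C\<^sup>2 * (norm \<phi>)\<^sup>2 * kernel_sqnorm a"
      by (simp add: infsum_cmult_right' l2_kernel_rows(3)[OF a])
    also have "\<dots> = (C * sqrt (kernel_sqnorm a) * norm \<phi>)\<^sup>2"
      by (simp add: power_mult_distrib kernel_sqnorm_def infsum_nonneg mult_ac)
    finally show "norm (kernel_op a A \<phi>) \<le> C * sqrt (kernel_sqnorm a) * norm \<phi>"
      by (rule power2_le_imp_le)
        (use C(1) in \<open>auto simp: kernel_sqnorm_def infsum_nonneg intro!: mult_nonneg_nonneg\<close>)
  qed
qed

lemma kernel_op_add:
  assumes a: "l2_kernel a" and b: "l2_kernel b"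
  shows "kernel_op (\<lambda>n m. a n m + b n m) A \<phi> = kernel_op a A \<phi> + kernel_op b A \<phi>"
  unfolding Rep_ell2Z_inject[symmetric] plus_ell2Z.rep_eq Rep_kernel_op[OF a] Rep_kernel_op[OF b]
    Rep_kernel_op[OF l2_kernel_add[OF a b]]
  by (simp add: pairing_add l2_kernel_rows(1)[OF a] l2_kernel_rows(1)[OF b] bounded_clinear_add[OF A])

lemma kernel_op_cmult:
  assumes a: "l2_kernel a"
  shows "kernel_op (\<lambda>n m. c * a n m) A \<phi> = c *\<^sub>C kernel_op a A \<phi>"
  unfolding Rep_ell2Z_inject[symmetric] scaleC_ell2Z.rep_eq Rep_kernel_op[OF a]
    Rep_kernel_op[OF l2_kernel_cmult[OF a]]
  by (simp add: pairing_cmult l2_kernel_rows(1)[OF a] bounded_clinearD(2)[OF A])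

text \<open>Squared Hilbert-Schmidt norms multiply under tensor products. Row \<open>n\<close> is
  \<open>A\<close> after \<open>pairing (a n)\<close>, which costs \<open>sqnorm (a n)\<close>, and
  the rows are summed.\<close>

lemma hs_le_kernel_op:
  assumes a: "l2_kernel a" and c: "hs_le A c"
  shows "hs_le (kernel_op a A) (kernel_sqnorm a * c)"
  unfolding hs_le_def
proof (intro allI impI)
  fix F :: "'a ell2Z set" assume F: "finite F \<and> orthonormal F"
  note s = kernel_op_summable[OF a]
  have "(\<Sum>e\<in>F. \<Sum>\<^sub>\<infinity>n. (norm (A (pairing (a n) e)))\<^sup>2) = (\<Sum>\<^sub>\<infinity>n.  \<Sum>e\<in>F. (norm (A (pairing (a n) e)))\<^sup>2) \<and>
      (\<lambda>n. \<Sum>e\<in>F. (norm (A (pairing (a n) e)))\<^sup>2) summable_on UNIV"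
    using conjunct1[OF F]
  proof (induction F)
    case (insert e F)
    then show ?case using infsum_add[OF s[of e], of "\<lambda>n. \<Sum>e\<in>F. (norm (A (pairing (a n) e)))\<^sup>2"]
        summable_on_add[OF s[of e], of "\<lambda>n. \<Sum>e\<in>F. (norm (A (pairing (a n) e)))\<^sup>2"]
      by simp
  qed simp
  then have sF: "(\<lambda>n. \<Sum>e\<in>F. (norm (A (pairing (a n) e)))\<^sup>2) summable_on UNIV"
    and eq: "(\<Sum>e\<in>F. \<Sum>\<^sub>\<infinity>n. (norm (A (pairing (a n) e)))\<^sup>2) = (\<Sum>\<^sub>\<infinity>n. \<Sum>e\<in>F. (norm (A (pairing (a n) e)))\<^sup>2)"
    by blast+
  have "(\<Sum>e\<in>F. (norm (kernel_op a A e))\<^sup>2) = (\<Sum>\<^sub>\<infinity>n. \<Sum>e\<in>F. (norm (A (pairing (a n) e)))\<^sup>2)"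
    unfolding eq[symmetric] by (simp add: norm_ell2Z_sq Rep_kernel_op[OF a])
  also have "\<dots> \<le> (\<Sum>\<^sub>\<infinity>n. sqnorm (a n) * c)"
  proof (intro infsum_mono sF summable_on_cmult_left l2_kernel_rows(2)[OF a])
    fix n
    note f = l2_kernel_rows(1)[OF a, of n]
    have "hs_le (\<lambda>\<phi>. A (pairing (a n) \<phi>)) ((sqrt (sqnorm (a n)))\<^sup>2 * c)"
      by (rule hs_le_compose_right[OF cinner_adj[OF A] cinner_pairing[OF f] c norm_pairing_le[OF f]])
        (simp add: sqnorm_nonneg)
    then show "(\<Sum>e\<in>F. (norm (A (pairing (a n) e)))\<^sup>2) \<le> sqnorm (a n) * c"
      using F by (auto simp: sqnorm_nonneg dest: hs_leD)
  qed
  also have "\<dots> = kernel_sqnorm a * c" by (simp add: infsum_cmult_left' l2_kernel_rows(3)[OF a])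
  finally show "(\<Sum>e\<in>F. (norm (kernel_op a A e))\<^sup>2) \<le> kernel_sqnorm a * c" .
qed

end

text \<open>An exchange of two sums; the double family is absolutely summable as a product of two
  square-summable ones.\<close>

lemma cinner_kernel_op:
  fixes A :: "'a :: chilbert_space \<Rightarrow> 'a"
  assumes A: "selfadjoint A" and a: "l2_kernel a"
  shows "cinner (kernel_op a A \<phi>) \<eta> = cinner \<phi> (kernel_op (\<lambda>n m. cnj (a m n)) A \<eta>)"
proof -
  note Ab = selfadjointD(1)[OF A]
  let ?f = "Rep_ell2Z \<phi>" and ?g = "Rep_ell2Z \<eta>"
  obtain C where C: "C > 0" "\<And>x. norm (A x) \<le> C * norm x" using bounded_clinear_bound[OF Ab] by blast
  let ?F = "\<lambda>n m. cnj (a n m) * cinner (?f m) (A (?g n))"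
  have s: "(\<lambda>p. norm (?F (fst p) (snd p))) summable_on UNIV"
  proof (rule l2_mult_abs_summable)
    show "(\<lambda>p. (norm (a (fst p) (snd p)))\<^sup>2) summable_on UNIV" using a by (simp add: l2_kernel_def)
    have "(\<lambda>p. (norm (?g (fst p)))\<^sup>2 * (norm (?f (snd p)))\<^sup>2) summable_on UNIV"
      by (rule summable_on_product_pairs(1)[OF l2_Rep _ l2_Rep]) auto
    from summable_on_cmult_right[OF this, of "C\<^sup>2"]
    show "(\<lambda>p. (norm (C * (norm (?g (fst p)) * norm (?f (snd p)))))\<^sup>2) summable_on UNIV"
      by (simp add: power_mult_distrib)
    fix p :: "int \<times> int"
    have "cmod (cinner (?f (snd p)) (A (?g (fst p)))) \<le> norm (?f (snd p)) * norm (A (?g (fst p)))"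
      by (rule cmod_cinner_le)
    also have "\<dots> \<le> norm (?f (snd p)) * (C * norm (?g (fst p)))" by (intro mult_left_mono C) simp
    finally show "norm (?F (fst p) (snd p))
        \<le> norm (a (fst p) (snd p)) * norm (C * (norm (?g (fst p)) * norm (?f (snd p))))"
      using C(1) mult_left_mono[of "cmod (cinner (?f (snd p)) (A (?g (fst p))))"
          "norm (?f (snd p)) * (C * norm (?g (fst p)))" "cmod (a (fst p) (snd p))"]
      by (simp add: norm_mult abs_mult mult_ac)
  qed
  then have s': "(\<lambda>(n, m). ?F n m) summable_on UNIV \<times> UNIV"
    using abs_summable_summable[OF s] by (simp add: case_prod_unfold)
  have "cinner (kernel_op a A \<phi>) \<eta> = (\<Sum>\<^sub>\<infinity>n. \<Sum>\<^sub>\<infinity>m. ?F n m)"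
    unfolding cinner_ell2Z_def Rep_kernel_op[OF Ab a]
  proof (rule infsum_cong)
    fix n
    have "cinner (A (pairing (a n) \<phi>)) (?g n) = cinner (pairing (a n) \<phi>) (A (?g n))"
      by (rule selfadjointD(2)[OF A])
    also have "\<dots> = (\<Sum>\<^sub>\<infinity>m. cinner (a n m *\<^sub>C ?f m) (A (?g n)))"
      unfolding pairing_def
      by (rule infsum_bounded_linear[OF bounded_linear_cinner_left
            pairing_summable[OF l2_kernel_rows(1)[OF a]], symmetric])
    finally show "cinner (A (pairing (a n) \<phi>)) (?g n) = (\<Sum>\<^sub>\<infinity>m. ?F n m)" by (simp add: cinner_simps)
  qed
  also have "\<dots> = (\<Sum>\<^sub>\<infinity>m. \<Sum>\<^sub>\<infinity>n. ?F n m)" by (rule infsum_swap_banach[OF s'])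
  also have "\<dots> = cinner \<phi> (kernel_op (\<lambda>n m. cnj (a m n)) A \<eta>)"
    unfolding cinner_ell2Z_def Rep_kernel_op[OF Ab l2_kernel_swap[OF a]]
  proof (rule infsum_cong)
    fix m
    have "cinner (?f m) (A (pairing (\<lambda>n. cnj (a n m)) \<eta>))
        = (\<Sum>\<^sub>\<infinity>n. cinner (?f m) (A (cnj (a n m) *\<^sub>C ?g n)))"
      unfolding pairing_def
      by (rule infsum_bounded_linear[symmetric,
            OF bounded_linear_compose[OF bounded_linear_cinner_right bounded_clinearD(1)[OF Ab]]
              pairing_summable[OF l2_kernel_rows(1)[OF l2_kernel_swap[OF a]]]])
    then show "(\<Sum>\<^sub>\<infinity>n. ?F n m) = cinner (?f m) (A (pairing (\<lambda>n. cnj (a n m)) \<eta>))"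
      by (simp add: bounded_clinearD(2)[OF Ab] cinner_simps)
  qed
  finally show ?thesis .
qed

section \<open>The weight\<close>

lemma summable_on_int_even:
  fixes g :: "nat \<Rightarrow> real"
  assumes "summable g" "\<And>k. 0 \<le> g k"
  shows "(\<lambda>n :: int. g (nat \<bar>n\<bar>)) summable_on UNIV"
proof -
  have g: "g summable_on UNIV" using assms summable_on_UNIV_nonneg_real_iff by blast
  have 1: "(\<lambda>n :: int. g (nat \<bar>n\<bar>)) summable_on range int"
    using g by (subst summable_on_reindex) (auto simp: o_def)
  have 2: "(\<lambda>n :: int. g (nat \<bar>n\<bar>)) summable_on range (\<lambda>k. - int k)"
    using g by (subst summable_on_reindex) (auto simp: o_def inj_on_def)
  have "(UNIV :: int set) = range int \<union> range (\<lambda>k. - int k)"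
  proof (intro equalityI subsetI)
    fix n :: int
    show "n \<in> range int \<union> range (\<lambda>k. - int k)"
      by (cases "n \<ge> 0") (auto intro: range_eqI[of _ _ "nat n"] range_eqI[of _ _ "nat (- n)"])
  qed simp
  moreover have "(\<lambda>n :: int. g (nat \<bar>n\<bar>)) summable_on range int \<union> range (\<lambda>k. - int k)"
    using 1 2 by (rule summable_on_union)
  ultimately show ?thesis by simp
qed

text \<open>The terms are comparable to \<open>(1 + |n|) powr (2 - \<nu>0)\<close>, which is
  summable precisely for \<open>\<nu>0 > 3\<close>.\<close>

lemma psi_weight_summable:
  assumes "\<nu>0 > 3"
  shows "(\<lambda>n. (psi \<nu>0 n)\<^sup>2 * (1 + \<bar>real_of_int n\<bar>)\<^sup>2) summable_on UNIV"
proof -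
  have "summable (\<lambda>k. real k powr (2 - \<nu>0))" using assms by (simp add: summable_real_powr_iff)
  then have s: "summable (\<lambda>k. real (Suc k) powr (2 - \<nu>0))" by (subst summable_Suc_iff)
  \<comment> \<open>From \<open>1 + |n| <= sqrt 2 <n>\<close>, raised to the negative power
    \<open>- \<nu>0\<close>.\<close>
  define c where "c = (1 / sqrt 2) powr (- \<nu>0)"
  have "(\<lambda>n :: int. c * real (Suc (nat \<bar>n\<bar>)) powr (2 - \<nu>0)) summable_on UNIV"
    by (intro summable_on_cmult_right summable_on_int_even[OF s]) simp
  then show ?thesis
  proof (rule summable_on_comparison_test)
    fix n :: int
    define t where "t = 1 + \<bar>real_of_int n\<bar>"
    have t: "t \<ge> 1" "real (Suc (nat \<bar>n\<bar>)) = t" by (simp_all add: t_def)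
    have "t\<^sup>2 \<le> 2 * (1 + (real_of_int n)\<^sup>2)"
      using zero_le_power2[of "1 - \<bar>real_of_int n\<bar>"] by (simp add: t_def power2_eq_square algebra_simps)
    then have "t \<le> sqrt 2 * sqrt (1 + (real_of_int n)\<^sup>2)"
      using t by (simp add: real_sqrt_mult[symmetric] real_le_rsqrt)
    then have le: "t * (1 / sqrt 2) \<le> sqrt (1 + (real_of_int n)\<^sup>2)" by (simp add: field_simps)
    have "(psi \<nu>0 n)\<^sup>2 = sqrt (1 + (real_of_int n)\<^sup>2) powr (- \<nu>0)"
      unfolding psi_def by (simp add: power2_eq_square powr_add[symmetric])
    also have "\<dots> \<le> (t * (1 / sqrt 2)) powr (- \<nu>0)"
      using le t assms by (intro powr_mono2') auto
    also have "\<dots> = t powr (- \<nu>0) * c" unfolding c_def by (rule powr_mult)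
    finally have "(psi \<nu>0 n)\<^sup>2 * t\<^sup>2 \<le> (t powr (- \<nu>0) * c) * t\<^sup>2" by (rule mult_right_mono) simp
    also have "t\<^sup>2 = t powr 2" using t by simp
    then have "(t powr (- \<nu>0) * c) * t\<^sup>2 = c * t powr (2 - \<nu>0)"
      by (simp add: powr_add[symmetric])
    finally show "(psi \<nu>0 n)\<^sup>2 * (1 + \<bar>real_of_int n\<bar>)\<^sup>2 \<le> c * real (Suc (nat \<bar>n\<bar>)) powr (2 - \<nu>0)"
      unfolding t(2) t_def[symmetric] .
  qed simp
qed

definition psi_moment :: "real \<Rightarrow> real" where
  "psi_moment \<nu>0 = (\<Sum>\<^sub>\<infinity>n. (psi \<nu>0 n)\<^sup>2 * (1 + \<bar>real_of_int n\<bar>)\<^sup>2)"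

definition weighted :: "real \<Rightarrow> (int \<Rightarrow> int \<Rightarrow> complex) \<Rightarrow> int \<Rightarrow> int \<Rightarrow> complex" where
  "weighted \<nu>0 \<kappa> n m = of_real (psi \<nu>0 n * psi \<nu>0 m) * \<kappa> n m"

text \<open>\<open>1 + |n - m| <= (1 + |n|) (1 + |m|)\<close>, so the double sum is bounded by a
  product of two copies of \<open>psi_moment\<close>.\<close>

lemma weighted_kernel:
  assumes \<nu>: "\<nu>0 > 3" and \<delta>: "\<And>n m. cmod (\<kappa> n m) \<le> \<delta> * (1 + \<bar>real_of_int (n - m)\<bar>)"
  shows "l2_kernel (weighted \<nu>0 \<kappa>)" "kernel_sqnorm (weighted \<nu>0 \<kappa>) \<le> \<delta>\<^sup>2 * (psi_moment \<nu>0)\<^sup>2"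
proof -
  let ?w = "\<lambda>n. (psi \<nu>0 n)\<^sup>2 * (1 + \<bar>real_of_int n\<bar>)\<^sup>2"
  note w = psi_weight_summable[OF \<nu>]
  note pp = summable_on_product_pairs[OF w _ w]
  have b: "(cmod (weighted \<nu>0 \<kappa> (fst p) (snd p)))\<^sup>2 \<le> \<delta>\<^sup>2 * (?w (fst p) * ?w (snd p))" for p
  proof -
    obtain n m where p: "p = (n, m)" by (cases p)
    have d0: "\<delta> \<ge> 0" using order_trans[OF norm_ge_zero \<delta>[of 0 0]] by simp
    have "1 + \<bar>real_of_int (n - m)\<bar> \<le> (1 + \<bar>real_of_int n\<bar>) * (1 + \<bar>real_of_int m\<bar>)"
    proof -
      have "\<bar>real_of_int (n - m)\<bar> \<le> \<bar>real_of_int n\<bar> + \<bar>real_of_int m\<bar>" by simp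
      moreover have "0 \<le> \<bar>real_of_int n\<bar> * \<bar>real_of_int m\<bar>" by (intro mult_nonneg_nonneg abs_ge_zero)
      moreover have "(1 + \<bar>real_of_int n\<bar>) * (1 + \<bar>real_of_int m\<bar>)
          = 1 + \<bar>real_of_int n\<bar> + \<bar>real_of_int m\<bar> + \<bar>real_of_int n\<bar> * \<bar>real_of_int m\<bar>"
        by (simp only: distrib_left distrib_right mult_1_left mult_1_right add_ac)
      ultimately show ?thesis by linarith
    qed
    then have "cmod (\<kappa> n m) \<le> \<delta> * ((1 + \<bar>real_of_int n\<bar>) * (1 + \<bar>real_of_int m\<bar>))"
      using \<delta>[of n m] mult_left_mono[OF _ d0] order_trans by blast
    then have "psi \<nu>0 n * psi \<nu>0 m * cmod (\<kappa> n m)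
        \<le> psi \<nu>0 n * psi \<nu>0 m * (\<delta> * ((1 + \<bar>real_of_int n\<bar>) * (1 + \<bar>real_of_int m\<bar>)))"
      by (rule mult_left_mono) (simp add: psi_nonneg)
    from power_mono[OF this, of 2]
    have "(psi \<nu>0 n * psi \<nu>0 m * cmod (\<kappa> n m))\<^sup>2
        \<le> (psi \<nu>0 n * psi \<nu>0 m * (\<delta> * ((1 + \<bar>real_of_int n\<bar>) * (1 + \<bar>real_of_int m\<bar>))))\<^sup>2"
      by (simp add: psi_nonneg)
    then show ?thesis
      by (simp add: p weighted_def norm_mult psi_nonneg power_mult_distrib mult_ac)
  qed
  have s: "(\<lambda>p. \<delta>\<^sup>2 * (?w (fst p) * ?w (snd p))) summable_on UNIV"
    by (intro summable_on_cmult_right pp(1)) auto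
  show l: "l2_kernel (weighted \<nu>0 \<kappa>)"
    unfolding l2_kernel_def by (rule summable_on_comparison_test[OF s b]) simp
  have "kernel_sqnorm (weighted \<nu>0 \<kappa>) \<le> (\<Sum>\<^sub>\<infinity>p. \<delta>\<^sup>2 * (?w (fst p) * ?w (snd p)))"
    unfolding kernel_sqnorm_def by (intro infsum_mono l[unfolded l2_kernel_def] s b)
  also have "\<dots> = \<delta>\<^sup>2 * (\<Sum>\<^sub>\<infinity>p. ?w (fst p) * ?w (snd p))" by (rule infsum_cmult_right')
  also have "(\<Sum>\<^sub>\<infinity>p. ?w (fst p) * ?w (snd p)) = (psi_moment \<nu>0)\<^sup>2"
    by (subst pp(2)) (simp_all add: psi_moment_def power2_eq_square)
  finally show "kernel_sqnorm (weighted \<nu>0 \<kappa>) \<le> \<delta>\<^sup>2 * (psi_moment \<nu>0)\<^sup>2" .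
qed

section \<open>The free resolvent\<close>

lift_definition shift :: "int \<Rightarrow> 'a :: real_inner ell2Z \<Rightarrow> 'a ell2Z" is "\<lambda>k f n. f (n - k)"
  using summable_on_shift_int[of _ "- _"] by fastforce

lemma infsum_translate: "(\<Sum>\<^sub>\<infinity>n. f (n + k)) = (\<Sum>\<^sub>\<infinity>n :: int. f n)"
  by (rule infsum_reindex_bij_betw) (rule bij_betwI[of _ _ _ "\<lambda>n. n - k"]; simp)

lemma norm_shift: "norm (shift k x) = norm x"
proof -
  have "(norm (shift k x))\<^sup>2 = (norm x)\<^sup>2"
    unfolding norm_ell2Z_sq shift.rep_eq
    using infsum_translate[of "\<lambda>n. (norm (Rep_ell2Z x n))\<^sup>2" "- k"] by simp
  then show ?thesis by simp
qed

lemma bounded_clinear_shift: "bounded_clinear (shift k :: 'a :: complex_inner ell2Z \<Rightarrow> 'a ell2Z)"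
  by (rule bounded_clinearI[where C = 1])
    (auto simp: norm_shift Rep_ell2Z_inject[symmetric] shift.rep_eq plus_ell2Z.rep_eq scaleC_ell2Z.rep_eq)

lemma cinner_shift: "cinner (shift k x) y = cinner x (shift (- k) y)"
  unfolding cinner_ell2Z_def shift.rep_eq
  using infsum_translate[of "\<lambda>n. cinner (Rep_ell2Z x (n - k)) (Rep_ell2Z y n)" k] by simp

lemma shift_shift: "shift j (shift k x) = shift (j + k) x"
  by (simp add: Rep_ell2Z_inject[symmetric] shift.rep_eq fun_eq_iff algebra_simps)

lemma shift_0 [simp]: "shift 0 x = x"
  by (simp add: Rep_ell2Z_inject[symmetric] shift.rep_eq)

lemma neg_laplacian_shift:
  "neg_laplacian h x = (1 / h\<^sup>2) *\<^sub>R (2 *\<^sub>R x - shift (- 1) x - shift 1 x)"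
  by (simp add: Rep_ell2Z_inject[symmetric] shift.rep_eq minus_ell2Z.rep_eq scaleR_ell2Z.rep_eq
      neg_laplacian.rep_eq)

lemma cinner_neg_laplacian: "cinner (neg_laplacian h x) y = cinner x (neg_laplacian h y)"
  unfolding neg_laplacian_shift by (simp add: cinner_simps cinner_shift algebra_simps)

lemma bounded_linear_Rep: "bounded_linear (\<lambda>x. Rep_ell2Z x n)"
  by (rule bounded_linear_intro[where K = 1])
    (auto simp: plus_ell2Z.rep_eq scaleR_ell2Z.rep_eq norm_Rep_ell2Z_le)

lemma Rep_I_tensor:
  assumes "bounded_clinear A"
  shows "Rep_ell2Z (I_tensor A x) = (\<lambda>n. A (Rep_ell2Z x n))"
proof -
  obtain C where "\<And>x. norm (A x) \<le> C * norm x" using bounded_clinear_bound[OF assms] by blast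
  then show ?thesis unfolding I_tensor_def by (rule Rep_fibre_op)
qed

definition geom :: "complex \<Rightarrow> int \<Rightarrow> complex" where
  "geom \<rho> j = \<rho> ^ nat \<bar>j\<bar>"

text \<open>Convolution with \<open>\<rho> ^ |j|\<close>, written as a norm-convergent sum of shifts
  so that bounded operators can be applied term by term.\<close>

definition geom_conv :: "complex \<Rightarrow> 'a :: complex_inner ell2Z \<Rightarrow> 'a ell2Z" where
  "geom_conv \<rho> u = (\<Sum>\<^sub>\<infinity>j. geom \<rho> j *\<^sub>C shift j u)"

lemma geom_summable:
  assumes "cmod \<rho> < 1"
  shows "(\<lambda>j. cmod (geom \<rho> j)) summable_on UNIV"
  unfolding geom_def norm_power using assms
  by (intro summable_on_int_even summable_geometric) auto

lemma geom_conv_summable: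
  assumes \<rho>: "cmod \<rho> < 1"
  shows "(\<lambda>j. geom \<rho> j *\<^sub>C shift (j + k) (u :: 'a :: chilbert_space ell2Z)) summable_on UNIV"
proof (rule abs_summable_summable)
  show "(\<lambda>j. norm (geom \<rho> j *\<^sub>C shift (j + k) u)) summable_on UNIV"
    unfolding norm_scaleC norm_shift by (rule summable_on_cmult_left[OF geom_summable[OF \<rho>]])
qed

lemma shift_geom_conv:
  assumes \<rho>: "cmod \<rho> < 1"
  shows "shift k (geom_conv \<rho> u) = (\<Sum>\<^sub>\<infinity>j. geom \<rho> (j - k) *\<^sub>C shift j (u :: 'a :: chilbert_space ell2Z))"
    and "(\<lambda>j. geom \<rho> (j - k) *\<^sub>C shift j u) summable_on UNIV"
proof -
  have bij: "bij_betw (\<lambda>j. j + k) UNIV (UNIV :: int set)"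
    by (rule bij_betwI[of _ _ _ "\<lambda>n. n - k"]) auto
  show "(\<lambda>j. geom \<rho> (j - k) *\<^sub>C shift j u) summable_on UNIV"
    using summable_on_reindex_bij_betw[OF bij, of "\<lambda>j. geom \<rho> (j - k) *\<^sub>C shift j u"]
      geom_conv_summable[OF \<rho>, of k u] by simp
  have "shift k (geom_conv \<rho> u) = (\<Sum>\<^sub>\<infinity>j. shift k (geom \<rho> j *\<^sub>C shift j u))"
    unfolding geom_conv_def
    by (rule infsum_bounded_linear[OF bounded_clinearD(1)[OF bounded_clinear_shift], symmetric])
      (use geom_conv_summable[OF \<rho>, of 0 u] in simp)
  also have "\<dots> = (\<Sum>\<^sub>\<infinity>j. geom \<rho> (j + k - k) *\<^sub>C shift (j + k) u)"
    by (simp add: bounded_clinearD(2)[OF bounded_clinear_shift] shift_shift add.commute)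
  also have "\<dots> = (\<Sum>\<^sub>\<infinity>j. geom \<rho> (j - k) *\<^sub>C shift j u)" by (rule infsum_translate)
  finally show "shift k (geom_conv \<rho> u) = (\<Sum>\<^sub>\<infinity>j. geom \<rho> (j - k) *\<^sub>C shift j u)" .
qed

lemma infsum_diff:
  fixes f g :: "'i \<Rightarrow> 'b :: banach"
  assumes "f summable_on A" "g summable_on A"
  shows "(\<Sum>\<^sub>\<infinity>x\<in>A. f x - g x) = infsum f A - infsum g A" "(\<lambda>x. f x - g x) summable_on A"
proof -
  note m = bounded_linear_minus[OF bounded_linear_ident]
  show "(\<Sum>\<^sub>\<infinity>x\<in>A. f x - g x) = infsum f A - infsum g A"
    using infsum_add[OF assms(1) summable_on_bounded_linear[OF m assms(2)]]
      infsum_bounded_linear[OF m assms(2)] by simp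
  show "(\<lambda>x. f x - g x) summable_on A"
    using summable_on_add[OF assms(1) summable_on_bounded_linear[OF m assms(2)]] by simp
qed

text \<open>On each half-line the sequence solves the homogeneous equation; the kink at
  \<open>j = 0\<close> leaves the source \<open>1 / \<rho> - \<rho>\<close>.\<close>

lemma geom_recurrence:
  assumes "\<rho> \<noteq> 0"
  shows "(\<rho> + 1 / \<rho>) * geom \<rho> j - geom \<rho> (j + 1) - geom \<rho> (j - 1) = (if j = 0 then 1 / \<rho> - \<rho> else 0)"
proof -
  have *: "(\<rho> + 1 / \<rho>) * \<rho> ^ Suc k - \<rho> ^ Suc (Suc k) - \<rho> ^ k = 0" for k
    using assms by (simp add: field_simps)
  have **: "(\<rho> + 1 / \<rho>) * \<rho> ^ Suc k - \<rho> ^ k - \<rho> ^ Suc (Suc k) = 0" for k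
    using assms by (simp add: field_simps)
  consider "j = 0" | k where "j = int (Suc k)" | k where "j = - int (Suc k)"
    by (metis int_cases2 nat.exhaust of_nat_0 neg_0_equal_iff_equal)
  then show ?thesis
  proof cases
    case (2 k)
    then have "nat \<bar>j\<bar> = Suc k" "nat \<bar>j + 1\<bar> = Suc (Suc k)" "nat \<bar>j - 1\<bar> = k" by auto
    then show ?thesis using *[of k] 2 by (simp add: geom_def)
  next
    case (3 k)
    then have "nat \<bar>j\<bar> = Suc k" "nat \<bar>j - 1\<bar> = Suc (Suc k)" "nat \<bar>j + 1\<bar> = k" by auto
    then show ?thesis using **[of k] 3(1) by (simp only: geom_def) simp
  qed (simp add: geom_def)
qed

text \<open>Shifting the convolution shifts its coefficients, so the recurrence applies term by
  term: up to a factor, \<open>geom \<rho>\<close> is the Green function at energy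
  \<open>w\<close>.\<close>

lemma neg_laplacian_geom_conv:
  fixes u :: "'a :: chilbert_space ell2Z"
  assumes \<rho>: "cmod \<rho> < 1" "\<rho> \<noteq> 0" "\<rho> + 1 / \<rho> = 2 - of_real (h\<^sup>2) * w" and h: "h > 0"
  shows "neg_laplacian h (geom_conv \<rho> u)
    = (1 / of_real (h\<^sup>2) * (1 / \<rho> - \<rho>)) *\<^sub>C u + w *\<^sub>C geom_conv \<rho> u"
proof -
  let ?v = "geom_conv \<rho> u"
  let ?g = "\<lambda>k j. geom \<rho> (j - k) *\<^sub>C shift j u"
  have sv: "?v = (\<Sum>\<^sub>\<infinity>j. ?g 0 j)" using shift_geom_conv(1)[OF \<rho>(1), of 0 u] by simp
  note s = shift_geom_conv(2)[OF \<rho>(1), of _ u]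
  have bs: "bounded_linear (\<lambda>x :: 'a ell2Z. c *\<^sub>C x)" for c by (rule bounded_linear_scaleC_right)
  have "(\<rho> + 1 / \<rho>) *\<^sub>C ?v - shift (- 1) ?v - shift 1 ?v
      = (\<Sum>\<^sub>\<infinity>j. (\<rho> + 1 / \<rho>) *\<^sub>C ?g 0 j) - (\<Sum>\<^sub>\<infinity>j. ?g (- 1) j) - (\<Sum>\<^sub>\<infinity>j. ?g 1 j)"
    unfolding shift_geom_conv(1)[OF \<rho>(1)] infsum_bounded_linear[OF bs s] sv[symmetric] ..
  also have "\<dots> = (\<Sum>\<^sub>\<infinity>j. (\<rho> + 1 / \<rho>) *\<^sub>C ?g 0 j - ?g (- 1) j - ?g 1 j)"
    by (simp only: infsum_diff summable_on_bounded_linear[OF bs s] s)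
  also have "\<dots> = (\<Sum>\<^sub>\<infinity>j. ((\<rho> + 1 / \<rho>) * geom \<rho> j - geom \<rho> (j + 1) - geom \<rho> (j - 1)) *\<^sub>C shift j u)"
    by (simp add: scaleC_scaleC complex_vector.scale_left_diff_distrib)
  also have "\<dots> = (\<Sum>\<^sub>\<infinity>j\<in>{0}. (1 / \<rho> - \<rho>) *\<^sub>C shift j u)"
    unfolding geom_recurrence[OF \<rho>(2)] by (rule infsum_cong_neutral) auto
  finally have eq: "(\<rho> + 1 / \<rho>) *\<^sub>C ?v - shift (- 1) ?v - shift 1 ?v = (1 / \<rho> - \<rho>) *\<^sub>C u" by simp
  have two: "2 *\<^sub>R ?v = (\<rho> + 1 / \<rho>) *\<^sub>C ?v + (of_real (h\<^sup>2) * w) *\<^sub>C ?v"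
    unfolding scaleC_add_left[symmetric] \<rho>(3) by (simp add: scaleR_scaleC)
  have "2 *\<^sub>R ?v - shift (- 1) ?v - shift 1 ?v = (1 / \<rho> - \<rho>) *\<^sub>C u + (of_real (h\<^sup>2) * w) *\<^sub>C ?v"
    unfolding two eq[symmetric] by simp
  then show ?thesis
    using h unfolding neg_laplacian_shift
    by (simp add: scaleR_scaleC scaleC_add_right scaleC_scaleC)
qed

lemma neg_laplacian_I_tensor:
  assumes A: "bounded_clinear A"
  shows "neg_laplacian h (I_tensor A x) = I_tensor A (neg_laplacian h x)"
  unfolding Rep_ell2Z_inject[symmetric] neg_laplacian.rep_eq Rep_I_tensor[OF A]
  by (simp add: bounded_clinear_scaleR[OF A] bounded_clinear_diff[OF A])

lemma I_tensor_add: "bounded_clinear A \<Longrightarrow> I_tensor A (x + y) = I_tensor A x + I_tensor A y"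
  by (simp add: Rep_ell2Z_inject[symmetric] Rep_I_tensor plus_ell2Z.rep_eq bounded_clinear_add)

lemma I_tensor_scaleC: "bounded_clinear A \<Longrightarrow> I_tensor A (c *\<^sub>C x) = c *\<^sub>C I_tensor A x"
  by (simp add: Rep_ell2Z_inject[symmetric] Rep_I_tensor scaleC_ell2Z.rep_eq bounded_clinearD(2))

lemma bounded_clinear_neg_laplacian: "bounded_clinear (neg_laplacian h :: 'a :: complex_inner ell2Z \<Rightarrow> _)"
proof -
  have id: "bounded_clinear (\<lambda>x :: 'a ell2Z. x)" by (rule bounded_clinearI[where C = 1]) auto
  show ?thesis unfolding neg_laplacian_shift[abs_def]
    by (intro bounded_clinear_scaleR_fun bounded_clinear_diff_fun bounded_clinear_shift id)
qed

section \<open>Spectral projections of Q and the resolvent of the free operator\<close>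

lemma closed_subspace_orth_proj:
  fixes S :: "'a :: chilbert_space set"
  assumes S: "csubspace S" "closed S"
  shows "orth_proj S x \<in> S" "z \<in> S \<Longrightarrow> cinner z (x - orth_proj S x) = 0"
proof -
  obtain y where y: "y \<in> S" "\<And>z. z \<in> S \<Longrightarrow> cinner z (x - y) = 0" using orth_proj_exists[OF S] by blast
  have "orth_proj S x = y" by (rule orth_proj_unique[OF S(1) y])
  then show "orth_proj S x \<in> S" "z \<in> S \<Longrightarrow> cinner z (x - orth_proj S x) = 0" using y by auto
qed

lemma orth_proj_properties:
  fixes S :: "'a :: chilbert_space set"
  assumes S: "csubspace S" "closed S"
  shows "selfadjoint (orth_proj S)" "x \<in> S \<Longrightarrow> orth_proj S x = x" "norm (orth_proj S x) \<le> norm x"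
proof -
  let ?P = "orth_proj S"
  note P = closed_subspace_orth_proj[OF S]
  have add: "?P (x + y) = ?P x + ?P y" for x y
    proof (rule orth_proj_unique[OF S(1)])
    show "?P x + ?P y \<in> S" using P(1) complex_vector.subspace_add[OF S(1)] by blast
    show "cinner z (x + y - (?P x + ?P y)) = 0" if "z \<in> S" for z
      using P(2)[OF that, of x] P(2)[OF that, of y] by (simp add: cinner_simps)
  qed
  have scale: "?P (c *\<^sub>C x) = c *\<^sub>C ?P x" for c x
  proof (rule orth_proj_unique[OF S(1)])
    show "c *\<^sub>C ?P x \<in> S" using P(1) complex_vector.subspace_scale[OF S(1)] by blast
    show "cinner z (c *\<^sub>C x - c *\<^sub>C ?P x) = 0" if "z \<in> S" for z
      using P(2)[OF that, of x] by (simp add: cinner_simps)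
  qed
  have pp: "cinner (?P x) y = cinner (?P x) (?P y)" for x y
    using P(2)[OF P(1)[of x], of y] by (simp add: cinner_diff_right)
  have nrm: "norm (?P x) \<le> 1 * norm x" for x
  proof -
    have "(norm (?P x))\<^sup>2 = Re (cinner (?P x) x)" by (simp add: pp[of x x] norm_sq_eq_cinner)
    also have "\<dots> \<le> norm (?P x) * norm x" by (rule Re_cinner_le)
    finally show ?thesis by (cases "?P x = 0") (simp_all add: power2_eq_square)
  qed
  then show "norm (?P x) \<le> norm x" by simp
  have "cinner (?P x) y = cinner x (?P y)" for x y
    proof -
    have "cinner (?P x) y = cnj (cinner (?P y) (?P x))" unfolding pp[of x y] by (rule cinner_commute)
    also have "\<dots> = cnj (cinner (?P y) x)" unfolding pp[of y x] ..
    also have "\<dots> = cinner x (?P y)" by (rule cinner_commute[symmetric])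
    finally show ?thesis .
  qed
  then show "selfadjoint ?P" unfolding selfadjoint_def using bounded_clinearI[OF add scale nrm] by blast
  show "?P x = x" if "x \<in> S" for x
    by (rule orth_proj_unique[OF S(1) that]) simp
qed

lemma csubspace_eigenspace: "bounded_clinear Q \<Longrightarrow> csubspace (eigenspace Q m)"
  by (auto simp: complex_vector.subspace_def eigenspace_def bounded_clinear_zero bounded_clinear_add
      bounded_clinearD(2) scaleR_add_right scaleR_scaleC_commute)

lemma closed_eigenspace:
  assumes "bounded_clinear (Q :: 'a :: complex_inner \<Rightarrow> 'a)" shows "closed (eigenspace Q m)"
  unfolding eigenspace_def
  by (intro closed_Collect_eq linear_continuous_on bounded_clinearD(1)[OF assms] bounded_linear_scaleR_right)

lemma eigenspace_orthogonal:
  assumes Q: "selfadjoint Q" and "x \<in> eigenspace Q a" "y \<in> eigenspace Q b" "a \<noteq> b"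
  shows "cinner x y = 0"
proof -
  have "of_real a * cinner x y = of_real b * cinner x y"
    using selfadjointD(2)[OF Q, of x y] assms by (simp add: eigenspace_def cinner_simps)
  then show ?thesis using assms(4) by simp
qed

lemma spectral_data_finite:
  assumes "spectral_data Q IQ \<mu>"
  shows "selfadjoint Q" "finite IQ" "inj_on \<mu> IQ"
  using assms by (auto simp: spectral_data_def)

text \<open>Eigenvectors for distinct eigenvalues are orthogonal, so the components of any
  decomposition into eigenvectors are the orthogonal projections.\<close>

lemma spectral_data_sum_proj:
  fixes Q :: "'g :: chilbert_space \<Rightarrow> 'g"
  assumes sd: "spectral_data Q IQ \<mu>"
  shows "(\<Sum>s\<in>IQ. orth_proj (eigenspace Q (\<mu> s)) x) = x"
proof -
  note Q = spectral_data_finite[OF sd]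
  note Qb = selfadjointD(1)[OF Q(1)]
  have "\<exists>y. (\<forall>s\<in>IQ. y s \<in> eigenspace Q (\<mu> s)) \<and> x = (\<Sum>s\<in>IQ. y s)"
  proof (cases "Q = (\<lambda>_. 0)")
    case True
    then have "IQ = {0}" "\<mu> 0 = 0" using sd by (auto simp: spectral_data_def)
    then show ?thesis using True by (intro exI[of _ "\<lambda>_. x"]) (simp add: eigenspace_def)
  next
    case False
    then show ?thesis using sd by (simp add: spectral_data_def)
  qed
  then obtain y where y: "\<And>s. s \<in> IQ \<Longrightarrow> y s \<in> eigenspace Q (\<mu> s)" "x = (\<Sum>s\<in>IQ. y s)" by blast
  have "orth_proj (eigenspace Q (\<mu> s)) x = y s" if s: "s \<in> IQ" for s
  proof (rule orth_proj_unique[OF csubspace_eigenspace[OF Qb] y(1)[OF s]])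
    fix z assume z: "z \<in> eigenspace Q (\<mu> s)"
    have "cinner z (y t) = 0" if "t \<in> IQ - {s}" for t
      using that s Q(3) by (intro eigenspace_orthogonal[OF Q(1) z y(1)]) (auto dest: inj_onD)
    then have "(\<Sum>t\<in>IQ - {s}. cinner z (y t)) = 0" by simp
    moreover have "x - y s = (\<Sum>t\<in>IQ - {s}. y t)"
      unfolding y(2) using sum.remove[OF Q(2) s, of y] by simp
    ultimately show "cinner z (x - y s) = 0" by (simp add: cinner_sum_right)
  qed
  then show ?thesis using y(2) by simp
qed

lemma Q_orth_proj:
  fixes Q :: "'g :: chilbert_space \<Rightarrow> 'g"
  assumes "bounded_clinear Q"
  shows "Q (orth_proj (eigenspace Q m) x) = m *\<^sub>R orth_proj (eigenspace Q m) x"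
  using closed_subspace_orth_proj(1)[OF csubspace_eigenspace[OF assms, of m] closed_eigenspace[OF assms, of m], of x]
  by (simp add: eigenspace_def)

lemma Rep_sum: "Rep_ell2Z (\<Sum>i\<in>I. f i) n = (\<Sum>i\<in>I. Rep_ell2Z (f i) n)"
  by (induction I rule: infinite_finite_induct) (simp_all add: zero_ell2Z.rep_eq plus_ell2Z.rep_eq)

lemma bounded_clinear_I_tensor:
  fixes A :: "'a :: complex_inner \<Rightarrow> 'a"
  assumes A: "bounded_clinear A"
  shows "bounded_clinear (I_tensor A)"
proof -
  obtain C where C: "C > 0" "\<And>x. norm (A x) \<le> C * norm x" using bounded_clinear_bound[OF A] by blast
  show ?thesis
  proof (rule bounded_clinearI[where C = C])
    show "I_tensor A (x + y) = I_tensor A x + I_tensor A y" for x y by (rule I_tensor_add[OF A])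
    show "I_tensor A (c *\<^sub>C x) = c *\<^sub>C I_tensor A x" for c x by (rule I_tensor_scaleC[OF A])
    fix x :: "'a ell2Z"
    have "(norm (I_tensor A x))\<^sup>2 \<le> (\<Sum>\<^sub>\<infinity>n. C\<^sup>2 * (norm (Rep_ell2Z x n))\<^sup>2)"
      unfolding norm_ell2Z_sq
    proof (intro infsum_mono l2_Rep summable_on_cmult_right)
      show "(norm (Rep_ell2Z (I_tensor A x) n))\<^sup>2 \<le> C\<^sup>2 * (norm (Rep_ell2Z x n))\<^sup>2" for n
        using power_mono[OF C(2)[of "Rep_ell2Z x n"] norm_ge_zero, of 2]
        by (simp add: Rep_I_tensor[OF A] power_mult_distrib)
    qed
    also have "\<dots> = (C * norm x)\<^sup>2"
      by (simp add: infsum_cmult_right' norm_ell2Z_sq[symmetric] power_mult_distrib)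
    finally show "norm (I_tensor A x) \<le> C * norm x"
      by (rule power2_le_imp_le) (use C(1) in simp)
  qed
qed

lemma cinner_I_tensor:
  assumes A: "selfadjoint A"
  shows "cinner (I_tensor A x) y = cinner x (I_tensor A y)"
  by (simp add: cinner_ell2Z_def Rep_I_tensor[OF selfadjointD(1)[OF A]] selfadjointD(2)[OF A])

text \<open>On the range of each spectral projection \<open>Q\<close> is the number
  \<open>\<mu> s\<close>, which shifts the energy of the lattice Green function. Their sum is a
  preimage of \<open>u\<close>.\<close>

lemma resolvent_H_free:
  fixes Q :: "'g :: chilbert_space \<Rightarrow> 'g"
  assumes h: "h > 0" and sd: "spectral_data Q IQ \<mu>" and z: "Im z \<noteq> 0"
    and \<rho>: "\<And>s. s \<in> IQ \<Longrightarrow> cmod (\<rho> s) < 1 \<and> \<rho> s \<noteq> 0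
      \<and> \<rho> s + 1 / \<rho> s = 2 - of_real (h\<^sup>2) * (z - of_real (\<mu> s))"
  shows "resolvent (H_free h Q) z u = (\<Sum>s\<in>IQ. (of_real (h\<^sup>2) / (1 / \<rho> s - \<rho> s)) *\<^sub>C
      I_tensor (orth_proj (eigenspace Q (\<mu> s))) (geom_conv (\<rho> s) u))"
proof -
  note Q = spectral_data_finite[OF sd]
  note Qb = selfadjointD(1)[OF Q(1)]
  define \<pi> where "\<pi> s = orth_proj (eigenspace Q (\<mu> s))" for s
  have \<pi>b: "bounded_clinear (\<pi> s)" for s
    unfolding \<pi>_def
    by (rule selfadjointD(1)[OF orth_proj_properties(1)[OF csubspace_eigenspace[OF Qb] closed_eigenspace[OF Qb]]])
  define c where "c s = of_real (h\<^sup>2) / (1 / \<rho> s - \<rho> s)" for s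
  define H where "H = H_free h Q"
  have Hb: "bounded_clinear H"
    unfolding H_def H_free_def[abs_def]
    by (intro bounded_clinear_add_fun bounded_clinear_neg_laplacian bounded_clinear_I_tensor Qb)
  have Hsa: "cinner (H x) y = cinner x (H y)" for x y
    by (simp add: H_def H_free_def cinner_simps cinner_neg_laplacian cinner_I_tensor[OF Q(1)])
  \<comment> \<open>Symmetry makes \<open><x, H x>\<close> real, while \<open>Im z\<close> is
    nonzero; injectivity makes \<open>inv\<close> return the preimage exhibited below.\<close>
  have inj: "inj (\<lambda>x. H x - z *\<^sub>C x)"
  proof (rule injI)
    fix x y assume "H x - z *\<^sub>C x = H y - z *\<^sub>C y"
    then have "H (x - y) = z *\<^sub>C (x - y)"
      by (simp add: bounded_clinear_diff[OF Hb] complex_vector.scale_right_diff_distrib algebra_simps)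
    then have 1: "cinner (x - y) (H (x - y)) = z * cinner (x - y) (x - y)" by (simp add: cinner_scaleC_right)
    have "cinner (x - y) (H (x - y)) = cnj (cinner (x - y) (H (x - y)))"
      using cinner_commute[of "x - y" "H (x - y)"] by (simp only: Hsa)
    then have "Im (cinner (x - y) (H (x - y))) = 0" by (simp add: complex_eq_iff)
    then have "Im z * (norm (x - y))\<^sup>2 = 0" unfolding 1 cinner_self by simp
    then show "x = y" using z by simp
  qed
  have ev: "H (c s *\<^sub>C I_tensor (\<pi> s) (geom_conv (\<rho> s) u))
      = I_tensor (\<pi> s) u + z *\<^sub>C (c s *\<^sub>C I_tensor (\<pi> s) (geom_conv (\<rho> s) u))" if s: "s \<in> IQ" for s
  proof -
    let ?v = "geom_conv (\<rho> s) u"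
    have ne: "1 / \<rho> s - \<rho> s \<noteq> 0"
    proof
      assume "1 / \<rho> s - \<rho> s = 0"
      then have "\<rho> s * \<rho> s = 1" using \<rho>[OF s] by (simp add: field_simps)
      then have "cmod (\<rho> s) * cmod (\<rho> s) = 1" by (metis norm_mult norm_one)
      moreover have "cmod (\<rho> s) * cmod (\<rho> s) < 1 * 1" using \<rho>[OF s] by (intro mult_strict_mono') auto
      ultimately show False by simp
    qed
    have cc: "c s * (1 / of_real (h\<^sup>2) * (1 / \<rho> s - \<rho> s)) = 1" using ne h by (simp add: c_def)
    have "neg_laplacian h ?v = (1 / of_real (h\<^sup>2) * (1 / \<rho> s - \<rho> s)) *\<^sub>C u + (z - of_real (\<mu> s)) *\<^sub>C ?v"
      using \<rho>[OF s] h by (intro neg_laplacian_geom_conv) auto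
    then have "neg_laplacian h (c s *\<^sub>C I_tensor (\<pi> s) ?v)
        = I_tensor (\<pi> s) u + (c s * (z - of_real (\<mu> s))) *\<^sub>C I_tensor (\<pi> s) ?v"
      by (simp only: bounded_clinearD(2)[OF bounded_clinear_neg_laplacian] neg_laplacian_I_tensor[OF \<pi>b]
          I_tensor_add[OF \<pi>b] I_tensor_scaleC[OF \<pi>b] scaleC_add_right scaleC_scaleC cc scaleC_one)
    moreover have "I_tensor Q (c s *\<^sub>C I_tensor (\<pi> s) ?v) = (c s * of_real (\<mu> s)) *\<^sub>C I_tensor (\<pi> s) ?v"
      unfolding Rep_ell2Z_inject[symmetric] Rep_I_tensor[OF Qb] Rep_I_tensor[OF \<pi>b] scaleC_ell2Z.rep_eq
      by (simp add: bounded_clinearD(2)[OF Qb] \<pi>_def Q_orth_proj[OF Qb] scaleR_scaleC scaleC_scaleC)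
    ultimately have "H (c s *\<^sub>C I_tensor (\<pi> s) ?v) = I_tensor (\<pi> s) u
        + ((c s * (z - of_real (\<mu> s))) *\<^sub>C I_tensor (\<pi> s) ?v + (c s * of_real (\<mu> s)) *\<^sub>C I_tensor (\<pi> s) ?v)"
      by (simp add: H_def H_free_def)
    also have "(c s * (z - of_real (\<mu> s))) *\<^sub>C I_tensor (\<pi> s) ?v + (c s * of_real (\<mu> s)) *\<^sub>C I_tensor (\<pi> s) ?v
        = z *\<^sub>C (c s *\<^sub>C I_tensor (\<pi> s) ?v)"
      unfolding scaleC_add_left[symmetric] scaleC_scaleC by (simp add: algebra_simps)
    finally show ?thesis .
  qed
  have id: "(\<Sum>s\<in>IQ. I_tensor (\<pi> s) u) = u"
    unfolding Rep_ell2Z_inject[symmetric] fun_eq_iff Rep_sum Rep_I_tensor[OF \<pi>b]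
    unfolding \<pi>_def spectral_data_sum_proj[OF sd] by simp
  define v where "v = (\<Sum>s\<in>IQ. c s *\<^sub>C I_tensor (\<pi> s) (geom_conv (\<rho> s) u))"
  have "H v = (\<Sum>s\<in>IQ. I_tensor (\<pi> s) u + z *\<^sub>C (c s *\<^sub>C I_tensor (\<pi> s) (geom_conv (\<rho> s) u)))"
    unfolding v_def bounded_clinear_sum[OF Hb] by (rule sum.cong[OF refl ev])
  also have "\<dots> = u + z *\<^sub>C v"
    unfolding sum.distrib id v_def complex_vector.scale_sum_right ..
  finally have "H v - z *\<^sub>C v = u" by simp
  then have "inv (\<lambda>x. H x - z *\<^sub>C x) u = v" using inv_f_f[OF inj, of v] by simp
  then show ?thesis by (simp add: resolvent_def H_def v_def c_def \<pi>_def)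
qed

lemma Rep_geom_conv:
  fixes u :: "'a :: chilbert_space ell2Z"
  assumes \<rho>: "cmod \<rho> < 1"
  shows "Rep_ell2Z (geom_conv \<rho> u) n = (\<Sum>\<^sub>\<infinity>m. geom \<rho> (n - m) *\<^sub>C Rep_ell2Z u m)"
proof -
  have "Rep_ell2Z (geom_conv \<rho> u) n = (\<Sum>\<^sub>\<infinity>j. Rep_ell2Z (geom \<rho> j *\<^sub>C shift j u) n)"
    unfolding geom_conv_def
    by (rule infsum_bounded_linear[OF bounded_linear_Rep, symmetric])
      (use geom_conv_summable[OF \<rho>, of 0 u] in simp)
  also have "\<dots> = (\<Sum>\<^sub>\<infinity>j. geom \<rho> j *\<^sub>C Rep_ell2Z u (n - j))"
    by (simp add: scaleC_ell2Z.rep_eq shift.rep_eq)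
  also have "\<dots> = (\<Sum>\<^sub>\<infinity>m. geom \<rho> (n - m) *\<^sub>C Rep_ell2Z u (n - (n - m)))"
    by (rule infsum_reindex_bij_betw[symmetric]) (rule bij_betwI[of _ _ _ "\<lambda>m. n - m"]; simp)
  finally show ?thesis by simp
qed

lemma Rep_Mpsi_tensor:
  assumes A: "bounded_clinear A" and \<nu>: "0 \<le> \<nu>0"
  shows "Rep_ell2Z (Mpsi_tensor \<nu>0 A x) = (\<lambda>n. psi \<nu>0 n *\<^sub>R A (Rep_ell2Z x n))"
proof -
  obtain C where C: "C > 0" "\<And>x. norm (A x) \<le> C * norm x" using bounded_clinear_bound[OF A] by blast
  have "norm (psi \<nu>0 n *\<^sub>R A x) \<le> C * norm x" for n x
  proof -
    have "psi \<nu>0 n * norm (A x) \<le> 1 * norm (A x)"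
      using psi_le_1[OF \<nu>, of n] by (intro mult_right_mono) auto
    then show ?thesis using C(2)[of x] by (simp add: psi_nonneg)
  qed
  then show ?thesis unfolding Mpsi_tensor_def by (rule Rep_fibre_op)
qed

lemma square_summable_psi:
  assumes \<nu>: "\<nu>0 > 3" and f: "\<And>n. cmod (f n) \<le> 1"
  shows "square_summable (\<lambda>n. of_real (psi \<nu>0 n) * f n)"
  unfolding square_summable_def
proof (rule summable_on_comparison_test[OF psi_weight_summable[OF \<nu>]])
  fix n
  have "(cmod (f n))\<^sup>2 \<le> 1" using f[of n] by (simp add: power_le_one)
  also have "1 \<le> (1 + \<bar>real_of_int n\<bar>)\<^sup>2" by simp
  finally show "(cmod (of_real (psi \<nu>0 n) * f n))\<^sup>2 \<le> (psi \<nu>0 n)\<^sup>2 * (1 + \<bar>real_of_int n\<bar>)\<^sup>2"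
    by (simp add: norm_mult power_mult_distrib psi_nonneg mult_left_mono)
qed simp

lemma cmod_geom_le: "cmod \<rho> \<le> 1 \<Longrightarrow> cmod (geom \<rho> j) \<le> 1"
  by (simp add: geom_def norm_power power_le_one)

text \<open>Weights and Green function act on the lattice only, \<open>K\<close>,
  \<open>\<pi>\<close> and \<open>L\<close> on the fibre only, so the product collects into one
  kernel and one fibre operator.\<close>

lemma Mpsi_geom_conv:
  fixes K :: "'g :: chilbert_space \<Rightarrow> 'g"
  assumes K: "bounded_clinear K" and L: "bounded_clinear L" and \<pi>: "bounded_clinear \<pi>"
    and \<nu>: "\<nu>0 > 3" and \<rho>: "cmod \<rho> < 1"
  shows "Mpsi_tensor \<nu>0 K (c *\<^sub>C I_tensor \<pi> (geom_conv \<rho> (Mpsi_tensor \<nu>0 L y)))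
    = kernel_op (weighted \<nu>0 (\<lambda>n m. c * geom \<rho> (n - m))) (\<lambda>x. K (\<pi> (L x))) y"
proof -
  have \<nu>': "0 \<le> \<nu>0" using \<nu> by simp
  have KL: "bounded_clinear (\<lambda>x. K (\<pi> (L x)))"
    using bounded_clinear_compose[OF K bounded_clinear_compose[OF \<pi> L]] by (simp add: o_def)
  have l2: "l2_kernel (weighted \<nu>0 (\<lambda>n m. c * geom \<rho> (n - m)))"
  proof (rule weighted_kernel(1)[OF \<nu>])
    fix n m
    have "cmod (c * geom \<rho> (n - m)) \<le> cmod c * 1"
      unfolding norm_mult using cmod_geom_le[of \<rho> "n - m"] \<rho> by (intro mult_left_mono) auto
    also have "\<dots> \<le> cmod c * (1 + \<bar>real_of_int (n - m)\<bar>)" by (intro mult_left_mono) auto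
    finally show "cmod (c * geom \<rho> (n - m)) \<le> cmod c * (1 + \<bar>real_of_int (n - m)\<bar>)" .
  qed
  show ?thesis
    unfolding Rep_ell2Z_inject[symmetric] Rep_Mpsi_tensor[OF K \<nu>'] Rep_kernel_op[OF KL l2]
      scaleC_ell2Z.rep_eq Rep_I_tensor[OF \<pi>]
  proof
    fix n
    define f where "f m = of_real (psi \<nu>0 m) * geom \<rho> (n - m)" for m
    have f: "square_summable f"
      unfolding f_def[abs_def] using cmod_geom_le[of \<rho>] \<rho> by (intro square_summable_psi[OF \<nu>]) auto
    have "Rep_ell2Z (geom_conv \<rho> (Mpsi_tensor \<nu>0 L y)) n = (\<Sum>\<^sub>\<infinity>m. L (f m *\<^sub>C Rep_ell2Z y m))"
      unfolding Rep_geom_conv[OF \<rho>] Rep_Mpsi_tensor[OF L \<nu>']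
      by (simp add: f_def bounded_clinearD(2)[OF L] scaleR_scaleC scaleC_scaleC mult.commute)
    also have "\<dots> = L (pairing f y)"
      unfolding pairing_def
      by (rule infsum_bounded_linear[OF bounded_clinearD(1)[OF L] pairing_summable[OF f]])
    finally have 1: "Rep_ell2Z (geom_conv \<rho> (Mpsi_tensor \<nu>0 L y)) n = L (pairing f y)" .
    have "weighted \<nu>0 (\<lambda>n m. c * geom \<rho> (n - m)) n = (\<lambda>m. (of_real (psi \<nu>0 n) * c) * f m)"
      by (simp add: weighted_def f_def mult_ac fun_eq_iff)
    then have "pairing (weighted \<nu>0 (\<lambda>n m. c * geom \<rho> (n - m)) n) y = (of_real (psi \<nu>0 n) * c) *\<^sub>C pairing f y"
      by (simp only: pairing_cmult[OF f])
    then show "psi \<nu>0 n *\<^sub>R K (c *\<^sub>C \<pi> (Rep_ell2Z (geom_conv \<rho> (Mpsi_tensor \<nu>0 L y)) n))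
        = K (\<pi> (L (pairing (weighted \<nu>0 (\<lambda>n m. c * geom \<rho> (n - m)) n) y)))"
      unfolding 1 by (simp add: bounded_clinearD(2)[OF K] bounded_clinearD(2)[OF L]
          bounded_clinearD(2)[OF \<pi>] scaleR_scaleC scaleC_scaleC)
  qed
qed

section \<open>Boundary values\<close>

text \<open>
  With \<open>e\<close> the distance of the energy to the eigenvalue of \<open>Q\<close>, \<open>\<rho>\<close> is the limit from the upper
  half-plane of the root in the unit disc of \<open>\<rho> + 1 / \<rho> = 2 - h\<^sup>2 e\<close>.
\<close>
definition boundary_root :: "real \<Rightarrow> real \<Rightarrow> complex \<Rightarrow> bool" where
  "boundary_root h e \<rho> \<longleftrightarrow> \<rho> \<noteq> 0 \<and> \<rho> + 1 / \<rho> = of_real (2 - h\<^sup>2 * e)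
    \<and> ((\<exists>p. \<rho> = of_real p \<and> \<bar>p\<bar> < 1) \<or> (cmod \<rho> = 1 \<and> Im \<rho> > 0))"

lemma csqrt_tendsto:
  assumes "(f \<longlongrightarrow> of_real x) F" "x > 0"
  shows "((\<lambda>t. csqrt (f t)) \<longlongrightarrow> of_real (sqrt x)) F"
proof -
  have "isCont csqrt (of_real x)"
    using assms(2) by (intro continuous_at_csqrt) (auto simp: complex_nonpos_Reals_iff)
  from isCont_tendsto_compose[OF this assms(1)] show ?thesis
    using assms(2) by (simp add: csqrt_of_real_nonneg)
qed

text \<open>The roots are \<open>a \<plusminus> sqrt (a^2 - 1)\<close>. Inside the band
  (\<open>|b| < 1\<close>) the limit lies on the unit circle and the chosen root has to be shown to
  approach it from within; outside the band the smaller real root stays in the disc by continuity.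
  In both cases the radicand is signed so that its limit is positive, away from the cut of
  \<open>csqrt\<close>.\<close>

lemma boundary_root_exists:
  assumes h: "h > 0" and e: "e \<noteq> 0" "e \<noteq> 4 / h\<^sup>2"
  shows "\<exists>\<rho> r. boundary_root h e \<rho> \<and> (r \<longlongrightarrow> \<rho>) (at_right 0) \<and>
    (\<forall>\<^sub>F \<epsilon> in at_right 0. cmod (r \<epsilon>) < 1 \<and> r \<epsilon> \<noteq> 0
      \<and> r \<epsilon> + 1 / r \<epsilon> = 2 - of_real (h\<^sup>2) * Complex e \<epsilon>)"
proof -
  \<comment> \<open>Half of \<open>\<rho> + 1 / \<rho>\<close>. Its limit \<open>b\<close> equals
    \<open>\<plusminus> 1\<close> exactly at the two excluded thresholds.\<close>
  define a where "a \<epsilon> = 1 - of_real (h\<^sup>2 / 2) * Complex e \<epsilon>" for \<epsilon> :: real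
  define b where "b = 1 - h\<^sup>2 * e / 2"
  have b1: "b \<noteq> 1" "b \<noteq> - 1" using h e by (auto simp: b_def field_simps)
  have lim: "(a \<longlongrightarrow> of_real b) (at_right 0)"
  proof -
    have "((\<lambda>\<epsilon>. 1 - of_real (h\<^sup>2 / 2) * Complex e \<epsilon>) \<longlongrightarrow> 1 - of_real (h\<^sup>2 / 2) * Complex e 0) (at_right 0)"
      by (intro tendsto_intros tendsto_Complex)
    moreover have "1 - of_real (h\<^sup>2 / 2) * Complex e 0 = of_real b" by (simp add: b_def complex_eq_iff)
    ultimately show ?thesis by (simp add: a_def[abs_def])
  qed
  have a2: "2 * a \<epsilon> = 2 - of_real (h\<^sup>2) * Complex e \<epsilon>" for \<epsilon> by (simp add: a_def complex_eq_iff)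
  have b2: "2 * b = 2 - h\<^sup>2 * e" by (simp add: b_def)
  have inv: "u \<noteq> 0 \<and> 1 / u = v \<and> u + 1 / u = u + v" if "u * v = 1" for u v :: complex
    proof -
    have "u \<noteq> 0" using that by auto
    then show ?thesis using that by (simp add: divide_eq_eq mult.commute)
  qed
  have small: "1 - b\<^sup>2 > 0 \<longleftrightarrow> \<bar>b\<bar> < 1" using abs_square_less_1[of b] by simp
  show ?thesis
  proof (cases "\<bar>b\<bar> < 1")
    case True
    define q where "q = sqrt (1 - b\<^sup>2)"
    have q: "q > 0" "q\<^sup>2 = 1 - b\<^sup>2" using True small by (auto simp: q_def)
    define \<rho> where "\<rho> = of_real b + \<i> * of_real q"
    define r where "r \<epsilon> = a \<epsilon> + \<i> * csqrt (1 - (a \<epsilon>)\<^sup>2)" for \<epsilon>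
    have "((\<lambda>\<epsilon>. 1 - (a \<epsilon>)\<^sup>2) \<longlongrightarrow> 1 - (of_real b)\<^sup>2) (at_right 0)" by (intro tendsto_intros lim)
    then have "((\<lambda>\<epsilon>. 1 - (a \<epsilon>)\<^sup>2) \<longlongrightarrow> of_real (1 - b\<^sup>2)) (at_right 0)" by simp
    then have "((\<lambda>\<epsilon>. csqrt (1 - (a \<epsilon>)\<^sup>2)) \<longlongrightarrow> of_real q) (at_right 0)"
      unfolding q_def using True small by (intro csqrt_tendsto) auto
    then have rlim: "(r \<longlongrightarrow> \<rho>) (at_right 0)" unfolding r_def[abs_def] \<rho>_def by (intro tendsto_intros lim)
    have ru: "r \<epsilon> * (a \<epsilon> - \<i> * csqrt (1 - (a \<epsilon>)\<^sup>2)) = 1" for \<epsilon>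
    proof -
      have "r \<epsilon> * (a \<epsilon> - \<i> * csqrt (1 - (a \<epsilon>)\<^sup>2)) = (a \<epsilon>)\<^sup>2 + (csqrt (1 - (a \<epsilon>)\<^sup>2))\<^sup>2"
        by (simp add: r_def power2_eq_square algebra_simps)
      then show ?thesis by simp
    qed
    have sum: "r \<epsilon> \<noteq> 0 \<and> r \<epsilon> + 1 / r \<epsilon> = 2 - of_real (h\<^sup>2) * Complex e \<epsilon>" for \<epsilon>
    proof -
      have "r \<epsilon> + (a \<epsilon> - \<i> * csqrt (1 - (a \<epsilon>)\<^sup>2)) = 2 * a \<epsilon>" by (simp add: r_def)
      then show ?thesis using inv[OF ru[of \<epsilon>]] unfolding a2[symmetric] by metis
    qed
    have "\<forall>\<^sub>F \<epsilon> in at_right 0. Im (r \<epsilon>) > 0"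
      using order_tendstoD(1)[OF tendsto_Im[OF rlim], of 0] q(1) by (simp add: \<rho>_def)
    moreover have "\<forall>\<^sub>F \<epsilon> in at_right 0. \<epsilon> > (0 :: real)" by (simp add: eventually_at_right_less)
    ultimately have "\<forall>\<^sub>F \<epsilon> in at_right 0. cmod (r \<epsilon>) < 1"
    proof eventually_elim
      case (elim \<epsilon>)
      have r0: "r \<epsilon> \<noteq> 0" using sum by blast
      have "1 / r \<epsilon> = cnj (r \<epsilon>) / of_real ((cmod (r \<epsilon>))\<^sup>2)"
        unfolding complex_norm_square using r0 by simp
      then have "Im (1 / r \<epsilon>) = - Im (r \<epsilon>) / (cmod (r \<epsilon>))\<^sup>2" by simp
      \<comment> \<open>As \<open>Im (1 / r) = - Im r / |r|^2\<close>, a negative sum with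
        \<open>Im r > 0\<close> forces \<open>|r| < 1\<close>.\<close>
      moreover have "Im (r \<epsilon> + 1 / r \<epsilon>) = - (h\<^sup>2 * \<epsilon>)" using sum[of \<epsilon>] by simp
      ultimately have "Im (r \<epsilon>) - Im (r \<epsilon>) / (cmod (r \<epsilon>))\<^sup>2 < 0" using elim(2) h by simp
      then have "Im (r \<epsilon>) * (cmod (r \<epsilon>))\<^sup>2 < Im (r \<epsilon>) * 1"
        using r0 by (simp add: less_divide_eq)
      then have "(cmod (r \<epsilon>))\<^sup>2 < 1" using elim(1) by simp
      then show ?case using abs_square_less_1[of "cmod (r \<epsilon>)"] by simp
    qed
    moreover have "boundary_root h e \<rho>"
    proof -
      have "\<rho> * (of_real b - \<i> * of_real q) = of_real (b\<^sup>2 + q\<^sup>2)"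
        by (simp add: \<rho>_def power2_eq_square algebra_simps)
      then have "\<rho> * (of_real b - \<i> * of_real q) = 1" using q(2) by simp
      from inv[OF this] have "\<rho> \<noteq> 0" "\<rho> + 1 / \<rho> = 2 * of_real b" by (auto simp: \<rho>_def)
      moreover have "cmod \<rho> = 1" using q(2) by (simp add: \<rho>_def cmod_def)
      moreover have "2 * of_real b = (of_real (2 - h\<^sup>2 * e) :: complex)" unfolding b2[symmetric] by simp
      ultimately show ?thesis using q(1) by (simp add: boundary_root_def \<rho>_def)
    qed
    ultimately show ?thesis using rlim sum by (intro exI[of _ \<rho>] exI[of _ r]) (auto elim: eventually_mono)
  next
    case False
    then have big: "\<bar>b\<bar> > 1" using b1 by auto
    then have bb: "b\<^sup>2 - 1 > 0" using one_less_power[of "\<bar>b\<bar>" 2] by simp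
    define q where "q = sqrt (b\<^sup>2 - 1)"
    have q: "q > 0" "q\<^sup>2 = b\<^sup>2 - 1" using bb by (auto simp: q_def)
    \<comment> \<open>The sign that subtracts \<open>q\<close> from \<open>|b|\<close> and so
      selects the root of smaller modulus.\<close>
    define \<sigma> where "\<sigma> = sgn b"
    have \<sigma>: "\<sigma> * \<sigma> = 1" "\<sigma> * b = \<bar>b\<bar>" using big by (auto simp: \<sigma>_def sgn_if)
    define p where "p = b - \<sigma> * q"
    define r where "r \<epsilon> = a \<epsilon> - of_real \<sigma> * csqrt ((a \<epsilon>)\<^sup>2 - 1)" for \<epsilon>
    have "((\<lambda>\<epsilon>. (a \<epsilon>)\<^sup>2 - 1) \<longlongrightarrow> (of_real b)\<^sup>2 - 1) (at_right 0)" by (intro tendsto_intros lim)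
    then have "((\<lambda>\<epsilon>. (a \<epsilon>)\<^sup>2 - 1) \<longlongrightarrow> of_real (b\<^sup>2 - 1)) (at_right 0)" by simp
    then have "((\<lambda>\<epsilon>. csqrt ((a \<epsilon>)\<^sup>2 - 1)) \<longlongrightarrow> of_real q) (at_right 0)"
      unfolding q_def using bb by (intro csqrt_tendsto) auto
    then have "(r \<longlongrightarrow> of_real b - of_real \<sigma> * of_real q) (at_right 0)"
      unfolding r_def[abs_def] by (intro tendsto_intros lim)
    then have rlim: "(r \<longlongrightarrow> of_real p) (at_right 0)" by (simp add: p_def)
    have \<sigma>c: "(of_real \<sigma> :: complex) * of_real \<sigma> = 1" using \<sigma>(1) by (simp flip: of_real_mult)
    have ru: "r \<epsilon> * (a \<epsilon> + of_real \<sigma> * csqrt ((a \<epsilon>)\<^sup>2 - 1)) = 1" for \<epsilon>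
    proof -
      have "r \<epsilon> * (a \<epsilon> + of_real \<sigma> * csqrt ((a \<epsilon>)\<^sup>2 - 1))
          = (a \<epsilon>)\<^sup>2 - (of_real \<sigma> * of_real \<sigma>) * (csqrt ((a \<epsilon>)\<^sup>2 - 1))\<^sup>2"
        by (simp add: r_def power2_eq_square algebra_simps)
      then show ?thesis unfolding \<sigma>c by simp
    qed
    have sum: "r \<epsilon> \<noteq> 0 \<and> r \<epsilon> + 1 / r \<epsilon> = 2 - of_real (h\<^sup>2) * Complex e \<epsilon>" for \<epsilon>
    proof -
      have "r \<epsilon> + (a \<epsilon> + of_real \<sigma> * csqrt ((a \<epsilon>)\<^sup>2 - 1)) = 2 * a \<epsilon>" by (simp add: r_def)
      then show ?thesis using inv[OF ru[of \<epsilon>]] unfolding a2[symmetric] by metis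
    qed
    have pu: "p * (b + \<sigma> * q) = 1"
    proof -
      have "p * (b + \<sigma> * q) = b\<^sup>2 - (\<sigma> * \<sigma>) * q\<^sup>2" by (simp add: p_def power2_eq_square algebra_simps)
      then show ?thesis unfolding \<sigma>(1) q(2) by simp
    qed
    have p1: "\<bar>p\<bar> < 1"
    proof (rule ccontr)
      assume "\<not> ?thesis"
      then have "1 \<le> \<bar>p\<bar>" by simp
      have "\<sigma> * (b + \<sigma> * q) = \<bar>b\<bar> + q" using \<sigma> by (simp add: distrib_left mult.assoc[symmetric])
      then have "\<bar>\<sigma> * (b + \<sigma> * q)\<bar> > 1" using big q(1) by simp
      moreover have "\<bar>\<sigma>\<bar> = 1" using big by (auto simp: \<sigma>_def sgn_if)
      ultimately have "\<bar>b + \<sigma> * q\<bar> > 1" by (simp add: abs_mult)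
      moreover have "1 * \<bar>b + \<sigma> * q\<bar> \<le> \<bar>p\<bar> * \<bar>b + \<sigma> * q\<bar>" using \<open>1 \<le> \<bar>p\<bar>\<close> by (rule mult_right_mono) simp
      moreover have "\<bar>p\<bar> * \<bar>b + \<sigma> * q\<bar> = 1" using pu by (simp flip: abs_mult)
      ultimately show False by simp
    qed
    have "\<forall>\<^sub>F \<epsilon> in at_right 0. cmod (r \<epsilon>) < 1"
      using order_tendstoD(2)[OF tendsto_norm[OF rlim], of 1] p1 by simp
    moreover have "boundary_root h e (of_real p)"
    proof -
      have "(of_real p :: complex) * of_real (b + \<sigma> * q) = 1"
        unfolding of_real_mult[symmetric] pu by (rule of_real_1)
      from inv[OF this] have "(of_real p :: complex) \<noteq> 0"
        "(of_real p :: complex) + 1 / of_real p = of_real (p + (b + \<sigma> * q))" by auto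
      moreover have "p + (b + \<sigma> * q) = 2 - h\<^sup>2 * e" unfolding b2[symmetric] by (simp add: p_def)
      ultimately show ?thesis using p1 unfolding boundary_root_def by auto
    qed
    ultimately show ?thesis using rlim sum by (intro exI[of _ "of_real p"] exI[of _ r]) (auto elim: eventually_mono)
  qed
qed

definition green_coeff :: "real \<Rightarrow> complex \<Rightarrow> complex" where
  "green_coeff h \<rho> = of_real (h\<^sup>2) / (1 / \<rho> - \<rho>)"

text \<open>The discriminant \<open>(\<rho> + 1 / \<rho>)^2 - 4\<close> is explicit in the energy,
  which gives the modulus of the Green coefficient without solving for
  \<open>\<rho>\<close>.\<close>

lemma boundary_root_disc:
  assumes "boundary_root h e \<rho>"
  shows "(1 / \<rho> - \<rho>)\<^sup>2 = of_real (h\<^sup>2 * e * (h\<^sup>2 * e - 4))"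
proof -
  have "\<rho> \<noteq> 0" using assms by (simp add: boundary_root_def)
  then have "(1 / \<rho> - \<rho>)\<^sup>2 = (\<rho> + 1 / \<rho>)\<^sup>2 - 4" by (simp add: power2_eq_square field_simps)
  also have "\<rho> + 1 / \<rho> = of_real (2 - h\<^sup>2 * e)" using assms by (simp add: boundary_root_def)
  also have "(of_real (2 - h\<^sup>2 * e))\<^sup>2 - 4 = (of_real (h\<^sup>2 * e * (h\<^sup>2 * e - 4)) :: complex)"
    by (simp add: power2_eq_square algebra_simps)
  finally show ?thesis .
qed

lemma boundary_root_nonzero:
  assumes "boundary_root h e \<rho>" "h > 0" "e \<noteq> 0" "e \<noteq> 4 / h\<^sup>2"
  shows "1 / \<rho> - \<rho> \<noteq> 0"
proof
  assume 0: "1 / \<rho> - \<rho> = 0"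
  have "(of_real (h\<^sup>2 * e * (h\<^sup>2 * e - 4)) :: complex) = 0"
    using boundary_root_disc[OF assms(1)] unfolding 0 by simp
  then have "h\<^sup>2 * e * (h\<^sup>2 * e - 4) = 0" by (simp only: of_real_eq_0_iff)
  then have "h\<^sup>2 * e = 4" using assms(2,3) by simp
  then have "e = 4 / h\<^sup>2" using assms(2) by (simp add: eq_divide_eq mult.commute)
  then show False using assms(4) by simp
qed

lemma cmod_green_coeff:
  assumes "boundary_root h e \<rho>"
  shows "cmod (green_coeff h \<rho>) = h\<^sup>2 / sqrt \<bar>h\<^sup>2 * e * (h\<^sup>2 * e - 4)\<bar>"
proof -
  have "(cmod (1 / \<rho> - \<rho>))\<^sup>2 = \<bar>h\<^sup>2 * e * (h\<^sup>2 * e - 4)\<bar>"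
    unfolding norm_power[symmetric] boundary_root_disc[OF assms] by (rule norm_of_real)
  then have "cmod (1 / \<rho> - \<rho>) = sqrt \<bar>h\<^sup>2 * e * (h\<^sup>2 * e - 4)\<bar>"
    by (metis norm_ge_zero real_sqrt_unique)
  then show ?thesis by (simp add: green_coeff_def norm_divide norm_power)
qed

lemma boundary_root_cmod_le: "boundary_root h e \<rho> \<Longrightarrow> cmod \<rho> \<le> 1"
  by (auto simp: boundary_root_def)

lemma geom_diff_le:
  assumes "cmod \<rho> \<le> 1" "cmod \<rho>' \<le> 1"
  shows "cmod (geom \<rho> j - geom \<rho>' j) \<le> \<bar>real_of_int j\<bar> * cmod (\<rho> - \<rho>')"
  using norm_power_diff[OF assms, of "nat \<bar>j\<bar>"] by (simp add: geom_def)

definition green_kernel :: "real \<Rightarrow> complex \<Rightarrow> int \<Rightarrow> int \<Rightarrow> complex" where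
  "green_kernel h \<rho> n m = green_coeff h \<rho> * geom \<rho> (n - m)"

text \<open>The growth that the weights absorb. Linear growth has to be allowed because differences
  of \<open>\<rho> ^ |j|\<close> in \<open>\<rho>\<close> are only bounded by
  \<open>|j|\<close>.\<close>

definition admissible :: "real \<Rightarrow> (int \<Rightarrow> int \<Rightarrow> complex) \<Rightarrow> bool" where
  "admissible \<delta> \<kappa> \<longleftrightarrow> (\<forall>n m. cmod (\<kappa> n m) \<le> \<delta> * (1 + \<bar>real_of_int (n - m)\<bar>))"

lemma admissibleI_bounded:
  assumes "\<And>n m. cmod (\<kappa> n m) \<le> \<delta>"
  shows "admissible \<delta> \<kappa>"
  unfolding admissible_def
proof (intro allI)
  fix n m
  have "0 \<le> \<delta>" using order_trans[OF norm_ge_zero assms[of 0 0]] .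
  then have "\<delta> * 1 \<le> \<delta> * (1 + \<bar>real_of_int (n - m)\<bar>)" by (intro mult_left_mono) auto
  then show "cmod (\<kappa> n m) \<le> \<delta> * (1 + \<bar>real_of_int (n - m)\<bar>)" using assms[of n m] by simp
qed

lemma admissible_green_kernel:
  assumes "cmod \<rho> \<le> 1"
  shows "admissible (cmod (green_coeff h \<rho>)) (green_kernel h \<rho>)"
  by (rule admissibleI_bounded)
    (simp add: green_kernel_def norm_mult mult_left_le cmod_geom_le[OF assms])

text \<open>Change the coefficient first and the geometric sequence second. The bound tends to
  \<open>0\<close> with \<open>\<rho> - \<rho>'\<close> as long as the coefficient is
  continuous.\<close>

lemma admissible_green_kernel_diff:
  assumes "cmod \<rho> \<le> 1" "cmod \<rho>' \<le> 1"
  shows "admissible (cmod (green_coeff h \<rho> - green_coeff h \<rho>') + cmod (green_coeff h \<rho>') * cmod (\<rho> - \<rho>'))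
    (\<lambda>n m. green_kernel h \<rho> n m - green_kernel h \<rho>' n m)"
  unfolding admissible_def
proof (intro allI)
  fix n m :: int
  let ?j = "n - m" and ?c = "green_coeff h \<rho>" and ?c' = "green_coeff h \<rho>'"
  have "green_kernel h \<rho> n m - green_kernel h \<rho>' n m
      = (?c - ?c') * geom \<rho> ?j + ?c' * (geom \<rho> ?j - geom \<rho>' ?j)"
    by (simp add: green_kernel_def algebra_simps)
  also have "cmod \<dots> \<le> cmod (?c - ?c') * cmod (geom \<rho> ?j) + cmod ?c' * cmod (geom \<rho> ?j - geom \<rho>' ?j)"
    by (metis norm_mult norm_triangle_ineq)
  also have "\<dots> \<le> cmod (?c - ?c') * 1 + cmod ?c' * (\<bar>real_of_int ?j\<bar> * cmod (\<rho> - \<rho>'))"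
    by (intro add_mono mult_left_mono cmod_geom_le geom_diff_le assms) auto
  also have "\<dots> \<le> (cmod (?c - ?c') + cmod ?c' * cmod (\<rho> - \<rho>')) * (1 + \<bar>real_of_int ?j\<bar>)"
    by (simp add: algebra_simps)
  finally show "cmod (green_kernel h \<rho> n m - green_kernel h \<rho>' n m)
      \<le> (cmod (?c - ?c') + cmod ?c' * cmod (\<rho> - \<rho>')) * (1 + \<bar>real_of_int (n - m)\<bar>)" .
qed

lemma bounded_clinear_adjoint:
  fixes T :: "'a :: complex_inner \<Rightarrow> 'b :: complex_inner"
  assumes T: "bounded_clinear T" and adj: "\<And>x y. cinner (T x) y = cinner x (S y)"
  shows "bounded_clinear S"
proof -
  obtain C where C: "C > 0" "\<And>x. norm (T x) \<le> C * norm x" using bounded_clinear_bound[OF T] by blast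
  show ?thesis
  proof (rule bounded_clinearI[where C = C])
    show "S (x + y) = S x + S y" for x y
      by (rule cinner_ext) (simp add: adj[symmetric] cinner_add_right)
    show "S (c *\<^sub>C x) = c *\<^sub>C S x" for c x
      by (rule cinner_ext) (simp add: adj[symmetric] cinner_scaleC_right)
    show "norm (S x) \<le> C * norm x" for x
      using norm_adjoint_le[OF adj C(2)] C(1) by simp
  qed
qed

section \<open>The sandwiched resolvent as a sum over the eigenvalues of Q\<close>

locale lattice_model =
  fixes h \<nu>0 :: real and Q K :: "'g :: chilbert_space \<Rightarrow> 'g" and W :: "'g ell2Z \<Rightarrow> 'g ell2Z"
    and IQ :: "nat set" and \<mu> :: "nat \<Rightarrow> real"
  assumes h: "h > 0" and sd: "spectral_data Q IQ \<mu>" and \<nu>: "\<nu>0 > 3"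
    and W: "positive_op W" and K: "schatten2 K"
begin

definition rootW :: "'g ell2Z \<Rightarrow> 'g ell2Z" where "rootW = op_sqrt W"

definition proj :: "nat \<Rightarrow> 'g \<Rightarrow> 'g" where "proj s = orth_proj (eigenspace Q (\<mu> s))"

definition fibre :: "nat \<Rightarrow> 'g \<Rightarrow> 'g" where "fibre s x = K (proj s (adj K x))"

text \<open>The contribution of the eigenvalue \<open>\<mu> s\<close> to the sandwiched resolvent,
  with the lattice kernel left as a parameter: limits, real parts and leading terms then become
  operations on kernels.\<close>

definition channel :: "(int \<Rightarrow> int \<Rightarrow> complex) \<Rightarrow> nat \<Rightarrow> 'g ell2Z \<Rightarrow> 'g ell2Z" where
  "channel \<kappa> s x = rootW (kernel_op (weighted \<nu>0 \<kappa>) (fibre s) (rootW x))"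

lemma Kb: "bounded_clinear K" using K by (simp add: schatten2_def)
lemma K'b: "bounded_clinear (adj K)" by (rule bounded_clinear_adjoint[OF Kb cinner_adj[OF Kb]])
lemma Qb: "bounded_clinear Q" by (rule selfadjointD(1)[OF spectral_data_finite(1)[OF sd]])
lemma finite_IQ: "finite IQ" by (rule spectral_data_finite(2)[OF sd])

lemma rootW_sa: "selfadjoint rootW" and rootW_rootW: "rootW (rootW x) = W x"
  using op_sqrt_positive[OF W] by (auto simp: rootW_def positive_op_def fun_eq_iff)

lemmas rootWb = selfadjointD(1)[OF rootW_sa]

lemmas proj_properties =
  orth_proj_properties[OF csubspace_eigenspace[OF Qb] closed_eigenspace[OF Qb]]

lemma proj_sa: "selfadjoint (proj s)" unfolding proj_def by (rule proj_properties(1))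
lemma projb: "bounded_clinear (proj s)" by (rule selfadjointD(1)[OF proj_sa])
lemma proj_proj: "proj s (proj s x) = proj s x"
  unfolding proj_def
  by (rule proj_properties(2)) (rule closed_subspace_orth_proj(1)[OF csubspace_eigenspace[OF Qb] closed_eigenspace[OF Qb]])
lemma norm_proj: "norm (proj s x) \<le> 1 * norm x" unfolding proj_def using proj_properties(3) by simp

lemma fibreb: "bounded_clinear (fibre s)"
  using bounded_clinear_compose[OF Kb bounded_clinear_compose[OF projb K'b]]
  by (simp add: fibre_def[abs_def] o_def)

lemma fibre_sa: "selfadjoint (fibre s)"
  unfolding selfadjoint_def
proof (intro conjI allI fibreb)
  show "cinner (fibre s x) y = cinner x (fibre s y)" for x y
    by (simp add: fibre_def cinner_adj[OF Kb] cinner_adj'[OF Kb] selfadjointD(2)[OF proj_sa])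
qed

lemma hs_fibre: "\<exists>k\<ge>0. \<forall>s. hs_le (fibre s) k"
proof -
  obtain k where k: "hs_le K k" using K schatten2_iff by blast
  obtain C where C: "C > 0" "\<And>x. norm (adj K x) \<le> C * norm x" using bounded_clinear_bound[OF K'b] by blast
  have 1: "cinner (proj s (adj K x)) y = cinner x (K (proj s y))" for s x y
    by (simp add: selfadjointD(2)[OF proj_sa] cinner_adj'[OF Kb])
  have 2: "norm (proj s (adj K x)) \<le> C * norm x" for s x
    using norm_proj[of s "adj K x"] C(2)[of x] by simp
  have "hs_le (fibre s) (C\<^sup>2 * k)" for s
    unfolding fibre_def[abs_def]
    by (rule hs_le_compose_right[OF cinner_adj[OF Kb] 1 k 2]) (use C(1) in simp)
  moreover have "0 \<le> C\<^sup>2 * k" using hs_le_nonneg[OF k] by simp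
  ultimately show ?thesis by blast
qed

lemma weighted_l2: "admissible \<delta> \<kappa> \<Longrightarrow> l2_kernel (weighted \<nu>0 \<kappa>)"
  by (rule weighted_kernel(1)[OF \<nu>, of _ \<delta>]) (simp add: admissible_def)

lemma channelb:
  assumes "admissible \<delta> \<kappa>" shows "bounded_clinear (channel \<kappa> s)"
  using bounded_clinear_compose[OF rootWb bounded_clinear_compose[OF
        bounded_clinear_kernel_op[OF fibreb weighted_l2[OF assms]] rootWb]]
  by (simp add: channel_def[abs_def] o_def)

lemma channel_add:
  assumes "admissible \<delta> \<kappa>" "admissible \<delta>' \<kappa>'"
  shows "channel (\<lambda>n m. \<kappa> n m + \<kappa>' n m) s x = channel \<kappa> s x + channel \<kappa>' s x"
proof -
  have "weighted \<nu>0 (\<lambda>n m. \<kappa> n m + \<kappa>' n m) = (\<lambda>n m. weighted \<nu>0 \<kappa> n m + weighted \<nu>0 \<kappa>' n m)"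
    by (simp add: weighted_def distrib_left fun_eq_iff)
  then show ?thesis
    by (simp add: channel_def kernel_op_add[OF fibreb weighted_l2[OF assms(1)] weighted_l2[OF assms(2)]]
        bounded_clinear_add[OF rootWb])
qed

lemma channel_cmult:
  assumes "admissible \<delta> \<kappa>"
  shows "channel (\<lambda>n m. c * \<kappa> n m) s x = c *\<^sub>C channel \<kappa> s x"
proof -
  have "weighted \<nu>0 (\<lambda>n m. c * \<kappa> n m) = (\<lambda>n m. c * weighted \<nu>0 \<kappa> n m)"
    by (simp add: weighted_def fun_eq_iff)
  then show ?thesis
    by (simp add: channel_def kernel_op_cmult[OF fibreb weighted_l2[OF assms]] bounded_clinearD(2)[OF rootWb])
qed

lemma admissible_add: "admissible \<delta> \<kappa> \<Longrightarrow> admissible \<delta>' \<kappa>' \<Longrightarrow> admissible (\<delta> + \<delta>') (\<lambda>n m. \<kappa> n m + \<kappa>' n m)"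
  unfolding admissible_def distrib_right by (meson add_mono norm_triangle_le)

lemma admissible_cmult:
  assumes "admissible \<delta> \<kappa>" shows "admissible (cmod c * \<delta>) (\<lambda>n m. c * \<kappa> n m)"
  using assms unfolding admissible_def norm_mult mult.assoc by (simp add: mult_left_mono)

lemma channel_diff:
  assumes "admissible \<delta> \<kappa>" "admissible \<delta>' \<kappa>'"
  shows "channel (\<lambda>n m. \<kappa> n m - \<kappa>' n m) s x = channel \<kappa> s x - channel \<kappa>' s x"
  using channel_add[OF assms(1) admissible_cmult[OF assms(2), of "- 1"], of s x]
    channel_cmult[OF assms(2), of "- 1" s x] by simp

lemma cinner_channel:
  assumes "admissible \<delta> \<kappa>"
  shows "cinner (channel \<kappa> s x) y = cinner x (channel (\<lambda>n m. cnj (\<kappa> m n)) s y)"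
proof -
  have "weighted \<nu>0 (\<lambda>n m. cnj (\<kappa> m n)) = (\<lambda>n m. cnj (weighted \<nu>0 \<kappa> m n))"
    by (simp add: weighted_def fun_eq_iff mult.commute)
  then show ?thesis
    by (simp add: channel_def selfadjointD(2)[OF rootW_sa] cinner_kernel_op[OF fibre_sa weighted_l2[OF assms]])
qed

text \<open>A single constant for all kernels and all eigenvalues; this is what makes the later
  estimates uniform in the energy.\<close>

lemma hs_channel: "\<exists>G\<ge>0. \<forall>\<kappa> \<delta> s. admissible \<delta> \<kappa> \<longrightarrow> hs_le (channel \<kappa> s) (\<delta>\<^sup>2 * G)"
proof -
  obtain k where k: "k \<ge> 0" "\<And>s. hs_le (fibre s) k" using hs_fibre by blast
  obtain C where C: "C > 0" "\<And>x. norm (rootW x) \<le> C * norm x" using bounded_clinear_bound[OF rootWb] by blast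
  define G where "G = C\<^sup>2 * (C\<^sup>2 * ((psi_moment \<nu>0)\<^sup>2 * k))"
  have "hs_le (channel \<kappa> s) (\<delta>\<^sup>2 * G)" if a: "admissible \<delta> \<kappa>" for \<kappa> \<delta> s
  proof -
    note l2 = weighted_l2[OF a]
    have "kernel_sqnorm (weighted \<nu>0 \<kappa>) \<le> \<delta>\<^sup>2 * (psi_moment \<nu>0)\<^sup>2"
      by (rule weighted_kernel(2)[OF \<nu>]) (use a in \<open>simp add: admissible_def\<close>)
    then have "kernel_sqnorm (weighted \<nu>0 \<kappa>) * k \<le> \<delta>\<^sup>2 * (psi_moment \<nu>0)\<^sup>2 * k"
      using k(1) by (rule mult_right_mono)
    then have "hs_le (kernel_op (weighted \<nu>0 \<kappa>) (fibre s)) (\<delta>\<^sup>2 * (psi_moment \<nu>0)\<^sup>2 * k)"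
      using hs_le_mono[OF hs_le_kernel_op[OF fibreb l2 k(2)]] by blast
    then have "hs_le (\<lambda>x. kernel_op (weighted \<nu>0 \<kappa>) (fibre s) (rootW x)) (C\<^sup>2 * (\<delta>\<^sup>2 * (psi_moment \<nu>0)\<^sup>2 * k))"
      using hs_le_compose_right[OF cinner_kernel_op[OF fibre_sa l2] selfadjointD(2)[OF rootW_sa] _ C(2)] C(1)
      by simp
    from hs_le_compose_left[OF this C(2)] show ?thesis
      by (simp add: channel_def[abs_def] G_def mult_ac)
  qed
  moreover have "G \<ge> 0" using k(1) by (simp add: G_def)
  ultimately show ?thesis by blast
qed

lemma V_factor_adj:
  "adj (V_factor \<nu>0 W K) = (\<lambda>x. Mpsi_tensor \<nu>0 (adj K) (rootW x))"
proof (rule adj_eqI)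
  have \<nu>': "0 \<le> \<nu>0" using \<nu> by simp
  fix x y
  have "cinner (Mpsi_tensor \<nu>0 K x) z = cinner x (Mpsi_tensor \<nu>0 (adj K) z)" for z
    by (simp add: cinner_ell2Z_def Rep_Mpsi_tensor[OF Kb \<nu>'] Rep_Mpsi_tensor[OF K'b \<nu>'] cinner_simps
        cinner_adj[OF Kb])
  then show "cinner (V_factor \<nu>0 W K x) y = cinner x (Mpsi_tensor \<nu>0 (adj K) (rootW y))"
    by (simp add: V_factor_def rootW_def[symmetric] selfadjointD(2)[OF rootW_sa])
qed

lemma Mpsi_tensor_sum:
  assumes "bounded_clinear A"
  shows "Mpsi_tensor \<nu>0 A (\<Sum>i\<in>I. f i) = (\<Sum>i\<in>I. Mpsi_tensor \<nu>0 A (f i))"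
proof -
  have \<nu>': "0 \<le> \<nu>0" using \<nu> by simp
  show ?thesis
    unfolding Rep_ell2Z_inject[symmetric]
    by (rule ext) (simp add: Rep_sum Rep_Mpsi_tensor[OF assms \<nu>'] bounded_clinear_sum[OF assms] scaleR_sum_right)
qed

lemma sandwiched_resolvent:
  assumes z: "Im z \<noteq> 0"
    and \<rho>: "\<And>s. s \<in> IQ \<Longrightarrow> cmod (\<rho> s) < 1 \<and> \<rho> s \<noteq> 0
      \<and> \<rho> s + 1 / \<rho> s = 2 - of_real (h\<^sup>2) * (z - of_real (\<mu> s))"
  shows "(V_factor \<nu>0 W K \<circ> resolvent (H_free h Q) z \<circ> adj (V_factor \<nu>0 W K)) x
    = (\<Sum>s\<in>IQ. channel (green_kernel h (\<rho> s)) s x)"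
proof -
  have res: "resolvent (H_free h Q) z u = (\<Sum>s\<in>IQ. green_coeff h (\<rho> s) *\<^sub>C
      I_tensor (proj s) (geom_conv (\<rho> s) u))" for u
    unfolding green_coeff_def proj_def by (rule resolvent_H_free[OF h sd z \<rho>])
  have "(V_factor \<nu>0 W K \<circ> resolvent (H_free h Q) z \<circ> adj (V_factor \<nu>0 W K)) x
      = rootW (Mpsi_tensor \<nu>0 K (\<Sum>s\<in>IQ. green_coeff h (\<rho> s) *\<^sub>C
          I_tensor (proj s) (geom_conv (\<rho> s) (Mpsi_tensor \<nu>0 (adj K) (rootW x)))))"
    unfolding V_factor_adj o_def res by (simp add: V_factor_def rootW_def)
  also have "\<dots> = rootW (\<Sum>s\<in>IQ. kernel_op (weighted \<nu>0 (green_kernel h (\<rho> s))) (fibre s) (rootW x))"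
    unfolding Mpsi_tensor_sum[OF Kb]
  proof (intro arg_cong[where f = rootW] sum.cong refl)
    fix s assume "s \<in> IQ"
    then have "cmod (\<rho> s) < 1" using \<rho> by blast
    from Mpsi_geom_conv[OF Kb K'b projb \<nu> this, of "green_coeff h (\<rho> s)" s "rootW x"]
    show "Mpsi_tensor \<nu>0 K (green_coeff h (\<rho> s) *\<^sub>C
          I_tensor (proj s) (geom_conv (\<rho> s) (Mpsi_tensor \<nu>0 (adj K) (rootW x))))
        = kernel_op (weighted \<nu>0 (green_kernel h (\<rho> s))) (fibre s) (rootW x)"
      by (simp add: green_kernel_def[abs_def] fibre_def[abs_def])
  qed
  also have "\<dots> = (\<Sum>s\<in>IQ. channel (green_kernel h (\<rho> s)) s x)"
    by (simp add: channel_def bounded_clinear_sum[OF rootWb])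
  finally show ?thesis .
qed

text \<open>The difference from the limit is again a sum of channels, with kernels bounded by
  \<open>admissible_green_kernel_diff\<close>; away from thresholds the coefficients are continuous,
  so \<open>hs_channel\<close> gives convergence in Hilbert-Schmidt norm.\<close>

lemma T_boundary_eq:
  assumes E: "\<And>s. s \<in> IQ \<Longrightarrow> E - \<mu> s \<noteq> 0 \<and> E - \<mu> s \<noteq> 4 / h\<^sup>2"
  shows "\<exists>\<rho>. (\<forall>s\<in>IQ. boundary_root h (E - \<mu> s) (\<rho> s)) \<and>
    T_boundary (H_free h Q) (V_factor \<nu>0 W K) E = (\<lambda>x. \<Sum>s\<in>IQ. channel (green_kernel h (\<rho> s)) s x)"
proof -
  \<comment> \<open>Limit root and approximating family are paired so that one choice over the
    eigenvalues provides both.\<close>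
  define P where "P s p \<longleftrightarrow> boundary_root h (E - \<mu> s) (fst p) \<and> (snd p \<longlongrightarrow> fst p) (at_right 0) \<and>
    (\<forall>\<^sub>F \<epsilon> in at_right 0. cmod (snd p \<epsilon>) < 1 \<and> snd p \<epsilon> \<noteq> 0
      \<and> snd p \<epsilon> + 1 / snd p \<epsilon> = 2 - of_real (h\<^sup>2) * Complex (E - \<mu> s) \<epsilon>)"
    for s and p :: "complex \<times> (real \<Rightarrow> complex)"
  have "\<exists>p. P s p" if s: "s \<in> IQ" for s
  proof -
    obtain \<rho> r where "P s (\<rho>, r)"
      using boundary_root_exists[OF h, of "E - \<mu> s"] E[OF s] unfolding P_def fst_conv snd_conv by blast
    then show ?thesis by blast
  qed
  then obtain f where f: "\<And>s. s \<in> IQ \<Longrightarrow> P s (f s)" by metis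
  define \<rho> r where "\<rho> s = fst (f s)" and "r s = snd (f s)" for s
  have \<rho>: "\<And>s. s \<in> IQ \<Longrightarrow> boundary_root h (E - \<mu> s) (\<rho> s)"
    and r: "\<And>s. s \<in> IQ \<Longrightarrow> (r s \<longlongrightarrow> \<rho> s) (at_right 0)"
    and ev: "\<And>s. s \<in> IQ \<Longrightarrow> \<forall>\<^sub>F \<epsilon> in at_right 0. cmod (r s \<epsilon>) < 1 \<and> r s \<epsilon> \<noteq> 0
      \<and> r s \<epsilon> + 1 / r s \<epsilon> = 2 - of_real (h\<^sup>2) * Complex (E - \<mu> s) \<epsilon>"
    using f unfolding P_def \<rho>_def r_def by blast+
  have \<rho>1: "cmod (\<rho> s) \<le> 1" if "s \<in> IQ" for s using boundary_root_cmod_le[OF \<rho>[OF that]] .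
  obtain G where G: "G \<ge> 0" "\<And>\<kappa> \<delta> s. admissible \<delta> \<kappa> \<Longrightarrow> hs_le (channel \<kappa> s) (\<delta>\<^sup>2 * G)"
    using hs_channel by blast
  let ?F = "\<lambda>\<epsilon>. V_factor \<nu>0 W K \<circ> resolvent (H_free h Q) (Complex E \<epsilon>) \<circ> adj (V_factor \<nu>0 W K)"
  define L where "L x = (\<Sum>s\<in>IQ. channel (green_kernel h (\<rho> s)) s x)" for x
  define \<delta> where "\<delta> s \<epsilon> = cmod (green_coeff h (r s \<epsilon>) - green_coeff h (\<rho> s))
      + cmod (green_coeff h (\<rho> s)) * cmod (r s \<epsilon> - \<rho> s)" for s \<epsilon>
  define d where "d \<epsilon> = real (card IQ) * (\<Sum>s\<in>IQ. (\<delta> s \<epsilon>)\<^sup>2 * G)" for \<epsilon>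
  have Lb: "bounded_clinear L" unfolding L_def[abs_def]
    by (rule bounded_clinear_sum_fun) (rule channelb[OF admissible_green_kernel[OF \<rho>1]])
  have Lhs: "hs_le L (real (card IQ) * (\<Sum>s\<in>IQ. (cmod (green_coeff h (\<rho> s)))\<^sup>2 * G))"
    unfolding L_def[abs_def] by (intro hs_le_sum finite_IQ G(2) admissible_green_kernel \<rho>1)
  have "\<forall>\<^sub>F \<epsilon> in at_right 0. \<forall>s\<in>IQ. cmod (r s \<epsilon>) < 1 \<and> r s \<epsilon> \<noteq> 0
      \<and> r s \<epsilon> + 1 / r s \<epsilon> = 2 - of_real (h\<^sup>2) * Complex (E - \<mu> s) \<epsilon>"
    using ev finite_IQ by (simp add: eventually_ball_finite)
  moreover have "\<forall>\<^sub>F \<epsilon> in at_right 0. \<epsilon> > (0 :: real)" by (simp add: eventually_at_right_less)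
  ultimately have F: "\<forall>\<^sub>F \<epsilon> in at_right 0. bounded_clinear (?F \<epsilon>) \<and> hs_le (\<lambda>x. ?F \<epsilon> x - L x) (d \<epsilon>)"
  proof eventually_elim
    case (elim \<epsilon>)
    have C: "Complex (E - \<mu> s) \<epsilon> = Complex E \<epsilon> - of_real (\<mu> s)" for s by (simp add: complex_eq_iff)
    have "?F \<epsilon> x = (\<Sum>s\<in>IQ. channel (green_kernel h (r s \<epsilon>)) s x)" for x
      by (rule sandwiched_resolvent) (use elim C in auto)
    then have Feq: "?F \<epsilon> = (\<lambda>x. \<Sum>s\<in>IQ. channel (green_kernel h (r s \<epsilon>)) s x)" by blast
    have r1: "cmod (r s \<epsilon>) \<le> 1" if "s \<in> IQ" for s using elim that by (simp add: less_imp_le)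
    have "bounded_clinear (?F \<epsilon>)" unfolding Feq
      by (rule bounded_clinear_sum_fun) (rule channelb[OF admissible_green_kernel[OF r1]])
    moreover have "(\<lambda>x. ?F \<epsilon> x - L x)
        = (\<lambda>x. \<Sum>s\<in>IQ. channel (\<lambda>n m. green_kernel h (r s \<epsilon>) n m - green_kernel h (\<rho> s) n m) s x)"
      unfolding Feq L_def sum_subtractf[symmetric]
      by (intro ext sum.cong refl) (rule channel_diff[symmetric,
            OF admissible_green_kernel[OF r1] admissible_green_kernel[OF \<rho>1]])
    then have "hs_le (\<lambda>x. ?F \<epsilon> x - L x) (d \<epsilon>)"
      unfolding d_def \<delta>_def
      by (simp only:) (intro hs_le_sum finite_IQ G(2) admissible_green_kernel_diff r1 \<rho>1)
    ultimately show ?case by blast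
  qed
  have "((\<lambda>\<epsilon>. \<delta> s \<epsilon>) \<longlongrightarrow> 0) (at_right 0)" if s: "s \<in> IQ" for s
  proof -
    note ne = boundary_root_nonzero[OF \<rho>[OF s] h]
    have "\<rho> s \<noteq> 0" using \<rho>[OF s] by (simp add: boundary_root_def)
    then have "((\<lambda>\<epsilon>. green_coeff h (r s \<epsilon>)) \<longlongrightarrow> green_coeff h (\<rho> s)) (at_right 0)"
      unfolding green_coeff_def using ne E[OF s] by (intro tendsto_intros r[OF s]) auto
    then have "((\<lambda>\<epsilon>. \<delta> s \<epsilon>) \<longlongrightarrow> cmod (green_coeff h (\<rho> s) - green_coeff h (\<rho> s))
        + cmod (green_coeff h (\<rho> s)) * cmod (\<rho> s - \<rho> s)) (at_right 0)"
      unfolding \<delta>_def by (intro tendsto_intros r[OF s])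
    then show ?thesis by simp
  qed
  then have "(d \<longlongrightarrow> real (card IQ) * (\<Sum>s\<in>IQ. 0\<^sup>2 * G)) (at_right 0)"
    unfolding d_def[abs_def] by (intro tendsto_intros)
  then have d0: "(d \<longlongrightarrow> 0) (at_right 0)" by simp
  have "T_boundary (H_free h Q) (V_factor \<nu>0 W K) E = L"
    by (rule T_boundary_eqI, rule tendsto_schatten2I[OF Lb Lhs F d0])
  then show ?thesis using \<rho> by (intro exI[of _ \<rho>]) (simp add: L_def[abs_def])
qed

end

section \<open>Real and imaginary parts of the boundary values\<close>

definition re_kernel :: "(int \<Rightarrow> int \<Rightarrow> complex) \<Rightarrow> int \<Rightarrow> int \<Rightarrow> complex" where
  "re_kernel \<kappa> n m = of_real (Re (\<kappa> n m))"

definition im_kernel :: "(int \<Rightarrow> int \<Rightarrow> complex) \<Rightarrow> int \<Rightarrow> int \<Rightarrow> complex" where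
  "im_kernel \<kappa> n m = of_real (Im (\<kappa> n m))"

text \<open>For \<open>\<sigma> = \<plusminus> 1\<close> this is \<open>\<sigma> ^ n\<close>, and
  \<open>\<sigma>\<close> is the limit of the root at the threshold. The alternating branch has the
  form used in \<open>J_tensor\<close>.\<close>

definition parity :: "real \<Rightarrow> int \<Rightarrow> real" where
  "parity \<sigma> n = (if \<sigma> = 1 then 1 else (- 1) powi n)"

lemma abs_parity: "\<bar>parity \<sigma> n\<bar> = 1"
  by (simp add: parity_def power_int_abs)

lemma parity_mult:
  assumes "\<sigma> = 1 \<or> \<sigma> = - 1"
  shows "parity \<sigma> n * parity \<sigma> m = \<sigma> ^ nat \<bar>n - m\<bar>"
proof (cases "\<sigma> = 1")
  case False
  then have \<sigma>: "\<sigma> = - 1" using assms by simp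
  have p: "(- 1 :: real) powi k = (if even k then 1 else - 1)" for k :: int
    by (simp add: power_int_minus_left)
  have "even (nat \<bar>n - m\<bar>) \<longleftrightarrow> even (n - m)" by (simp add: even_nat_iff)
  then show ?thesis by (simp add: parity_def \<sigma> p)
qed (simp add: parity_def)

lemma admissible_re_kernel: "admissible \<delta> \<kappa> \<Longrightarrow> admissible \<delta> (re_kernel \<kappa>)"
  unfolding admissible_def re_kernel_def norm_of_real by (meson abs_Re_le_cmod order_trans)

lemma admissible_im_kernel: "admissible \<delta> \<kappa> \<Longrightarrow> admissible \<delta> (im_kernel \<kappa>)"
  unfolding admissible_def im_kernel_def norm_of_real by (meson abs_Im_le_cmod order_trans)

lemma admissible_conj: "admissible \<delta> \<kappa> \<Longrightarrow> admissible \<delta> (\<lambda>n m. cnj (\<kappa> n m))"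
  by (simp add: admissible_def)

lemma admissible_zero: "0 \<le> \<delta> \<Longrightarrow> admissible \<delta> (\<lambda>n m. 0)"
  by (simp add: admissible_def)

lemma green_kernel_sym: "green_kernel h \<rho> n m = green_kernel h \<rho> m n"
  by (simp add: green_kernel_def geom_def abs_minus_commute)

lemma im_kernel_real_root: "im_kernel (green_kernel h (of_real p)) = (\<lambda>n m. 0)"
proof -
  have "green_kernel h (of_real p) n m = of_real (h\<^sup>2 / (1 / p - p) * p ^ nat \<bar>n - m\<bar>)" for n m
    by (simp add: green_kernel_def green_coeff_def geom_def)
  then show ?thesis unfolding im_kernel_def by (simp only: Im_complex_of_real of_real_0)
qed

text \<open>On the unit circle the coefficient is \<open>\<i>\<close> times a positive number, so
  the imaginary part is a positive multiple of \<open>cos (\<theta> (n - m))\<close>, which the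
  addition formula splits into two rank-one kernels.\<close>

lemma im_kernel_unit_root:
  assumes \<rho>: "cmod \<rho> = 1" "Im \<rho> > 0"
  shows "\<exists>\<theta>. \<forall>n m. im_kernel (green_kernel h \<rho>) n m = of_real (cmod (green_coeff h \<rho>)) *
    (of_real (cos (\<theta> * n) * cos (\<theta> * m)) + of_real (sin (\<theta> * n) * sin (\<theta> * m)))"
proof -
  have r0: "\<rho> \<noteq> 0" using \<rho> by auto
  define \<theta> where "\<theta> = Arg \<rho>"
  have cis: "\<rho> = cis \<theta>" using cis_Arg[OF r0] \<rho>(1) by (simp add: \<theta>_def sgn_eq)
  \<comment> \<open>Hence \<open>1 / \<rho> - \<rho> = - 2 \<i> Im \<rho>\<close>, which fixes the
    phase of the coefficient.\<close>
  have "1 / \<rho> = cnj \<rho>" using \<rho>(1) r0 by (simp add: divide_eq_eq complex_norm_square[symmetric] mult.commute)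
  then have "1 / \<rho> - \<rho> = - (2 * \<i> * of_real (Im \<rho>))" by (simp add: complex_eq_iff)
  then have "green_coeff h \<rho> = of_real (h\<^sup>2) / (- (2 * \<i> * of_real (Im \<rho>)))"
    by (simp only: green_coeff_def)
  also have "\<dots> = \<i> * of_real (h\<^sup>2 / (2 * Im \<rho>))"
    using \<rho>(2) by (simp add: field_simps)
  finally have c: "green_coeff h \<rho> = \<i> * of_real (h\<^sup>2 / (2 * Im \<rho>))" .
  then have cc: "cmod (green_coeff h \<rho>) = h\<^sup>2 / (2 * Im \<rho>)"
    using \<rho>(2) by (simp add: norm_mult norm_divide norm_power)
  have g: "Re (geom \<rho> (n - m)) = cos (\<theta> * n) * cos (\<theta> * m) + sin (\<theta> * n) * sin (\<theta> * m)" for n m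
  proof -
    have "geom \<rho> (n - m) = cis (real (nat \<bar>n - m\<bar>) * \<theta>)" by (simp only: geom_def cis Complex.DeMoivre)
    then have "Re (geom \<rho> (n - m)) = cos (\<bar>real_of_int (n - m)\<bar> * \<theta>)" by simp
    also have "\<dots> = cos (\<theta> * n - \<theta> * m)"
      by (cases "n \<ge> m") (auto simp: abs_if algebra_simps cos_minus[of "\<theta> * n - \<theta> * m", symmetric])
    finally show ?thesis by (simp add: cos_diff)
  qed
  have "im_kernel (green_kernel h \<rho>) n m = of_real (cmod (green_coeff h \<rho>)) *
    (of_real (cos (\<theta> * n) * cos (\<theta> * m)) + of_real (sin (\<theta> * n) * sin (\<theta> * m)))" for n m
  proof -
    have "Im (green_kernel h \<rho> n m) = h\<^sup>2 / (2 * Im \<rho>) * Re (geom \<rho> (n - m))"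
      unfolding green_kernel_def c by simp
    then show ?thesis unfolding im_kernel_def cc g by (simp only: of_real_mult of_real_add)
  qed
  then show ?thesis by blast
qed

text \<open>The error \<open>h\<^sup>2 \<bar>n - m\<bar>\<close> is square-summable against the weights because \<open>\<nu>0 > 3\<close>.\<close>
lemma re_kernel_leading:
  assumes h: "h > 0" and \<rho>: "boundary_root h e \<rho>" and \<sigma>: "\<sigma> = 1 \<and> e < 0 \<or> \<sigma> = - 1 \<and> e > 4 / h\<^sup>2"
  shows "\<exists>p. \<rho> = of_real p"
    and "admissible (h\<^sup>2) (\<lambda>n m. re_kernel (green_kernel h \<rho>) n m
      - of_real (\<sigma> * cmod (green_coeff h \<rho>)) * of_real (parity \<sigma> n * parity \<sigma> m))"
proof -
  have eq: "\<rho> + 1 / \<rho> = of_real (2 - h\<^sup>2 * e)" using \<rho> by (simp add: boundary_root_def)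
  have \<sigma>': "\<sigma> = 1 \<or> \<sigma> = - 1" using \<sigma> by auto
  \<comment> \<open>The energy lies outside the band, so \<open>2 - h^2 e\<close> has modulus above
    \<open>2\<close> and sign \<open>\<sigma>\<close>; a root on the unit circle would give
    \<open>2 Re \<rho>\<close> instead.\<close>
  have he: "\<sigma> * (2 - h\<^sup>2 * e) > 2"
  proof (cases "\<sigma> = 1")
    case True
    then have "e < 0" using \<sigma> by auto
    then show ?thesis using True h by (simp add: mult_pos_neg)
  next
    case False
    then have "\<sigma> = - 1" "e > 4 / h\<^sup>2" using \<sigma> by auto
    then show ?thesis using h by (simp add: divide_less_eq mult.commute)
  qed
  have "\<not> (cmod \<rho> = 1 \<and> Im \<rho> > 0)"
  proof
    assume a: "cmod \<rho> = 1 \<and> Im \<rho> > 0"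
    then have "\<rho> \<noteq> 0" by auto
    then have "1 / \<rho> = cnj \<rho>" using a by (simp add: divide_eq_eq complex_norm_square[symmetric] mult.commute)
    then have "2 * Re \<rho> = 2 - h\<^sup>2 * e" using arg_cong[OF eq, of Re] by simp
    moreover have "\<bar>Re \<rho>\<bar> \<le> 1" using abs_Re_le_cmod[of \<rho>] a by simp
    ultimately show False using he \<sigma>' by auto
  qed
  then obtain p where p: "\<rho> = of_real p" "\<bar>p\<bar> < 1" "p \<noteq> 0"
    using \<rho> by (auto simp: boundary_root_def)
  then show "\<exists>p. \<rho> = of_real p" by blast
  have "(of_real (p + 1 / p) :: complex) = of_real (2 - h\<^sup>2 * e)" using eq p by simp
  then have pe: "p + 1 / p = 2 - h\<^sup>2 * e" by (simp only: of_real_eq_iff)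
  \<comment> \<open>Removing the sign treats both thresholds at once: \<open>q\<close> lies in
    \<open>(0, 1)\<close> and tends to \<open>1\<close> at the threshold.\<close>
  define q where "q = \<sigma> * p"
  have \<sigma>\<sigma>: "\<sigma> * \<sigma> = 1" using \<sigma>' by auto
  have pq: "p = \<sigma> * q" using \<sigma>\<sigma> by (simp add: q_def mult.assoc[symmetric])
  have "q + 1 / q = \<sigma> * (p + 1 / p)" using \<sigma>' by (auto simp: q_def)
  then have "q + 1 / q > 0" using he pe by simp
  then have q0: "q > 0"
  proof (rule contrapos_pp)
    assume "\<not> q > 0"
    then have "1 / q \<le> 0" "q \<le> 0" by (simp_all add: divide_le_0_iff)
    then show "\<not> q + 1 / q > 0" by linarith
  qed
  have q1: "q < 1" using p(2) q0 \<sigma>' by (auto simp: q_def)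
  define cc where "cc = h\<^sup>2 / (1 / q - q)"
  have d: "1 / q - q > 0"
  proof -
    have "q * q < 1 * 1" using q0 q1 by (intro mult_strict_mono) auto
    then show ?thesis using q0 by (simp add: field_simps)
  qed
  have cc0: "cc > 0" using h d by (simp add: cc_def)
  have gc: "green_coeff h \<rho> = of_real (\<sigma> * cc)"
    proof -
    have "green_coeff h \<rho> = of_real (h\<^sup>2 / (1 / p - p))" by (simp add: green_coeff_def p(1))
    also have "1 / p - p = \<sigma> * (1 / q - q)" unfolding pq using \<sigma>' by auto
    also have "x / (\<sigma> * y) = \<sigma> * (x / y)" for x y :: real using \<sigma>' by auto
    then have "h\<^sup>2 / (\<sigma> * (1 / q - q)) = \<sigma> * cc" unfolding cc_def .
    finally show ?thesis .
  qed
  have cmc: "cmod (green_coeff h \<rho>) = cc"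
    unfolding gc norm_of_real using \<sigma>' cc0 by (auto simp: abs_mult)
  have rk: "re_kernel (green_kernel h \<rho>) n m - of_real (\<sigma> * cmod (green_coeff h \<rho>)) * of_real (parity \<sigma> n * parity \<sigma> m)
      = of_real (\<sigma> * cc * (\<sigma> ^ nat \<bar>n - m\<bar>) * (q ^ nat \<bar>n - m\<bar> - 1))" for n m
  proof -
    have "green_kernel h \<rho> n m = of_real (\<sigma> * cc * (\<sigma> ^ nat \<bar>n - m\<bar> * q ^ nat \<bar>n - m\<bar>))"
      unfolding green_kernel_def gc unfolding geom_def p(1) pq by (simp add: power_mult_distrib)
    then have "re_kernel (green_kernel h \<rho>) n m = of_real (\<sigma> * cc * (\<sigma> ^ nat \<bar>n - m\<bar> * q ^ nat \<bar>n - m\<bar>))"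
      by (simp only: re_kernel_def Re_complex_of_real)
    then show ?thesis
      unfolding cmc parity_mult[OF \<sigma>'] by (simp add: algebra_simps)
  qed
  show "admissible (h\<^sup>2) (\<lambda>n m. re_kernel (green_kernel h \<rho>) n m
      - of_real (\<sigma> * cmod (green_coeff h \<rho>)) * of_real (parity \<sigma> n * parity \<sigma> m))"
    unfolding admissible_def rk
  proof (intro allI)
    fix n m :: int
    define j where "j = nat \<bar>n - m\<bar>"
    have s1: "\<bar>\<sigma>\<bar> = 1" using \<sigma>' by auto
    have "\<bar>q ^ j - 1 ^ j\<bar> \<le> real j * \<bar>q - 1\<bar>"
      using norm_power_diff[of q 1 j] q0 q1 by simp
    then have "cc * \<bar>q ^ j - 1\<bar> \<le> cc * (real j * (1 - q))"
      using q1 cc0 by (intro mult_left_mono) auto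
    also have "\<dots> = (cc * (1 - q)) * real j" by simp
    \<comment> \<open>\<open>1 / q - q >= 1 - q\<close>: the coefficient blows up no faster than
      \<open>1 / (1 - q)\<close>, exactly compensating the factor from
      \<open>1 - q ^ j\<close>.\<close>
    also have "cc * (1 - q) \<le> h\<^sup>2"
    proof -
      have "h\<^sup>2 * (1 - q) \<le> h\<^sup>2 * (1 / q - q)"
        using q0 q1 by (intro mult_left_mono) (auto simp: field_simps)
      then show ?thesis using d by (simp add: cc_def pos_divide_le_eq)
    qed
    then have "(cc * (1 - q)) * real j \<le> h\<^sup>2 * real j" by (rule mult_right_mono) simp
    also have "\<dots> \<le> h\<^sup>2 * (1 + \<bar>real_of_int (n - m)\<bar>)" by (intro mult_left_mono) (auto simp: j_def)
    finally have "cc * \<bar>q ^ j - 1\<bar> \<le> h\<^sup>2 * (1 + \<bar>real_of_int (n - m)\<bar>)" .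
    then show "cmod (of_real (\<sigma> * cc * (\<sigma> ^ nat \<bar>n - m\<bar>) * (q ^ nat \<bar>n - m\<bar> - 1)))
        \<le> h\<^sup>2 * (1 + \<bar>real_of_int (n - m)\<bar>)"
      unfolding norm_of_real j_def[symmetric] using s1 cc0 by (simp add: abs_mult power_abs)
  qed
qed

context lattice_model
begin

lemma channel_zero: "channel (\<lambda>n m. 0) s x = 0"
  using channel_cmult[OF admissible_zero[of 0], of 0 s x] by simp

text \<open>The adjoint transposes and conjugates a kernel. For symmetric kernels only the
  conjugation remains, so real and imaginary parts of the operator are taken entrywise.\<close>

lemma adj_sum_channel:
  assumes a: "\<And>s. s \<in> IQ \<Longrightarrow> admissible (\<delta> s) (\<kappa> s)" and sym: "\<And>s n m. \<kappa> s n m = \<kappa> s m n"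
  shows "adj (\<lambda>x. \<Sum>s\<in>IQ. channel (\<kappa> s) s x) = (\<lambda>x. \<Sum>s\<in>IQ. channel (\<lambda>n m. cnj (\<kappa> s n m)) s x)"
proof (rule adj_eqI)
  fix x y
  have "cinner (channel (\<kappa> s) s x) y = cinner x (channel (\<lambda>n m. cnj (\<kappa> s n m)) s y)" if "s \<in> IQ" for s
    unfolding cinner_channel[OF a[OF that]] by (simp add: sym[of s])
  then show "cinner (\<Sum>s\<in>IQ. channel (\<kappa> s) s x) y = cinner x (\<Sum>s\<in>IQ. channel (\<lambda>n m. cnj (\<kappa> s n m)) s y)"
    unfolding cinner_sum_left cinner_sum_right by (rule sum.cong[OF refl])
qed

lemma re_part_sum_channel:
  assumes a: "\<And>s. s \<in> IQ \<Longrightarrow> admissible (\<delta> s) (\<kappa> s)" and sym: "\<And>s n m. \<kappa> s n m = \<kappa> s m n"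
  shows "re_part (\<lambda>x. \<Sum>s\<in>IQ. channel (\<kappa> s) s x) x = (\<Sum>s\<in>IQ. channel (re_kernel (\<kappa> s)) s x)"
  proof -
  have adj: "adj (\<lambda>x. \<Sum>s\<in>IQ. channel (\<kappa> s) s x) = (\<lambda>x. \<Sum>s\<in>IQ. channel (\<lambda>n m. cnj (\<kappa> s n m)) s x)"
    by (rule adj_sum_channel[OF a sym])
  show ?thesis
  unfolding re_part_def adj sum.distrib[symmetric] complex_vector.scale_sum_right
  proof (rule sum.cong[OF refl])
  fix s assume s: "s \<in> IQ"
  note b = admissible_add[OF a[OF s] admissible_conj[OF a[OF s]]]
  have "re_kernel (\<kappa> s) = (\<lambda>n m. (1 / 2) * (\<kappa> s n m + cnj (\<kappa> s n m)))"
    by (simp add: re_kernel_def complex_add_cnj fun_eq_iff)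
  then show "(1 / 2) *\<^sub>C (channel (\<kappa> s) s x + channel (\<lambda>n m. cnj (\<kappa> s n m)) s x)
      = channel (re_kernel (\<kappa> s)) s x"
    by (simp only: channel_cmult[OF b] channel_add[OF a[OF s] admissible_conj[OF a[OF s]]])
  qed
qed

lemma im_part_sum_channel:
  assumes a: "\<And>s. s \<in> IQ \<Longrightarrow> admissible (\<delta> s) (\<kappa> s)" and sym: "\<And>s n m. \<kappa> s n m = \<kappa> s m n"
  shows "im_part (\<lambda>x. \<Sum>s\<in>IQ. channel (\<kappa> s) s x) x = (\<Sum>s\<in>IQ. channel (im_kernel (\<kappa> s)) s x)"
  proof -
  have adj: "adj (\<lambda>x. \<Sum>s\<in>IQ. channel (\<kappa> s) s x) = (\<lambda>x. \<Sum>s\<in>IQ. channel (\<lambda>n m. cnj (\<kappa> s n m)) s x)"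
    by (rule adj_sum_channel[OF a sym])
  show ?thesis
  unfolding im_part_def adj sum_subtractf[symmetric] complex_vector.scale_sum_right
  proof (rule sum.cong[OF refl])
  fix s assume s: "s \<in> IQ"
  note c = admissible_cmult[OF admissible_conj[OF a[OF s]], of "- 1"]
  note b = admissible_add[OF a[OF s] c]
  have "im_kernel (\<kappa> s) = (\<lambda>n m. (1 / (2 * \<i>)) * (\<kappa> s n m + (- 1) * cnj (\<kappa> s n m)))"
    by (simp add: im_kernel_def complex_diff_cnj fun_eq_iff mult_ac)
  then show "(1 / (2 * \<i>)) *\<^sub>C (channel (\<kappa> s) s x - channel (\<lambda>n m. cnj (\<kappa> s n m)) s x)
      = channel (im_kernel (\<kappa> s)) s x"
    by (simp only: channel_cmult[OF b] channel_add[OF a[OF s] c] channel_cmult[OF admissible_conj[OF a[OF s]]])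
      simp
  qed
qed

lemma channel_selfadjoint:
  assumes a: "admissible \<delta> \<kappa>" and sym: "\<And>n m. cnj (\<kappa> m n) = \<kappa> n m"
  shows "hs_selfadjoint (channel \<kappa> s)"
proof -
  obtain G where "\<And>\<kappa> \<delta> s. admissible \<delta> \<kappa> \<Longrightarrow> hs_le (channel \<kappa> s) (\<delta>\<^sup>2 * G)" using hs_channel by blast
  then have "\<exists>c. hs_le (channel \<kappa> s) c" using a by blast
  moreover have "selfadjoint (channel \<kappa> s)"
    unfolding selfadjoint_def using channelb[OF a] cinner_channel[OF a] by (simp add: sym)
  ultimately show ?thesis by (simp add: hs_selfadjoint_def)
qed

lemma hs_selfadjoint_sum:
  assumes "finite I" "\<And>i. i \<in> I \<Longrightarrow> hs_selfadjoint (T i)"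
  shows "hs_selfadjoint (\<lambda>x. \<Sum>i\<in>I. T i x)"
  using assms
proof (induction I)
  case (insert i I)
  then show ?case using hs_selfadjoint_add[of "T i" "\<lambda>x. \<Sum>i\<in>I. T i x"] by simp
qed (simp add: hs_selfadjoint_zero)

section \<open>Factorisation of rank-one kernels\<close>

definition wt :: "(int \<Rightarrow> real) \<Rightarrow> int \<Rightarrow> complex" where
  "wt f n = of_real (psi \<nu>0 n) * of_real (f n)"

text \<open>The operator \<open>Y\<close> of the overview for the real profile \<open>f\<close>:
  constant or alternating at a threshold, cosine or sine inside the band. \<open>cofactor\<close> is
  its adjoint.\<close>

definition factor :: "(int \<Rightarrow> real) \<Rightarrow> nat \<Rightarrow> 'g ell2Z \<Rightarrow> 'g" where
  "factor f s x = proj s (adj K (pairing (wt f) (rootW x)))"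

definition cofactor :: "(int \<Rightarrow> real) \<Rightarrow> nat \<Rightarrow> 'g \<Rightarrow> 'g ell2Z" where
  "cofactor f s g = rootW (tensor (wt f) (K (proj s g)))"

lemma wt_l2:
  assumes "\<And>n. \<bar>f n\<bar> \<le> 1"
  shows "square_summable (wt f)" "sqnorm (wt f) \<le> psi_moment \<nu>0"
proof -
  show s: "square_summable (wt f)" unfolding wt_def[abs_def] using assms by (intro square_summable_psi[OF \<nu>]) auto
  have le: "(cmod (wt f n))\<^sup>2 \<le> (psi \<nu>0 n)\<^sup>2 * (1 + \<bar>real_of_int n\<bar>)\<^sup>2" for n
  proof -
    have "(f n)\<^sup>2 \<le> 1" using assms[of n] by (simp add: abs_square_le_1)
    also have "1 \<le> (1 + \<bar>real_of_int n\<bar>)\<^sup>2" by simp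
    finally show ?thesis by (simp add: wt_def norm_mult power_mult_distrib mult_left_mono)
  qed
  show "sqnorm (wt f) \<le> psi_moment \<nu>0"
    unfolding sqnorm_def psi_moment_def
    by (rule infsum_mono[OF s[unfolded square_summable_def] psi_weight_summable[OF \<nu>] le])
qed

context
  fixes f :: "int \<Rightarrow> real"
  assumes f: "\<And>n. \<bar>f n\<bar> \<le> 1"
begin

lemma cinner_factor: "cinner (factor f s x) g = cinner x (cofactor f s g)"
  by (simp add: factor_def cofactor_def selfadjointD(2)[OF proj_sa] cinner_adj'[OF Kb, symmetric]
      cinner_pairing[OF wt_l2(1)[OF f]] selfadjointD(2)[OF rootW_sa] flip: cinner_adj'[OF Kb])

lemma factorb: "bounded_clinear (factor f s)"
  using bounded_clinear_compose[OF projb bounded_clinear_compose[OF K'b bounded_clinear_compose[OF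
        bounded_clinear_pairing[OF wt_l2(1)[OF f]] rootWb]]]
  by (simp add: factor_def[abs_def] o_def)

lemma cofactorb: "bounded_clinear (cofactor f s)"
  by (rule bounded_clinear_adjoint[OF factorb cinner_factor])

text \<open>The rank-one kernel separates the two lattice variables, and idempotence of the spectral
  projection provides one copy for each factor.\<close>

lemma channel_rank_one:
  "channel (\<lambda>n m. of_real (f n * f m)) s x = cofactor f s (factor f s x)"
proof -
  have a: "admissible 1 (\<lambda>n m. of_real (f n * f m))"
    using f by (intro admissibleI_bounded) (simp add: norm_mult mult_le_one)
  note l2 = weighted_l2[OF a]
  have "kernel_op (weighted \<nu>0 (\<lambda>n m. of_real (f n * f m))) (fibre s) (rootW x)
      = tensor (wt f) (K (proj s (factor f s x)))"
    unfolding Rep_ell2Z_inject[symmetric] Rep_kernel_op[OF fibreb l2] Rep_tensor[OF wt_l2(1)[OF f]]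
  proof
    fix n
    have "weighted \<nu>0 (\<lambda>n m. of_real (f n * f m)) n = (\<lambda>m. wt f n * wt f m)"
      by (simp add: weighted_def wt_def fun_eq_iff mult_ac)
    then have "pairing (weighted \<nu>0 (\<lambda>n m. of_real (f n * f m)) n) (rootW x) = wt f n *\<^sub>C pairing (wt f) (rootW x)"
      by (simp only: pairing_cmult[OF wt_l2(1)[OF f]])
    then show "fibre s (pairing (weighted \<nu>0 (\<lambda>n m. of_real (f n * f m)) n) (rootW x))
        = cnj (wt f n) *\<^sub>C K (proj s (factor f s x))"
      by (simp add: bounded_clinearD(2)[OF Kb] bounded_clinearD(2)[OF K'b] bounded_clinearD(2)[OF projb]
          wt_def[of f n] factor_def proj_proj fibre_def)
  qed
  then show ?thesis by (simp add: channel_def cofactor_def)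
qed

end

text \<open>Uniformity over all profiles bounded by \<open>1\<close> is needed because the frequency
  of the cosine and sine profiles varies with the energy.\<close>

lemma hs_factor: "\<exists>G\<ge>0. \<forall>f s. (\<forall>n. \<bar>f n\<bar> \<le> 1) \<longrightarrow> hs_le (factor f s) G"
proof -
  obtain k where k: "hs_le K k" using K schatten2_iff by blast
  obtain C where C: "C > 0" "\<And>x. norm (rootW x) \<le> C * norm x" using bounded_clinear_bound[OF rootWb] by blast
  define D where "D = sqrt (psi_moment \<nu>0) * C"
  have pm: "psi_moment \<nu>0 \<ge> 0" unfolding psi_moment_def by (intro infsum_nonneg) simp
  have "hs_le (factor f s) (D\<^sup>2 * (1\<^sup>2 * k))" if f: "\<And>n. \<bar>f n\<bar> \<le> 1" for f s
  proof -
    note w = wt_l2[OF f]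
    have 1: "hs_le (\<lambda>x. proj s (adj K x)) (1\<^sup>2 * k)"
      by (rule hs_le_compose_left[OF hs_le_adjoint[OF cinner_adj[OF Kb] k] norm_proj])
    have 2: "cinner (proj s (adj K x)) y = cinner x (K (proj s y))" for x y
      by (simp add: selfadjointD(2)[OF proj_sa] cinner_adj'[OF Kb])
    have 3: "cinner (pairing (wt f) (rootW x)) y = cinner x (rootW (tensor (wt f) y))" for x y
      by (simp add: cinner_pairing[OF w(1)] selfadjointD(2)[OF rootW_sa])
    have 4: "norm (pairing (wt f) (rootW x)) \<le> D * norm x" for x
    proof -
      have "norm (pairing (wt f) (rootW x)) \<le> sqrt (sqnorm (wt f)) * norm (rootW x)" by (rule norm_pairing_le[OF w(1)])
      also have "\<dots> \<le> sqrt (psi_moment \<nu>0) * (C * norm x)"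
        using w(2) C by (intro mult_mono) (auto simp: pm)
      finally show ?thesis by (simp add: D_def)
    qed
    show ?thesis
      unfolding factor_def[abs_def]
      by (rule hs_le_compose_right[OF 2 3 1 4]) (use pm C(1) in \<open>simp add: D_def\<close>)
  qed
  moreover have "D\<^sup>2 * (1\<^sup>2 * k) \<ge> 0" using hs_le_nonneg[OF k] by simp
  ultimately show ?thesis by blast
qed

lemma hs_selfadjoint_factor:
  assumes f: "\<And>n. \<bar>f n\<bar> \<le> 1"
  shows "hs_selfadjoint (\<lambda>x. cofactor f s (factor f s x))" "hs_selfadjoint (\<lambda>g. factor f s (cofactor f s g))"
proof -
  note a = cinner_factor[of f, OF f]
  have a': "cinner (cofactor f s g) x = cinner g (factor f s x)" for s g x by (metis a cinner_commute)
  obtain G where G: "hs_le (factor f s) G" using hs_factor f by blast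
  obtain C where C: "C > 0" "\<And>x. norm (cofactor f s x) \<le> C * norm x"
    using bounded_clinear_bound[OF cofactorb[of f, OF f]] by blast
  have "bounded_clinear (\<lambda>x. cofactor f s (factor f s x))" "bounded_clinear (\<lambda>g. factor f s (cofactor f s g))"
    using bounded_clinear_compose[OF cofactorb[of f, OF f] factorb[of f, OF f], of s s]
      bounded_clinear_compose[OF factorb[of f, OF f] cofactorb[of f, OF f], of s s] by (simp_all add: o_def)
  moreover have "hs_le (\<lambda>x. cofactor f s (factor f s x)) (C\<^sup>2 * G)" by (rule hs_le_compose_left[OF G C(2)])
  moreover have "hs_le (\<lambda>g. factor f s (cofactor f s g)) (C\<^sup>2 * G)"
    by (rule hs_le_compose_right[OF a a' G C(2)]) (use C(1) in simp)
  ultimately show "hs_selfadjoint (\<lambda>x. cofactor f s (factor f s x))"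
      "hs_selfadjoint (\<lambda>g. factor f s (cofactor f s g))"
    unfolding hs_selfadjoint_def selfadjoint_def by (auto simp: a a')
qed

lemma Re_cofactor_factor:
  assumes f: "\<And>n. \<bar>f n\<bar> \<le> 1"
  shows "Re (cinner x (cofactor f s (factor f s x))) = (norm (factor f s x))\<^sup>2"
  by (simp add: cinner_factor[of f, OF f, symmetric] norm_sq_eq_cinner)

text \<open>Either the root is real and the imaginary part vanishes, or the part is a positive
  combination of two operators \<open>Y^* Y\<close>. Positivity is then evident, and the trace is a
  sum of squared Hilbert-Schmidt norms of the factors.\<close>

lemma channel_im_kernel:
  assumes \<rho>: "boundary_root h e \<rho>" and G: "\<And>f. (\<And>n. \<bar>f n\<bar> \<le> 1) \<Longrightarrow> hs_le (factor f s) G" "G \<ge> 0"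
  shows "0 \<le> Re (cinner x (channel (im_kernel (green_kernel h \<rho>)) s x))"
    and "tr_le (channel (im_kernel (green_kernel h \<rho>)) s) (cmod (green_coeff h \<rho>) * (2 * G))"
proof -
  let ?B = "channel (im_kernel (green_kernel h \<rho>)) s" and ?c = "cmod (green_coeff h \<rho>)"
  have "(\<forall>x. 0 \<le> Re (cinner x (?B x))) \<and> tr_le ?B (?c * (2 * G))"
  proof (cases "\<exists>p. \<rho> = of_real p")
    case True
    then obtain p where p: "\<rho> = of_real p" by blast
    have "?B x = 0" for x unfolding p im_kernel_real_root by (rule channel_zero)
    then show ?thesis using G(2) by (simp add: tr_le_def)
  next
    case False
    then have "cmod \<rho> = 1" "Im \<rho> > 0" using \<rho> by (auto simp: boundary_root_def)
    from im_kernel_unit_root[OF this] obtain \<theta> where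
      \<theta>: "\<And>n m. im_kernel (green_kernel h \<rho>) n m = of_real ?c *
        (of_real (cos (\<theta> * n) * cos (\<theta> * m)) + of_real (sin (\<theta> * n) * sin (\<theta> * m)))" by blast
    define C S where "C n = cos (\<theta> * real_of_int n)" and "S n = sin (\<theta> * real_of_int n)" for n
    have C: "\<And>n. \<bar>C n\<bar> \<le> 1" and S: "\<And>n. \<bar>S n\<bar> \<le> 1" by (simp_all add: C_def S_def)
    have aC: "admissible 1 (\<lambda>n m. of_real (C n * C m))" and aS: "admissible 1 (\<lambda>n m. of_real (S n * S m))"
      using C S by (auto intro!: admissibleI_bounded simp: norm_mult mult_le_one)
    have k: "im_kernel (green_kernel h \<rho>) = (\<lambda>n m. of_real ?c * (of_real (C n * C m) + of_real (S n * S m)))"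
      unfolding C_def S_def using \<theta> by blast
    have B: "?B x = ?c *\<^sub>R (cofactor C s (factor C s x) + cofactor S s (factor S s x))" for x
      unfolding k channel_cmult[OF admissible_add[OF aC aS]] channel_add[OF aC aS]
        channel_rank_one[of C, OF C] channel_rank_one[of S, OF S] scaleR_scaleC ..
    have form: "Re (cinner x (?B x)) = ?c * ((norm (factor C s x))\<^sup>2 + (norm (factor S s x))\<^sup>2)" for x
      unfolding B by (simp add: cinner_simps Re_cofactor_factor[of C, OF C] Re_cofactor_factor[of S, OF S])
    have "tr_le ?B (?c * (2 * G))"
      unfolding tr_le_def form sum_distrib_left[symmetric] sum.distrib
    proof (intro allI impI mult_left_mono)
      fix F :: "'g ell2Z set" assume F: "finite F \<and> orthonormal F"
      show "(\<Sum>e\<in>F. (norm (factor C s e))\<^sup>2) + (\<Sum>e\<in>F. (norm (factor S s e))\<^sup>2) \<le> 2 * G"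
        proof -
        have F': "finite F" "orthonormal F" using F by blast+
        have "hs_le (factor C s) G" "hs_le (factor S s) G" using G(1)[of C] G(1)[of S] C S by blast+
        from hs_leD[OF this(1) F'] hs_leD[OF this(2) F'] show ?thesis by linarith
      qed
    qed simp
    then show ?thesis unfolding form by simp
  qed
  then show "0 \<le> Re (cinner x (?B x))" "tr_le ?B (?c * (2 * G))" by blast+
qed

text \<open>Everything singular sits in the real part of the channel \<open>s0\<close>, where the
  root is real; \<open>cb\<close> controls the coefficients of the other channels. In the bounds one
  \<open>N\<close> comes from \<open>hs_le_sum\<close>, the other from adding \<open>N\<close> equal
  constants.\<close>

lemma boundary_decomposition:
  assumes cb: "cb \<ge> 0" and s0: "s0 \<in> IQ"
    and G: "\<And>\<kappa> \<delta> s. admissible \<delta> \<kappa> \<Longrightarrow> hs_le (channel \<kappa> s) (\<delta>\<^sup>2 * G)" "G \<ge> 0"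
    and G': "\<And>f s. (\<And>n. \<bar>f n\<bar> \<le> 1) \<Longrightarrow> hs_le (factor f s) G'" "G' \<ge> 0"
    and \<sigma>: "\<sigma> = 1 \<and> E - \<mu> s0 < 0 \<or> \<sigma> = - 1 \<and> E - \<mu> s0 > 4 / h\<^sup>2"
    and E: "\<And>s. s \<in> IQ - {s0} \<Longrightarrow> E - \<mu> s \<noteq> 0 \<and> E - \<mu> s \<noteq> 4 / h\<^sup>2
      \<and> h\<^sup>2 / sqrt \<bar>h\<^sup>2 * (E - \<mu> s) * (h\<^sup>2 * (E - \<mu> s) - 4)\<bar> \<le> cb"
  defines "T \<equiv> T_boundary (H_free h Q) (V_factor \<nu>0 W K) E"
    and "c \<equiv> h\<^sup>2 / sqrt \<bar>h\<^sup>2 * (E - \<mu> s0) * (h\<^sup>2 * (E - \<mu> s0) - 4)\<bar>"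
    and "N \<equiv> real (card IQ)"
  shows "\<exists>A0. hs_selfadjoint A0 \<and> hs_le A0 (N * (N * ((h\<^sup>2 + cb)\<^sup>2 * G))) \<and>
      (\<forall>x. re_part T x = (\<sigma> * c) *\<^sub>R cofactor (parity \<sigma>) s0 (factor (parity \<sigma>) s0 x) + A0 x)"
    "hs_selfadjoint (im_part T)" "hs_le (im_part T) (N * (N * (cb\<^sup>2 * G)))"
    "\<And>x. 0 \<le> Re (cinner x (im_part T x))" "tr_le (im_part T) (N * (cb * (2 * G')))"
proof -
  have E0: "E - \<mu> s0 \<noteq> 0 \<and> E - \<mu> s0 \<noteq> 4 / h\<^sup>2"
    proof -
    have "4 / h\<^sup>2 > 0" using h by simp
    then show ?thesis using \<sigma> by linarith
  qed
  have "E - \<mu> s \<noteq> 0 \<and> E - \<mu> s \<noteq> 4 / h\<^sup>2" if "s \<in> IQ" for s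
    using E[of s] E0 that by (cases "s = s0") auto
  from T_boundary_eq[OF this] obtain \<rho> where \<rho>: "\<And>s. s \<in> IQ \<Longrightarrow> boundary_root h (E - \<mu> s) (\<rho> s)"
    and T: "T = (\<lambda>x. \<Sum>s\<in>IQ. channel (green_kernel h (\<rho> s)) s x)" unfolding T_def by blast
  define gk where "gk s = green_kernel h (\<rho> s)" for s
  have a: "admissible (cmod (green_coeff h (\<rho> s))) (gk s)" if "s \<in> IQ" for s
    unfolding gk_def by (rule admissible_green_kernel[OF boundary_root_cmod_le[OF \<rho>[OF that]]])
  have sym: "gk s n m = gk s m n" for s n m unfolding gk_def by (rule green_kernel_sym)
  have cs: "cmod (green_coeff h (\<rho> s)) \<le> cb" if "s \<in> IQ - {s0}" for s
    using cmod_green_coeff[OF \<rho>, of s] E[OF that] that by simp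
  have c0: "cmod (green_coeff h (\<rho> s0)) = c" using cmod_green_coeff[OF \<rho>[OF s0]] by (simp add: c_def)
  have mono: "admissible \<delta> \<kappa> \<Longrightarrow> \<delta> \<le> \<delta>' \<Longrightarrow> admissible \<delta>' \<kappa>" for \<delta> \<delta>' \<kappa>
    unfolding admissible_def by (meson mult_right_mono order_trans abs_ge_zero add_nonneg_nonneg zero_le_one)
  have re: "re_part T x = (\<Sum>s\<in>IQ. channel (re_kernel (gk s)) s x)" for x
    unfolding T gk_def[symmetric] by (rule re_part_sum_channel[OF a sym])
  have im: "im_part T = (\<lambda>x. \<Sum>s\<in>IQ. channel (im_kernel (gk s)) s x)"
    unfolding T gk_def[symmetric] by (rule ext, rule im_part_sum_channel[OF a sym])
  define lead where "lead n m = (of_real (\<sigma> * c) * of_real (parity \<sigma> n * parity \<sigma> m) :: complex)" for n m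
  \<comment> \<open>Remainder kernels: in the channel \<open>s0\<close> the leading rank-one kernel
    is removed, elsewhere the real part is kept whole.\<close>
  define R where "R s = (if s = s0 then (\<lambda>n m. re_kernel (gk s0) n m - lead n m) else re_kernel (gk s))" for s
  have par: "\<And>n. \<bar>parity \<sigma> n\<bar> \<le> 1" by (simp add: abs_parity)
  have apar: "admissible 1 (\<lambda>n m. of_real (parity \<sigma> n * parity \<sigma> m))"
    by (intro admissibleI_bounded) (simp add: norm_mult abs_parity)
  note alead = admissible_cmult[OF apar, of "of_real (\<sigma> * c)", folded lead_def]
  have aR: "admissible (h\<^sup>2 + cb) (R s)" if "s \<in> IQ" for s
  proof (cases "s = s0")
    case True
    have "admissible (h\<^sup>2) (R s)"
      unfolding R_def if_P[OF True] lead_def c0[symmetric] gk_def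
      by (rule re_kernel_leading(2)[OF h \<rho>[OF s0] \<sigma>])
    then show ?thesis by (rule mono) (use cb in simp)
  next
    case False
    then have "admissible (cmod (green_coeff h (\<rho> s))) (R s)"
      unfolding R_def using admissible_re_kernel[OF a[OF that]] by simp
    then show ?thesis by (rule mono) (use cs[of s] that False in \<open>simp add: add_increasing\<close>)
  qed
  have symR: "cnj (R s m n) = R s n m" for s n m
    using sym[of s n m] sym[of s0 n m] by (simp add: R_def re_kernel_def lead_def mult.commute)
  define A0 where "A0 x = (\<Sum>s\<in>IQ. channel (R s) s x)" for x
  have "hs_selfadjoint A0" unfolding A0_def[abs_def]
    by (intro hs_selfadjoint_sum finite_IQ) (rule channel_selfadjoint[OF aR symR])
  moreover have "hs_le A0 (N * (N * ((h\<^sup>2 + cb)\<^sup>2 * G)))"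
    using hs_le_sum[OF finite_IQ, of "\<lambda>s. channel (R s) s" "\<lambda>_. (h\<^sup>2 + cb)\<^sup>2 * G"] G(1)[OF aR]
    by (simp add: A0_def[abs_def] N_def)
  moreover have "re_part T x = (\<sigma> * c) *\<^sub>R cofactor (parity \<sigma>) s0 (factor (parity \<sigma>) s0 x) + A0 x" for x
  proof -
    have "channel (re_kernel (gk s)) s x
        = channel (R s) s x + (if s = s0 then (\<sigma> * c) *\<^sub>R cofactor (parity \<sigma>) s0 (factor (parity \<sigma>) s0 x) else 0)"
      if s: "s \<in> IQ" for s
    proof (cases "s = s0")
      case True
      have "channel (R s) s x = channel (re_kernel (gk s0)) s0 x - channel lead s0 x"
        unfolding R_def if_P[OF True] unfolding True
        by (rule channel_diff[OF admissible_re_kernel[OF a[OF s0]] alead])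
      moreover have "channel lead s0 x = (\<sigma> * c) *\<^sub>R cofactor (parity \<sigma>) s0 (factor (parity \<sigma>) s0 x)"
        unfolding lead_def channel_cmult[OF apar] channel_rank_one[of "parity \<sigma>", OF par] scaleR_scaleC ..
      ultimately show ?thesis using True by simp
    qed (simp add: R_def)
    then have "re_part T x = (\<Sum>s\<in>IQ. channel (R s) s x
        + (if s = s0 then (\<sigma> * c) *\<^sub>R cofactor (parity \<sigma>) s0 (factor (parity \<sigma>) s0 x) else 0))"
      unfolding re by (rule sum.cong[OF refl])
    then show ?thesis using s0 finite_IQ by (simp add: sum.distrib A0_def)
  qed
  ultimately show "\<exists>A0. hs_selfadjoint A0 \<and> hs_le A0 (N * (N * ((h\<^sup>2 + cb)\<^sup>2 * G))) \<and>
      (\<forall>x. re_part T x = (\<sigma> * c) *\<^sub>R cofactor (parity \<sigma>) s0 (factor (parity \<sigma>) s0 x) + A0 x)" by blast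
  \<comment> \<open>The energy lies outside the band of the channel \<open>s0\<close>, so the large
    coefficient never enters the imaginary part.\<close>
  have im0: "im_kernel (gk s0) = (\<lambda>n m. 0)"
    using re_kernel_leading(1)[OF h \<rho>[OF s0] \<sigma>] im_kernel_real_root unfolding gk_def by auto
  have aI: "admissible cb (im_kernel (gk s))" if "s \<in> IQ" for s
  proof (cases "s = s0")
    case True
    then show ?thesis using im0 admissible_zero[OF cb] by simp
  next
    case False
    then show ?thesis using mono[OF admissible_im_kernel[OF a[OF that]] cs] that by simp
  qed
  have symI: "cnj (im_kernel (gk s) m n) = im_kernel (gk s) n m" for s n m
    using sym[of s n m] by (simp add: im_kernel_def)
  show "hs_selfadjoint (im_part T)" unfolding im
    by (intro hs_selfadjoint_sum finite_IQ) (rule channel_selfadjoint[OF aI symI])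
  show "hs_le (im_part T) (N * (N * (cb\<^sup>2 * G)))"
    using hs_le_sum[OF finite_IQ, of "\<lambda>s. channel (im_kernel (gk s)) s" "\<lambda>_. cb\<^sup>2 * G"] G(1)[OF aI]
    by (simp add: im N_def)
  have pos: "0 \<le> Re (cinner x (channel (im_kernel (gk s)) s x))" if "s \<in> IQ" for s x
    unfolding gk_def by (rule channel_im_kernel(1)[OF \<rho>[OF that] G'])
  then show "0 \<le> Re (cinner x (im_part T x))" for x
    unfolding im cinner_sum_right by (simp add: sum_nonneg)
  have tr: "tr_le (channel (im_kernel (gk s)) s) (cb * (2 * G'))" if s: "s \<in> IQ" for s
  proof (cases "s = s0")
    case True
    then show ?thesis using cb G'(2) by (simp add: im0 channel_zero tr_le_def)
  next
    case False
    have "tr_le (channel (im_kernel (gk s)) s) (cmod (green_coeff h (\<rho> s)) * (2 * G'))"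
      unfolding gk_def by (rule channel_im_kernel(2)[OF \<rho>[OF s] G'])
    moreover have "cmod (green_coeff h (\<rho> s)) * (2 * G') \<le> cb * (2 * G')"
      using cs[of s] s False G'(2) by (intro mult_right_mono) auto
    ultimately show ?thesis unfolding tr_le_def by (meson order_trans)
  qed
  show "tr_le (im_part T) (N * (cb * (2 * G')))"
    unfolding tr_le_def
  proof (intro allI impI)
    fix F :: "'g ell2Z set" assume F: "finite F \<and> orthonormal F"
    have "(\<Sum>e\<in>F. Re (cinner e (im_part T e))) = (\<Sum>s\<in>IQ. \<Sum>e\<in>F. Re (cinner e (channel (im_kernel (gk s)) s e)))"
      unfolding im cinner_sum_right Re_sum by (rule sum.swap)
    also have "\<dots> \<le> (\<Sum>s\<in>IQ. cb * (2 * G'))"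
      using tr F unfolding tr_le_def by (intro sum_mono) blast
    finally show "(\<Sum>e\<in>F. Re (cinner e (im_part T e))) \<le> N * (cb * (2 * G'))" by (simp add: N_def)
  qed
qed

end

section \<open>Effective operators and the counting integrals\<close>

context lattice_model
begin

lemma pairing_I_tensor:
  fixes A :: "'g \<Rightarrow> 'g"
  assumes A: "bounded_clinear A" and w: "square_summable w"
  shows "pairing w (I_tensor A y) = A (pairing w y)"
proof -
  have "pairing w (I_tensor A y) = (\<Sum>\<^sub>\<infinity>n. A (w n *\<^sub>C Rep_ell2Z y n))"
    by (simp add: pairing_def Rep_I_tensor[OF A] bounded_clinearD(2)[OF A])
  also have "\<dots> = A (pairing w y)"
    unfolding pairing_def by (rule infsum_bounded_linear[OF bounded_clinearD(1)[OF A] pairing_summable[OF w]])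
  finally show ?thesis .
qed

lemma I_tensor_tensor:
  fixes A :: "'g \<Rightarrow> 'g"
  assumes A: "bounded_clinear A" and w: "square_summable w"
  shows "I_tensor A (tensor w g) = tensor w (A g)"
  unfolding Rep_ell2Z_inject[symmetric] Rep_I_tensor[OF A] Rep_tensor[OF w]
  by (simp add: bounded_clinearD(2)[OF A])

lemma parity_le_1: "\<bar>parity \<sigma> n\<bar> \<le> 1"
  by (simp add: abs_parity)

lemma wt_parity_l2: "square_summable (wt (parity \<sigma>))"
  by (rule wt_l2(1)) (rule parity_le_1)

lemma P_thr_eq: "P_thr \<nu>0 Q (\<mu> s) = (\<lambda>\<phi>. proj s (pairing (wt (parity 1)) \<phi>))"
proof
  fix \<phi> :: "'g ell2Z"
  have "P_thr \<nu>0 Q (\<mu> s) \<phi> = (\<Sum>\<^sub>\<infinity>n. proj s (wt (parity 1) n *\<^sub>C Rep_ell2Z \<phi> n))"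
    by (simp add: P_thr_def bra_psi_tensor_def proj_def[symmetric] wt_def parity_def
        bounded_clinearD(2)[OF projb] scaleR_scaleC)
  also have "\<dots> = proj s (pairing (wt (parity 1)) \<phi>)"
    unfolding pairing_def
    by (rule infsum_bounded_linear[OF bounded_clinearD(1)[OF projb] pairing_summable[OF wt_parity_l2]])
  finally show "P_thr \<nu>0 Q (\<mu> s) \<phi> = proj s (pairing (wt (parity 1)) \<phi>)" .
qed

lemma adj_P_thr: "adj (P_thr \<nu>0 Q (\<mu> s)) = (\<lambda>g. tensor (wt (parity 1)) (proj s g))"
  unfolding P_thr_eq
  by (rule adj_eqI) (simp add: selfadjointD(2)[OF proj_sa] cinner_pairing[OF wt_parity_l2])

lemma Rep_J_tensor: "Rep_ell2Z (J_tensor x) = (\<lambda>n. parity (- 1) n *\<^sub>R Rep_ell2Z (x :: 'g ell2Z) n)"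
  unfolding J_tensor_def parity_def
  by (subst Rep_fibre_op[where c = 1]) (auto simp: power_int_abs)

lemma adj_J_tensor: "adj (J_tensor :: 'g ell2Z \<Rightarrow> 'g ell2Z) = J_tensor"
  by (rule adj_eqI) (simp add: cinner_ell2Z_def Rep_J_tensor cinner_simps)

text \<open>\<open>J\<close> only changes signs, and these can be moved onto the weight; this turns
  the constant profile into the alternating one.\<close>

lemma pairing_J_tensor: "pairing (wt (parity 1)) (J_tensor x) = pairing (wt (parity (- 1))) (x :: 'g ell2Z)"
  by (simp add: pairing_def Rep_J_tensor wt_def parity_def scaleR_scaleC scaleC_scaleC)

lemma J_tensor_tensor: "J_tensor (tensor (wt (parity 1)) (g :: 'g)) = tensor (wt (parity (- 1))) g"
  unfolding Rep_ell2Z_inject[symmetric] Rep_J_tensor Rep_tensor[OF wt_parity_l2]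
  by (simp add: wt_def parity_def scaleR_scaleC scaleC_scaleC mult.commute)

text \<open>Writing \<open>W\<close> as \<open>rootW\<close> twice cuts the effective operator in
  the middle, with \<open>K\<close> and its adjoint, weight and projection falling symmetrically to
  both sides.\<close>

lemma V_bold_pairing:
  "proj s (pairing (wt (parity \<sigma>)) (V_bold W K (tensor (wt (parity \<sigma>)) (proj s g))))
    = factor (parity \<sigma>) s (cofactor (parity \<sigma>) s g)"
  by (simp add: V_bold_def factor_def cofactor_def pairing_I_tensor[OF K'b wt_parity_l2]
      I_tensor_tensor[OF Kb wt_parity_l2] rootW_rootW)

lemma sandwich_eq:
  "sandwich (P_thr \<nu>0 Q (\<mu> s)) (V_bold W K) = (\<lambda>g. factor (parity 1) s (cofactor (parity 1) s g))"
  unfolding sandwich_def adj_P_thr by (simp add: P_thr_eq o_def V_bold_pairing)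

lemma sandwich_J_eq:
  "sandwich (P_thr \<nu>0 Q (\<mu> s)) (V_bold_J W K) = (\<lambda>g. factor (parity (- 1)) s (cofactor (parity (- 1)) s g))"
  unfolding sandwich_def adj_P_thr V_bold_J_def adj_J_tensor
  by (simp add: P_thr_eq o_def pairing_J_tensor J_tensor_tensor V_bold_pairing)

definition eff_count :: "real \<Rightarrow> nat \<Rightarrow> real \<Rightarrow> real" where
  "eff_count \<sigma> s r = real (ncount r (\<lambda>x. cofactor (parity \<sigma>) s (factor (parity \<sigma>) s x)))"

text \<open>The hypotheses count for the effective operator on the fibre, whereas the boundary value
  contains the product in the other order on the lattice space; \<open>ncount_swap_le\<close> in
  both directions identifies the counts.\<close>

lemma counting_fun_eff:
  assumes r: "r > 0"
  shows "counting_fun (\<lambda>g. factor (parity \<sigma>) s (cofactor (parity \<sigma>) s g)) r = ennreal (eff_count \<sigma> s r)"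
proof -
  note a = cinner_factor[of "parity \<sigma>", OF parity_le_1]
  have a': "cinner (cofactor (parity \<sigma>) s g) x = cinner g (factor (parity \<sigma>) s x)" for g x
    using cinner_commute[of g "factor (parity \<sigma>) s x"] cinner_commute[of "cofactor (parity \<sigma>) s g" x]
    by (simp add: a)
  note hs = hs_selfadjoint_factor[of "parity \<sigma>", OF parity_le_1]
  have "ncount r (\<lambda>g. factor (parity \<sigma>) s (cofactor (parity \<sigma>) s g))
      = ncount r (\<lambda>x. cofactor (parity \<sigma>) s (factor (parity \<sigma>) s x))"
    by (intro antisym ncount_swap_le[OF a hs(2,1) r] ncount_swap_le[OF a' hs(1,2) r])
  then show ?thesis by (simp add: eff_count_def counting_fun_eq_ncount[OF hs(2) r])
qed

text \<open>One expression for both signs: counting below \<open>- 1\<close> for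
  \<open>A + t B\<close> is counting above \<open>1\<close> for its negative, so
  \<open>\<eta> = 1\<close> belongs to the operator with \<open>- V\<close> and
  \<open>\<eta> = - 1\<close> to the one with \<open>+ V\<close>.\<close>

definition count_integral :: "real \<Rightarrow> real \<Rightarrow> ennreal" where
  "count_integral \<eta> E = (let T = T_boundary (H_free h Q) (V_factor \<nu>0 W K) E in
    \<integral>\<^sup>+t. ennreal_of_enat (N_plus 1 (\<lambda>x. \<eta> *\<^sub>R re_part T x + (\<eta> * t) *\<^sub>R im_part T x))
      * ennreal (1 / (1 + t\<^sup>2)) \<partial>lborel)"

lemma xi_minus_eq: "xi_minus h \<nu>0 Q W K E = - ereal (1 / pi) * enn2ereal (count_integral 1 E)"
  by (simp add: xi_minus_def ssf_minus_def count_integral_def Let_def)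

lemma xi_plus_eq: "xi_plus h \<nu>0 Q W K E = ereal (1 / pi) * enn2ereal (count_integral (- 1) E)"
  by (simp add: xi_plus_def ssf_plus_def count_integral_def Let_def N_minus_def N_plus_def
      minus_add_distrib add.commute)

text \<open>This is where non-degeneracy enters: away from their own thresholds the coefficients are
  continuous in the energy, hence bounded near \<open>E0\<close>.\<close>

lemma eventually_channels_bounded:
  assumes E0: "\<And>s. s \<in> I \<Longrightarrow> E0 - \<mu> s \<noteq> 0 \<and> E0 - \<mu> s \<noteq> 4 / h\<^sup>2" and I: "finite I"
  shows "\<exists>cb\<ge>0. \<forall>\<^sub>F E in nhds E0. \<forall>s\<in>I. E - \<mu> s \<noteq> 0 \<and> E - \<mu> s \<noteq> 4 / h\<^sup>2
      \<and> h\<^sup>2 / sqrt \<bar>h\<^sup>2 * (E - \<mu> s) * (h\<^sup>2 * (E - \<mu> s) - 4)\<bar> \<le> cb"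
proof -
  define g where "g s E = h\<^sup>2 * (E - \<mu> s) * (h\<^sup>2 * (E - \<mu> s) - 4)" for s E
  define u where "u s E = h\<^sup>2 / sqrt \<bar>g s E\<bar>" for s E
  have g0: "g s E \<noteq> 0 \<longleftrightarrow> E - \<mu> s \<noteq> 0 \<and> E - \<mu> s \<noteq> 4 / h\<^sup>2" for s E
    using h by (auto simp: g_def eq_divide_eq mult.commute)
  have u0: "0 \<le> u s E" for s E by (simp add: u_def)
  define cb where "cb = (\<Sum>s\<in>I. u s E0 + 1)"
  have "\<forall>\<^sub>F E in nhds E0. g s E \<noteq> 0 \<and> u s E \<le> cb" if s: "s \<in> I" for s
  proof -
    have ne: "g s E0 \<noteq> 0" using g0 E0[OF s] by blast
    have lg: "(g s \<longlongrightarrow> g s E0) (nhds E0)" unfolding g_def by (intro tendsto_intros filterlim_ident)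
    have lu: "(u s \<longlongrightarrow> u s E0) (nhds E0)" unfolding u_def by (intro tendsto_intros lg) (use ne in auto)
    have "\<forall>\<^sub>F E in nhds E0. g s E \<noteq> 0" by (rule tendsto_imp_eventually_ne[OF lg ne])
    moreover have "\<forall>\<^sub>F E in nhds E0. u s E < u s E0 + 1" by (rule order_tendstoD(2)[OF lu]) simp
    moreover have "u s E0 + 1 \<le> cb"
      unfolding cb_def using I s u0 by (intro member_le_sum) (auto intro: add_nonneg_nonneg)
    ultimately show ?thesis by (auto elim: eventually_elim2)
  qed
  then have ev: "\<forall>\<^sub>F E in nhds E0. \<forall>s\<in>I. g s E \<noteq> 0 \<and> u s E \<le> cb" using I by (simp add: eventually_ball_finite)
  have "cb \<ge> 0" unfolding cb_def by (intro sum_nonneg) (simp add: u0 add_nonneg_nonneg)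
  moreover have "\<forall>\<^sub>F E in nhds E0. \<forall>s\<in>I. E - \<mu> s \<noteq> 0 \<and> E - \<mu> s \<noteq> 4 / h\<^sup>2
      \<and> h\<^sup>2 / sqrt \<bar>h\<^sup>2 * (E - \<mu> s) * (h\<^sup>2 * (E - \<mu> s) - 4)\<bar> \<le> cb"
    using ev
  proof eventually_elim
    case (elim E)
    show ?case
    proof
      fix s assume "s \<in> I"
      then have "g s E \<noteq> 0" and u: "u s E \<le> cb" using elim by auto
      then have "E - \<mu> s \<noteq> 0 \<and> E - \<mu> s \<noteq> 4 / h\<^sup>2" using g0 by blast
      then show "E - \<mu> s \<noteq> 0 \<and> E - \<mu> s \<noteq> 4 / h\<^sup>2
          \<and> h\<^sup>2 / sqrt \<bar>h\<^sup>2 * (E - \<mu> s) * (h\<^sup>2 * (E - \<mu> s) - 4)\<bar> \<le> cb"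
        using u unfolding u_def g_def by blast
    qed
  qed
  ultimately show ?thesis by blast
qed

text \<open>The constants depend on \<open>cb\<close> only, not on \<open>E\<close>,
  \<open>c\<close>, \<open>d\<close>, \<open>r\<close> or \<open>T\<close>. The auxiliary level
  \<open>r\<close> replaces \<open>1 / c\<close>: upper bounds allow \<open>r\<close> up to
  \<open>1 / c\<close>, and lower bounds need it larger by the factor
  \<open>1 + 2 d\<close>.\<close>

lemma count_integral_bounds:
  assumes s0: "s0 \<in> IQ" and cb: "cb \<ge> 0"
  shows "\<exists>a b b'. \<forall>E \<sigma> c.
    (\<sigma> = 1 \<and> E - \<mu> s0 < 0 \<or> \<sigma> = - 1 \<and> E - \<mu> s0 > 4 / h\<^sup>2) \<longrightarrow>
    (\<forall>s\<in>IQ - {s0}. E - \<mu> s \<noteq> 0 \<and> E - \<mu> s \<noteq> 4 / h\<^sup>2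
      \<and> h\<^sup>2 / sqrt \<bar>h\<^sup>2 * (E - \<mu> s) * (h\<^sup>2 * (E - \<mu> s) - 4)\<bar> \<le> cb) \<longrightarrow>
    c = h\<^sup>2 / sqrt \<bar>h\<^sup>2 * (E - \<mu> s0) * (h\<^sup>2 * (E - \<mu> s0) - 4)\<bar> \<longrightarrow> c > 0 \<longrightarrow>
    count_integral (- \<sigma>) E \<le> ennreal (pi * (a * 16) + b * 4) \<and>
    (\<forall>d. 0 < d \<and> d < 1 / 2 \<longrightarrow>
      (\<forall>r>0. r * c \<le> 1 \<longrightarrow> count_integral \<sigma> E \<le> ennreal (pi * (eff_count \<sigma> s0 (r * (1 - 2 * d)) + a / d\<^sup>2) + b / d)) \<and>
      (\<forall>r>0. \<forall>T>0. 1 + 2 * d \<le> r * c \<longrightarrow>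
        ennreal (2 * arctan T * (eff_count \<sigma> s0 r - a / d\<^sup>2 - T\<^sup>2 * b' / d\<^sup>2)) \<le> count_integral \<sigma> E))"
proof -
  obtain G where G: "G \<ge> 0" "\<And>\<kappa> \<delta> s. admissible \<delta> \<kappa> \<Longrightarrow> hs_le (channel \<kappa> s) (\<delta>\<^sup>2 * G)"
    using hs_channel by blast
  obtain G' where G': "G' \<ge> 0" "\<And>f s. (\<And>n. \<bar>f n\<bar> \<le> 1) \<Longrightarrow> hs_le (factor f s) G'"
    using hs_factor by blast
  define N where "N = real (card IQ)"
  define a where "a = N * (N * ((h\<^sup>2 + cb)\<^sup>2 * G))"
  define b where "b = N * (cb * (2 * G'))"
  define b' where "b' = N * (N * (cb\<^sup>2 * G))"
  show ?thesis
  proof (rule exI[of _ a], rule exI[of _ b], rule exI[of _ b'], intro allI impI)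
    fix E \<sigma> c :: real
    assume \<sigma>: "\<sigma> = 1 \<and> E - \<mu> s0 < 0 \<or> \<sigma> = - 1 \<and> E - \<mu> s0 > 4 / h\<^sup>2"
      and E: "\<forall>s\<in>IQ - {s0}. E - \<mu> s \<noteq> 0 \<and> E - \<mu> s \<noteq> 4 / h\<^sup>2
        \<and> h\<^sup>2 / sqrt \<bar>h\<^sup>2 * (E - \<mu> s) * (h\<^sup>2 * (E - \<mu> s) - 4)\<bar> \<le> cb"
      and c: "c = h\<^sup>2 / sqrt \<bar>h\<^sup>2 * (E - \<mu> s0) * (h\<^sup>2 * (E - \<mu> s0) - 4)\<bar>" and c0: "c > 0"
    define T where "T = T_boundary (H_free h Q) (V_factor \<nu>0 W K) E"
    define ZY where "ZY x = cofactor (parity \<sigma>) s0 (factor (parity \<sigma>) s0 x)" for x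
    note dec = boundary_decomposition[OF cb s0 G(2,1) G'(2,1) \<sigma>, folded c T_def N_def]
    have E': "\<And>s. s \<in> IQ - {s0} \<Longrightarrow> E - \<mu> s \<noteq> 0 \<and> E - \<mu> s \<noteq> 4 / h\<^sup>2
        \<and> h\<^sup>2 / sqrt \<bar>h\<^sup>2 * (E - \<mu> s) * (h\<^sup>2 * (E - \<mu> s) - 4)\<bar> \<le> cb" using E by blast
    have "\<exists>A0. hs_selfadjoint A0 \<and> hs_le A0 a \<and> (\<forall>x. re_part T x = (\<sigma> * c) *\<^sub>R ZY x + A0 x)"
      unfolding a_def ZY_def by (rule dec(1)[OF _ _ E']; blast)
    then obtain A0 where A0: "hs_selfadjoint A0" "hs_le A0 a"
      and re: "\<And>x. re_part T x = (\<sigma> * c) *\<^sub>R ZY x + A0 x" by blast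
    have im1: "hs_selfadjoint (im_part T)" by (rule dec(2)[OF _ _ E']; blast)
    have im2: "hs_le (im_part T) b'" unfolding b'_def by (rule dec(3)[OF _ _ E']; blast)
    have im3: "0 \<le> Re (cinner x (im_part T x))" for x by (rule dec(4)[OF _ _ E']; blast)
    have im4: "tr_le (im_part T) b" unfolding b_def by (rule dec(5)[OF _ _ E']; blast)
    note im = im1 im2 im3 im4
    have \<sigma>1: "\<bar>\<sigma>\<bar> = 1" "\<sigma> * \<sigma> = 1" "\<sigma>\<^sup>2 = 1" using \<sigma> by auto
    have ZY: "hs_selfadjoint ZY" unfolding ZY_def[abs_def] by (rule hs_selfadjoint_factor(1)) (rule parity_le_1)
    have ZYpos: "0 \<le> Re (cinner x (ZY x))" for x
      unfolding ZY_def Re_cofactor_factor[of "parity \<sigma>", OF parity_le_1] by simp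
    have reh: "hs_selfadjoint (re_part T)"
    proof -
      have "re_part T = (\<lambda>x. (\<sigma> * c) *\<^sub>R ZY x + A0 x)" using re by blast
      then show ?thesis using hs_selfadjoint_add[OF hs_selfadjoint_scaleR[OF ZY] A0(1)] by simp
    qed
    have scaled: "hs_selfadjoint (\<lambda>x. \<eta> *\<^sub>R re_part T x)" "hs_selfadjoint (\<lambda>x. \<eta> *\<^sub>R A0 x)" for \<eta>
      by (rule hs_selfadjoint_scaleR[OF reh], rule hs_selfadjoint_scaleR[OF A0(1)])
    have hsA0: "hs_le (\<lambda>x. \<eta> *\<^sub>R A0 x) a" if "\<eta>\<^sup>2 = 1" for \<eta>
      using hs_le_scaleR[OF A0(2), of \<eta>] that by simp
    have cZY: "hs_selfadjoint (\<lambda>x. c *\<^sub>R ZY x)" by (rule hs_selfadjoint_scaleR[OF ZY])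
    have form: "Re (cinner x (\<sigma> *\<^sub>R re_part T x)) = c * Re (cinner x (ZY x)) + \<sigma> * Re (cinner x (A0 x))" for x
    proof -
      have "Re (cinner x (\<sigma> *\<^sub>R re_part T x)) = (\<sigma> * \<sigma>) * c * Re (cinner x (ZY x)) + \<sigma> * Re (cinner x (A0 x))"
        by (simp add: re cinner_simps distrib_left mult.assoc)
      then show ?thesis unfolding \<sigma>1(2) by simp
    qed
    have "count_integral (- \<sigma>) E \<le> ennreal (pi * (a * 16) + b * 4)"
    proof -
      \<comment> \<open>In this direction the leading term is nonpositive and is replaced by
        \<open>0\<close>; the choice \<open>d = 1 / 4\<close> produces the constants
        \<open>16\<close> and \<open>4\<close>.\<close>
      have "count_integral (- \<sigma>) E
          \<le> ennreal (pi * (real (ncount (1 - 2 * (1 / 4)) (\<lambda>x :: 'g ell2Z. 0)) + a / (1 / 4)\<^sup>2) + b / (1 / 4))"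
        unfolding count_integral_def T_def[symmetric] Let_def
      proof (rule ssf_integral_upper[OF scaled(1) hs_selfadjoint_zero scaled(2) _ im(1,3,4)])
        show "hs_le (\<lambda>x. (- \<sigma>) *\<^sub>R A0 x) a" by (rule hsA0) (simp add: \<sigma>1)
        fix x
        have "Re (cinner x ((- \<sigma>) *\<^sub>R re_part T x)) = - Re (cinner x (\<sigma> *\<^sub>R re_part T x))"
          by (simp add: cinner_simps)
        also have "\<dots> \<le> Re (cinner x 0) + Re (cinner x ((- \<sigma>) *\<^sub>R A0 x))"
          unfolding form using mult_nonneg_nonneg[OF less_imp_le[OF c0] ZYpos[of x]] by (simp add: cinner_simps)
        finally show "Re (cinner x ((- \<sigma>) *\<^sub>R re_part T x)) \<le> Re (cinner x 0) + Re (cinner x ((- \<sigma>) *\<^sub>R A0 x))" .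
      qed (use \<sigma>1 in auto)
      then show ?thesis by (simp add: ncount_zero power2_eq_square)
    qed
    moreover have "count_integral \<sigma> E \<le> ennreal (pi * (eff_count \<sigma> s0 (r * (1 - 2 * d)) + a / d\<^sup>2) + b / d)"
      if d: "0 < d" "d < 1 / 2" and r: "r > 0" "r * c \<le> 1" for d r
    proof -
      have "count_integral \<sigma> E \<le> ennreal (pi * (real (ncount (1 - 2 * d) (\<lambda>x. c *\<^sub>R ZY x)) + a / d\<^sup>2) + b / d)"
        unfolding count_integral_def T_def[symmetric] Let_def
      proof (rule ssf_integral_upper[OF scaled(1) cZY scaled(2) hsA0[OF \<sigma>1(3)] im(1,3,4) d \<sigma>1(1)])
        show "Re (cinner x (\<sigma> *\<^sub>R re_part T x)) \<le> Re (cinner x (c *\<^sub>R ZY x)) + Re (cinner x (\<sigma> *\<^sub>R A0 x))" for x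
          unfolding form by (simp add: cinner_simps)
      qed
      \<comment> \<open>The coupling \<open>c\<close> is moved into the level.\<close>
      moreover have "ncount (1 - 2 * d) (\<lambda>x. c *\<^sub>R ZY x) \<le> ncount (r * (1 - 2 * d)) ZY"
      proof (rule ncount_mono[OF cZY ZY, where a = c])
        show "c * (r * (1 - 2 * d)) \<le> 1 - 2 * d"
          using mult_right_mono[OF r(2), of "1 - 2 * d"] d by (simp add: mult_ac)
      qed (use d r c0 in \<open>auto simp: cinner_simps\<close>)
      then have "pi * (real (ncount (1 - 2 * d) (\<lambda>x. c *\<^sub>R ZY x)) + a / d\<^sup>2) + b / d
          \<le> pi * (eff_count \<sigma> s0 (r * (1 - 2 * d)) + a / d\<^sup>2) + b / d"
        unfolding eff_count_def ZY_def[symmetric] by simp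
      ultimately show ?thesis by (meson ennreal_leI order_trans)
    qed
    moreover have "ennreal (2 * arctan S * (eff_count \<sigma> s0 r - a / d\<^sup>2 - S\<^sup>2 * b' / d\<^sup>2)) \<le> count_integral \<sigma> E"
      if d: "0 < d" and r: "r > 0" "1 + 2 * d \<le> r * c" and S: "S > 0" for d r S
    proof -
      have 1: "ennreal (2 * arctan S * (real (ncount (1 + 2 * d) (\<lambda>x. c *\<^sub>R ZY x)) - a / d\<^sup>2 - S\<^sup>2 * b' / d\<^sup>2))
          \<le> count_integral \<sigma> E"
        unfolding count_integral_def T_def[symmetric] Let_def
      proof (rule ssf_integral_lower[OF scaled(1) cZY scaled(2) hsA0 im(1,2) d S \<sigma>1(1)])
        show "(- \<sigma>)\<^sup>2 = 1" by (simp add: \<sigma>1)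
        show "Re (cinner x (c *\<^sub>R ZY x)) \<le> Re (cinner x (\<sigma> *\<^sub>R re_part T x)) + Re (cinner x ((- \<sigma>) *\<^sub>R A0 x))" for x
          unfolding form by (simp add: cinner_simps)
      qed
      have "ncount r ZY \<le> ncount (1 + 2 * d) (\<lambda>x. c *\<^sub>R ZY x)"
      proof (rule ncount_mono[OF ZY cZY, where a = "1 / c"])
        show "1 / c * (1 + 2 * d) \<le> r" using r(2) c0 by (simp add: divide_le_eq)
      qed (use d r c0 in \<open>auto simp: cinner_simps\<close>)
      then have "eff_count \<sigma> s0 r - a / d\<^sup>2 - S\<^sup>2 * b' / d\<^sup>2
          \<le> real (ncount (1 + 2 * d) (\<lambda>x. c *\<^sub>R ZY x)) - a / d\<^sup>2 - S\<^sup>2 * b' / d\<^sup>2"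
        unfolding eff_count_def ZY_def[symmetric] by simp
      then have "2 * arctan S * (eff_count \<sigma> s0 r - a / d\<^sup>2 - S\<^sup>2 * b' / d\<^sup>2)
          \<le> 2 * arctan S * (real (ncount (1 + 2 * d) (\<lambda>x. c *\<^sub>R ZY x)) - a / d\<^sup>2 - S\<^sup>2 * b' / d\<^sup>2)"
        using S by (intro mult_left_mono) (auto simp: zero_le_arctan_iff)
      then show ?thesis using 1 by (meson ennreal_leI order_trans)
    qed
    ultimately show "count_integral (- \<sigma>) E \<le> ennreal (pi * (a * 16) + b * 4) \<and>
    (\<forall>d. 0 < d \<and> d < 1 / 2 \<longrightarrow>
      (\<forall>r>0. r * c \<le> 1 \<longrightarrow> count_integral \<sigma> E \<le> ennreal (pi * (eff_count \<sigma> s0 (r * (1 - 2 * d)) + a / d\<^sup>2) + b / d)) \<and>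
      (\<forall>r>0. \<forall>T>0. 1 + 2 * d \<le> r * c \<longrightarrow>
        ennreal (2 * arctan T * (eff_count \<sigma> s0 r - a / d\<^sup>2 - T\<^sup>2 * b' / d\<^sup>2)) \<le> count_integral \<sigma> E))"
      by blast
  qed
qed

end

section \<open>From counting functions to asymptotics\<close>

text \<open>The order of the limits matters: \<open>d\<close> and \<open>T\<close> are fixed first,
  so the error \<open>C\<close> is constant and is absorbed because \<open>\<Psi>\<close> tends to
  infinity; only then does the tolerance \<open>\<eta>\<close> shrink. Using \<open>3 d\<close> in
  the lower bound, where Weyl's inequalities cost \<open>2 d\<close>, leaves room for replacing
  \<open>1 / c\<close> by its leading order.\<close>

lemma counting_asymptotics:
  fixes I :: "real \<Rightarrow> ennreal" and N \<Psi> r :: "real \<Rightarrow> real"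
  assumes r: "filterlim r (at_right 0) flt"
    and \<Phi>: "\<And>x. x > 0 \<Longrightarrow> \<Phi> x = ennreal (N x)" and N: "\<And>x. 0 \<le> N x"
    and \<Psi>: "filterlim \<Psi> at_top (at_right 0)" and reg: "regular_counting \<Phi> \<Psi>"
    and up: "\<And>d. 0 < d \<Longrightarrow> d < 1 / 2 \<Longrightarrow>
      \<exists>C. \<forall>\<^sub>F E in flt. I E \<le> ennreal (pi * N (r E * (1 - 2 * d)) + C)"
    and lo: "\<And>d T. 0 < d \<Longrightarrow> d < 1 / 2 \<Longrightarrow> T > 0 \<Longrightarrow>
      \<exists>C. \<forall>\<^sub>F E in flt. ennreal (2 * arctan T * (N (r E * (1 + 3 * d)) - C)) \<le> I E"
  shows "\<exists>e. (e \<longlongrightarrow> 0) flt \<and>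
    (\<forall>\<^sub>F E in flt. ereal (1 / pi) * enn2ereal (I E) = ereal (\<Psi> (r E) * (1 + e E)))"
proof -
  obtain C0 \<epsilon>0 where e01: "\<epsilon>0 \<in> {0<..<1}"
    and R: "\<forall>\<epsilon>\<in>{0<..<\<epsilon>0}. \<forall>\<sigma>\<in>{1, - 1}.
      \<exists>a b. (a \<longlongrightarrow> 0) (at_right 0) \<and> (\<forall>\<^sub>F x in at_right 0. \<bar>b x\<bar> \<le> C0 * \<epsilon> \<and>
        enn2ereal (\<Phi> (x * (1 + \<sigma> * \<epsilon>))) = ereal (\<Psi> x * (1 + a x + b x)))"
    using reg unfolding regular_counting_def by (elim exE bexE) (rule that)
  have \<epsilon>0: "\<epsilon>0 > 0" "\<epsilon>0 < 1" using e01 by auto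
  have reg': "\<exists>a b. (a \<longlongrightarrow> 0) (at_right 0) \<and> (\<forall>\<^sub>F x in at_right 0. \<bar>b x\<bar> \<le> C0 * \<epsilon> \<and>
        enn2ereal (\<Phi> (x * (1 + \<sigma> * \<epsilon>))) = ereal (\<Psi> x * (1 + a x + b x)))"
    if "0 < \<epsilon>" "\<epsilon> < \<epsilon>0" "\<sigma> \<in> {1, - 1}" for \<epsilon> \<sigma>
    using R[rule_format, of \<epsilon> \<sigma>] that by simp
  have pull: "\<forall>\<^sub>F E in flt. P (r E)" if "\<forall>\<^sub>F x in at_right 0. P x" for P
    using r that by (auto simp: filterlim_iff)
  have rpos: "\<forall>\<^sub>F E in flt. r E > 0" by (rule pull) (simp add: eventually_at_right_less)
  have big: "\<forall>\<^sub>F E in flt. \<Psi> (r E) \<ge> Z" for Z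
    by (rule pull) (use \<Psi> in \<open>simp add: filterlim_at_top\<close>)
  have near: "\<forall>\<^sub>F E in flt. \<bar>N (r E * (1 + \<sigma> * \<epsilon>)) - \<Psi> (r E)\<bar> \<le> \<Psi> (r E) * \<eta>"
    if \<epsilon>: "0 < \<epsilon>" "\<epsilon> < \<epsilon>0" "\<sigma> \<in> {1, - 1}" and \<eta>: "\<eta> > 0" "C0 * \<epsilon> \<le> \<eta> / 2" for \<epsilon> \<sigma> \<eta>
  proof -
    obtain a b where a: "(a \<longlongrightarrow> 0) (at_right 0)"
      and ab: "\<forall>\<^sub>F x in at_right 0. \<bar>b x\<bar> \<le> C0 * \<epsilon> \<and>
        enn2ereal (\<Phi> (x * (1 + \<sigma> * \<epsilon>))) = ereal (\<Psi> x * (1 + a x + b x))"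
      using reg'[OF \<epsilon>] by blast
    have "\<forall>\<^sub>F x in at_right 0. \<bar>a x\<bar> < \<eta> / 2"
      using tendstoD[OF a, of "\<eta> / 2"] \<eta>(1) by (simp add: dist_real_def)
    from pull[OF this] pull[OF ab] rpos big[of 0] show ?thesis
    proof eventually_elim
      case (elim E)
      have "1 + \<sigma> * \<epsilon> > 0" using \<epsilon> \<epsilon>0(2) by auto
      then have "\<Phi> (r E * (1 + \<sigma> * \<epsilon>)) = ennreal (N (r E * (1 + \<sigma> * \<epsilon>)))"
        using elim(3) by (intro \<Phi> mult_pos_pos)
      then have "ereal (N (r E * (1 + \<sigma> * \<epsilon>))) = ereal (\<Psi> (r E) * (1 + a (r E) + b (r E)))"
        using elim(2) N by (simp add: enn2ereal_ennreal)
      then have eq: "N (r E * (1 + \<sigma> * \<epsilon>)) - \<Psi> (r E) = \<Psi> (r E) * (a (r E) + b (r E))"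
        by (simp add: algebra_simps)
      have "\<bar>a (r E) + b (r E)\<bar> \<le> \<eta>" using elim(1,2) \<eta>(2) by linarith
      then show ?case unfolding eq abs_mult using elim(4) by (simp add: mult_left_mono)
    qed
  qed
  \<comment> \<open>Small enough that both shifts, \<open>2 d\<close> and \<open>3 d\<close>, lie
    below \<open>\<epsilon>0\<close> and that each contributes at most \<open>\<eta> / 2\<close>
    through the \<open>O(\<epsilon>)\<close> term. The modulus is taken because \<open>C0\<close>
    comes without a sign.\<close>
  define dd where "dd \<eta> = min (1 / 4) (min (\<epsilon>0 / 4) (\<eta> / (6 * (\<bar>C0\<bar> + 1))))" for \<eta> :: real
  have dd: "0 < dd \<eta>" "dd \<eta> < 1 / 2" "2 * dd \<eta> < \<epsilon>0" "3 * dd \<eta> < \<epsilon>0" "C0 * (2 * dd \<eta>) \<le> \<eta> / 2"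
    "C0 * (3 * dd \<eta>) \<le> \<eta> / 2" if "\<eta> > 0" for \<eta>
  proof -
    show p: "0 < dd \<eta>" using that \<epsilon>0 by (simp add: dd_def)
    show "dd \<eta> < 1 / 2" "2 * dd \<eta> < \<epsilon>0" "3 * dd \<eta> < \<epsilon>0" using \<epsilon>0 unfolding dd_def by linarith+
    have "dd \<eta> \<le> \<eta> / (6 * (\<bar>C0\<bar> + 1))" by (simp add: dd_def)
    then have 1: "dd \<eta> * (6 * (\<bar>C0\<bar> + 1)) \<le> \<eta>" by (simp add: pos_le_divide_eq add_nonneg_pos)
    have "C0 * dd \<eta> \<le> \<bar>C0\<bar> * dd \<eta>" using p by (intro mult_right_mono) auto
    moreover have "dd \<eta> * (6 * (\<bar>C0\<bar> + 1)) = 6 * (\<bar>C0\<bar> * dd \<eta>) + 6 * dd \<eta>"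
      by (simp add: distrib_left)
    ultimately have 2: "C0 * dd \<eta> \<le> \<eta> / 6" using 1 p by linarith
    have "C0 * (2 * dd \<eta>) = 2 * (C0 * dd \<eta>)" "C0 * (3 * dd \<eta>) = 3 * (C0 * dd \<eta>)" by simp_all
    then show "C0 * (2 * dd \<eta>) \<le> \<eta> / 2" "C0 * (3 * dd \<eta>) \<le> \<eta> / 2" using 2 that by linarith+
  qed
  have upper: "\<forall>\<^sub>F E in flt. I E \<le> ennreal (pi * \<Psi> (r E) * (1 + 2 * \<eta>))" if \<eta>: "\<eta> > 0" for \<eta>
  proof -
    note d = dd[OF \<eta>]
    obtain C where C: "\<forall>\<^sub>F E in flt. I E \<le> ennreal (pi * N (r E * (1 - 2 * dd \<eta>)) + C)" using up[OF d(1,2)] by blast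
    from C near[of "2 * dd \<eta>" "- 1" \<eta>, OF _ d(3) _ \<eta> d(5)] big[of "C / (pi * \<eta>)"]
    have "\<forall>\<^sub>F E in flt. I E \<le> ennreal (pi * N (r E * (1 - 2 * dd \<eta>)) + C) \<and>
        \<bar>N (r E * (1 + - 1 * (2 * dd \<eta>))) - \<Psi> (r E)\<bar> \<le> \<Psi> (r E) * \<eta> \<and> \<Psi> (r E) \<ge> C / (pi * \<eta>)"
      using d(1) by (simp add: eventually_conj_iff)
    then show ?thesis
    proof eventually_elim
      case (elim E)
      have "N (r E * (1 - 2 * dd \<eta>)) \<le> \<Psi> (r E) + \<Psi> (r E) * \<eta>" using elim by auto
      then have "pi * N (r E * (1 - 2 * dd \<eta>)) \<le> pi * (\<Psi> (r E) + \<Psi> (r E) * \<eta>)" by (rule mult_left_mono) simp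
      moreover have "C \<le> pi * \<Psi> (r E) * \<eta>" using elim \<eta> by (simp add: divide_le_eq mult_ac)
      ultimately have "pi * N (r E * (1 - 2 * dd \<eta>)) + C \<le> pi * \<Psi> (r E) * (1 + 2 * \<eta>)"
        by (simp add: algebra_simps)
      then show ?case using elim by (meson ennreal_leI order_trans)
    qed
  qed
  have lower: "\<forall>\<^sub>F E in flt. ennreal (pi * \<Psi> (r E) * (1 - 3 * \<eta>)) \<le> I E" if \<eta>: "0 < \<eta>" "\<eta> < 1 / 2" for \<eta>
  proof -
    note d = dd[OF \<eta>(1)]
    have "\<forall>\<^sub>F T in at_top. arctan T > pi / 2 * (1 - \<eta>)"
      by (rule order_tendstoD(1)[OF tendsto_arctan_at_top]) (use \<eta> in simp)
    then have "\<forall>\<^sub>F T in at_top. arctan T > pi / 2 * (1 - \<eta>) \<and> T > 0"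
      using eventually_gt_at_top[of 0] by (rule eventually_conj)
    \<comment> \<open>\<open>T\<close> is chosen from \<open>\<eta>\<close> alone, so that cutting
      off the \<open>t\<close>-integral loses at most the fraction \<open>\<eta>\<close> of its
      total weight \<open>pi\<close>.\<close>
    then obtain T where T: "arctan T > pi / 2 * (1 - \<eta>)" "T > 0"
      using eventually_happens[of _ at_top] by (metis (no_types, lifting) trivial_limit_at_top_linorder)
    obtain C where C: "\<forall>\<^sub>F E in flt. ennreal (2 * arctan T * (N (r E * (1 + 3 * dd \<eta>)) - C)) \<le> I E"
      using lo[OF d(1,2) T(2)] by blast
    from C near[of "3 * dd \<eta>" 1 \<eta>, OF _ d(4) _ \<eta>(1) d(6)] big[of "C / \<eta>"] big[of 0]
    have "\<forall>\<^sub>F E in flt. ennreal (2 * arctan T * (N (r E * (1 + 3 * dd \<eta>)) - C)) \<le> I E \<and>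
        \<bar>N (r E * (1 + 1 * (3 * dd \<eta>))) - \<Psi> (r E)\<bar> \<le> \<Psi> (r E) * \<eta> \<and> \<Psi> (r E) \<ge> C / \<eta> \<and> \<Psi> (r E) \<ge> 0"
      using d(1) by (simp add: eventually_conj_iff)
    then show ?thesis
    proof eventually_elim
      case (elim E)
      have "C \<le> \<Psi> (r E) * \<eta>" using elim \<eta> by (simp add: divide_le_eq)
      then have 1: "\<Psi> (r E) * (1 - 2 * \<eta>) \<le> N (r E * (1 + 3 * dd \<eta>)) - C"
        using elim by (auto simp: algebra_simps)
      \<comment> \<open>The cut-off in \<open>t\<close> accounts for \<open>1 - \<eta>\<close>; the
        shift of the level and the constant \<open>C\<close> each cost one \<open>\<eta>\<close>
        more.\<close>
      have "pi * \<Psi> (r E) * (1 - 3 * \<eta>) \<le> pi * \<Psi> (r E) * ((1 - \<eta>) * (1 - 2 * \<eta>))"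
        using elim \<eta> by (intro mult_left_mono) (auto simp: algebra_simps)
      also have "\<dots> = (pi * (1 - \<eta>)) * (\<Psi> (r E) * (1 - 2 * \<eta>))" by simp
      also have "\<dots> \<le> (2 * arctan T) * (N (r E * (1 + 3 * dd \<eta>)) - C)"
      proof (rule mult_mono[OF _ 1])
        show "pi * (1 - \<eta>) \<le> 2 * arctan T" using T(1) by (simp add: field_simps)
        show "0 \<le> 2 * arctan T" using T(2) by (simp add: zero_le_arctan_iff)
        show "0 \<le> \<Psi> (r E) * (1 - 2 * \<eta>)" using elim \<eta> by (intro mult_nonneg_nonneg) auto
      qed
      finally show ?case using elim by (meson ennreal_leI order_trans)
    qed
  qed
  \<comment> \<open>The relative error itself serves as witness, so what remains is to squeeze it
    between the two bounds.\<close>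
  define e where "e E = enn2real (I E) / (pi * \<Psi> (r E)) - 1" for E
  have "\<forall>\<^sub>F E in flt. \<bar>e E\<bar> < \<eta>" if \<eta>: "\<eta> > 0" for \<eta>
  proof -
    define \<theta> where "\<theta> = min (1 / 4) (\<eta> / 4)"
    have \<theta>: "\<theta> > 0" "\<theta> < 1 / 2" "3 * \<theta> < \<eta>" using \<eta> by (auto simp: \<theta>_def)
    from upper[OF \<theta>(1)] lower[OF \<theta>(1,2)] big[of 1] show ?thesis
    proof eventually_elim
      case (elim E)
      have p: "pi * \<Psi> (r E) > 0" using elim(3) by simp
      have fin: "I E < \<infinity>" using elim(1) ennreal_less_top le_less_trans by (metis infinity_ennreal_def)
      then have IE: "I E = ennreal (enn2real (I E))" by (simp add: ennreal_enn2real)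
      have 1: "enn2real (I E) \<le> pi * \<Psi> (r E) * (1 + 2 * \<theta>)"
        using elim(1) p \<theta>(1) by (intro enn2real_leI) auto
      have 2: "pi * \<Psi> (r E) * (1 - 3 * \<theta>) \<le> enn2real (I E)"
        using elim(2) by (subst (asm) IE) (simp add: ennreal_le_iff)
      have "enn2real (I E) / (pi * \<Psi> (r E)) \<le> 1 + 2 * \<theta>" "1 - 3 * \<theta> \<le> enn2real (I E) / (pi * \<Psi> (r E))"
        using 1 2 p by (simp_all add: pos_divide_le_eq pos_le_divide_eq mult.commute)
      then show ?case unfolding e_def using \<theta> by (simp add: abs_less_iff)
    qed
  qed
  then have "(e \<longlongrightarrow> 0) flt" by (auto intro!: tendstoI simp: dist_real_def)
  moreover have "\<forall>\<^sub>F E in flt. ereal (1 / pi) * enn2ereal (I E) = ereal (\<Psi> (r E) * (1 + e E))"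
    using upper[of 1, OF zero_less_one] big[of 1]
  proof eventually_elim
    case (elim E)
    have "I E < \<infinity>" using elim(1) ennreal_less_top le_less_trans by (metis infinity_ennreal_def)
    then have "I E = ennreal (enn2real (I E))" by (simp add: ennreal_enn2real)
    then have "enn2ereal (I E) = ereal (enn2real (I E))" by (metis enn2ereal_ennreal enn2real_nonneg)
    moreover have "\<Psi> (r E) * (1 + e E) = 1 / pi * enn2real (I E)" using elim(2) by (simp add: e_def field_simps)
    ultimately show ?case by simp
  qed
  ultimately show ?thesis by blast
qed

context lattice_model
begin

text \<open>
  At distance \<open>D\<close> from the threshold the coefficient of the Green kernel has modulus
  \<open>1 / (r sqrt (1 + h\<^sup>2 D / 4))\<close> with \<open>r = (2 / h) sqrt D\<close>.
\<close>
lemma threshold_asymptotics: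
  assumes s0: "s0 \<in> IQ" and \<sigma>: "\<sigma> = 1 \<or> \<sigma> = - 1"
    and E0: "\<And>s. s \<in> IQ - {s0} \<Longrightarrow> E0 - \<mu> s \<noteq> 0 \<and> E0 - \<mu> s \<noteq> 4 / h\<^sup>2"
    and E0_def: "E0 = \<mu> s0 + (if \<sigma> = 1 then 0 else 4 / h\<^sup>2)"
    and flt: "flt \<le> nhds E0" "\<forall>\<^sub>F E in flt. \<sigma> * (E0 - E) > 0"
    and \<Psi>: "filterlim \<Psi> at_top (at_right 0)"
    and reg: "regular_counting (counting_fun (\<lambda>g. factor (parity \<sigma>) s0 (cofactor (parity \<sigma>) s0 g))) \<Psi>"
  shows "\<exists>C. \<forall>\<^sub>F E in flt. count_integral (- \<sigma>) E \<le> ennreal C"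
    and "\<exists>e. (e \<longlongrightarrow> 0) flt \<and> (\<forall>\<^sub>F E in flt. ereal (1 / pi) * enn2ereal (count_integral \<sigma> E)
      = ereal (\<Psi> (2 / h * sqrt (\<sigma> * (E0 - E))) * (1 + e E)))"
proof -
  define D where "D E = \<sigma> * (E0 - E)" for E
  define c where "c E = h\<^sup>2 / sqrt \<bar>h\<^sup>2 * (E - \<mu> s0) * (h\<^sup>2 * (E - \<mu> s0) - 4)\<bar>" for E
  define r where "r E = 2 / h * sqrt (D E)" for E
  have "finite (IQ - {s0})" using finite_IQ by simp
  from eventually_channels_bounded[OF E0 this] obtain cb where cb: "cb \<ge> 0"
    and ev: "\<forall>\<^sub>F E in nhds E0. \<forall>s\<in>IQ - {s0}. E - \<mu> s \<noteq> 0 \<and> E - \<mu> s \<noteq> 4 / h\<^sup>2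
      \<and> h\<^sup>2 / sqrt \<bar>h\<^sup>2 * (E - \<mu> s) * (h\<^sup>2 * (E - \<mu> s) - 4)\<bar> \<le> cb" by blast
  obtain a b b' where bnd: "\<And>E. (\<sigma> = 1 \<and> E - \<mu> s0 < 0 \<or> \<sigma> = - 1 \<and> E - \<mu> s0 > 4 / h\<^sup>2) \<Longrightarrow>
    (\<forall>s\<in>IQ - {s0}. E - \<mu> s \<noteq> 0 \<and> E - \<mu> s \<noteq> 4 / h\<^sup>2
      \<and> h\<^sup>2 / sqrt \<bar>h\<^sup>2 * (E - \<mu> s) * (h\<^sup>2 * (E - \<mu> s) - 4)\<bar> \<le> cb) \<Longrightarrow> c E > 0 \<Longrightarrow>
    count_integral (- \<sigma>) E \<le> ennreal (pi * (a * 16) + b * 4) \<and>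
    (\<forall>d. 0 < d \<and> d < 1 / 2 \<longrightarrow>
      (\<forall>r>0. r * c E \<le> 1 \<longrightarrow> count_integral \<sigma> E \<le> ennreal (pi * (eff_count \<sigma> s0 (r * (1 - 2 * d)) + a / d\<^sup>2) + b / d)) \<and>
      (\<forall>r>0. \<forall>T>0. 1 + 2 * d \<le> r * c E \<longrightarrow>
        ennreal (2 * arctan T * (eff_count \<sigma> s0 r - a / d\<^sup>2 - T\<^sup>2 * b' / d\<^sup>2)) \<le> count_integral \<sigma> E))"
    using count_integral_bounds[OF s0 cb] unfolding c_def by metis
  have Epos: "\<sigma> = 1 \<and> E - \<mu> s0 < 0 \<or> \<sigma> = - 1 \<and> E - \<mu> s0 > 4 / h\<^sup>2" if "D E > 0" for E
    using \<sigma> that by (auto simp: D_def E0_def)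
  \<comment> \<open>The discriminant is symmetric under exchanging the two ends of the band, so both
    thresholds give the same function of the distance \<open>D\<close>.\<close>
  have rc: "r E * c E * sqrt (1 + h\<^sup>2 * D E / 4) = 1" "c E > 0" "r E > 0" if D: "D E > 0" for E
  proof -
    have pos: "0 \<le> h\<^sup>2 * D E * (h\<^sup>2 * D E + 4)" using D by simp
    have "\<bar>h\<^sup>2 * (E - \<mu> s0) * (h\<^sup>2 * (E - \<mu> s0) - 4)\<bar> = h\<^sup>2 * D E * (h\<^sup>2 * D E + 4)"
    proof (cases "\<sigma> = 1")
      case True
      then have e: "E - \<mu> s0 = - D E" by (simp add: D_def E0_def)
      have "h\<^sup>2 * (E - \<mu> s0) * (h\<^sup>2 * (E - \<mu> s0) - 4) = h\<^sup>2 * D E * (h\<^sup>2 * D E + 4)"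
        unfolding e by (simp add: algebra_simps)
      then show ?thesis using pos by (simp only: abs_of_nonneg)
    next
      case False
      then have e: "E - \<mu> s0 = 4 / h\<^sup>2 + D E" using \<sigma> by (auto simp: D_def E0_def)
      have "h\<^sup>2 * (E - \<mu> s0) = 4 + h\<^sup>2 * D E" unfolding e using h by (simp add: distrib_left)
      then have "h\<^sup>2 * (E - \<mu> s0) * (h\<^sup>2 * (E - \<mu> s0) - 4) = h\<^sup>2 * D E * (h\<^sup>2 * D E + 4)"
        by (simp add: algebra_simps)
      then show ?thesis using pos by (simp only: abs_of_nonneg)
    qed
    also have "\<dots> = h\<^sup>2 * D E * 4 * (1 + h\<^sup>2 * D E / 4)" by (simp add: algebra_simps)
    finally have s: "sqrt \<bar>h\<^sup>2 * (E - \<mu> s0) * (h\<^sup>2 * (E - \<mu> s0) - 4)\<bar> = h * sqrt (D E) * 2 * sqrt (1 + h\<^sup>2 * D E / 4)"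
      using h by (simp add: real_sqrt_mult)
    have p: "sqrt (1 + h\<^sup>2 * D E / 4) > 0" "sqrt (D E) > 0" using D h by (auto simp: add_pos_nonneg)
    show "c E > 0" unfolding c_def s using p h by simp
    show "r E > 0" unfolding r_def using p h by simp
    show "r E * c E * sqrt (1 + h\<^sup>2 * D E / 4) = 1"
      unfolding c_def s r_def using p h by (simp add: power2_eq_square)
  qed
  have evD: "\<forall>\<^sub>F E in flt. D E > 0" using flt(2) by (simp add: D_def)
  have evE: "\<forall>\<^sub>F E in flt. \<forall>s\<in>IQ - {s0}. E - \<mu> s \<noteq> 0 \<and> E - \<mu> s \<noteq> 4 / h\<^sup>2
      \<and> h\<^sup>2 / sqrt \<bar>h\<^sup>2 * (E - \<mu> s) * (h\<^sup>2 * (E - \<mu> s) - 4)\<bar> \<le> cb"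
    by (rule filter_leD[OF flt(1) ev])
  show "\<exists>C. \<forall>\<^sub>F E in flt. count_integral (- \<sigma>) E \<le> ennreal C"
    proof (rule exI[of _ "pi * (a * 16) + b * 4"])
    show "\<forall>\<^sub>F E in flt. count_integral (- \<sigma>) E \<le> ennreal (pi * (a * 16) + b * 4)"
      using evD evE by eventually_elim (use bnd Epos rc(2) in blast)
  qed
  have lim: "((\<lambda>E. E) \<longlongrightarrow> E0) flt" using flt(1) by (simp add: filterlim_def)
  then have limD: "(D \<longlongrightarrow> 0) flt"
    using tendsto_mult[OF tendsto_const[of \<sigma>] tendsto_diff[OF tendsto_const[of E0] lim]] by (simp add: D_def[abs_def])
  have limr: "filterlim r (at_right 0) flt"
  proof -
    have "((\<lambda>E. 2 / h * sqrt (D E)) \<longlongrightarrow> 2 / h * sqrt 0) flt" by (intro tendsto_intros limD)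
    then have "(r \<longlongrightarrow> 0) flt" by (simp add: r_def[abs_def])
    moreover have "\<forall>\<^sub>F E in flt. r E \<in> {0<..} \<and> r E \<noteq> 0" using evD
      by eventually_elim (use rc(3) in force)
    ultimately show ?thesis by (simp add: filterlim_at)
  qed
  have "\<exists>e. (e \<longlongrightarrow> 0) flt \<and>
    (\<forall>\<^sub>F E in flt. ereal (1 / pi) * enn2ereal (count_integral \<sigma> E) = ereal (\<Psi> (r E) * (1 + e E)))"
  proof (rule counting_asymptotics[OF limr counting_fun_eff _ \<Psi> reg])
    show "0 \<le> eff_count \<sigma> s0 x" for x by (simp add: eff_count_def)
    fix d :: real assume d: "0 < d" "d < 1 / 2"
    show "\<exists>C. \<forall>\<^sub>F E in flt. count_integral \<sigma> E \<le> ennreal (pi * eff_count \<sigma> s0 (r E * (1 - 2 * d)) + C)"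
      proof (rule exI[of _ "pi * (a / d\<^sup>2) + b / d"])
      show "\<forall>\<^sub>F E in flt. count_integral \<sigma> E
          \<le> ennreal (pi * eff_count \<sigma> s0 (r E * (1 - 2 * d)) + (pi * (a / d\<^sup>2) + b / d))"
      using evD evE
    proof eventually_elim
      case (elim E)
      have "1 \<le> sqrt (1 + h\<^sup>2 * D E / 4)" using elim(1) by simp
      then have "r E * c E * 1 \<le> r E * c E * sqrt (1 + h\<^sup>2 * D E / 4)"
        using rc[OF elim(1)] by (intro mult_left_mono) auto
      then have "r E * c E \<le> 1" using rc(1)[OF elim(1)] by simp
      then have "count_integral \<sigma> E \<le> ennreal (pi * (eff_count \<sigma> s0 (r E * (1 - 2 * d)) + a / d\<^sup>2) + b / d)"
        using bnd[OF Epos[OF elim(1)] elim(2) rc(2)[OF elim(1)]] d rc(3)[OF elim(1)] by blast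
      then show ?case by (simp add: distrib_left add.assoc)
    qed
    qed
    fix T :: real assume T: "T > 0"
    show "\<exists>C. \<forall>\<^sub>F E in flt. ennreal (2 * arctan T * (eff_count \<sigma> s0 (r E * (1 + 3 * d)) - C)) \<le> count_integral \<sigma> E"
    proof (intro exI[of _ "a / d\<^sup>2 + T\<^sup>2 * b' / d\<^sup>2"])
      \<comment> \<open>This factor is the mismatch between \<open>r\<close> and
        \<open>1 / c\<close>. It exceeds \<open>1\<close>, which suits the upper bound, and tends to
        \<open>1\<close>, so the gap between \<open>1 + 2 d\<close> and \<open>1 + 3 d\<close>
        eventually absorbs it in the lower bound.\<close>
      have "((\<lambda>E. sqrt (1 + h\<^sup>2 * D E / 4)) \<longlongrightarrow> sqrt (1 + h\<^sup>2 * 0 / 4)) flt" by (intro tendsto_intros limD) simp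
      then have "\<forall>\<^sub>F E in flt. sqrt (1 + h\<^sup>2 * D E / 4) < (1 + 3 * d) / (1 + 2 * d)"
        using d by (intro order_tendstoD(2)) (auto simp: less_divide_eq)
      then show "\<forall>\<^sub>F E in flt. ennreal (2 * arctan T * (eff_count \<sigma> s0 (r E * (1 + 3 * d))
          - (a / d\<^sup>2 + T\<^sup>2 * b' / d\<^sup>2))) \<le> count_integral \<sigma> E"
        using evD evE
      proof eventually_elim
        case (elim E)
        note rcE = rc[OF elim(2)]
        have "sqrt (1 + h\<^sup>2 * D E / 4) * (1 + 2 * d) \<le> 1 + 3 * d"
          using elim(1) d by (simp add: less_divide_eq)
        then have "(r E * c E) * (sqrt (1 + h\<^sup>2 * D E / 4) * (1 + 2 * d)) \<le> (r E * c E) * (1 + 3 * d)"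
          using rcE by (intro mult_left_mono) auto
        moreover have "(r E * c E) * (sqrt (1 + h\<^sup>2 * D E / 4) * (1 + 2 * d))
            = (r E * c E * sqrt (1 + h\<^sup>2 * D E / 4)) * (1 + 2 * d)" by (simp only: mult.assoc)
        moreover have "(r E * c E) * (1 + 3 * d) = r E * (1 + 3 * d) * c E" by (simp only: mult_ac)
        ultimately have le: "1 + 2 * d \<le> r E * (1 + 3 * d) * c E" unfolding rcE(1) by simp
        have "r E * (1 + 3 * d) > 0" using rcE(3) d by simp
        then have "ennreal (2 * arctan T * (eff_count \<sigma> s0 (r E * (1 + 3 * d)) - a / d\<^sup>2 - T\<^sup>2 * b' / d\<^sup>2))
            \<le> count_integral \<sigma> E"
          using bnd[OF Epos[OF elim(2)] elim(3) rcE(2)] d T le by blast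
        then show ?case by (simp add: diff_diff_eq)
      qed
    qed
  qed
  then show "\<exists>e. (e \<longlongrightarrow> 0) flt \<and> (\<forall>\<^sub>F E in flt. ereal (1 / pi) * enn2ereal (count_integral \<sigma> E)
      = ereal (\<Psi> (2 / h * sqrt (\<sigma> * (E0 - E))) * (1 + e E)))"
    by (simp add: r_def D_def)
qed

end

lemma ereal_abs_minus: "\<bar>- x\<bar> = \<bar>x :: ereal\<bar>"
  by (cases x) auto

text \<open>\<open>ennreal\<close> maps negative reals to \<open>0\<close>, hence the maximum with
  \<open>0\<close>.\<close>

lemma abs_scaled_enn2ereal_le:
  assumes "x \<le> ennreal C" "0 \<le> k"
  shows "\<bar>ereal k * enn2ereal x\<bar> \<le> ereal (k * max C 0)"
proof -
  define M where "M = max C 0"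
  have M: "C \<le> M" "0 \<le> M" by (simp_all add: M_def)
  have "x \<le> ennreal M" using order_trans[OF assms(1) ennreal_leI[OF M(1)]] .
  then have "enn2ereal x \<le> ereal M" unfolding less_eq_ennreal.rep_eq by (simp add: enn2ereal_ennreal M(2))
  moreover have "0 \<le> enn2ereal x" by simp
  ultimately obtain y where y: "enn2ereal x = ereal y" "0 \<le> y" "y \<le> M"
    by (cases "enn2ereal x") auto
  then show ?thesis unfolding M_def[symmetric] using assms(2) by (simp add: abs_mult mult_left_mono)
qed

theorem corollary5p15:
  fixes h \<nu>0 :: real
    and Q K :: "'g :: chilbert_space \<Rightarrow> 'g"
    and W :: "'g ell2Z \<Rightarrow> 'g ell2Z"
    and IQ :: "nat set" and \<mu> :: "nat \<Rightarrow> real" and s :: nat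
    and \<Psi>1 \<Psi>2 :: "real \<Rightarrow> real"
  assumes "h > 0"
    and "separable_space (euclidean :: 'g topology)"
    and "\<not> finite_cdim (UNIV :: 'g set)"
    and "spectral_data Q IQ \<mu>"
    and "\<nu>0 > 3"
    and "positive_op W"
    and "schatten2 K"
    and "s \<in> IQ"
    and "lower_threshold_nondeg h IQ \<mu> s"
    and "upper_threshold_nondeg h IQ \<mu> s"
    and "op_rank (sandwich (P_thr \<nu>0 Q (\<mu> s)) (V_bold W K)) = \<infinity>"
    and "op_rank (sandwich (P_thr \<nu>0 Q (\<mu> s)) (V_bold_J W K)) = \<infinity>"
    and "filterlim \<Psi>1 at_top (at_right 0)"
    and "filterlim \<Psi>2 at_top (at_right 0)"
    and "regular_counting (counting_fun (sandwich (P_thr \<nu>0 Q (\<mu> s)) (V_bold W K))) \<Psi>1"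
    and "regular_counting (counting_fun (sandwich (P_thr \<nu>0 Q (\<mu> s)) (V_bold_J W K))) \<Psi>2"
  shows "(\<exists>e. (e \<longlongrightarrow> 0) (at_left (\<mu> s)) \<and>
            (\<forall>\<^sub>F E in at_left (\<mu> s). xi_minus h \<nu>0 Q W K E =
               ereal (- \<Psi>1 (2 / h * sqrt (\<mu> s - E)) * (1 + e E))))
    \<and> (\<exists>C::real. \<forall>\<^sub>F E in at_right (4 / h\<^sup>2 + \<mu> s). \<bar>xi_minus h \<nu>0 Q W K E\<bar> \<le> ereal C)
    \<and> (\<exists>C::real. \<forall>\<^sub>F E in at_left (\<mu> s). \<bar>xi_plus h \<nu>0 Q W K E\<bar> \<le> ereal C)
    \<and> (\<exists>e. (e \<longlongrightarrow> 0) (at_right (4 / h\<^sup>2 + \<mu> s)) \<and>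
            (\<forall>\<^sub>F E in at_right (4 / h\<^sup>2 + \<mu> s). xi_plus h \<nu>0 Q W K E =
               ereal (\<Psi>2 (2 / h * sqrt (E - 4 / h\<^sup>2 - \<mu> s)) * (1 + e E))))"
proof -
  interpret lattice_model h \<nu>0 Q K W IQ \<mu>
    by unfold_locales (rule assms)+
  have h4: "4 / h\<^sup>2 > 0" using h by simp
  have ne: "\<mu> s' \<noteq> \<mu> s" if "s' \<in> IQ - {s}" for s'
    using that assms(8) spectral_data_finite(3)[OF sd] by (auto dest: inj_onD)
  have "\<mu> s - \<mu> s' \<noteq> 0 \<and> \<mu> s - \<mu> s' \<noteq> 4 / h\<^sup>2" if "s' \<in> IQ - {s}" for s'
    using ne[OF that] assms(9) that by (auto simp: lower_threshold_nondeg_def)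
  \<comment> \<open>With \<open>\<sigma> = 1\<close> the growing integral is that of
    \<open>xi_minus\<close> and the bounded one that of \<open>xi_plus\<close>;
    \<open>\<sigma> = - 1\<close> at the upper threshold exchanges the roles. Each instance thus
    yields two of the four claims.\<close>
  note lower = threshold_asymptotics[of s 1 "\<mu> s" "at_left (\<mu> s)" \<Psi>1, OF assms(8) _ this _ at_within_le_nhds _
      assms(13) assms(15)[unfolded sandwich_eq]]
  have "4 / h\<^sup>2 + \<mu> s - \<mu> s' \<noteq> 0 \<and> 4 / h\<^sup>2 + \<mu> s - \<mu> s' \<noteq> 4 / h\<^sup>2" if "s' \<in> IQ - {s}" for s'
    using ne[OF that] assms(10) that by (auto simp: upper_threshold_nondeg_def)
  note upper = threshold_asymptotics[of s "- 1" "4 / h\<^sup>2 + \<mu> s" "at_right (4 / h\<^sup>2 + \<mu> s)" \<Psi>2, OF assms(8) _ this _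
      at_within_le_nhds _ assms(14) assms(16)[unfolded sandwich_J_eq]]
  have l: "\<forall>\<^sub>F E in at_left (\<mu> s). 1 * (\<mu> s - E) > 0" by (simp add: eventually_at_filter)
  have u: "\<forall>\<^sub>F E in at_right (4 / h\<^sup>2 + \<mu> s). - 1 * (4 / h\<^sup>2 + \<mu> s - E) > 0"
    using eventually_at_right_less[of "4 / h\<^sup>2 + \<mu> s"] by eventually_elim simp
  have "\<exists>e. (e \<longlongrightarrow> 0) (at_left (\<mu> s)) \<and>
      (\<forall>\<^sub>F E in at_left (\<mu> s). xi_minus h \<nu>0 Q W K E = ereal (- \<Psi>1 (2 / h * sqrt (\<mu> s - E)) * (1 + e E)))"
  proof -
    obtain e where e: "(e \<longlongrightarrow> 0) (at_left (\<mu> s))" "\<forall>\<^sub>F E in at_left (\<mu> s).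
        ereal (1 / pi) * enn2ereal (count_integral 1 E) = ereal (\<Psi>1 (2 / h * sqrt (1 * (\<mu> s - E))) * (1 + e E))"
      using lower(2)[OF _ _ _ l] by auto
    from e(2) have "\<forall>\<^sub>F E in at_left (\<mu> s).
        xi_minus h \<nu>0 Q W K E = ereal (- \<Psi>1 (2 / h * sqrt (\<mu> s - E)) * (1 + e E))"
    proof eventually_elim
      case (elim E)
      have "xi_minus h \<nu>0 Q W K E = - (ereal (1 / pi) * enn2ereal (count_integral 1 E))"
        unfolding xi_minus_eq by (simp only: ereal_mult_minus_left)
      then show ?case unfolding elim by simp
    qed
    then show ?thesis using e(1) by blast
  qed
  moreover have "\<exists>C::real. \<forall>\<^sub>F E in at_right (4 / h\<^sup>2 + \<mu> s). \<bar>xi_minus h \<nu>0 Q W K E\<bar> \<le> ereal C"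
  proof -
    obtain C where C: "\<forall>\<^sub>F E in at_right (4 / h\<^sup>2 + \<mu> s). count_integral (- (- 1)) E \<le> ennreal C"
      using upper(1)[OF _ _ _ u] by auto
    from C have "\<forall>\<^sub>F E in at_right (4 / h\<^sup>2 + \<mu> s). \<bar>xi_minus h \<nu>0 Q W K E\<bar> \<le> ereal (1 / pi * max C 0)"
    proof eventually_elim
      case (elim E)
      have "\<bar>xi_minus h \<nu>0 Q W K E\<bar> = \<bar>ereal (1 / pi) * enn2ereal (count_integral 1 E)\<bar>"
        unfolding xi_minus_eq ereal_mult_minus_left by (rule ereal_abs_minus)
      also have "\<dots> \<le> ereal (1 / pi * max C 0)" using elim by (intro abs_scaled_enn2ereal_le) auto
      finally show ?case .
    qed
    then show ?thesis by blast
  qed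
  moreover have "\<exists>C::real. \<forall>\<^sub>F E in at_left (\<mu> s). \<bar>xi_plus h \<nu>0 Q W K E\<bar> \<le> ereal C"
  proof -
    obtain C where C: "\<forall>\<^sub>F E in at_left (\<mu> s). count_integral (- 1) E \<le> ennreal C"
      using lower(1)[OF _ _ _ l] by auto
    from C have "\<forall>\<^sub>F E in at_left (\<mu> s). \<bar>xi_plus h \<nu>0 Q W K E\<bar> \<le> ereal (1 / pi * max C 0)"
      unfolding xi_plus_eq by eventually_elim (intro abs_scaled_enn2ereal_le, auto)
    then show ?thesis by blast
  qed
  moreover have "\<exists>e. (e \<longlongrightarrow> 0) (at_right (4 / h\<^sup>2 + \<mu> s)) \<and>
      (\<forall>\<^sub>F E in at_right (4 / h\<^sup>2 + \<mu> s). xi_plus h \<nu>0 Q W K E =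
        ereal (\<Psi>2 (2 / h * sqrt (E - 4 / h\<^sup>2 - \<mu> s)) * (1 + e E)))"
  proof -
    have d: "- 1 * (4 / h\<^sup>2 + \<mu> s - E) = E - 4 / h\<^sup>2 - \<mu> s" for E by simp
    have "\<exists>e. (e \<longlongrightarrow> 0) (at_right (4 / h\<^sup>2 + \<mu> s)) \<and> (\<forall>\<^sub>F E in at_right (4 / h\<^sup>2 + \<mu> s).
        ereal (1 / pi) * enn2ereal (count_integral (- 1) E)
          = ereal (\<Psi>2 (2 / h * sqrt (- 1 * (4 / h\<^sup>2 + \<mu> s - E))) * (1 + e E)))"
      by (rule upper(2)[OF _ _ _ u]) auto
    then show ?thesis unfolding d xi_plus_eq .
  qed
  ultimately show ?thesis by blast
qed

end
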